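(* Let $(\overline{\widehat{K}(X)}|K,v)$ be an extension of valued fields, where $\widehat{K}$ is the completion of $(K,v)$. Assume that $(K(X)|K,v)$ is not valuation algebraic of type II. Assume further that $(K,v)$ is henselian and that $IC(K(X)|K,v)|K$ is a finite extension. Then $IC(\widehat{K}(X)|\widehat{K},v)$ is the completion of $IC(K(X)|K,v)$.
   Context: Valuations are Krull valuations written additively; $vL$, $Lv$ denote value group and residue field. $(K,v)$ is dense in $(L,v)$ if for every $a\in L$, $\gamma\in vL$ there is $b\in K$ with $v(a-b)>\gamma$; the completion $(\widehat{K},v)$ is the maximal extension in which $(K,v)$ is dense. "An extension of valued fields $(\overline{\widehat{K}(X)}|K,v)$" means a valuation $v$ on the algebraic closure $\overline{\widehat{K}(X)}$ of $\widehat{K}(X)$ whose restriction to $\widehat{K}$ is the valuation of the completion; all subfields, in particular the algebraic closures of $K$, $\widehat{K}$, $K(X)$ taken inside it, carry the restricted valuation. For a subfield $F$, $F^h$ denotes the henselization of $(F,v)$ inside $\overline{F}$ with respect to $v$. The implicit constant field of $(F(X)|F,v)$ is $IC(F(X)|F,v):=\overline{F}\cap F(X)^h$. $(K(X)|K,v)$ is value transcendental if $\dim_{\mathbb{Q}}\big((vK(X)/vK)\otimes\mathbb{Q}\big)=1$, residue transcendental if $\mathrm{trdeg}[K(X)v:Kv]=1$, valuation transcendental if it is one of these, and valuation algebraic otherwise. A sequence $\{z_\nu\}_{\nu<\lambda}$ ($\lambda$ a limit ordinal) in a valued field is a pseudo-Cauchy sequence (pCs) if $v(z_{\nu_1}-z_{\nu_2})<v(z_{\nu_2}-z_{\nu_3})$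 for all $\nu_1<\nu_2<\nu_3<\lambda$. A pCs in $(F,v)$ is of transcendental type in $(F,v)$ if for every polynomial $h$ over $F$ the sequence $\{vh(z_\nu)\}$ is ultimately constant, and of algebraic type otherwise. Suppose $(K(X)|K,v)$ is valuation algebraic. Take a strictly increasing cofinal sequence $\{\gamma_\nu\}_{\nu<\lambda}$ in $\{v(X-c)\mid c\in\overline{K}\}$ ($\lambda$ a limit ordinal) and $a_\nu\in\overline{K}$ with $v(X-a_\nu)=\gamma_\nu$; then $\{a_\nu\}$ is a pCs. $(K(X)|K,v)$ is valuation algebraic of type I if $\{a_\nu\}$ is of transcendental type in $(\overline{\widehat{K}},v)$, and of type II otherwise (independent of the choices). *)

theory Defs
  imports "HOL-Algebra.Algebra" "HOL-Library.Extended"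
begin

section \<open>Krull valuations, written additively\<close>

text \<open>
  The value \<open>\<infinity>\<close> is \<open>Pinf\<close>. The group \<open>'g\<close> may be larger than the value group of \<open>(L,v)\<close>,
  so conditions on "all values" below range over \<open>value_group\<close>, not over \<open>'g\<close>.
  Subfields of \<open>L\<close> are carrier sets, and carry the restricted valuation.
\<close>

locale valued_field = field L for L (structure) +
  fixes v :: "'a \<Rightarrow> 'g::linordered_ab_group_add extended"
  assumes v_zero: "v \<zero> = Pinf"
    and v_nonzero: "\<lbrakk>a \<in> carrier L; a \<noteq> \<zero>\<rbrakk> \<Longrightarrow> \<exists>\<gamma>. v a = Fin \<gamma>"
    and v_mult: "\<lbrakk>a \<in> carrier L; b \<in> carrier L\<rbrakk> \<Longrightarrow> v (a \<otimes> b) = v a + v b"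
    and v_add: "\<lbrakk>a \<in> carrier L; b \<in> carrier L\<rbrakk> \<Longrightarrow> min (v a) (v b) \<le> v (a \<oplus> b)"

definition value_group ::
  "('a, 'b) ring_scheme \<Rightarrow> ('a \<Rightarrow> 'g extended) \<Rightarrow> 'a set \<Rightarrow> 'g set" where
  "value_group L v F = {\<gamma>. \<exists>a\<in>F. a \<noteq> \<zero>\<^bsub>L\<^esub> \<and> v a = Fin \<gamma>}"

definition valuation_ring ::
  "('a \<Rightarrow> 'g::linordered_ab_group_add extended) \<Rightarrow> 'a set \<Rightarrow> 'a set" where
  "valuation_ring v F = {a \<in> F. 0 \<le> v a}"

definition valuation_ideal ::
  "('a \<Rightarrow> 'g::linordered_ab_group_add extended) \<Rightarrow> 'a set \<Rightarrow> 'a set" where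
  "valuation_ideal v F = {a \<in> F. 0 < v a}"

definition residue_field ::
  "('a, 'b) ring_scheme \<Rightarrow> ('a \<Rightarrow> 'g::linordered_ab_group_add extended) \<Rightarrow> 'a set \<Rightarrow> 'a set ring"
  where
  "residue_field L v E = L\<lparr>carrier := valuation_ring v E\<rparr> Quot valuation_ideal v E"

text \<open>For \<open>F \<subseteq> E\<close>, the residue field \<open>Fv\<close> as a subfield of \<open>Ev\<close>.\<close>

definition residue_subfield ::
  "('a, 'b) ring_scheme \<Rightarrow> ('a \<Rightarrow> 'g::linordered_ab_group_add extended) \<Rightarrow> 'a set \<Rightarrow> 'a set
    \<Rightarrow> 'a set set" where
  "residue_subfield L v E F = (\<lambda>a. valuation_ideal v E +>\<^bsub>L\<^esub> a) ` valuation_ring v F"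


section \<open>Completions\<close>

definition dense_in ::
  "('a, 'b) ring_scheme \<Rightarrow> ('a \<Rightarrow> 'g::linordered_ab_group_add extended) \<Rightarrow> 'a set \<Rightarrow> 'a set \<Rightarrow> bool"
  where
  "dense_in L v K F \<longleftrightarrow> (\<forall>a\<in>F. \<forall>\<gamma>\<in>value_group L v F. \<exists>b\<in>K. Fin \<gamma> < v (a \<ominus>\<^bsub>L\<^esub> b))"

text \<open>
  \<open>F\<close> is a maximal extension in which \<open>K\<close> is dense. Maximality is tested against arbitrary
  valued extension fields \<open>(M,w)\<close> of \<open>F\<close>, which need not lie in \<open>L\<close>. Fixing the carrier type
  \<open>'g \<Rightarrow> 'a\<close> and the value type \<open>'g\<close> loses nothing: if \<open>K\<close> is dense in \<open>M\<close>, then \<open>M\<close> and \<open>K\<close>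
  have the same value group, and an element \<open>y\<close> of \<open>M\<close> is determined by any family
  \<open>\<gamma> \<mapsto> c\<^sub>\<gamma>\<close> of elements of \<open>K\<close>, indexed by that group, with \<open>w (y - c\<^sub>\<gamma>) > \<gamma>\<close>.
\<close>

definition is_completion ::
  "('a, 'b) ring_scheme \<Rightarrow> ('a \<Rightarrow> 'g::linordered_ab_group_add extended) \<Rightarrow> 'a set \<Rightarrow> 'a set \<Rightarrow> bool"
  where
  "is_completion L v K F \<longleftrightarrow>
     subfield K L \<and> subfield F L \<and> K \<subseteq> F \<and> dense_in L v K F \<and>
     (\<forall>(M :: ('g \<Rightarrow> 'a) ring) (w :: ('g \<Rightarrow> 'a) \<Rightarrow> 'g extended) \<phi>.
        valued_field M w \<and>
        \<phi> \<in> ring_hom (L\<lparr>carrier := F\<rparr>) M \<and> (\<forall>a\<in>F. w (\<phi> a) = v a) \<and>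
        dense_in M w (\<phi> ` K) (carrier M)
        \<longrightarrow> \<phi> ` F = carrier M)"


section \<open>Henselizations and implicit constant fields\<close>

text \<open>If \<open>L\<close> is algebraically closed, this is the algebraic closure of \<open>F\<close> inside \<open>L\<close>.\<close>

definition algebraic_closure_in :: "('a, 'b) ring_scheme \<Rightarrow> 'a set \<Rightarrow> 'a set" where
  "algebraic_closure_in L F = {x \<in> carrier L. (ring.algebraic L over F) x}"

text \<open>
  For \<open>L\<close> algebraically closed: the valuation of \<open>F\<close> extends uniquely to the algebraic closure.
  Every extension \<open>w\<close> has its value group in the divisible hull of that of \<open>F\<close>, and the value
  group of the algebraic closure under \<open>v\<close> is such a hull in \<open>'g\<close>; hence \<open>'g\<close>-valued \<open>w\<close> suffice.
\<close>

definition henselian ::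
  "('a, 'b) ring_scheme \<Rightarrow> ('a \<Rightarrow> 'g::linordered_ab_group_add extended) \<Rightarrow> 'a set \<Rightarrow> bool" where
  "henselian L v F \<longleftrightarrow> subfield F L \<and>
     (\<forall>w :: 'a \<Rightarrow> 'g extended.
        valued_field (L\<lparr>carrier := algebraic_closure_in L F\<rparr>) w \<and> (\<forall>a\<in>F. w a = v a)
        \<longrightarrow> (\<forall>a\<in>algebraic_closure_in L F. w a = v a))"

text \<open>The smallest henselian field between \<open>F\<close> and its algebraic closure.\<close>

definition henselization ::
  "('a, 'b) ring_scheme \<Rightarrow> ('a \<Rightarrow> 'g::linordered_ab_group_add extended) \<Rightarrow> 'a set \<Rightarrow> 'a set" where
  "henselization L v F =
     \<Inter> {E. F \<subseteq> E \<and> E \<subseteq> algebraic_closure_in L F \<and> henselian L v E}"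

definition adjoin :: "('a, 'b) ring_scheme \<Rightarrow> 'a set \<Rightarrow> 'a \<Rightarrow> 'a set" where
  "adjoin L F x = generate_field L (insert x F)"

definition IC ::
  "('a, 'b) ring_scheme \<Rightarrow> ('a \<Rightarrow> 'g::linordered_ab_group_add extended) \<Rightarrow> 'a set \<Rightarrow> 'a \<Rightarrow> 'a set"
  where
  "IC L v F x = algebraic_closure_in L F \<inter> henselization L v (adjoin L F x)"


section \<open>Value transcendental and residue transcendental extensions\<close>

definition int_mult :: "int \<Rightarrow> 'g::ab_group_add \<Rightarrow> 'g" where
  "int_mult n g = (\<Sum>i<nat n. g) - (\<Sum>i<nat (- n). g)"

text \<open>
  For subgroups \<open>H \<subseteq> G\<close>: the images of the elements of \<open>B\<close> form a \<open>\<rat>\<close>-basis of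
  \<open>(G/H) \<otimes> \<rat>\<close>, with denominators cleared. Every \<open>\<rat>\<close>-basis can be rescaled to one
  of this form, so the cardinality of \<open>B\<close> is the dimension.
\<close>

definition rational_basis :: "'g::ab_group_add set \<Rightarrow> 'g set \<Rightarrow> 'g set \<Rightarrow> bool" where
  "rational_basis G H B \<longleftrightarrow> B \<subseteq> G \<and>
     (\<forall>S c. finite S \<and> S \<subseteq> B \<and> (\<Sum>b\<in>S. int_mult (c b) b) \<in> H \<longrightarrow> (\<forall>b\<in>S. c b = 0)) \<and>
     (\<forall>g\<in>G. \<exists>n S c. n \<noteq> 0 \<and> finite S \<and> S \<subseteq> B \<and>
        int_mult n g - (\<Sum>b\<in>S. int_mult (c b) b) \<in> H)"

definition has_rational_rank :: "'g::ab_group_add set \<Rightarrow> 'g set \<Rightarrow> nat \<Rightarrow> bool" where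
  "has_rational_rank G H n \<longleftrightarrow> (\<exists>B. rational_basis G H B \<and> finite B \<and> card B = n)"

definition transcendence_basis ::
  "('a, 'b) ring_scheme \<Rightarrow> 'a set \<Rightarrow> 'a set \<Rightarrow> 'a set \<Rightarrow> bool" where
  "transcendence_basis R F E B \<longleftrightarrow> B \<subseteq> E \<and>
     (\<forall>b\<in>B. (ring.transcendental R over generate_field R (F \<union> (B - {b}))) b) \<and>
     (\<forall>y\<in>E. (ring.algebraic R over generate_field R (F \<union> B)) y)"

definition has_trdeg ::
  "('a, 'b) ring_scheme \<Rightarrow> 'a set \<Rightarrow> 'a set \<Rightarrow> nat \<Rightarrow> bool" where
  "has_trdeg R F E n \<longleftrightarrow> (\<exists>B. transcendence_basis R F E B \<and> finite B \<and> card B = n)"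

text \<open>The following notions concern the extension \<open>(K(x)|K,v)\<close> inside \<open>(L,v)\<close>.\<close>

definition value_transcendental ::
  "('a, 'b) ring_scheme \<Rightarrow> ('a \<Rightarrow> 'g::linordered_ab_group_add extended) \<Rightarrow> 'a set \<Rightarrow> 'a \<Rightarrow> bool"
  where
  "value_transcendental L v K x \<longleftrightarrow>
     has_rational_rank (value_group L v (adjoin L K x)) (value_group L v K) 1"

definition residue_transcendental ::
  "('a, 'b) ring_scheme \<Rightarrow> ('a \<Rightarrow> 'g::linordered_ab_group_add extended) \<Rightarrow> 'a set \<Rightarrow> 'a \<Rightarrow> bool"
  where
  "residue_transcendental L v K x \<longleftrightarrow>
     has_trdeg (residue_field L v (adjoin L K x)) (residue_subfield L v (adjoin L K x) K)
       (carrier (residue_field L v (adjoin L K x))) 1"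

definition valuation_algebraic ::
  "('a, 'b) ring_scheme \<Rightarrow> ('a \<Rightarrow> 'g::linordered_ab_group_add extended) \<Rightarrow> 'a set \<Rightarrow> 'a \<Rightarrow> bool"
  where
  "valuation_algebraic L v K x \<longleftrightarrow>
     \<not> value_transcendental L v K x \<and> \<not> residue_transcendental L v K x"


section \<open>Pseudo-Cauchy sequences\<close>

text \<open>A limit ordinal is represented by a well-order without greatest element.\<close>

definition limit_well_order :: "'i rel \<Rightarrow> bool" where
  "limit_well_order r \<longleftrightarrow>
     Well_order r \<and> Field r \<noteq> {} \<and> (\<forall>i\<in>Field r. \<exists>j. (i, j) \<in> r - Id)"

definition pseudo_Cauchy ::
  "('a, 'b) ring_scheme \<Rightarrow> ('a \<Rightarrow> 'g::linordered_ab_group_add extended) \<Rightarrow> 'a set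
    \<Rightarrow> 'i rel \<Rightarrow> ('i \<Rightarrow> 'a) \<Rightarrow> bool" where
  "pseudo_Cauchy L v F r z \<longleftrightarrow>
     limit_well_order r \<and> (\<forall>i\<in>Field r. z i \<in> F) \<and>
     (\<forall>i j k. (i, j) \<in> r - Id \<and> (j, k) \<in> r - Id \<longrightarrow>
        v (z i \<ominus>\<^bsub>L\<^esub> z j) < v (z j \<ominus>\<^bsub>L\<^esub> z k))"

definition transcendental_type ::
  "('a, 'b) ring_scheme \<Rightarrow> ('a \<Rightarrow> 'g::linordered_ab_group_add extended) \<Rightarrow> 'a set
    \<Rightarrow> 'i rel \<Rightarrow> ('i \<Rightarrow> 'a) \<Rightarrow> bool" where
  "transcendental_type L v F r z \<longleftrightarrow>
     pseudo_Cauchy L v F r z \<and>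
     (\<forall>h \<in> carrier (F[X]\<^bsub>L\<^esub>). \<exists>i\<in>Field r. \<forall>j. (i, j) \<in> r \<longrightarrow>
        v (ring.eval L h (z j)) = v (ring.eval L h (z i)))"

text \<open>
  The sequences \<open>a\<close> in the algebraic closure of \<open>K\<close> for which \<open>v (x - a\<^sub>i)\<close> is strictly
  increasing and cofinal in \<open>{v (x - c) | c}\<close>, with \<open>c\<close> in the algebraic closure of \<open>K\<close>.
\<close>

definition approximates ::
  "('a, 'b) ring_scheme \<Rightarrow> ('a \<Rightarrow> 'g::linordered_ab_group_add extended) \<Rightarrow> 'a set \<Rightarrow> 'a
    \<Rightarrow> 'i rel \<Rightarrow> ('i \<Rightarrow> 'a) \<Rightarrow> bool" where
  "approximates L v K x r a \<longleftrightarrow>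
     limit_well_order r \<and> (\<forall>i\<in>Field r. a i \<in> algebraic_closure_in L K) \<and>
     (\<forall>i j. (i, j) \<in> r - Id \<longrightarrow> v (x \<ominus>\<^bsub>L\<^esub> a i) < v (x \<ominus>\<^bsub>L\<^esub> a j)) \<and>
     (\<forall>c\<in>algebraic_closure_in L K. \<exists>i\<in>Field r. v (x \<ominus>\<^bsub>L\<^esub> c) \<le> v (x \<ominus>\<^bsub>L\<^esub> a i))"

text \<open>
  \<open>Kh\<close> is the completion of \<open>K\<close>. The index type \<open>'g\<close> is general enough: an index \<open>i\<close> may be
  replaced by the value \<open>v (x - a\<^sub>i)\<close>. The type does not depend on the chosen sequence.
\<close>

definition valuation_algebraic_type_I ::
  "('a, 'b) ring_scheme \<Rightarrow> ('a \<Rightarrow> 'g::linordered_ab_group_add extended) \<Rightarrow> 'a set \<Rightarrow> 'a set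
    \<Rightarrow> 'a \<Rightarrow> bool" where
  "valuation_algebraic_type_I L v K Kh x \<longleftrightarrow>
     valuation_algebraic L v K x \<and>
     (\<exists>(r :: 'g rel) a. approximates L v K x r a \<and>
        transcendental_type L v (algebraic_closure_in L Kh) r a)"

definition valuation_algebraic_type_II ::
  "('a, 'b) ring_scheme \<Rightarrow> ('a \<Rightarrow> 'g::linordered_ab_group_add extended) \<Rightarrow> 'a set \<Rightarrow> 'a set
    \<Rightarrow> 'a \<Rightarrow> bool" where
  "valuation_algebraic_type_II L v K Kh x \<longleftrightarrow>
     valuation_algebraic L v K x \<and> \<not> valuation_algebraic_type_I L v K Kh x"

end

theory Submission
  imports Defs
begin

text \<open>
  Let \<open>E\<close> and \<open>F\<close> be the implicit constant fields over \<open>K\<close> and \<open>Kh\<close>, and \<open>A\<close> and \<open>B\<close> the algebraic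
  closures of \<open>K\<close> and \<open>Kh\<close>. A field is henselian iff conjugate elements over it have equal values,
  so a henselian field containing \<open>Kh(x)\<close> meets the algebraic closure of \<open>K(x)\<close> in a henselian
  field; hence \<open>E \<subseteq> F\<close>. Conversely, let \<open>b \<in> A\<close> be separable over \<open>K\<close> and lie in \<open>F\<close>. If some
  henselian field containing \<open>K(x)\<close> did not contain \<open>b\<close>, then an isometry over that field would
  move \<open>b\<close>. Restrict it to \<open>A\<close>, extend it by continuity to \<open>B\<close>, then by \<open>x \<mapsto> x\<close>, and finally to \<open>L\<close>.
  The fixed field of the result is henselian, contains \<open>Kh(x)\<close> and misses \<open>b\<close>, a contradiction;
  so \<open>b \<in> E\<close>. Elements of \<open>F\<close> are separable over \<open>Kh\<close>, and Krasner's lemma approximates them by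
  such \<open>b\<close>; hence \<open>E\<close> is dense in \<open>F\<close>. Finally, \<open>F\<close> contains the \<open>Kh\<close>-span of a finite basis of
  \<open>E\<close>, which is complete because \<open>Kh\<close> is, so every limit of elements of \<open>E\<close> lies in \<open>F\<close>.
\<close>

section \<open>Polynomials as coefficient lists, constant term first\<close>

text \<open>The isometry that moves \<open>b\<close> preserves values only on the algebraic closure
  of a henselian field about which little is known, and it must be carried over to fields neither
  containing this closure nor contained in it. Partial isomorphisms are therefore kept as subrings
  of \<open>L \<times> L\<close>: a polynomial over such a subring is evaluated on both sides at
  once, unions of chains stay of this form, and plain isomorphisms are the case of the trivial
  valuation. Newton polygons take the place of Galois theory. The values of the roots of a monic
  polynomial depend only on the values of its coefficients; this gives both the criterion by
  conjugates and the isometric extension to algebraic elements. Sending \<open>x\<close> to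
  \<open>x\<close> preserves values because \<open>x\<close> lies in the henselian field, so
  \<open>v (x - a)\<close> is preserved for \<open>a\<close> in \<open>A\<close>. Approximation
  carries this to \<open>B\<close>; two elements of \<open>B\<close> closer to \<open>x\<close> than
  every value of \<open>K\<close> are equal. Values in \<open>L\<close> may exceed all values of
  \<open>K\<close>, so each approximation is made up to a bound in the value group of
  \<open>K\<close>, which is cofinal in that of \<open>B\<close>. Separability of an element is
  witnessed by a polynomial whose derivative does not vanish at it.\<close>

fun ev :: "('a, 'b) ring_scheme \<Rightarrow> 'a list \<Rightarrow> 'a \<Rightarrow> 'a" where
  "ev R [] y = \<zero>\<^bsub>R\<^esub>"
| "ev R (c # cs) y = c \<oplus>\<^bsub>R\<^esub> y \<otimes>\<^bsub>R\<^esub> ev R cs y"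

text \<open>The formal derivative at \<open>y\<close>, from the product rule
  \<open>(c + T g)' = g + T g'\<close>; in this form no integer multiples of coefficients
  occur.\<close>

fun dv :: "('a, 'b) ring_scheme \<Rightarrow> 'a list \<Rightarrow> 'a \<Rightarrow> 'a" where
  "dv R [] y = \<zero>\<^bsub>R\<^esub>"
| "dv R (c # cs) y = ev R cs y \<oplus>\<^bsub>R\<^esub> y \<otimes>\<^bsub>R\<^esub> dv R cs y"

fun padd :: "('a, 'b) ring_scheme \<Rightarrow> 'a list \<Rightarrow> 'a list \<Rightarrow> 'a list" where
  "padd R [] q = q"
| "padd R (a # p) [] = a # p"
| "padd R (a # p) (b # q) = (a \<oplus>\<^bsub>R\<^esub> b) # padd R p q"

fun pmul :: "('a, 'b) ring_scheme \<Rightarrow> 'a list \<Rightarrow> 'a list \<Rightarrow> 'a list" where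
  "pmul R [] q = []"
| "pmul R (a # p) q = padd R (map ((\<otimes>\<^bsub>R\<^esub>) a) q) (\<zero>\<^bsub>R\<^esub> # pmul R p q)"

text \<open>The coefficients of \<open>r + (T - z) f\<close>.\<close>

fun plin :: "('a, 'b) ring_scheme \<Rightarrow> 'a \<Rightarrow> 'a \<Rightarrow> 'a list \<Rightarrow> 'a list" where
  "plin R z r [] = [r]"
| "plin R z r (c # cs) = (r \<ominus>\<^bsub>R\<^esub> z \<otimes>\<^bsub>R\<^esub> c) # plin R z c cs"

context cring begin

lemma ev_closed [simp, intro]:
  "set p \<subseteq> carrier R \<Longrightarrow> y \<in> carrier R \<Longrightarrow> ev R p y \<in> carrier R"
  by (induction p) auto

lemma dv_closed [simp, intro]:
  "set p \<subseteq> carrier R \<Longrightarrow> y \<in> carrier R \<Longrightarrow> dv R p y \<in> carrier R"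
  by (induction p) auto

lemma set_padd: "subring S R \<Longrightarrow> set p \<subseteq> S \<Longrightarrow> set q \<subseteq> S \<Longrightarrow> set (padd R p q) \<subseteq> S"
  by (induction R p q rule: padd.induct) (auto simp: subringE)

lemma set_padd_carrier [simp]:
  "set p \<subseteq> carrier R \<Longrightarrow> set q \<subseteq> carrier R \<Longrightarrow> set (padd R p q) \<subseteq> carrier R"
  using set_padd carrier_is_subring by blast

lemma length_padd: "length (padd R p q) = max (length p) (length q)"
  by (induction R p q rule: padd.induct) auto

lemma ev_padd:
  "set p \<subseteq> carrier R \<Longrightarrow> set q \<subseteq> carrier R \<Longrightarrow> y \<in> carrier R \<Longrightarrow>
     ev R (padd R p q) y = ev R p y \<oplus> ev R q y"
proof (induction p arbitrary: q)
  case (Cons a p)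
  show ?case using Cons by (cases q) (auto simp: r_distr a_ac)
qed auto

lemma dv_padd:
  "set p \<subseteq> carrier R \<Longrightarrow> set q \<subseteq> carrier R \<Longrightarrow> y \<in> carrier R \<Longrightarrow>
     dv R (padd R p q) y = dv R p y \<oplus> dv R q y"
proof (induction p arbitrary: q)
  case (Cons a p)
  show ?case using Cons by (cases q) (auto simp: ev_padd r_distr a_ac)
qed auto

lemma set_smult: "subring S R \<Longrightarrow> a \<in> S \<Longrightarrow> set q \<subseteq> S \<Longrightarrow> set (map ((\<otimes>) a) q) \<subseteq> S"
  by (auto simp: subringE)

lemma ev_smult:
  "a \<in> carrier R \<Longrightarrow> set q \<subseteq> carrier R \<Longrightarrow> y \<in> carrier R \<Longrightarrow>
     ev R (map ((\<otimes>) a) q) y = a \<otimes> ev R q y"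
  by (induction q) (auto simp: r_distr m_lcomm)

lemma dv_smult:
  "a \<in> carrier R \<Longrightarrow> set q \<subseteq> carrier R \<Longrightarrow> y \<in> carrier R \<Longrightarrow>
     dv R (map ((\<otimes>) a) q) y = a \<otimes> dv R q y"
  by (induction q) (auto simp: ev_smult r_distr m_lcomm)

lemma set_pmul: "subring S R \<Longrightarrow> set p \<subseteq> S \<Longrightarrow> set q \<subseteq> S \<Longrightarrow> set (pmul R p q) \<subseteq> S"
proof (induction p)
  case (Cons a p)
  then have "set (\<zero> # pmul R p q) \<subseteq> S" "set (map ((\<otimes>) a) q) \<subseteq> S"
    by (auto simp: subringE)
  then show ?case using set_padd[OF Cons.prems(1)] by simp
qed simp

lemma ev_pmul:
  "set p \<subseteq> carrier R \<Longrightarrow> set q \<subseteq> carrier R \<Longrightarrow> y \<in> carrier R \<Longrightarrow>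
     ev R (pmul R p q) y = ev R p y \<otimes> ev R q y"
proof (induction p)
  case (Cons a p)
  have "set (\<zero> # pmul R p q) \<subseteq> carrier R" "set (map ((\<otimes>) a) q) \<subseteq> carrier R"
    using Cons.prems set_pmul[OF carrier_is_subring, of p q] by auto
  then show ?case using Cons by (simp add: ev_padd ev_smult l_distr m_assoc)
qed simp

lemma ev_append:
  "set p \<subseteq> carrier R \<Longrightarrow> set q \<subseteq> carrier R \<Longrightarrow> y \<in> carrier R \<Longrightarrow>
     ev R (p @ q) y = ev R p y \<oplus> y [^] length p \<otimes> ev R q y"
  by (induction p) (auto simp: r_distr m_ac a_ac)

text \<open>The derivative of the monomial \<open>T^n\<close> stays an unevaluated
  \<open>dv\<close>; in \<open>monic_division\<close> the two terms containing it cancel.\<close>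

lemma dv_snoc:
  "set p \<subseteq> carrier R \<Longrightarrow> a \<in> carrier R \<Longrightarrow> y \<in> carrier R \<Longrightarrow>
     dv R (p @ [a]) y = dv R p y \<oplus> a \<otimes> dv R (replicate (length p) \<zero> @ [\<one>]) y"
proof (induction p)
  case (Cons c p)
  have "set (replicate (length p) \<zero> @ [\<one>]) \<subseteq> carrier R" by auto
  moreover have "ev R (replicate k \<zero>) y = \<zero>" for k using Cons.prems by (induction k) auto
  ultimately show ?case using Cons
    by (simp add: ev_append r_distr m_ac a_ac)
qed auto

lemma ev_all_zero: "set p \<subseteq> {\<zero>} \<Longrightarrow> y \<in> carrier R \<Longrightarrow> ev R p y = \<zero>"
  by (induction p) auto

lemma dv_all_zero: "set p \<subseteq> {\<zero>} \<Longrightarrow> y \<in> carrier R \<Longrightarrow> dv R p y = \<zero>"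
  by (induction p) (auto simp: ev_all_zero)

lemma length_plin [simp]: "length (plin R z r cs) = Suc (length cs)"
  by (induction R z r cs rule: plin.induct) auto

lemma plin_closed:
  "subring S R \<Longrightarrow> z \<in> S \<Longrightarrow> r \<in> S \<Longrightarrow> set cs \<subseteq> S \<Longrightarrow> set (plin R z r cs) \<subseteq> S"
  by (induction cs arbitrary: r) (auto simp: subringE a_minus_def)

lemma plin_carrier [simp]:
  "z \<in> carrier R \<Longrightarrow> r \<in> carrier R \<Longrightarrow> set cs \<subseteq> carrier R \<Longrightarrow> set (plin R z r cs) \<subseteq> carrier R"
  using plin_closed carrier_is_subring by blast

lemma ev_plin:
  "z \<in> carrier R \<Longrightarrow> r \<in> carrier R \<Longrightarrow> set cs \<subseteq> carrier R \<Longrightarrow> y \<in> carrier R \<Longrightarrow>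
     ev R (plin R z r cs) y = r \<oplus> (y \<ominus> z) \<otimes> ev R cs y"
proof (induction cs arbitrary: r)
  case (Cons c cs)
  then have "ev R cs y \<in> carrier R" "c \<in> carrier R" by auto
  moreover have "ev R (plin R z c cs) y = c \<oplus> (y \<ominus> z) \<otimes> ev R cs y" using Cons by auto
  ultimately show ?case using Cons.prems by (simp, algebra)
qed simp

lemma dv_plin:
  "z \<in> carrier R \<Longrightarrow> r \<in> carrier R \<Longrightarrow> set cs \<subseteq> carrier R \<Longrightarrow> y \<in> carrier R \<Longrightarrow>
     dv R (plin R z r cs) y = ev R cs y \<oplus> (y \<ominus> z) \<otimes> dv R cs y"
proof (induction cs arbitrary: r)
  case (Cons c cs)
  then have "ev R cs y \<in> carrier R" "dv R cs y \<in> carrier R" "c \<in> carrier R" by auto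
  moreover have "dv R (plin R z c cs) y = ev R cs y \<oplus> (y \<ominus> z) \<otimes> dv R cs y" using Cons by auto
  ultimately show ?case using Cons.prems by (simp add: ev_plin, algebra)
qed simp

text \<open>Horner's scheme: if \<open>cs\<close> is \<open>r + (T - z) ds\<close>, then
  \<open>c + T cs\<close> has the remainder \<open>c + z r\<close> and the quotient
  \<open>r + T ds\<close>.\<close>

lemma synthetic_division:
  assumes "subring S R" "z \<in> S" "set cs \<subseteq> S" "cs \<noteq> []"
  shows "\<exists>r ds. r \<in> S \<and> set ds \<subseteq> S \<and> cs = plin R z r ds"
  using assms(3,4)
proof (induction cs)
  case (Cons c cs)
  have S: "S \<subseteq> carrier R" using subringE(1)[OF assms(1)] .
  show ?case
  proof (cases "cs = []")
    case True
    then show ?thesis using Cons.prems by (intro exI[of _ c] exI[of _ "[]"]) auto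
  next
    case False
    then obtain r ds where r: "r \<in> S" "set ds \<subseteq> S" "cs = plin R z r ds" using Cons by auto
    have "c \<oplus> z \<otimes> r \<in> S" using Cons.prems r assms by (auto simp: subringE)
    moreover have "c = (c \<oplus> z \<otimes> r) \<ominus> z \<otimes> r"
    proof -
      have "c \<in> carrier R" "z \<in> carrier R" "r \<in> carrier R" using Cons.prems r S assms(2) by auto
      then show ?thesis by algebra
    qed
    ultimately show ?thesis using r
      by (intro exI[of _ "c \<oplus> z \<otimes> r"] exI[of _ "r # ds"]) auto
  qed
qed simp

lemma last_plin: "cs \<noteq> [] \<Longrightarrow> last (plin R z r cs) = last cs"
proof (induction cs arbitrary: r)
  case (Cons c cs)
  then show ?case by (cases cs) auto
qed simp

lemma monic_synthetic_division:
  assumes "subring S R" "z \<in> S" "set m \<subseteq> S" "m \<noteq> []" "ev R (m @ [\<one>]) z = \<zero>"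
  shows "\<exists>k. set k \<subseteq> S \<and> m @ [\<one>] = plin R z \<zero> (k @ [\<one>]) \<and> length m = Suc (length k)"
proof -
  have S: "S \<subseteq> carrier R" using subringE(1)[OF assms(1)] .
  obtain r ds where r: "r \<in> S" "set ds \<subseteq> S" "m @ [\<one>] = plin R z r ds"
    using synthetic_division[OF assms(1,2), of "m @ [\<one>]"] assms(1,3) by (auto simp: subringE)
  have "length (m @ [\<one>]) = Suc (length ds)" using r(3) by simp
  then have ds: "ds \<noteq> []" and len: "length m = length ds" using assms(4) by auto
  have "last ds = \<one>" using last_plin[OF ds, of z r] r(3) by (metis last_snoc)
  then obtain k where k: "ds = k @ [\<one>]" using ds by (metis append_butlast_last_id)
  have "r = \<zero>" using assms(5) ev_plin[of z r ds z] r S assms(2) by (auto simp: r_neg a_minus_def)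
  then show ?thesis using r k len by (intro exI[of _ k]) auto
qed

text \<open>The division of the tail is multiplied by \<open>T\<close> and the new constant term is
  added; a remainder that has become too long is shortened by a multiple of the divisor. The
  identity for derivatives is carried along because it does not follow from equality of values at
  all points.\<close>

lemma monic_division:
  assumes S: "subring S R" and m: "set m \<subseteq> S" and p: "set p \<subseteq> S"
  shows "\<exists>q r. set q \<subseteq> S \<and> set r \<subseteq> S \<and> length r \<le> length m \<and>
     (\<forall>z\<in>carrier R. ev R p z = ev R q z \<otimes> ev R (m @ [\<one>]) z \<oplus> ev R r z \<and>
       dv R p z = dv R q z \<otimes> ev R (m @ [\<one>]) z \<oplus> ev R q z \<otimes> dv R (m @ [\<one>]) z \<oplus> dv R r z)"
  using p
proof (induction p)
  case Nil
  have "set (m @ [\<one>]) \<subseteq> carrier R" using S m subringE(1) by auto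
  then show ?case by (intro exI[of _ "[]"]) (auto intro!: ev_closed dv_closed)
next
  case (Cons c p)
  let ?M = "m @ [\<one>]"
  have SR: "S \<subseteq> carrier R" using subringE(1)[OF S] .
  obtain q r where q: "set q \<subseteq> S" "set r \<subseteq> S" "length r \<le> length m"
    and ev_p: "\<And>z. z \<in> carrier R \<Longrightarrow> ev R p z = ev R q z \<otimes> ev R ?M z \<oplus> ev R r z"
    and dv_p: "\<And>z. z \<in> carrier R \<Longrightarrow>
      dv R p z = dv R q z \<otimes> ev R ?M z \<oplus> ev R q z \<otimes> dv R ?M z \<oplus> dv R r z"
    using Cons by auto
  have c: "c \<in> S" "set p \<subseteq> S" using Cons.prems by auto
  have M: "set ?M \<subseteq> carrier R" using m SR by auto
  define U where "U z = z \<otimes> ev R q z" for z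
  define D where "D z = ev R q z \<oplus> z \<otimes> dv R q z" for z
  have cs: "ev R (c # p) z = U z \<otimes> ev R ?M z \<oplus> ev R (c # r) z"
    "dv R (c # p) z = D z \<otimes> ev R ?M z \<oplus> U z \<otimes> dv R ?M z \<oplus> dv R (c # r) z"
    if z: "z \<in> carrier R" for z
  proof -
    have cl: "ev R ?M z \<in> carrier R" "dv R ?M z \<in> carrier R" "ev R q z \<in> carrier R"
      "dv R q z \<in> carrier R" "ev R r z \<in> carrier R" "dv R r z \<in> carrier R" "c \<in> carrier R"
      using M q c SR z by (auto intro!: ev_closed dv_closed)
    show "ev R (c # p) z = U z \<otimes> ev R ?M z \<oplus> ev R (c # r) z"
      unfolding U_def using cl z by (simp add: ev_p del: ev.simps(1)) algebra
    show "dv R (c # p) z = D z \<otimes> ev R ?M z \<oplus> U z \<otimes> dv R ?M z \<oplus> dv R (c # r) z"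
      unfolding U_def D_def using cl z by (simp add: ev_p dv_p) algebra
  qed
  show ?case
  proof (cases "length (c # r) \<le> length m")
    case True
    show ?thesis
    proof (intro exI conjI ballI)
      show "set (\<zero> # q) \<subseteq> S" "set (c # r) \<subseteq> S" "length (c # r) \<le> length m"
        using q c True S by (auto simp: subringE)
      fix z assume z: "z \<in> carrier R"
      then have "ev R q z \<in> carrier R" "dv R q z \<in> carrier R" using q SR by auto
      then show "ev R (c # p) z = ev R (\<zero> # q) z \<otimes> ev R ?M z \<oplus> ev R (c # r) z"
        "dv R (c # p) z = dv R (\<zero> # q) z \<otimes> ev R ?M z \<oplus> ev R (\<zero> # q) z \<otimes> dv R ?M z \<oplus> dv R (c # r) z"
        using cs[OF z] z by (simp_all add: U_def D_def)
    qed
  next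
    case False
    then obtain s a where s: "c # r = s @ [a]" "length s = length m"
      using q(3) by (metis append_butlast_last_id length_append_singleton length_Cons
          le_antisym not_less_eq_eq list.distinct(1) add_right_cancel nat.inject)
    have sa: "set s \<subseteq> S" "a \<in> S" using q c s by (metis Un_subset_iff insert_subset list.simps(15) set_append)+
    \<comment> \<open>With \<open>n = length m\<close>, the list \<open>c # r\<close> is
      \<open>s + a T^n\<close>. Subtracting \<open>a\<close> times the divisor cancels the top term
      and leaves \<open>?t\<close>.\<close>
    let ?t = "padd R s (map ((\<otimes>) (\<ominus> a)) m)"
    have ma: "\<ominus> a \<in> S" using sa S by (auto simp: subringE)
    show ?thesis
    proof (intro exI conjI ballI)
      show "set (a # q) \<subseteq> S" using sa q by auto
      show "set ?t \<subseteq> S" using set_padd[OF S sa(1) set_smult[OF S ma m]] .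
      show "length ?t \<le> length m" using s by (simp add: length_padd)
      fix z assume z: "z \<in> carrier R"
      have set: "set s \<subseteq> carrier R" "set m \<subseteq> carrier R" "set (map ((\<otimes>) (\<ominus> a)) m) \<subseteq> carrier R"
        "a \<in> carrier R" "set q \<subseteq> carrier R"
        using sa m SR set_smult[OF S ma m] q by auto
      define w where "w = dv R (replicate (length m) \<zero> @ [\<one>]) z"
      have w: "w \<in> carrier R" unfolding w_def using z by (intro dv_closed) auto
      have e: "ev R (c # r) z = ev R s z \<oplus> z [^] length m \<otimes> a"
        "ev R ?M z = ev R m z \<oplus> z [^] length m"
        "dv R (c # r) z = dv R s z \<oplus> a \<otimes> w" "dv R ?M z = dv R m z \<oplus> w"
        using z set dv_snoc[of s a z] dv_snoc[of m \<one> z] w_def w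
        by (auto simp: s(1) ev_append s(2))
      have t: "ev R ?t z = ev R s z \<ominus> a \<otimes> ev R m z" "dv R ?t z = dv R s z \<ominus> a \<otimes> dv R m z"
        using z set by (auto simp: ev_padd dv_padd ev_smult dv_smult a_minus_def l_minus)
      have cl: "ev R s z \<in> carrier R" "dv R s z \<in> carrier R" "ev R m z \<in> carrier R" "dv R m z \<in> carrier R"
        "ev R q z \<in> carrier R" "dv R q z \<in> carrier R" "z [^] length m \<in> carrier R"
        using set z by auto
      note cs = cs[OF z, unfolded e U_def D_def]
      show "ev R (c # p) z = ev R (a # q) z \<otimes> ev R ?M z \<oplus> ev R ?t z"
        unfolding cs(1) unfolding e t ev.simps using cl w set z by algebra
      show "dv R (c # p) z = dv R (a # q) z \<otimes> ev R ?M z \<oplus> ev R (a # q) z \<otimes> dv R ?M z \<oplus> dv R ?t z"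
        unfolding cs(2) unfolding e t ev.simps dv.simps using cl w set z by algebra
    qed
  qed
qed

end

section \<open>Products of linear factors, splitting and minimal polynomials\<close>

fun plins :: "('a, 'b) ring_scheme \<Rightarrow> 'a list \<Rightarrow> 'a list" where
  "plins R [] = [\<one>\<^bsub>R\<^esub>]"
| "plins R (z # zs) = plin R z \<zero>\<^bsub>R\<^esub> (plins R zs)"

lemma (in cring) set_plins: "subring S R \<Longrightarrow> set zs \<subseteq> S \<Longrightarrow> set (plins R zs) \<subseteq> S"
  by (induction zs) (simp_all add: subringE plin_closed)

lemma (in domain) ev_plins_eq_zero_iff:
  "set zs \<subseteq> carrier R \<Longrightarrow> y \<in> carrier R \<Longrightarrow> ev R (plins R zs) y = \<zero> \<longleftrightarrow> y \<in> set zs"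
proof (induction zs)
  case (Cons z zs)
  have "set (plins R zs) \<subseteq> carrier R" using set_plins[OF carrier_is_subring] Cons.prems by auto
  then show ?case using Cons by (auto simp: ev_plin integral_iff)
qed simp

lemma (in cring) ev_eq_eval:
  "set cs \<subseteq> carrier R \<Longrightarrow> y \<in> carrier R \<Longrightarrow> ev R cs y = eval (rev cs) y"
proof (induction cs)
  case (Cons c cs)
  then show ?case using eval_append_aux[of "rev cs" c y] eval_in_carrier[of "rev cs" y]
    by (auto simp: m_comm a_comm)
qed simp

lemma (in field) algebraic_iff_monic:
  assumes F: "subfield F R" and y: "y \<in> carrier R"
  shows "(algebraic over F) y \<longleftrightarrow> (\<exists>m. set m \<subseteq> F \<and> ev R (m @ [\<one>]) y = \<zero>)"
proof
  have FR: "F \<subseteq> carrier R" using subfieldE(3)[OF F] .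
  assume "(algebraic over F) y"
  then obtain p where p: "p \<in> carrier (F[X])" "p \<noteq> []" "eval p y = \<zero>"
    using algebraicE[OF subfieldE(1)[OF F] y] by auto
  then obtain a p' where p': "p = a # p'" by (cases p) auto
  have a: "a \<in> F - {\<zero>}" "set p' \<subseteq> F"
    using p(1) unfolding p' univ_poly_carrier[symmetric] polynomial_def by auto
  have inv: "inv a \<in> F" "inv a \<otimes> a = \<one>" using subfield_m_inv[OF F a(1)] by auto
  have "set (rev p) \<subseteq> carrier R" using a FR by (auto simp: p')
  then have "ev R (map ((\<otimes>) (inv a)) (rev p)) y = \<zero>"
    using ev_eq_eval[of "rev p" y] p(3) y inv FR by (simp add: ev_smult subset_iff)
  then have "ev R (map ((\<otimes>) (inv a)) (rev p') @ [\<one>]) y = \<zero>" by (simp add: p' inv)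
  moreover have "set (map ((\<otimes>) (inv a)) (rev p')) \<subseteq> F"
    using set_smult[OF subfieldE(1)[OF F] inv(1), of "rev p'"] a by simp
  ultimately show "\<exists>m. set m \<subseteq> F \<and> ev R (m @ [\<one>]) y = \<zero>" by blast
next
  have FR: "F \<subseteq> carrier R" using subfieldE(3)[OF F] .
  assume "\<exists>m. set m \<subseteq> F \<and> ev R (m @ [\<one>]) y = \<zero>"
  then obtain m where m: "set m \<subseteq> F" "ev R (m @ [\<one>]) y = \<zero>" by blast
  show "(algebraic over F) y"
  proof (rule algebraicI)
    show "\<one> # rev m \<in> carrier (F[X])"
      using m subringE(3)[OF subfieldE(1)[OF F]]
      unfolding univ_poly_carrier[symmetric] polynomial_def by auto
    show "eval (\<one> # rev m) y = \<zero>" using ev_eq_eval[of "m @ [\<one>]" y] m FR y by auto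
  qed simp
qed

lemma (in algebraically_closed) monic_has_root:
  assumes "set m \<subseteq> carrier L" "m \<noteq> []"
  shows "\<exists>y\<in>carrier L. ev L (m @ [\<one>]) y = \<zero>"
proof -
  let ?p = "\<one> # rev m"
  have p: "?p \<in> carrier (poly_ring L)"
    using assms unfolding univ_poly_carrier[symmetric] polynomial_def by auto
  have "size (roots ?p) = degree ?p" using roots_over_carrier[OF p] unfolding splitted_def .
  then have "roots ?p \<noteq> {#}" using assms(2) by auto
  then obtain y where "y \<in># roots ?p" by blast
  then have "is_root ?p y" using roots_mem_iff_is_root[OF p] by blast
  then show ?thesis using ev_eq_eval[of "m @ [\<one>]" y] assms(1) unfolding is_root_def by auto
qed

lemma (in algebraically_closed) monic_splits:
  "set m \<subseteq> carrier L \<Longrightarrow> \<exists>zs. set zs \<subseteq> carrier L \<and> m @ [\<one>] = plins L zs \<and> length zs = length m"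
proof (induction "length m" arbitrary: m)
  case 0
  then show ?case by (intro exI[of _ "[]"]) auto
next
  case (Suc n)
  then obtain y where y: "y \<in> carrier L" "ev L (m @ [\<one>]) y = \<zero>"
    using monic_has_root[of m] by fastforce
  obtain k where k: "set k \<subseteq> carrier L" "m @ [\<one>] = plin L y \<zero> (k @ [\<one>])" "length m = Suc (length k)"
    using monic_synthetic_division[OF carrier_is_subring y(1) Suc.prems _ y(2)] Suc(2) by fastforce
  then obtain zs where "set zs \<subseteq> carrier L" "k @ [\<one>] = plins L zs" "length zs = length k"
    using Suc by force
  then show ?case using k y by (intro exI[of _ "y # zs"]) auto
qed

text \<open>
  The minimal polynomial of \<open>h z\<close>, with coefficients lifted along \<open>h\<close>. The case \<open>h = id\<close> is the
  usual one; the case \<open>h = fst\<close> on a product ring serves to extend homomorphisms.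
\<close>

lemma minimal_polynomial_lift:
  fixes R (structure)
  assumes R: "cring R" and S: "subring S R" and h: "h \<in> ring_hom R L" and L: "domain L"
    and inv: "\<And>s. s \<in> S \<Longrightarrow> h s \<noteq> \<zero>\<^bsub>L\<^esub> \<Longrightarrow> \<exists>t\<in>S. t \<otimes>\<^bsub>R\<^esub> s = \<one>\<^bsub>R\<^esub>"
    and inj: "\<And>s. s \<in> S \<Longrightarrow> h s = \<zero>\<^bsub>L\<^esub> \<Longrightarrow> s = \<zero>\<^bsub>R\<^esub>"
    and z: "z \<in> carrier R" and p: "set p \<subseteq> S" "\<not> set p \<subseteq> {\<zero>\<^bsub>R\<^esub>}" "h (ev R p z) = \<zero>\<^bsub>L\<^esub>"
  obtains m where "set m \<subseteq> S" "h (ev R (m @ [\<one>\<^bsub>R\<^esub>]) z) = \<zero>\<^bsub>L\<^esub>"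
    "\<And>r. set r \<subseteq> S \<Longrightarrow> length r \<le> length m \<Longrightarrow> h (ev R r z) = \<zero>\<^bsub>L\<^esub> \<Longrightarrow> set r \<subseteq> {\<zero>\<^bsub>R\<^esub>}"
    "\<And>f. set f \<subseteq> S \<Longrightarrow> h (ev R f z) = \<zero>\<^bsub>L\<^esub> \<Longrightarrow> \<exists>q. set q \<subseteq> S \<and> (\<forall>w\<in>carrier R.
       ev R f w = ev R q w \<otimes>\<^bsub>R\<^esub> ev R (m @ [\<one>\<^bsub>R\<^esub>]) w \<and>
       dv R f w = dv R q w \<otimes>\<^bsub>R\<^esub> ev R (m @ [\<one>\<^bsub>R\<^esub>]) w \<oplus>\<^bsub>R\<^esub> ev R q w \<otimes>\<^bsub>R\<^esub> dv R (m @ [\<one>\<^bsub>R\<^esub>]) w)"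
proof -
  interpret cring R by fact
  interpret L: domain L by fact
  interpret h: ring_hom_ring R L h using h by unfold_locales
  have SR: "S \<subseteq> carrier R" using subringE(1)[OF S] .
  \<comment> \<open>An annihilating nonzero list of least length is wanted. Its last entry is
    nonzero, as it could be dropped otherwise; by \<open>inj\<close> and \<open>inv\<close> it is
    then invertible in \<open>S\<close>, so the list can be made monic.\<close>
  define P where "P f \<longleftrightarrow> set f \<subseteq> S \<and> \<not> set f \<subseteq> {\<zero>} \<and> h (ev R f z) = \<zero>\<^bsub>L\<^esub>" for f
  have "P p" using p by (simp add: P_def)
  then obtain g where g: "P g" and least: "\<And>f. P f \<Longrightarrow> length g \<le> length f"
    using ex_has_least_nat[of P p length] by blast
  have gne: "g \<noteq> []" using g by (auto simp: P_def)
  define a where "a = last g"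
  have ga: "g = butlast g @ [a]" using gne by (simp add: a_def)
  have set: "set (butlast g) \<subseteq> S" "a \<in> S" using g ga unfolding P_def by (metis Un_subset_iff insert_subset list.simps(15) set_append)+
  have "a \<noteq> \<zero>"
  proof
    assume "a = \<zero>"
    then have "ev R g z = ev R (butlast g) z"
      using set SR z by (subst ga) (simp add: ev_append subset_iff)
    moreover have "\<not> set (butlast g) \<subseteq> {\<zero>}" using g \<open>a = \<zero>\<close>
      by (metis P_def ga Un_subset_iff list.simps(15) set_append empty_set subset_refl)
    ultimately have "P (butlast g)" using g set by (simp add: P_def)
    then have "length g \<le> length (butlast g)" by (rule least)
    moreover have "length (butlast g) < length g" using gne by simp
    ultimately show False using leD by blast
  qed
  then obtain t where t: "t \<in> S" "t \<otimes> a = \<one>" using inv[of a] inj[of a] set by blast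
  define m where "m = map ((\<otimes>) t) (butlast g)"
  have m: "set m \<subseteq> S" unfolding m_def using set_smult[OF S t(1) set(1)] .
  have "map ((\<otimes>) t) g = m @ [\<one>]" by (subst ga) (simp add: m_def t)
  then have "ev R (m @ [\<one>]) z = t \<otimes> ev R g z"
    using ev_smult[of t g z] t g SR z unfolding P_def by auto
  moreover have "ev R g z \<in> carrier R" "t \<in> carrier R" using g SR z t unfolding P_def by auto
  ultimately have zero: "h (ev R (m @ [\<one>]) z) = \<zero>\<^bsub>L\<^esub>" using g unfolding P_def by simp
  have small: "set r \<subseteq> {\<zero>}" if "set r \<subseteq> S" "length r \<le> length m" "h (ev R r z) = \<zero>\<^bsub>L\<^esub>" for r
  proof (rule ccontr)
    assume "\<not> set r \<subseteq> {\<zero>}"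
    then have "length g \<le> length r" using that by (intro least) (simp add: P_def)
    moreover have "length m < length g" using gne by (simp add: m_def)
    ultimately show False using that by simp
  qed
  have "\<exists>q. set q \<subseteq> S \<and> (\<forall>w\<in>carrier R. ev R f w = ev R q w \<otimes> ev R (m @ [\<one>]) w \<and>
       dv R f w = dv R q w \<otimes> ev R (m @ [\<one>]) w \<oplus> ev R q w \<otimes> dv R (m @ [\<one>]) w)"
    if f: "set f \<subseteq> S" "h (ev R f z) = \<zero>\<^bsub>L\<^esub>" for f
  proof -
    obtain q r where q: "set q \<subseteq> S" "set r \<subseteq> S" "length r \<le> length m"
      and eq: "\<And>w. w \<in> carrier R \<Longrightarrow> ev R f w = ev R q w \<otimes> ev R (m @ [\<one>]) w \<oplus> ev R r w"
      "\<And>w. w \<in> carrier R \<Longrightarrow> dv R f w = dv R q w \<otimes> ev R (m @ [\<one>]) w \<oplus> ev R q w \<otimes> dv R (m @ [\<one>]) w \<oplus> dv R r w"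
      using monic_division[OF S m f(1)] by blast
    have cl: "ev R q w \<in> carrier R" "dv R q w \<in> carrier R" "ev R (m @ [\<one>]) w \<in> carrier R"
      "dv R (m @ [\<one>]) w \<in> carrier R" "ev R r w \<in> carrier R" if "w \<in> carrier R" for w
      using q m SR that by (auto intro!: ev_closed dv_closed)
    have "h (ev R r z) = \<zero>\<^bsub>L\<^esub>" using f(2) eq(1)[OF z] cl[OF z] zero by simp
    then have "set r \<subseteq> {\<zero>}" using small q by blast
    then show ?thesis using q eq cl by (intro exI[of _ q]) (simp add: ev_all_zero dv_all_zero)
  qed
  then show thesis using that[OF m zero] small by blast
qed

text \<open>For \<open>y\<close> algebraic over \<open>F\<close> this means that \<open>y'\<close>
  is a root of the minimal polynomial of \<open>y\<close>. No automorphism is mentioned;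
  \<open>conjugate_plain_graph\<close> produces the isomorphism when one is required.\<close>

definition conjugate :: "('a, 'b) ring_scheme \<Rightarrow> 'a set \<Rightarrow> 'a \<Rightarrow> 'a \<Rightarrow> bool" where
  "conjugate L F y y' \<longleftrightarrow> y \<in> carrier L \<and> y' \<in> carrier L \<and>
     (\<forall>p. set p \<subseteq> F \<and> ev L p y = \<zero>\<^bsub>L\<^esub> \<longrightarrow> ev L p y' = \<zero>\<^bsub>L\<^esub>)"

text \<open>The leading coefficient is left out of \<open>m\<close>. The last clause records
  divisibility together with its derivative, so that a simple root of some \<open>f\<close> is also
  a simple root of the minimal polynomial.\<close>

definition minimal_poly :: "('a, 'b) ring_scheme \<Rightarrow> 'a set \<Rightarrow> 'a \<Rightarrow> 'a list \<Rightarrow> bool" where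
  "minimal_poly R F y m \<longleftrightarrow> set m \<subseteq> F \<and> ev R (m @ [\<one>\<^bsub>R\<^esub>]) y = \<zero>\<^bsub>R\<^esub> \<and>
     (\<forall>r. set r \<subseteq> F \<and> length r \<le> length m \<and> ev R r y = \<zero>\<^bsub>R\<^esub> \<longrightarrow> set r \<subseteq> {\<zero>\<^bsub>R\<^esub>}) \<and>
     (\<forall>f. set f \<subseteq> F \<and> ev R f y = \<zero>\<^bsub>R\<^esub> \<longrightarrow> (\<exists>q. set q \<subseteq> F \<and> (\<forall>w\<in>carrier R.
       ev R f w = ev R q w \<otimes>\<^bsub>R\<^esub> ev R (m @ [\<one>\<^bsub>R\<^esub>]) w \<and>
       dv R f w = dv R q w \<otimes>\<^bsub>R\<^esub> ev R (m @ [\<one>\<^bsub>R\<^esub>]) w \<oplus>\<^bsub>R\<^esub> ev R q w \<otimes>\<^bsub>R\<^esub> dv R (m @ [\<one>\<^bsub>R\<^esub>]) w)))"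

context field begin

lemma minimal_poly_exists:
  assumes F: "subfield F R" and y: "y \<in> carrier R" and p: "set p \<subseteq> F" "\<not> set p \<subseteq> {\<zero>}" "ev R p y = \<zero>"
  shows "\<exists>m. minimal_poly R F y m"
proof -
  have p3: "id (ev R p y) = \<zero>" using p by simp
  show ?thesis
  proof (rule minimal_polynomial_lift[OF is_cring subfieldE(1)[OF F] id_ring_hom domain_axioms _ _ y p(1,2) p3])
    fix s assume "s \<in> F" "id s \<noteq> \<zero>"
    then show "\<exists>t\<in>F. t \<otimes> s = \<one>" using subfield_m_inv(1,3)[OF F, of s] by auto
  next
    fix m assume m: "set m \<subseteq> F" "id (ev R (m @ [\<one>]) y) = \<zero>"
      "\<And>r. set r \<subseteq> F \<Longrightarrow> length r \<le> length m \<Longrightarrow> id (ev R r y) = \<zero> \<Longrightarrow> set r \<subseteq> {\<zero>}"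
      "\<And>f. set f \<subseteq> F \<Longrightarrow> id (ev R f y) = \<zero> \<Longrightarrow> \<exists>q. set q \<subseteq> F \<and> (\<forall>w\<in>carrier R.
       ev R f w = ev R q w \<otimes> ev R (m @ [\<one>]) w \<and>
       dv R f w = dv R q w \<otimes> ev R (m @ [\<one>]) w \<oplus> ev R q w \<otimes> dv R (m @ [\<one>]) w)"
    have "minimal_poly R F y m"
      unfolding minimal_poly_def
    proof (intro conjI allI impI)
      fix f assume "set f \<subseteq> F \<and> ev R f y = \<zero>"
      then show "\<exists>q. set q \<subseteq> F \<and> (\<forall>w\<in>carrier R. ev R f w = ev R q w \<otimes> ev R (m @ [\<one>]) w \<and>
         dv R f w = dv R q w \<otimes> ev R (m @ [\<one>]) w \<oplus> ev R q w \<otimes> dv R (m @ [\<one>]) w)"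
        by (intro m(4)) simp_all
    qed (use m(1-3) in auto)
    then show "\<exists>m. minimal_poly R F y m" ..
  qed simp
qed

lemma minimal_poly_conjugate:
  assumes F: "subfield F R" and y: "y \<in> carrier R" and m: "minimal_poly R F y m"
    and y': "y' \<in> carrier R" "ev R (m @ [\<one>]) y' = \<zero>"
  shows "conjugate R F y y'"
  unfolding conjugate_def
proof (intro conjI allI impI)
  fix f assume "set f \<subseteq> F \<and> ev R f y = \<zero>"
  then obtain q where q: "set q \<subseteq> F" "ev R f y' = ev R q y' \<otimes> ev R (m @ [\<one>]) y'"
    using m y' unfolding minimal_poly_def by meson
  then have "ev R q y' \<in> carrier R" using subfieldE(3)[OF F] y' by auto
  then show "ev R f y' = \<zero>" using q y' by simp
qed (use y y' in auto)

lemma monic_nonzero: "\<not> set (m @ [\<one>]) \<subseteq> {\<zero>}"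
  by simp

lemma mem_of_monic_linear:
  assumes "subfield F R" "set m \<subseteq> F" "length m = 1" "ev R (m @ [\<one>]) y = \<zero>" "y \<in> carrier R"
  shows "y \<in> F"
proof -
  obtain c where c: "m = [c]" using assms(3) by (cases m) auto
  have cF: "c \<in> F" "c \<in> carrier R" using assms(1,2) c subfieldE(3) by auto
  then have "y \<oplus> c = \<zero>" using assms(4,5) c by (simp add: a_comm)
  then have "y = \<ominus> c" using cF assms(5) by (simp add: sum_zero_eq_neg)
  then show ?thesis using cF subringE(5)[OF subfieldE(1)[OF assms(1)]] by auto
qed

end

context algebraically_closed begin

text \<open>Since the derivative of \<open>f\<close> at \<open>y\<close> is a multiple of that of
  the minimal polynomial, the latter is nonzero as well. Writing the minimal polynomial as
  \<open>(T - y) k\<close>, its derivative at \<open>y\<close> is \<open>k(y)\<close>, so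
  \<open>y\<close> is no root of \<open>k\<close>. As \<open>y\<close> is not in \<open>F\<close>,
  the factor \<open>k\<close> is not constant and has a root, which is the desired
  conjugate.\<close>

lemma simple_root_conjugate:
  assumes F: "subfield F L" and f: "set f \<subseteq> F" "ev L f y = \<zero>" "dv L f y \<noteq> \<zero>"
    and y: "y \<in> carrier L" "y \<notin> F"
  shows "\<exists>y'. y' \<noteq> y \<and> conjugate L F y y'"
proof -
  have FL: "F \<subseteq> carrier L" using subfieldE(3)[OF F] .
  have "\<not> set f \<subseteq> {\<zero>}" using f(3) dv_all_zero y by blast
  then obtain m where min: "minimal_poly L F y m"
    using minimal_poly_exists[OF F y(1) f(1) _ f(2)] by blast
  then have m: "set m \<subseteq> F" "ev L (m @ [\<one>]) y = \<zero>" by (simp_all add: minimal_poly_def)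
  then have m3: "m \<noteq> []" using y by auto
  obtain q where q: "set q \<subseteq> F"
    "dv L f y = dv L q y \<otimes> ev L (m @ [\<one>]) y \<oplus> ev L q y \<otimes> dv L (m @ [\<one>]) y"
    using min f(1,2) y unfolding minimal_poly_def by meson
  have cl: "dv L q y \<in> carrier L" "ev L q y \<in> carrier L" "dv L (m @ [\<one>]) y \<in> carrier L"
    using q m FL y by (auto intro!: dv_closed)
  have dm: "dv L (m @ [\<one>]) y \<noteq> \<zero>" using q(2) f(3) m(2) cl by auto
  obtain k where k: "set k \<subseteq> carrier L" "m @ [\<one>] = plin L y \<zero> (k @ [\<one>])" "length m = Suc (length k)"
    using monic_synthetic_division[OF carrier_is_subring y(1) _ m3 m(2)] m(1) FL by blast
  have kc: "set (k @ [\<one>]) \<subseteq> carrier L" using k by auto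
  have "k \<noteq> []" using mem_of_monic_linear[OF F m(1) _ m(2) y(1)] k(3) y(2) by auto
  then obtain y' where y': "y' \<in> carrier L" "ev L (k @ [\<one>]) y' = \<zero>" using monic_has_root k by blast
  have "ev L (k @ [\<one>]) y \<noteq> \<zero>"
    using dm dv_plin[OF y(1) _ kc y(1), of \<zero>] k y dv_closed[OF kc y(1)] ev_closed[OF kc y(1)]
    by (auto simp: a_minus_def r_neg)
  moreover have "ev L (m @ [\<one>]) y' = \<zero>"
    using ev_plin[OF y(1) _ kc y'(1), of \<zero>] k(2) y y' by auto
  ultimately show ?thesis using y' minimal_poly_conjugate[OF F y(1) min] by metis
qed

text \<open>The roots of the minimal polynomial over \<open>E\<close> are roots of a polynomial over
  \<open>F\<close>, hence algebraic over \<open>F\<close>, and so are its coefficients. Lying in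
  \<open>E\<close>, these coefficients belong to \<open>F\<close> by \<open>rel\<close>; thus the
  minimal polynomial over \<open>E\<close> already has coefficients in \<open>F\<close>.\<close>

lemma conjugate_lift:
  assumes F: "subfield F L" and E: "subfield E L" "F \<subseteq> E" and y: "y \<in> carrier L" "(algebraic over F) y"
    and rel: "\<And>a. a \<in> E \<Longrightarrow> (algebraic over F) a \<Longrightarrow> a \<in> F" and conj: "conjugate L F y y'"
  shows "conjugate L E y y'"
proof -
  have EL: "E \<subseteq> carrier L" and FL: "F \<subseteq> carrier L" using subfieldE(3) E F by auto
  obtain f where f: "set f \<subseteq> F" "ev L (f @ [\<one>]) y = \<zero>"
    using algebraic_iff_monic[OF F y(1)] y(2) by blast
  have f1: "set (f @ [\<one>]) \<subseteq> F" using f subringE(3)[OF subfieldE(1)[OF F]] by auto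
  obtain m where min: "minimal_poly L E y m"
    using minimal_poly_exists[OF E(1) y(1) _ monic_nonzero f(2)] f1 E(2) by blast
  then have m: "set m \<subseteq> E" "ev L (m @ [\<one>]) y = \<zero>" by (simp_all add: minimal_poly_def)
  obtain q where q: "set q \<subseteq> E" "\<And>w. w \<in> carrier L \<Longrightarrow> ev L (f @ [\<one>]) w = ev L q w \<otimes> ev L (m @ [\<one>]) w"
    using min f(2) subset_trans[OF f1 E(2)] unfolding minimal_poly_def by meson
  obtain zs where zs: "set zs \<subseteq> carrier L" "m @ [\<one>] = plins L zs"
    using monic_splits[of m] m EL by blast
  let ?C = "{a \<in> carrier L. (algebraic over F) a}"
  have "subfield ?C L" using subfield_of_algebraics[OF F] .
  moreover have "set zs \<subseteq> ?C"
  proof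
    fix w assume w: "w \<in> set zs"
    then have wL: "w \<in> carrier L" using zs by auto
    have "ev L (m @ [\<one>]) w = \<zero>" using zs w by (simp add: ev_plins_eq_zero_iff subset_iff)
    then have "ev L (f @ [\<one>]) w = \<zero>" using q(2)[OF wL] ev_closed[of q w] q(1) EL wL by auto
    then show "w \<in> ?C" using wL algebraic_iff_monic[OF F wL] f(1) by blast
  qed
  ultimately have "set (m @ [\<one>]) \<subseteq> ?C" using set_plins[OF subfieldE(1)] zs(2) by metis
  then have "set (m @ [\<one>]) \<subseteq> F" using m(1) rel f1 by auto
  then have "ev L (m @ [\<one>]) y' = \<zero>" using conj m(2) unfolding conjugate_def by blast
  then show ?thesis using minimal_poly_conjugate[OF E(1) y(1) min] conj unfolding conjugate_def by blast
qed

end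

section \<open>Values and Newton polygons\<close>

lemma Fin_add_less: "x < y \<Longrightarrow> Fin (a :: 'g::linordered_ab_group_add) + x < Fin a + y"
  by (cases x; cases y) auto

lemma Fin_add_less_iff: "Fin (a :: 'g::linordered_ab_group_add) + x < Fin a + y \<longleftrightarrow> x < y"
  by (cases x; cases y) auto

lemma Fin_add_le_iff: "Fin (a :: 'g::linordered_ab_group_add) + x \<le> Fin a + y \<longleftrightarrow> x \<le> y"
  by (cases x; cases y) auto

lemma add_less_mono_extended:
  "a < b \<Longrightarrow> c \<le> d \<Longrightarrow> c \<noteq> Pinf \<Longrightarrow> a \<noteq> Minf \<Longrightarrow> c \<noteq> Minf \<Longrightarrow>
     (a :: 'g::linordered_ab_group_add extended) + c < b + d"
  by (cases a; cases b; cases c; cases d) (auto intro: add_less_le_mono)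

context valued_field begin

lemma v_cases: "a \<in> carrier L \<Longrightarrow> (a = \<zero> \<and> v a = Pinf) \<or> (a \<noteq> \<zero> \<and> (\<exists>\<gamma>. v a = Fin \<gamma>))"
  using v_nonzero v_zero by blast

lemma v_Pinf_iff: "a \<in> carrier L \<Longrightarrow> v a = Pinf \<longleftrightarrow> a = \<zero>"
  using v_cases[of a] by auto

lemma v_not_Minf [simp]: "a \<in> carrier L \<Longrightarrow> v a \<noteq> Minf"
  using v_cases[of a] by auto

lemma v_one [simp]: "v \<one> = Fin 0"
proof -
  obtain \<gamma> where "v \<one> = Fin \<gamma>" using v_nonzero[of \<one>] by auto
  then show ?thesis using v_mult[of \<one> \<one>] by auto
qed

lemma v_minus [simp]: assumes "a \<in> carrier L" shows "v (\<ominus> a) = v a"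
proof -
  obtain \<gamma> where g: "v (\<ominus> \<one>) = Fin \<gamma>" using v_nonzero[of "\<ominus> \<one>"] by auto
  have "\<ominus> \<one> \<otimes> \<ominus> \<one> = \<one>" by algebra
  then have "\<gamma> + \<gamma> = 0" using v_mult[of "\<ominus> \<one>" "\<ominus> \<one>"] g by auto
  then have "v (\<ominus> \<one>) = 0" using g by (simp add: zero_extended_def)
  moreover have "\<ominus> a = \<ominus> \<one> \<otimes> a" using assms by algebra
  ultimately show ?thesis using v_mult[of "\<ominus> \<one>" a] assms by simp
qed

lemma v_diff: "a \<in> carrier L \<Longrightarrow> b \<in> carrier L \<Longrightarrow> min (v a) (v b) \<le> v (a \<ominus> b)"
  using v_add[of a "\<ominus> b"] by (simp add: a_minus_def)

lemma v_diff_commute: "a \<in> carrier L \<Longrightarrow> b \<in> carrier L \<Longrightarrow> v (a \<ominus> b) = v (b \<ominus> a)"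
  using v_minus[of "a \<ominus> b"] by (simp add: a_minus_def minus_add a_comm)

lemma v_diff_trans:
  assumes "a \<in> carrier L" "b \<in> carrier L" "c \<in> carrier L"
  shows "min (v (a \<ominus> b)) (v (b \<ominus> c)) \<le> v (a \<ominus> c)"
proof -
  have "a \<ominus> c = (a \<ominus> b) \<oplus> (b \<ominus> c)" using assms by algebra
  then show ?thesis using v_add[of "a \<ominus> b" "b \<ominus> c"] assms by simp
qed

lemma v_add_eq:
  assumes "a \<in> carrier L" "b \<in> carrier L" "v a < v b"
  shows "v (a \<oplus> b) = v a"
proof (rule antisym)
  show "v a \<le> v (a \<oplus> b)" using v_add[of a b] assms by (simp add: min.absorb3 min.absorb4)
  have "a = (a \<oplus> b) \<ominus> b" using assms by algebra
  then have "min (v (a \<oplus> b)) (v b) \<le> v a" using v_diff[of "a \<oplus> b" b] assms by simp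
  then show "v (a \<oplus> b) \<le> v a" using assms(3) by (auto simp: min_def split: if_splits)
qed

lemma v_eq_of_diff:
  assumes "a \<in> carrier L" "b \<in> carrier L" "v a < v (a \<ominus> b)"
  shows "v b = v a"
proof -
  have "b = a \<oplus> \<ominus> (a \<ominus> b)" using assms by algebra
  then show ?thesis using v_add_eq[of a "\<ominus> (a \<ominus> b)"] assms by simp
qed

lemma v_inv:
  assumes "a \<in> carrier L" "a \<noteq> \<zero>" "v a = Fin \<gamma>"
  shows "v (inv a) = Fin (- \<gamma>)"
proof -
  have i: "inv a \<in> carrier L" "a \<otimes> inv a = \<one>" using assms field_Units by auto
  then have "Fin \<gamma> + v (inv a) = Fin 0" using v_mult[of a "inv a"] assms by simp
  then show ?thesis using v_cases[of "inv a"] i(1) by (auto simp: eq_neg_iff_add_eq_0 add.commute)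
qed

end

text \<open>The Gauss valuation: the minimum of \<open>v c_i + i \<gamma>\<close> over the
  coefficients \<open>c_i\<close>.\<close>

fun gauss_val :: "('a \<Rightarrow> 'g::linordered_ab_group_add extended) \<Rightarrow> 'g \<Rightarrow> 'a list \<Rightarrow> 'g extended" where
  "gauss_val v \<gamma> [] = Pinf"
| "gauss_val v \<gamma> (c # cs) = min (v c) (Fin \<gamma> + gauss_val v \<gamma> cs)"

text \<open>The minimum in \<open>gauss_val\<close> is attained at exactly one index; in terms of
  the Newton polygon, \<open>-\<gamma>\<close> is not a slope. Lists of zeros are excluded.\<close>

fun unique_min :: "('a \<Rightarrow> 'g::linordered_ab_group_add extended) \<Rightarrow> 'g \<Rightarrow> 'a list \<Rightarrow> bool" where
  "unique_min v \<gamma> [] = False"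
| "unique_min v \<gamma> (c # cs) \<longleftrightarrow> v c < Fin \<gamma> + gauss_val v \<gamma> cs \<or>
     (Fin \<gamma> + gauss_val v \<gamma> cs < v c \<and> unique_min v \<gamma> cs)"

lemma gauss_val_cong: "map v cs = map w ds \<Longrightarrow> gauss_val v \<gamma> cs = gauss_val w \<gamma> ds"
proof (induction cs arbitrary: ds)
  case (Cons c cs)
  then show ?case by (cases ds) auto
qed simp

lemma unique_min_cong: "map v cs = map w ds \<Longrightarrow> unique_min v \<gamma> cs = unique_min w \<gamma> ds"
proof (induction cs arbitrary: ds)
  case (Cons c cs)
  then obtain d ds' where "ds = d # ds'" by (cases ds) auto
  then show ?case using Cons gauss_val_cong[of v cs w ds' \<gamma>] by auto
qed simp

lemma unique_min_finite: "unique_min v \<gamma> cs \<Longrightarrow> gauss_val v \<gamma> cs \<noteq> Pinf"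
proof (induction cs)
  case (Cons c cs)
  show ?case
  proof
    assume "gauss_val v \<gamma> (c # cs) = Pinf"
    then have "v c = Pinf" "Fin \<gamma> + gauss_val v \<gamma> cs = Pinf"
      by (auto simp: min_def split: if_splits)
    then show False using Cons.prems by auto
  qed
qed simp

context valued_field begin

lemma gauss_val_not_Minf: "set cs \<subseteq> carrier L \<Longrightarrow> gauss_val v \<gamma> cs \<noteq> Minf"
proof (induction cs)
  case (Cons c cs)
  then have "Fin \<gamma> + gauss_val v \<gamma> cs \<noteq> Minf" by (cases "gauss_val v \<gamma> cs") auto
  then show ?case using Cons by (auto simp: min_def)
qed simp

lemma v_ev_ge:
  assumes "set cs \<subseteq> carrier L" "y \<in> carrier L" "Fin \<gamma> \<le> v y"
  shows "gauss_val v \<gamma> cs \<le> v (ev L cs y)"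
  using assms(1)
proof (induction cs)
  case (Cons c cs)
  then have c: "c \<in> carrier L" "ev L cs y \<in> carrier L" using assms(2) by auto
  have "Fin \<gamma> + gauss_val v \<gamma> cs \<le> v y + v (ev L cs y)"
    using Cons assms by (intro add_mono) auto
  also have "\<dots> = v (y \<otimes> ev L cs y)" using v_mult c assms by simp
  finally have "gauss_val v \<gamma> (c # cs) \<le> min (v c) (v (y \<otimes> ev L cs y))" by (auto simp: min_def)
  also have "\<dots> \<le> v (ev L (c # cs) y)" using v_add c assms(2) by simp
  finally show ?case .
qed (simp add: v_zero)

lemma v_ev_unique_min:
  assumes "set cs \<subseteq> carrier L" "y \<in> carrier L" "v y = Fin \<gamma>" "unique_min v \<gamma> cs"
  shows "v (ev L cs y) = gauss_val v \<gamma> cs"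
  using assms(1,4)
proof (induction cs)
  case (Cons c cs)
  then have c: "c \<in> carrier L" "ev L cs y \<in> carrier L" "y \<otimes> ev L cs y \<in> carrier L" using assms(2) by auto
  have y: "v (y \<otimes> ev L cs y) = Fin \<gamma> + v (ev L cs y)" using v_mult c assms by simp
  show ?case
  proof (cases "v c < Fin \<gamma> + gauss_val v \<gamma> cs")
    case True
    also have "Fin \<gamma> + gauss_val v \<gamma> cs \<le> v (y \<otimes> ev L cs y)"
      unfolding y using v_ev_ge[of cs y \<gamma>] Cons.prems assms by (intro add_left_mono) auto
    finally show ?thesis using v_add_eq[OF c(1,3)] True by (simp add: min.absorb3 min.absorb4)
  next
    case False
    then have lt: "Fin \<gamma> + gauss_val v \<gamma> cs < v c" and "unique_min v \<gamma> cs" using Cons.prems by auto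
    then have "v (ev L cs y) = gauss_val v \<gamma> cs" using Cons by auto
    then show ?thesis using v_add_eq[OF c(3,1)] lt y c by (simp add: min.absorb3 min.absorb4 a_comm)
  qed
qed simp

text \<open>The easy half of multiplicativity: every coefficient of \<open>(T - z) g\<close> is a
  difference of one coefficient of \<open>g\<close> and \<open>z\<close> times the next, and
  \<open>T - z\<close> itself has Gauss value at least \<open>\<mu>\<close>.\<close>

lemma gauss_val_plin_ge:
  assumes "Fin \<mu> \<le> v z" "\<mu> \<le> \<gamma>" "z \<in> carrier L" "r \<in> carrier L" "set cs \<subseteq> carrier L"
  shows "min (v r) (Fin \<mu> + gauss_val v \<gamma> cs) \<le> gauss_val v \<gamma> (plin L z r cs)"
  using assms(4,5)
proof (induction cs arbitrary: r)
  case (Cons c cs)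
  then have c: "c \<in> carrier L" "z \<otimes> c \<in> carrier L" using assms by auto
  let ?g = "gauss_val v \<gamma> cs"
  have "min (v r) (Fin \<mu> + v c) \<le> min (v r) (v z + v c)"
    using assms(1) by (intro min.mono add_right_mono) auto
  also have "\<dots> \<le> v (r \<ominus> z \<otimes> c)" using v_diff[of r "z \<otimes> c"] c Cons.prems v_mult assms(3) by simp
  finally have 1: "min (v r) (Fin \<mu> + v c) \<le> v (r \<ominus> z \<otimes> c)" .
  have 2: "min (v c) (Fin \<mu> + ?g) \<le> gauss_val v \<gamma> (plin L z c cs)" using Cons by auto
  have 3: "Fin \<gamma> + min (v c) (Fin \<mu> + ?g) \<le> Fin \<gamma> + gauss_val v \<gamma> (plin L z c cs)"
    using 2 by (simp add: Fin_add_le_iff)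
  have "Fin \<mu> + v c \<le> Fin \<gamma> + v c" using assms(2) by (intro add_right_mono) auto
  moreover have "Fin \<mu> + (Fin \<gamma> + ?g) = Fin \<gamma> + (Fin \<mu> + ?g)" by (simp add: add.left_commute)
  moreover have "Fin \<mu> + min (v c) (Fin \<gamma> + ?g) \<le> Fin \<mu> + v c"
    "Fin \<mu> + min (v c) (Fin \<gamma> + ?g) \<le> Fin \<mu> + (Fin \<gamma> + ?g)"
    by (simp_all add: Fin_add_le_iff)
  ultimately have "Fin \<mu> + min (v c) (Fin \<gamma> + ?g) \<le> Fin \<mu> + v c"
    "Fin \<mu> + min (v c) (Fin \<gamma> + ?g) \<le> Fin \<gamma> + min (v c) (Fin \<mu> + ?g)"
    by (auto simp: min_def)
  then have "min (v r) (Fin \<mu> + min (v c) (Fin \<gamma> + ?g)) \<le> min (v r) (Fin \<mu> + v c)"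
    "min (v r) (Fin \<mu> + min (v c) (Fin \<gamma> + ?g)) \<le> Fin \<gamma> + min (v c) (Fin \<mu> + ?g)"
    by (blast intro: min.mono order_refl min.coboundedI2)+
  then have "min (v r) (Fin \<mu> + min (v c) (Fin \<gamma> + ?g)) \<le> v (r \<ominus> z \<otimes> c)"
    "min (v r) (Fin \<mu> + min (v c) (Fin \<gamma> + ?g)) \<le> Fin \<gamma> + gauss_val v \<gamma> (plin L z c cs)"
    using 1 3 by (blast intro: order_trans)+
  then show ?case by simp
qed simp

text \<open>As \<open>v z < \<gamma>\<close>, the contribution \<open>- z c_i\<close> at index
  \<open>i\<close> lies below the contribution \<open>c_i\<close> at index \<open>i + 1\<close>. The
  minimising index therefore stays where it is, and \<open>r\<close> is too large to
  interfere.\<close>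

lemma unique_min_plin_low:
  assumes z: "z \<in> carrier L" "v z = Fin \<mu>" "\<mu> < \<gamma>" and cs: "set cs \<subseteq> carrier L" "unique_min v \<gamma> cs"
    and r: "r \<in> carrier L" "Fin \<mu> + gauss_val v \<gamma> cs < v r"
  shows "unique_min v \<gamma> (plin L z r cs) \<and> gauss_val v \<gamma> (plin L z r cs) = Fin \<mu> + gauss_val v \<gamma> cs"
  using cs r
proof (induction cs arbitrary: r)
  case (Cons c cs)
  then have c: "c \<in> carrier L" "z \<otimes> c \<in> carrier L" using z by auto
  let ?g = "gauss_val v \<gamma> cs"
  have vzc: "v (\<ominus> (z \<otimes> c)) = Fin \<mu> + v c" using v_mult z c by simp
  have eq: "r \<ominus> z \<otimes> c = \<ominus> (z \<otimes> c) \<oplus> r" using c Cons.prems by algebra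
  show ?case
  proof (cases "v c < Fin \<gamma> + ?g")
    case True
    then have "v (\<ominus> (z \<otimes> c)) < v r" using Cons.prems vzc by (simp add: min.absorb3 min.absorb4)
    then have 1: "v (r \<ominus> z \<otimes> c) = Fin \<mu> + v c" unfolding eq using v_add_eq vzc c Cons.prems by simp
    have vc: "v c \<noteq> Pinf" "v c \<noteq> Minf" using True c by auto
    have "Fin \<mu> + v c < Fin \<gamma> + v c" using z(3) vc by (cases "v c") auto
    moreover have "Fin \<mu> + v c < Fin \<gamma> + (Fin \<mu> + ?g)"
      using True by (metis Fin_add_less_iff add.left_commute)
    ultimately have "Fin \<mu> + v c < Fin \<gamma> + min (v c) (Fin \<mu> + ?g)" unfolding min_def by simp
    also have "\<dots> \<le> Fin \<gamma> + gauss_val v \<gamma> (plin L z c cs)"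
      using gauss_val_plin_ge[of \<mu> z \<gamma> c cs] z c Cons.prems by (simp add: Fin_add_le_iff)
    finally show ?thesis using 1 True by (simp add: min.absorb3 min.absorb4)
  next
    case False
    then have lt: "Fin \<gamma> + ?g < v c" and um: "unique_min v \<gamma> cs" using Cons.prems by auto
    have gf: "?g \<noteq> Pinf" "?g \<noteq> Minf" using unique_min_finite[OF um] gauss_val_not_Minf Cons.prems by auto
    have "Fin \<mu> + ?g < Fin \<gamma> + ?g" using z(3) gf by (cases ?g) auto
    then have IH: "unique_min v \<gamma> (plin L z c cs)" "gauss_val v \<gamma> (plin L z c cs) = Fin \<mu> + ?g"
      using Cons.IH[of c] um lt c Cons.prems by auto
    have "Fin \<mu> + (Fin \<gamma> + ?g) < v r" using Cons.prems lt by (simp add: min.absorb3 min.absorb4)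
    moreover have "Fin \<mu> + (Fin \<gamma> + ?g) < v (z \<otimes> c)" using lt v_mult z c by (simp add: Fin_add_less_iff)
    ultimately have "Fin \<mu> + (Fin \<gamma> + ?g) < v (r \<ominus> z \<otimes> c)"
      using v_diff[of r "z \<otimes> c"] c Cons.prems by (meson less_le_trans min_less_iff_conj)
    then show ?thesis using IH lt by (simp add: min.absorb3 min.absorb4 add.left_commute)
  qed
qed simp

text \<open>The constant term alone decides: \<open>z d\<close> is larger than \<open>r\<close>, and
  all later terms are too. This settles the case of \<open>unique_min_plin_high\<close> in which the
  constant term of the factor is the minimiser.\<close>

lemma unique_min_plin_const:
  assumes z: "z \<in> carrier L" "Fin \<gamma> < v z" and cs: "set cs \<subseteq> carrier L"
    and r: "r \<in> carrier L" "v r < Fin \<gamma> + gauss_val v \<gamma> cs"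
  shows "unique_min v \<gamma> (plin L z r cs) \<and> gauss_val v \<gamma> (plin L z r cs) = v r"
proof (cases cs)
  case Nil
  then show ?thesis using r v_cases[of r] by (auto simp: min_def)
next
  case (Cons d ds)
  then have d: "d \<in> carrier L" "set ds \<subseteq> carrier L" "z \<otimes> d \<in> carrier L" using cs z by auto
  have 0: "v r < Fin \<gamma> + v d" "v r < Fin \<gamma> + (Fin \<gamma> + gauss_val v \<gamma> ds)"
    using r(2) unfolding Cons by (auto simp: min_def split: if_splits)
      (meson Fin_add_le_iff less_le_trans nle_le Fin_add_less_iff order.strict_trans linorder_not_le)+
  have "Fin \<gamma> + v d \<le> v z + v d" using z(2) by (intro add_right_mono) auto
  then have "v r < v (\<ominus> (z \<otimes> d))" using 0 v_mult z d by simp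
  then have 1: "v (r \<ominus> z \<otimes> d) = v r" using v_add_eq r d by (simp add: a_minus_def)
  have "Fin \<gamma> + min (v d) (Fin \<gamma> + gauss_val v \<gamma> ds) \<le> Fin \<gamma> + gauss_val v \<gamma> (plin L z d ds)"
    using gauss_val_plin_ge[of \<gamma> z \<gamma> d ds] z d by (simp add: Fin_add_le_iff)
  then have "v r < Fin \<gamma> + gauss_val v \<gamma> (plin L z d ds)" using r(2) Cons by auto
  then show ?thesis using 1 Cons by (simp add: min.absorb3 min.absorb4)
qed

text \<open>As \<open>v z > \<gamma>\<close>, the contribution \<open>c_i\<close> at index
  \<open>i + 1\<close> now lies below \<open>- z c_i\<close> at index \<open>i\<close>, so the
  minimising index moves up by one.\<close>

lemma unique_min_plin_high:
  assumes z: "z \<in> carrier L" "Fin \<gamma> < v z" and cs: "set cs \<subseteq> carrier L" "unique_min v \<gamma> cs"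
    and r: "r \<in> carrier L" "Fin \<gamma> + gauss_val v \<gamma> cs < v r"
  shows "unique_min v \<gamma> (plin L z r cs) \<and> gauss_val v \<gamma> (plin L z r cs) = Fin \<gamma> + gauss_val v \<gamma> cs"
  using cs r
proof (induction cs arbitrary: r)
  case (Cons c cs)
  then have c: "c \<in> carrier L" "z \<otimes> c \<in> carrier L" using z by auto
  let ?g = "gauss_val v \<gamma> cs"
  have vzc: "Fin \<gamma> + v c \<le> v (z \<otimes> c)"
    using v_mult[of z c] z c add_right_mono[of "Fin \<gamma>" "v z" "v c"] by simp
  have first: "Fin \<gamma> + gauss_val v \<gamma> (c # cs) < v (r \<ominus> z \<otimes> c)"
    if "Fin \<gamma> + gauss_val v \<gamma> (c # cs) < v (z \<otimes> c)"
    using v_diff[of r "z \<otimes> c"] that c Cons.prems by (meson less_le_trans min_less_iff_conj)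
  show ?case
  proof (cases "v c < Fin \<gamma> + ?g")
    case True
    then have g: "gauss_val v \<gamma> (c # cs) = v c" by (simp add: min.absorb3 min.absorb4)
    have vc: "v c \<noteq> Pinf" "v c \<noteq> Minf" using True c by auto
    have "Fin \<gamma> + v c < v z + v c" using z(2) vc by (intro add_less_mono_extended) auto
    then have "Fin \<gamma> + v c < v (r \<ominus> z \<otimes> c)" using first g v_mult z c by simp
    then show ?thesis
      using unique_min_plin_const[OF z, of cs c] True c Cons.prems g by (simp add: min.absorb3 min.absorb4)
  next
    case False
    then have lt: "Fin \<gamma> + ?g < v c" and um: "unique_min v \<gamma> cs" using Cons.prems by auto
    then have g: "gauss_val v \<gamma> (c # cs) = Fin \<gamma> + ?g" by (simp add: min.absorb3 min.absorb4)
    have IH: "unique_min v \<gamma> (plin L z c cs)" "gauss_val v \<gamma> (plin L z c cs) = Fin \<gamma> + ?g"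
      using Cons.IH[of c] um lt c Cons.prems by auto
    have "Fin \<gamma> + (Fin \<gamma> + ?g) < Fin \<gamma> + v c" using lt by (simp add: Fin_add_less_iff)
    then have "Fin \<gamma> + (Fin \<gamma> + ?g) < v (r \<ominus> z \<otimes> c)" using first g vzc by simp
    then show ?thesis using IH g by (simp add: min.absorb3 min.absorb4)
  qed
qed simp

text \<open>Starting from the constant 1, each linear factor either keeps the minimising index or
  moves it by one, according to whether the value of its root is below or above
  \<open>\<gamma>\<close>.\<close>

lemma unique_min_plins:
  assumes "set zs \<subseteq> carrier L" "\<And>z. z \<in> set zs \<Longrightarrow> v z \<noteq> Fin \<gamma>"
  shows "unique_min v \<gamma> (plins L zs)"
  using assms
proof (induction zs)
  case (Cons z zs)
  have set: "set (plins L zs) \<subseteq> carrier L" using set_plins[OF carrier_is_subring] Cons.prems by auto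
  have um: "unique_min v \<gamma> (plins L zs)" using Cons by auto
  have gf: "gauss_val v \<gamma> (plins L zs) \<noteq> Pinf" using unique_min_finite[OF um] .
  \<comment> \<open>The remainder in the product is zero and has value \<open>Pinf\<close>, so the
    conditions on \<open>r\<close> in the two lemmas hold.\<close>
  have lt: "Fin a + gauss_val v \<gamma> (plins L zs) < v \<zero>" for a
    using gf gauss_val_not_Minf[OF set] v_zero by (cases "gauss_val v \<gamma> (plins L zs)") auto
  have z: "z \<in> carrier L" "v z \<noteq> Fin \<gamma>" using Cons.prems by auto
  show ?case
  proof (cases "Fin \<gamma> < v z")
    case True
    then show ?thesis using unique_min_plin_high[OF z(1) _ set um _ lt] by simp
  next
    case False
    then obtain \<mu> where "v z = Fin \<mu>" "\<mu> < \<gamma>" using z v_cases[OF z(1)] by auto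
    then show ?thesis using unique_min_plin_low[OF z(1) _ _ set um _ lt] by simp
  qed
qed simp

end

lemma newton_polygon:
  assumes "valued_field L v" "valued_field L' w"
    and cs: "set cs \<subseteq> carrier L" "y \<in> carrier L" "ev L cs y = \<zero>\<^bsub>L\<^esub>" "v y = Fin \<gamma>"
    and zs: "set zs \<subseteq> carrier L'" "map v cs = map w (plins L' zs)"
  shows "\<exists>z\<in>set zs. w z = Fin \<gamma>"
proof (rule ccontr)
  interpret A: valued_field L v by fact
  interpret B: valued_field L' w by fact
  assume "\<not> ?thesis"
  then have "unique_min w \<gamma> (plins L' zs)" using B.unique_min_plins[OF zs(1)] by blast
  then have "unique_min v \<gamma> cs" using unique_min_cong[OF zs(2)] by blast
  then show False using A.v_ev_unique_min[OF cs(1,2,4)] unique_min_finite[of v \<gamma> cs] cs(3) A.v_zero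
    by auto
qed

section \<open>Isometries as subrings of the square of a field\<close>

abbreviation square_ring :: "('a, 'b) ring_scheme \<Rightarrow> ('a \<times> 'a) ring" where
  "square_ring L \<equiv> RDirProd L L"

lemma square_ring_simps:
  "carrier (square_ring L) = carrier L \<times> carrier L"
  "(a, b) \<otimes>\<^bsub>square_ring L\<^esub> (c, d) = (a \<otimes>\<^bsub>L\<^esub> c, b \<otimes>\<^bsub>L\<^esub> d)"
  "(a, b) \<oplus>\<^bsub>square_ring L\<^esub> (c, d) = (a \<oplus>\<^bsub>L\<^esub> c, b \<oplus>\<^bsub>L\<^esub> d)"
  "\<one>\<^bsub>square_ring L\<^esub> = (\<one>\<^bsub>L\<^esub>, \<one>\<^bsub>L\<^esub>)"
  "\<zero>\<^bsub>square_ring L\<^esub> = (\<zero>\<^bsub>L\<^esub>, \<zero>\<^bsub>L\<^esub>)"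
  by (simp_all add: RDirProd_def DirProd_def monoid.defs)

lemma ev_square:
  "ev (square_ring L) ps (a, b) = (ev L (map fst ps) a, ev L (map snd ps) b)"
  by (induction ps) (auto simp: square_ring_simps)

lemma (in cring) square_cring: "cring (square_ring R)"
proof -
  interpret P: ring "square_ring R" using RDirProd_ring ring_axioms by blast
  show ?thesis
    by unfold_locales (auto simp: square_ring_simps m_comm)
qed

lemma (in cring) square_minus:
  assumes "a \<in> carrier R" "b \<in> carrier R"
  shows "\<ominus>\<^bsub>square_ring R\<^esub> (a, b) = (\<ominus> a, \<ominus> b)"
proof -
  interpret P: cring "square_ring R" by (rule square_cring)
  show ?thesis using assms by (intro P.minus_equality) (auto simp: square_ring_simps l_neg)
qed

text \<open>
  Such a subring is the graph of an isometric isomorphism between two subrings of \<open>L\<close>, since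
  \<open>v (b - b') = v 0\<close> whenever \<open>(a, b)\<close> and \<open>(a, b')\<close> belong to it.
\<close>

definition isograph :: "('a, 'b) ring_scheme \<Rightarrow> ('a \<Rightarrow> 'g::linordered_ab_group_add extended)
    \<Rightarrow> ('a \<times> 'a) set \<Rightarrow> bool" where
  "isograph L v G \<longleftrightarrow> subring G (square_ring L) \<and> (\<forall>(a, b)\<in>G. v a = v b)"

text \<open>For an isograph this turns the projections into subfields, so that minimal polynomials
  over the domain become available.\<close>

definition inverse_closed :: "('a, 'b) ring_scheme \<Rightarrow> ('a \<times> 'a) set \<Rightarrow> bool" where
  "inverse_closed L G \<longleftrightarrow> (\<forall>(a, b)\<in>G. a \<noteq> \<zero>\<^bsub>L\<^esub> \<longrightarrow>
     (\<exists>c d. (c, d) \<in> G \<and> c \<otimes>\<^bsub>L\<^esub> a = \<one>\<^bsub>L\<^esub> \<and> d \<otimes>\<^bsub>L\<^esub> b = \<one>\<^bsub>L\<^esub>))"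

text \<open>The ring \<open>S[z]\<close>. In the square ring, with \<open>z = (y, y')\<close>, it is
  the candidate for extending the map with graph \<open>S\<close> by sending \<open>y\<close> to
  \<open>y'\<close>.\<close>

definition graph_adjoin :: "('a, 'b) ring_scheme \<Rightarrow> 'a set \<Rightarrow> 'a \<Rightarrow> 'a set" where
  "graph_adjoin R S z = (\<lambda>p. ev R p z) ` {p. set p \<subseteq> S}"

text \<open>An isograph for this valuation is the graph of an isomorphism with no condition on
  values, so isomorphisms and isometries share one theory.\<close>

definition trivial_val :: "('a, 'b) ring_scheme \<Rightarrow> 'a \<Rightarrow> 'g::linordered_ab_group_add extended" where
  "trivial_val L a = (if a = \<zero>\<^bsub>L\<^esub> then Pinf else Fin 0)"

lemma (in field) trivial_valued_field:
  "valued_field R (trivial_val R :: 'a \<Rightarrow> 'g::linordered_ab_group_add extended)"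
proof unfold_locales
  fix a b assume "a \<in> carrier R" "b \<in> carrier R"
  then show "(trivial_val R (a \<otimes> b) :: 'g extended) = trivial_val R a + trivial_val R b"
    "min (trivial_val R a) (trivial_val R b) \<le> (trivial_val R (a \<oplus> b) :: 'g extended)"
    by (auto simp: trivial_val_def integral_iff)
qed (auto simp: trivial_val_def)

lemma (in cring) ev_mem_subring:
  "subring S R \<Longrightarrow> set p \<subseteq> S \<Longrightarrow> y \<in> S \<Longrightarrow> ev R p y \<in> S"
  by (induction p) (auto simp: subringE)

lemma graph_adjoinI: "set p \<subseteq> S \<Longrightarrow> ev R p z \<in> graph_adjoin R S z"
  by (auto simp: graph_adjoin_def)

lemma (in cring) subring_graph_adjoin:
  assumes S: "subring S R" and z: "z \<in> carrier R"
  shows "subring (graph_adjoin R S z) R"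
proof (rule subringI)
  have SR: "S \<subseteq> carrier R" using subringE(1)[OF S] .
  show "graph_adjoin R S z \<subseteq> carrier R"
    using SR z by (auto simp: graph_adjoin_def)
  have "ev R [\<one>] z = \<one>" using z by simp
  then show "\<one> \<in> graph_adjoin R S z"
    using subringE(3)[OF S] graph_adjoinI[of "[\<one>]" S R z] by simp
next
  have SR: "S \<subseteq> carrier R" using subringE(1)[OF S] .
  fix a b assume "a \<in> graph_adjoin R S z" "b \<in> graph_adjoin R S z"
  then obtain p q where p: "set p \<subseteq> S" "a = ev R p z" "set q \<subseteq> S" "b = ev R q z"
    unfolding graph_adjoin_def by blast
  have c: "set p \<subseteq> carrier R" "set q \<subseteq> carrier R" using p SR by auto
  have "ev R (pmul R p q) z = a \<otimes> b" "ev R (padd R p q) z = a \<oplus> b"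
    using ev_pmul[OF c z] ev_padd[OF c z] p by auto
  then show "a \<otimes> b \<in> graph_adjoin R S z" "a \<oplus> b \<in> graph_adjoin R S z"
    using graph_adjoinI[OF set_pmul[OF S p(1,3)], of R z] graph_adjoinI[OF set_padd[OF S p(1,3)], of R z]
    by simp_all
next
  have SR: "S \<subseteq> carrier R" using subringE(1)[OF S] .
  fix a assume "a \<in> graph_adjoin R S z"
  then obtain p where p: "set p \<subseteq> S" "a = ev R p z" unfolding graph_adjoin_def by blast
  have o: "\<ominus> \<one> \<in> S" "\<ominus> \<one> \<in> carrier R" using subringE(3,5)[OF S] by auto
  have pc: "set p \<subseteq> carrier R" using p SR by auto
  then have "ev R (map ((\<otimes>) (\<ominus> \<one>)) p) z = \<ominus> \<one> \<otimes> ev R p z" by (intro ev_smult o z)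
  also have "\<dots> = \<ominus> a" using p ev_closed[OF pc z] by (simp add: l_minus)
  finally show "\<ominus> a \<in> graph_adjoin R S z"
    using graph_adjoinI[OF set_smult[OF S o(1) p(1)], of R z] by simp
qed

lemma (in cring) graph_adjoin_incl:
  assumes "S \<subseteq> carrier R" "z \<in> carrier R" shows "S \<subseteq> graph_adjoin R S z"
proof
  fix s assume "s \<in> S"
  then have "set [s] \<subseteq> S" "ev R [s] z = s" using assms by auto
  then show "s \<in> graph_adjoin R S z" using graph_adjoinI[of _ S R z] by metis
qed

lemma (in cring) graph_adjoin_mem:
  assumes "subring S R" "z \<in> carrier R" shows "z \<in> graph_adjoin R S z"
proof -
  have "set [\<zero>, \<one>] \<subseteq> S" using subringE(2,3)[OF assms(1)] by auto
  moreover have "ev R [\<zero>, \<one>] z = z" using assms(2) by simp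
  ultimately show ?thesis using graph_adjoinI[of _ S R z] by metis
qed

context valued_field begin

lemma isographD:
  assumes "isograph L v G"
  shows "subring G (square_ring L)" "(a, b) \<in> G \<Longrightarrow> v a = v b"
    "(a, b) \<in> G \<Longrightarrow> a \<in> carrier L" "(a, b) \<in> G \<Longrightarrow> b \<in> carrier L"
  using assms subringE(1)[of G "square_ring L"] unfolding isograph_def
  by (auto simp: square_ring_simps)

lemma isograph_ops:
  assumes "isograph L v G" "(a, b) \<in> G" "(c, d) \<in> G"
  shows "(a \<oplus> c, b \<oplus> d) \<in> G" "(a \<otimes> c, b \<otimes> d) \<in> G" "(\<ominus> a, \<ominus> b) \<in> G" "(a \<ominus> c, b \<ominus> d) \<in> G"
    "(\<one>, \<one>) \<in> G" "(\<zero>, \<zero>) \<in> G"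
proof -
  note S = isographD(1)[OF assms(1)]
  have c: "a \<in> carrier L" "b \<in> carrier L" "c \<in> carrier L" "d \<in> carrier L"
    using isographD(3,4)[OF assms(1)] assms by auto
  show add: "(a \<oplus> c, b \<oplus> d) \<in> G" "(a \<otimes> c, b \<otimes> d) \<in> G" "(\<one>, \<one>) \<in> G" "(\<zero>, \<zero>) \<in> G"
    "(\<ominus> a, \<ominus> b) \<in> G"
    using subringE(7)[OF S assms(2,3)] subringE(6)[OF S assms(2,3)] subringE(2,3)[OF S]
      subringE(5)[OF S assms(2)] c by (simp_all add: square_ring_simps square_minus)
  have "(\<ominus> c, \<ominus> d) \<in> G" using subringE(5)[OF S assms(3)] c by (simp add: square_minus)
  then show "(a \<ominus> c, b \<ominus> d) \<in> G"
    using subringE(7)[OF S assms(2), of "(\<ominus> c, \<ominus> d)"] by (simp add: square_ring_simps a_minus_def)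
qed

lemma isograph_zero_iff:
  assumes "isograph L v G" "(a, b) \<in> G" shows "a = \<zero> \<longleftrightarrow> b = \<zero>"
  using isographD[OF assms(1)] assms(2) v_Pinf_iff by metis

lemma isograph_unique:
  assumes "isograph L v G" "(a, b) \<in> G" "(a, b') \<in> G" shows "b = b'"
proof -
  have c: "a \<in> carrier L" "b \<in> carrier L" "b' \<in> carrier L" using isographD[OF assms(1)] assms by auto
  have "(a \<ominus> a, b \<ominus> b') \<in> G" using isograph_ops[OF assms] by blast
  then have "b \<ominus> b' = \<zero>" using isograph_zero_iff[OF assms(1)] c by (metis r_right_minus_eq)
  then show ?thesis using c by simp
qed

lemma isograph_triv:
  assumes "isograph L v G"
  shows "isograph L (trivial_val L :: 'a \<Rightarrow> 'h::linordered_ab_group_add extended) G"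
  using isographD(1)[OF assms] isograph_zero_iff[OF assms]
  unfolding isograph_def trivial_val_def by fastforce

text \<open>A pair with nonzero first entry has nonzero second entry, so fractions can be formed in
  both coordinates at once, and quotients of elements of equal values have equal values.\<close>

lemma isograph_fractions:
  assumes G: "isograph L v G"
  shows "\<exists>H. G \<subseteq> H \<and> isograph L v H \<and> inverse_closed L H"
proof (intro exI conjI)
  define H where "H = {(a \<otimes> inv s, b \<otimes> inv t) |a b s t. (a, b) \<in> G \<and> (s, t) \<in> G \<and> s \<noteq> \<zero>}"
  note D = isographD[OF G] and ops = isograph_ops[OF G] and z = isograph_zero_iff[OF G]
  interpret P: cring "square_ring L" by (rule square_cring)
  have sub: "G \<subseteq> carrier L \<times> carrier L" using D by auto
  have inv: "inv s \<in> carrier L" "s \<otimes> inv s = \<one>" "inv s \<otimes> s = \<one>" if "s \<in> carrier L" "s \<noteq> \<zero>" for s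
    using that field_Units by auto
  have inv_prod: "inv (s \<otimes> s') = inv s \<otimes> inv s'"
    if "s \<in> carrier L" "s' \<in> carrier L" "s \<noteq> \<zero>" "s' \<noteq> \<zero>" for s s'
  proof (rule comm_inv_char)
    have "s \<otimes> s' \<otimes> (inv s \<otimes> inv s') = (s \<otimes> inv s) \<otimes> (s' \<otimes> inv s')"
      using that inv by (simp add: m_ac)
    then show "s \<otimes> s' \<otimes> (inv s \<otimes> inv s') = \<one>" using that inv by simp
  qed (use that inv in auto)
  have Gone: "(\<one>, \<one>) \<in> G" using subringE(3)[OF D(1)] by (simp add: square_ring_simps)
  show "G \<subseteq> H"
  proof
    fix p assume p: "p \<in> G"
    obtain a b where ab: "p = (a, b)" by (cases p)
    have c: "a \<in> carrier L" "b \<in> carrier L" using D(3,4) p unfolding ab by blast+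
    have "(a, b) = (a \<otimes> inv \<one>, b \<otimes> inv \<one>)" unfolding inv_one r_one[OF c(1)] r_one[OF c(2)] ..
    moreover have "(a \<otimes> inv \<one>, b \<otimes> inv \<one>) \<in> H"
      unfolding H_def using Gone p one_not_zero unfolding ab by blast
    ultimately show "p \<in> H" unfolding ab by simp
  qed
  show "isograph L v H"
    unfolding isograph_def
  proof
    show "subring H (square_ring L)"
    proof (rule P.subringI)
      show "H \<subseteq> carrier (square_ring L)"
      proof
        fix p assume "p \<in> H"
        then obtain a b s t where p: "p = (a \<otimes> inv s, b \<otimes> inv t)" "(a, b) \<in> G" "(s, t) \<in> G" "s \<noteq> \<zero>"
          unfolding H_def by blast
        then show "p \<in> carrier (square_ring L)"
          using D(3,4)[OF p(2)] D(3,4)[OF p(3)] z[OF p(3)] inv by (simp add: square_ring_simps)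
      qed
      show "\<one>\<^bsub>square_ring L\<^esub> \<in> H" using Gone \<open>G \<subseteq> H\<close> by (auto simp: square_ring_simps)
    next
      fix p assume "p \<in> H"
      then obtain a b s t where p: "p = (a \<otimes> inv s, b \<otimes> inv t)" "(a, b) \<in> G" "(s, t) \<in> G" "s \<noteq> \<zero>"
        unfolding H_def by blast
      have c: "a \<in> carrier L" "b \<in> carrier L" "inv s \<in> carrier L" "inv t \<in> carrier L"
        using D(3,4)[OF p(2)] D(3,4)[OF p(3)] z[OF p(3)] inv p(4) by simp_all
      have "\<ominus>\<^bsub>square_ring L\<^esub> p = (\<ominus> a \<otimes> inv s, \<ominus> b \<otimes> inv t)"
        using c p by (simp add: square_minus l_minus)
      then show "\<ominus>\<^bsub>square_ring L\<^esub> p \<in> H" unfolding H_def using ops(3)[OF p(2,2)] p by blast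
    next
      fix p q assume "p \<in> H" "q \<in> H"
      then obtain a b s t a' b' s' t' where p: "p = (a \<otimes> inv s, b \<otimes> inv t)" "(a, b) \<in> G" "(s, t) \<in> G" "s \<noteq> \<zero>"
        and q: "q = (a' \<otimes> inv s', b' \<otimes> inv t')" "(a', b') \<in> G" "(s', t') \<in> G" "s' \<noteq> \<zero>"
        unfolding H_def by blast
      have c: "a \<in> carrier L" "b \<in> carrier L" "a' \<in> carrier L" "b' \<in> carrier L" "s \<in> carrier L" "t \<in> carrier L"
        "s' \<in> carrier L" "t' \<in> carrier L" "t \<noteq> \<zero>" "t' \<noteq> \<zero>"
        using D(3,4)[OF p(2)] D(3,4)[OF p(3)] z[OF p(3)] p(4)
          D(3,4)[OF q(2)] D(3,4)[OF q(3)] z[OF q(3)] q(4) by simp_all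
      note i = inv[OF c(5) p(4)] inv[OF c(7) q(4)] inv[OF c(6) c(9)] inv[OF c(8) c(10)]
      have invm: "inv (s \<otimes> s') = inv s \<otimes> inv s'" "inv (t \<otimes> t') = inv t \<otimes> inv t'"
        using inv_prod[OF c(5,7) p(4) q(4)] inv_prod[OF c(6,8,9,10)] by auto
      have ss: "(s \<otimes> s', t \<otimes> t') \<in> G" "s \<otimes> s' \<noteq> \<zero>" using ops(2)[OF p(3) q(3)] c p q integral by auto
      have "p \<otimes>\<^bsub>square_ring L\<^esub> q = (a \<otimes> a' \<otimes> inv (s \<otimes> s'), b \<otimes> b' \<otimes> inv (t \<otimes> t'))"
        unfolding invm p q square_ring_simps using c i(1,4,7,10) by (simp add: m_ac)
      then show "p \<otimes>\<^bsub>square_ring L\<^esub> q \<in> H" unfolding H_def using ops(2)[OF p(2) q(2)] ss by blast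
      have frac: "a \<otimes> is \<oplus> a' \<otimes> is' = (a \<otimes> s' \<oplus> a' \<otimes> s) \<otimes> (is \<otimes> is')"
        if "a \<in> carrier L" "a' \<in> carrier L" "s \<in> carrier L" "s' \<in> carrier L" "is \<in> carrier L" "is' \<in> carrier L"
          "s \<otimes> is = \<one>" "s' \<otimes> is' = \<one>" for a a' s s' "is" is'
      proof -
        have "(a \<otimes> s' \<oplus> a' \<otimes> s) \<otimes> (is \<otimes> is') = a \<otimes> is \<otimes> (s' \<otimes> is') \<oplus> a' \<otimes> is' \<otimes> (s \<otimes> is)"
          using that(1-6) by algebra
        then show ?thesis using that by simp
      qed
      have "p \<oplus>\<^bsub>square_ring L\<^esub> q = ((a \<otimes> s' \<oplus> a' \<otimes> s) \<otimes> inv (s \<otimes> s'), (b \<otimes> t' \<oplus> b' \<otimes> t) \<otimes> inv (t \<otimes> t'))"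
        unfolding invm p q square_ring_simps
        using frac[OF c(1,3,5,7) i(1,4,2,5)] frac[OF c(2,4,6,8) i(7,10,8,11)] by simp
      moreover have "(a \<otimes> s' \<oplus> a' \<otimes> s, b \<otimes> t' \<oplus> b' \<otimes> t) \<in> G"
        using ops(1)[OF ops(2)[OF p(2) q(3)] ops(2)[OF q(2) p(3)]] .
      ultimately show "p \<oplus>\<^bsub>square_ring L\<^esub> q \<in> H" unfolding H_def using ss by blast
    qed
    show "\<forall>(a, b)\<in>H. v a = v b"
    proof clarify
      fix x y assume "(x, y) \<in> H"
      then obtain a b s t where p: "x = a \<otimes> inv s" "y = b \<otimes> inv t" "(a, b) \<in> G" "(s, t) \<in> G" "s \<noteq> \<zero>"
        unfolding H_def by blast
      have c: "a \<in> carrier L" "b \<in> carrier L" "s \<in> carrier L" "t \<in> carrier L" "t \<noteq> \<zero>"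
        using D(3,4)[OF p(3)] D(3,4)[OF p(4)] z[OF p(4)] p(5) by simp_all
      obtain \<gamma> where "v s = Fin \<gamma>" using v_nonzero c p by blast
      then have "v (inv s) = v (inv t)" using v_inv[of s \<gamma>] v_inv[of t \<gamma>] c p D(2)[OF p(4)] by auto
      then show "v x = v y" using v_mult c p D(2)[OF p(3)] inv by simp
    qed
  qed
  show "inverse_closed L H"
    unfolding inverse_closed_def
  proof clarify
    fix x y assume "(x, y) \<in> H" "x \<noteq> \<zero>"
    then obtain a b s t where p: "x = a \<otimes> inv s" "y = b \<otimes> inv t" "(a, b) \<in> G" "(s, t) \<in> G" "s \<noteq> \<zero>"
      unfolding H_def by blast
    have c: "a \<in> carrier L" "b \<in> carrier L" "s \<in> carrier L" "t \<in> carrier L" "t \<noteq> \<zero>"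
      using D(3,4)[OF p(3)] D(3,4)[OF p(4)] z[OF p(4)] p(5) by simp_all
    have a: "a \<noteq> \<zero>" using \<open>x \<noteq> \<zero>\<close> p(1,5) inv(1)[OF c(3)] by auto
    then have b: "b \<noteq> \<zero>" using z[OF p(3)] by simp
    have one: "s \<otimes> inv a \<otimes> (a \<otimes> inv s) = \<one>" if "s \<in> carrier L" "a \<in> carrier L" "s \<noteq> \<zero>" "a \<noteq> \<zero>" for s a
    proof -
      have "s \<otimes> inv a \<otimes> (a \<otimes> inv s) = s \<otimes> inv s \<otimes> (a \<otimes> inv a)"
        using that inv(1)[of s] inv(1)[of a] by algebra
      then show ?thesis using that inv by simp
    qed
    have "(s \<otimes> inv a, t \<otimes> inv b) \<in> H" unfolding H_def using p a by blast
    then show "\<exists>c d. (c, d) \<in> H \<and> c \<otimes> x = \<one> \<and> d \<otimes> y = \<one>"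
      using one c p a b by blast
  qed
qed

lemma subfield_fst_isograph:
  assumes "isograph L v G" "inverse_closed L G" shows "subfield (fst ` G) L"
proof (rule subfieldI')
  note D = isographD[OF assms(1)] and ops = isograph_ops[OF assms(1)]
  have Gone: "(\<one>, \<one>) \<in> G" using subringE(3)[OF D(1)] by (simp add: square_ring_simps)
  show "subring (fst ` G) L"
  proof (rule subringI)
    show "fst ` G \<subseteq> carrier L" using D(3) by auto
    show "\<one> \<in> fst ` G" using Gone by (metis fst_conv image_eqI)
  next
    fix h assume "h \<in> fst ` G"
    then obtain k where "(h, k) \<in> G" by auto
    from ops(3)[OF this this] show "\<ominus> h \<in> fst ` G" by (metis fst_conv image_eqI)
  next
    fix h1 h2 assume "h1 \<in> fst ` G" "h2 \<in> fst ` G"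
    then obtain k1 k2 where k: "(h1, k1) \<in> G" "(h2, k2) \<in> G" by auto
    show "h1 \<otimes> h2 \<in> fst ` G" using ops(2)[OF k] by (metis fst_conv image_eqI)
    show "h1 \<oplus> h2 \<in> fst ` G" using ops(1)[OF k] by (metis fst_conv image_eqI)
  qed
  fix k assume k: "k \<in> fst ` G - {\<zero>}"
  then obtain b where "(k, b) \<in> G" by auto
  then obtain c d where c: "(c, d) \<in> G" "c \<otimes> k = \<one>"
    using assms(2) k unfolding inverse_closed_def by blast
  have "k \<in> carrier L" "c \<in> carrier L" using D(3) c \<open>(k, b) \<in> G\<close> by auto
  then have "inv k = c" using comm_inv_char[of k c] c(2) m_comm by metis
  then show "inv k \<in> fst ` G" using c(1) by (metis fst_conv image_eqI)
qed

end

abbreviation plain_graph :: "('a, 'b) ring_scheme \<Rightarrow> ('a \<times> 'a) set \<Rightarrow> bool" where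
  "plain_graph L G \<equiv> isograph L (trivial_val L :: 'a \<Rightarrow> int extended) G"

lemma lift_list: "set m \<subseteq> f ` G \<Longrightarrow> \<exists>ps. set ps \<subseteq> G \<and> map f ps = m"
proof (induction m)
  case (Cons c m)
  then obtain ps g where "set ps \<subseteq> G" "map f ps = m" "g \<in> G" "f g = c" by auto
  then show ?case by (intro exI[of _ "g # ps"]) auto
qed simp

lemma (in cring) fst_hom: "fst \<in> ring_hom (square_ring R) R"
  by (rule ring_hom_memI) (auto simp: square_ring_simps)

section \<open>Extension of field isomorphisms by roots\<close>

context algebraically_closed begin

lemma plain_graphI:
  assumes "subring G (square_ring L)" "\<And>a b. (a, b) \<in> G \<Longrightarrow> a = \<zero> \<longleftrightarrow> b = \<zero>"
  shows "plain_graph L G"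
  using assms unfolding isograph_def trivial_val_def by (auto split: if_splits)

text \<open>This is \<open>minimal_polynomial_lift\<close> for the projection \<open>fst\<close>:
  the coefficients are pairs, so the minimal polynomial over the domain comes together with its
  image under the isomorphism.\<close>

lemma graph_minimal_polynomial:
  assumes G: "plain_graph L G" "inverse_closed L G" and T: "subfield T L" "T \<subseteq> fst ` G"
    and y: "y \<in> carrier L" "(algebraic over T) y"
  obtains m where "set m \<subseteq> G" "ev L (map fst m @ [\<one>]) y = \<zero>" "m \<noteq> []"
    "\<And>r. set r \<subseteq> G \<Longrightarrow> length r \<le> length m \<Longrightarrow> ev L (map fst r) y = \<zero> \<Longrightarrow> set r \<subseteq> {(\<zero>, \<zero>)}"
    "\<And>f. set f \<subseteq> G \<Longrightarrow> ev L (map fst f) y = \<zero> \<Longrightarrow> \<exists>q. set q \<subseteq> G \<and>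
      (\<forall>w\<in>carrier (square_ring L). ev (square_ring L) f w =
         ev (square_ring L) q w \<otimes>\<^bsub>square_ring L\<^esub> ev (square_ring L) (m @ [(\<one>, \<one>)]) w)"
proof -
  interpret V: valued_field L "trivial_val L :: 'a \<Rightarrow> int extended" by (rule trivial_valued_field)
  interpret P: cring "square_ring L" by (rule square_cring)
  note D = V.isographD[OF G(1)]
  obtain k where k: "set k \<subseteq> T" "ev L (k @ [\<one>]) y = \<zero>" using algebraic_iff_monic[OF T(1) y(1)] y(2) by blast
  have "\<one> \<in> T" using subringE(3)[OF subfieldE(1)[OF T(1)]] .
  then have "set (k @ [\<one>]) \<subseteq> fst ` G" using k T by auto
  then obtain ps where ps: "set ps \<subseteq> G" "map fst ps = k @ [\<one>]" using lift_list by metis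
  have nz: "\<not> set ps \<subseteq> {\<zero>\<^bsub>square_ring L\<^esub>}"
  proof
    assume "set ps \<subseteq> {\<zero>\<^bsub>square_ring L\<^esub>}"
    then have "fst ` set ps \<subseteq> {\<zero>}" by (auto simp: square_ring_simps)
    then have "\<one> \<in> {\<zero>}" using ps(2) by (metis in_set_conv_decomp list.set_map subset_iff)
    then show False by simp
  qed
  \<comment> \<open>The second coordinate of the evaluation point is a dummy, since
    \<open>fst\<close> discards it.\<close>
  have zero: "fst (ev (square_ring L) ps (y, \<zero>)) = \<zero>" using ps k by (simp add: ev_square)
  have inv: "\<exists>t\<in>G. t \<otimes>\<^bsub>square_ring L\<^esub> s = \<one>\<^bsub>square_ring L\<^esub>" if "s \<in> G" "fst s \<noteq> \<zero>" for s
  proof -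
    obtain a b where s: "s = (a, b)" by (cases s)
    then have ab: "(a, b) \<in> G" "a \<noteq> \<zero>" using that by simp_all
    have "\<exists>c d. (c, d) \<in> G \<and> c \<otimes> a = \<one> \<and> d \<otimes> b = \<one>"
      using bspec[OF G(2)[unfolded inverse_closed_def] ab(1)] ab(2) by simp
    then obtain c d where "(c, d) \<in> G" "c \<otimes> a = \<one>" "d \<otimes> b = \<one>" by blast
    then show ?thesis using s by (intro bexI[of _ "(c, d)"]) (simp_all add: square_ring_simps)
  qed
  have inj: "s = \<zero>\<^bsub>square_ring L\<^esub>" if "s \<in> G" "fst s = \<zero>" for s
  proof -
    obtain a b where s: "s = (a, b)" by (cases s)
    then show ?thesis using that V.isograph_zero_iff[OF G(1), of a b] by (simp add: square_ring_simps)
  qed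
  have z: "(y, \<zero>) \<in> carrier (square_ring L)" using y by (simp add: square_ring_simps)
  show thesis
  proof (rule minimal_polynomial_lift[OF P.is_cring D(1) fst_hom domain_axioms _ _ z ps(1) nz zero])
    fix s assume "s \<in> G" "fst s \<noteq> \<zero>"
    then show "\<exists>t\<in>G. t \<otimes>\<^bsub>square_ring L\<^esub> s = \<one>\<^bsub>square_ring L\<^esub>" by (rule inv)
  next
    fix s assume "s \<in> G" "fst s = \<zero>"
    then show "s = \<zero>\<^bsub>square_ring L\<^esub>" by (rule inj)
  next
    fix m
    assume m: "set m \<subseteq> G" "fst (ev (square_ring L) (m @ [\<one>\<^bsub>square_ring L\<^esub>]) (y, \<zero>)) = \<zero>"
    and m3: "\<And>r. set r \<subseteq> G \<Longrightarrow> length r \<le> length m \<Longrightarrow> fst (ev (square_ring L) r (y, \<zero>)) = \<zero> \<Longrightarrow>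
       set r \<subseteq> {\<zero>\<^bsub>square_ring L\<^esub>}"
    and m4: "\<And>f. set f \<subseteq> G \<Longrightarrow> fst (ev (square_ring L) f (y, \<zero>)) = \<zero> \<Longrightarrow> \<exists>q. set q \<subseteq> G \<and>
       (\<forall>w\<in>carrier (square_ring L). ev (square_ring L) f w =
         ev (square_ring L) q w \<otimes>\<^bsub>square_ring L\<^esub> ev (square_ring L) (m @ [\<one>\<^bsub>square_ring L\<^esub>]) w \<and>
       dv (square_ring L) f w = dv (square_ring L) q w \<otimes>\<^bsub>square_ring L\<^esub>
         ev (square_ring L) (m @ [\<one>\<^bsub>square_ring L\<^esub>]) w \<oplus>\<^bsub>square_ring L\<^esub>
         ev (square_ring L) q w \<otimes>\<^bsub>square_ring L\<^esub> dv (square_ring L) (m @ [\<one>\<^bsub>square_ring L\<^esub>]) w)"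
    show thesis
    proof (rule that[OF m(1)])
      show zero: "ev L (map fst m @ [\<one>]) y = \<zero>" using m(2) by (simp add: ev_square square_ring_simps)
      then show "m \<noteq> []" using y by auto
      fix r assume "set r \<subseteq> G" "length r \<le> length m" "ev L (map fst r) y = \<zero>"
      then show "set r \<subseteq> {(\<zero>, \<zero>)}" using m3[of r] by (simp add: ev_square square_ring_simps(5))
    next
      fix f assume f: "set f \<subseteq> G" "ev L (map fst f) y = \<zero>"
      then have "fst (ev (square_ring L) f (y, \<zero>)) = \<zero>" by (simp add: ev_square)
      from m4[OF f(1) this, unfolded square_ring_simps(4)]
      show "\<exists>q. set q \<subseteq> G \<and> (\<forall>w\<in>carrier (square_ring L). ev (square_ring L) f w =
           ev (square_ring L) q w \<otimes>\<^bsub>square_ring L\<^esub> ev (square_ring L) (m @ [(\<one>, \<one>)]) w)"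
        by blast
    qed
  qed
qed

text \<open>If the first coordinate of an evaluation at \<open>(y, y')\<close> vanishes, the minimal
  polynomial divides, and its image kills the second coordinate too. Conversely, let
  \<open>(a, 0)\<close> occur with \<open>a\<close> nonzero. Evaluating the minimal polynomial of
  \<open>a\<close> there gives \<open>(0, c2)\<close>, where \<open>c2\<close> is the second entry
  of its constant term; \<open>c2\<close> is nonzero, against the first half.\<close>

lemma plain_graph_adjoin_root:
  assumes G: "plain_graph L G" "inverse_closed L G" and T: "subfield T L" "T \<subseteq> fst ` G"
    and y: "y \<in> carrier L" "(algebraic over T) y"
  obtains m where "set m \<subseteq> G" "m \<noteq> []" "ev L (map fst m @ [\<one>]) y = \<zero>"
    "\<And>y'. y' \<in> carrier L \<Longrightarrow> ev L (map snd m @ [\<one>]) y' = \<zero> \<Longrightarrow>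
       plain_graph L (graph_adjoin (square_ring L) G (y, y'))"
proof -
  interpret V: valued_field L "trivial_val L :: 'a \<Rightarrow> int extended" by (rule trivial_valued_field)
  interpret P: cring "square_ring L" by (rule square_cring)
  note D = V.isographD[OF G(1)]
  let ?P = "square_ring L"
  obtain m where m: "set m \<subseteq> G" "ev L (map fst m @ [\<one>]) y = \<zero>" "m \<noteq> []"
    and div: "\<And>f. set f \<subseteq> G \<Longrightarrow> ev L (map fst f) y = \<zero> \<Longrightarrow> \<exists>q. set q \<subseteq> G \<and>
      (\<forall>w\<in>carrier ?P. ev ?P f w = ev ?P q w \<otimes>\<^bsub>?P\<^esub> ev ?P (m @ [(\<one>, \<one>)]) w)"
    by (rule graph_minimal_polynomial[OF G T y]) blast
  have "G \<subseteq> carrier L \<times> carrier L" using subringE(1)[OF D(1)] unfolding square_ring_simps .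
  then have snd_carrier: "snd ` G \<subseteq> carrier L" by auto
  have "plain_graph L (graph_adjoin ?P G (y, y'))"
    if y': "y' \<in> carrier L" "ev L (map snd m @ [\<one>]) y' = \<zero>" for y'
  proof (rule plain_graphI)
    have yy: "(y, y') \<in> carrier ?P" using y y' by (simp add: square_ring_simps)
    show sub: "subring (graph_adjoin ?P G (y, y')) ?P" using P.subring_graph_adjoin[OF D(1) yy] .
    have carr: "a \<in> carrier L" "b \<in> carrier L" if "(a, b) \<in> graph_adjoin ?P G (y, y')" for a b
      using subringE(1)[OF sub] that by (auto simp: square_ring_simps)
    have root: "ev ?P (m @ [(\<one>, \<one>)]) (y, y') = (\<zero>, \<zero>)" using m(2) y' by (simp add: ev_square)
    have left: "b = \<zero>" if b: "(\<zero>, b) \<in> graph_adjoin ?P G (y, y')" for b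
    proof -
      obtain f where f: "set f \<subseteq> G" "ev ?P f (y, y') = (\<zero>, b)"
        using b unfolding graph_adjoin_def by auto
      then have "ev L (map fst f) y = \<zero>" by (simp add: ev_square)
      then obtain q where q: "set q \<subseteq> G"
        "ev ?P f (y, y') = ev ?P q (y, y') \<otimes>\<^bsub>?P\<^esub> ev ?P (m @ [(\<one>, \<one>)]) (y, y')"
        using div[OF f(1)] yy by blast
      have "ev ?P q (y, y') \<in> carrier ?P" using q(1) subringE(1)[OF D(1)] yy by (intro P.ev_closed) auto
      then have "ev ?P f (y, y') = (\<zero>, \<zero>)"
        using q(2) root by (cases "ev ?P q (y, y')") (auto simp: square_ring_simps)
      then show ?thesis using f(2) by simp
    qed
    fix a b assume ab: "(a, b) \<in> graph_adjoin ?P G (y, y')"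
    have "a = \<zero>" if "b = \<zero>"
    proof (rule ccontr)
      assume a0: "a \<noteq> \<zero>"
      let ?T = "fst ` G"
      have T': "subfield ?T L" using V.subfield_fst_isograph[OF G] .
      let ?A = "{a \<in> carrier L. (algebraic over ?T) a}"
      have A: "subring ?A L" using subfieldE(1)[OF subfield_of_algebraics[OF T']] .
      obtain f where f: "set f \<subseteq> G" "ev ?P f (y, y') = (a, b)"
        using ab unfolding graph_adjoin_def by auto
      have "?T \<subseteq> ?A" using algebraic_self[OF subfieldE(1)[OF T']] subfieldE(3)[OF T'] by auto
      moreover have "y \<in> ?A" using y algebraic_mono[OF T(2)] by auto
      ultimately have "ev L (map fst f) y \<in> ?A" using f(1) by (intro ev_mem_subring[OF A]) auto
      then have aA: "a \<in> carrier L" "(algebraic over ?T) a" using f(2) by (auto simp: ev_square)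
      obtain k where k: "set k \<subseteq> G" "ev L (map fst k @ [\<one>]) a = \<zero>" "k \<noteq> []"
        and small: "\<And>r. set r \<subseteq> G \<Longrightarrow> length r \<le> length k \<Longrightarrow> ev L (map fst r) a = \<zero> \<Longrightarrow> set r \<subseteq> {(\<zero>, \<zero>)}"
        by (rule graph_minimal_polynomial[OF G T' order_refl aA]) blast
      obtain c k' where kc: "k = c # k'" using k(3) by (cases k) auto
      obtain c1 c2 where c: "c = (c1, c2)" by (cases c)
      have cG: "(c1, c2) \<in> G" using k(1) kc c by simp
      \<comment> \<open>Without a constant term, the factor \<open>a\<close> could be cancelled,
        leaving a shorter relation with leading coefficient 1.\<close>
      have "c1 \<noteq> \<zero>"
      proof
        assume "c1 = \<zero>"
        have one: "(\<one>, \<one>) \<in> G" using subringE(3)[OF D(1)] by (simp add: square_ring_simps)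
        let ?r = "k' @ [(\<one>, \<one>)]"
        have set: "set (map fst ?r) \<subseteq> carrier L" using k(1) kc V.subfield_fst_isograph[OF G, THEN subfieldE(3)] by auto
        have r: "set ?r \<subseteq> G" "length ?r \<le> length k" using one k(1) kc by auto
        have "a \<otimes> ev L (map fst ?r) a = \<zero>"
          using k(2) kc c \<open>c1 = \<zero>\<close> aA(1) ev_closed[OF set aA(1)] by simp
        then have "ev L (map fst ?r) a = \<zero>" using a0 aA(1) integral ev_closed[OF set aA(1)] by blast
        then have "(\<one>, \<one>) \<in> {(\<zero>, \<zero>)}" using small[OF r] by auto
        then show False by simp
      qed
      then have c2: "c2 \<noteq> \<zero>" "c2 \<in> carrier L" using V.isograph_zero_iff[OF G(1) cG] D(4)[OF cG] by auto
      have "set (k @ [(\<one>, \<one>)]) \<subseteq> graph_adjoin ?P G (y, y')"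
        using P.graph_adjoin_incl[OF subringE(1)[OF D(1)] yy] k(1) subringE(3)[OF sub]
        by (auto simp: square_ring_simps)
      then have mem: "ev ?P (k @ [(\<one>, \<one>)]) (a, b) \<in> graph_adjoin ?P G (y, y')"
        using P.ev_mem_subring[OF sub _ ab] by blast
      have "set (map snd k') \<subseteq> snd ` G" using k(1) kc by auto
      then have set: "set (map snd (k' @ [(\<one>, \<one>)])) \<subseteq> carrier L"
        using snd_carrier by auto
      have "ev L (map snd (k @ [(\<one>, \<one>)])) \<zero> = c2"
        using kc c c2 l_null[OF ev_closed[OF set zero_closed]] by simp
      then have "(\<zero>, c2) \<in> graph_adjoin ?P G (y, y')"
        using mem k(2) that by (simp add: ev_square)
      then show False using left c2 by blast
    qed
    then show "a = \<zero> \<longleftrightarrow> b = \<zero>" using left ab by blast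
  qed
  then show thesis using that m by blast
qed

end

section \<open>Isometric extension to algebraic elements\<close>

lemma sum_const_nonzero:
  assumes "(d :: 'g::linordered_ab_group_add) \<noteq> 0" "n \<noteq> (0 :: nat)" shows "(\<Sum>k<n. d) \<noteq> 0"
proof (cases "d > 0")
  case True
  then have "0 < (\<Sum>k<n. d)" using assms by (intro sum_pos) auto
  then show ?thesis by simp
next
  case False
  then have "0 < (\<Sum>k<n. - d)" using assms by (intro sum_pos) auto
  then show ?thesis by (simp add: sum_negf)
qed

lemma sum_const_add: "(\<Sum>k<m + (n :: nat). d :: 'g::ab_group_add) = (\<Sum>k<m. d) + (\<Sum>k<n. d)"
  by (induction n) (simp_all add: add.assoc)

text \<open>An ordered group is torsion-free, so for each index at most one multiple
  \<open>n d + e\<close> vanishes if \<open>d\<close> is nonzero, and none does if \<open>d\<close>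
  is zero. Finitely many \<open>n\<close> are excluded.\<close>

lemma ex_multiple_avoiding_zero:
  assumes "finite I" "\<And>i. i \<in> I \<Longrightarrow> d i \<noteq> (0 :: 'g::linordered_ab_group_add) \<or> e i \<noteq> 0"
  shows "\<exists>n::nat. \<forall>i\<in>I. (\<Sum>k<n. d i) + e i \<noteq> 0"
proof -
  have "finite {n::nat. (\<Sum>k<n. d i) + e i = 0}" if i: "i \<in> I" for i
  proof (cases "d i = 0")
    case True
    then show ?thesis using assms(2)[OF i] by simp
  next
    case False
    have "m = n" if "(\<Sum>k<m. d i) + e i = 0" "(\<Sum>k<n. d i) + e i = 0" "m \<le> n" for m n :: nat
    proof (rule ccontr)
      assume "m \<noteq> n"
      have "(\<Sum>k<n. d i) = (\<Sum>k<m + (n - m). d i)" using that by simp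
      also have "\<dots> = (\<Sum>k<m. d i) + (\<Sum>k<n - m. d i)" by (rule sum_const_add)
      finally have split: "(\<Sum>k<n. d i) = (\<Sum>k<m. d i) + (\<Sum>k<n - m. d i)" .
      have "(\<Sum>k<n - m. d i) = ((\<Sum>k<n. d i) + e i) - ((\<Sum>k<m. d i) + e i)"
        unfolding split by (simp add: algebra_simps)
      then have "(\<Sum>k<n - m. d i) = 0" unfolding that(1,2) by simp
      then show False using sum_const_nonzero[OF False, of "n - m"] \<open>m \<noteq> n\<close> \<open>m \<le> n\<close> by simp
    qed
    then have "m = n" if "(\<Sum>k<m. d i) + e i = 0" "(\<Sum>k<n. d i) + e i = 0" for m n :: nat
      using that by (metis nle_le)
    then have "{n::nat. (\<Sum>k<n. d i) + e i = 0} \<subseteq> {THE n::nat. (\<Sum>k<n. d i) + e i = 0}"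
      by (auto intro!: the_equality[symmetric])
    then show ?thesis by (rule finite_subset) simp
  qed
  then have "finite (\<Union>i\<in>I. {n::nat. (\<Sum>k<n. d i) + e i = 0})" using assms(1) by blast
  then obtain n :: nat where "n \<notin> (\<Union>i\<in>I. {n::nat. (\<Sum>k<n. d i) + e i = 0})"
    using ex_new_if_finite[OF infinite_UNIV_nat] by blast
  then show ?thesis by blast
qed

locale valued_closed = valued_field L v + algebraically_closed L
  for L :: "('a, 'b) ring_scheme" (structure) and v :: "'a \<Rightarrow> 'g::linordered_ab_group_add extended"
begin

lemma v_ev_power_mult:
  assumes "set f \<subseteq> carrier L" "set g \<subseteq> carrier L" "y \<in> carrier L"
    "v (ev L f y) = Fin \<alpha>" "v (ev L g y) = Fin \<beta>"
  shows "v (ev L ((pmul L f ^^ n) g) y) = Fin ((\<Sum>k<n. \<alpha>) + \<beta>) \<and> set ((pmul L f ^^ n) g) \<subseteq> carrier L"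
proof (induction n)
  case (Suc n)
  then show ?case
    using assms ev_pmul[of f "(pmul L f ^^ n) g" y] set_pmul[OF carrier_is_subring, of f "(pmul L f ^^ n) g"]
    by (simp add: v_mult ev_closed add_ac)
qed (use assms in auto)

lemma map_pmul_square:
  "map fst (pmul (square_ring L) f g) = pmul L (map fst f) (map fst g)"
  "map snd (pmul (square_ring L) f g) = pmul L (map snd f) (map snd g)"
proof -
  have "map fst (padd (square_ring L) p q) = padd L (map fst p) (map fst q)"
    "map snd (padd (square_ring L) p q) = padd L (map snd p) (map snd q)" for p q
    by (induction "square_ring L" p q rule: padd.induct) (auto simp: square_ring_simps split: prod.splits)
  moreover have "fst (a \<otimes>\<^bsub>square_ring L\<^esub> b) = fst a \<otimes> fst b" "snd (a \<otimes>\<^bsub>square_ring L\<^esub> b) = snd a \<otimes> snd b" for a b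
    by (cases a; cases b; simp add: square_ring_simps)+
  ultimately show "map fst (pmul (square_ring L) f g) = pmul L (map fst f) (map fst g)"
    "map snd (pmul (square_ring L) f g) = pmul L (map snd f) (map snd g)"
    by (induction f) (simp_all add: square_ring_simps comp_def)
qed

text \<open>If no root \<open>z\<close> of the transferred minimal polynomial were an isometric
  image of \<open>y\<close>, then one element \<open>a = f(y)\<close> could be found whose value
  differs from that of the corresponding \<open>f(z)\<close> for every \<open>z\<close>. But the
  minimal polynomial of \<open>a\<close> and its image have coefficients of equal values, so some
  root \<open>z'\<close> of the image has the value of \<open>a\<close>. The isomorphism sending
  \<open>a\<close> to \<open>z'\<close> extends to \<open>y\<close>, and the image of
  \<open>y\<close> is one of the roots \<open>z\<close> with \<open>f(z) = z'\<close>, a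
  contradiction.\<close>

lemma isograph_adjoin:
  assumes G: "isograph L v G" "inverse_closed L G" and T: "subfield T L" "T \<subseteq> fst ` G"
    and y: "y \<in> carrier L" "(algebraic over T) y"
  shows "\<exists>y'\<in>carrier L. isograph L v (graph_adjoin (square_ring L) G (y, y'))"
proof (rule ccontr)
  interpret V: valued_field L "trivial_val L :: 'a \<Rightarrow> int extended" by (rule trivial_valued_field)
  interpret P: cring "square_ring L" by (rule square_cring)
  let ?P = "square_ring L"
  note D = isographD[OF G(1)]
  assume none: "\<not> ?thesis"
  have G': "plain_graph L G" using isograph_triv[OF G(1)] .
  have sub: "G \<subseteq> carrier L \<times> carrier L" using subringE(1)[OF D(1)] unfolding square_ring_simps .
  have set_carr: "set (map fst f) \<subseteq> carrier L" "set (map snd f) \<subseteq> carrier L" if "set f \<subseteq> G" for f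
    using that sub by auto
  obtain m where m: "set m \<subseteq> G" "m \<noteq> []" "ev L (map fst m @ [\<one>]) y = \<zero>"
    and plain: "\<And>y'. y' \<in> carrier L \<Longrightarrow> ev L (map snd m @ [\<one>]) y' = \<zero> \<Longrightarrow>
       plain_graph L (graph_adjoin ?P G (y, y'))"
    by (rule plain_graph_adjoin_root[OF G' G(2) T y]) blast
  obtain zs where zs: "set zs \<subseteq> carrier L" "map snd m @ [\<one>] = plins L zs"
    using monic_splits set_carr(2)[OF m(1)] by blast
  have root_iff: "z \<in> set zs \<longleftrightarrow> ev L (map snd m @ [\<one>]) z = \<zero>" if "z \<in> carrier L" for z
    using zs that by (simp add: ev_plins_eq_zero_iff)
  define A B where "A f = ev L (map fst f) y" and "B f z = ev L (map snd f) z" for f z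
  have AB: "(A f, B f z) \<in> graph_adjoin ?P G (y, z)" if "set f \<subseteq> G" for f z
    using graph_adjoinI[OF that, of ?P "(y, z)"] by (simp add: ev_square A_def B_def)
  have A_carr: "A f \<in> carrier L" if "set f \<subseteq> G" for f
    unfolding A_def using set_carr[OF that] y by auto
  have B_carr: "B f z \<in> carrier L" if "set f \<subseteq> G" "z \<in> set zs" for f z
    unfolding B_def using set_carr[OF that(1)] that zs(1) by auto
  have AB0: "A f = \<zero> \<longleftrightarrow> B f z = \<zero>" if "set f \<subseteq> G" "z \<in> set zs" for f z
    using V.isograph_zero_iff[OF plain AB[OF that(1)]] root_iff[of z] that zs(1) by blast
  have bad: "\<exists>f. set f \<subseteq> G \<and> v (A f) \<noteq> v (B f z)" if z: "z \<in> set zs" for z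
  proof -
    have "(y, z) \<in> carrier ?P" using y z zs(1) by (auto simp: square_ring_simps)
    then have "subring (graph_adjoin ?P G (y, z)) ?P" using P.subring_graph_adjoin[OF D(1)] by blast
    then obtain a b where ab: "(a, b) \<in> graph_adjoin ?P G (y, z)" "v a \<noteq> v b"
      using none z zs(1) unfolding isograph_def by blast
    then obtain f where "set f \<subseteq> G" "ev ?P f (y, z) = (a, b)" unfolding graph_adjoin_def by auto
    then show ?thesis using ab(2) by (intro exI[of _ f]) (auto simp: ev_square A_def B_def)
  qed
  \<comment> \<open>The polynomials witnessing failure at the single roots are merged one root at a
    time.\<close>
  have "\<exists>f. set f \<subseteq> G \<and> A f \<noteq> \<zero> \<and> (\<forall>z\<in>Z. v (A f) \<noteq> v (B f z))" if "finite Z" "Z \<subseteq> set zs" for Z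
    using that
  proof (induction Z)
    case empty
    have "(\<one>, \<one>) \<in> G" using subringE(3)[OF D(1)] by (simp add: square_ring_simps)
    then show ?case using y by (intro exI[of _ "[(\<one>, \<one>)]"]) (simp add: A_def)
  next
    case (insert z0 Z)
    then obtain f where f: "set f \<subseteq> G" "A f \<noteq> \<zero>" "\<And>z. z \<in> Z \<Longrightarrow> v (A f) \<noteq> v (B f z)" by auto
    obtain g where g: "set g \<subseteq> G" "v (A g) \<noteq> v (B g z0)" using bad insert.prems by blast
    have Ag: "A g \<noteq> \<zero>" using g AB0[OF g(1), of z0] insert.prems by auto
    obtain \<alpha> \<beta> where \<alpha>: "v (A f) = Fin \<alpha>" and \<beta>: "v (A g) = Fin \<beta>"
      using v_nonzero A_carr f g Ag by metis
    have "\<exists>\<gamma>. v (B p z) = Fin \<gamma>" if "set p \<subseteq> G" "A p \<noteq> \<zero>" "z \<in> insert z0 Z" for p z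
    proof -
      have "z \<in> set zs" using that(3) insert.prems(1) by blast
      then show ?thesis using v_nonzero[OF B_carr[OF that(1)]] AB0[OF that(1)] that(2) by blast
    qed
    then have "\<forall>z\<in>insert z0 Z. \<exists>\<gamma>. v (B f z) = Fin \<gamma>" "\<forall>z\<in>insert z0 Z. \<exists>\<gamma>. v (B g z) = Fin \<gamma>"
      using f(1,2) g(1) Ag by simp_all
    then obtain \<alpha>' \<beta>' where \<alpha>': "\<And>z. z \<in> insert z0 Z \<Longrightarrow> v (B f z) = Fin (\<alpha>' z)"
      and \<beta>': "\<And>z. z \<in> insert z0 Z \<Longrightarrow> v (B g z) = Fin (\<beta>' z)" by metis
    have "\<alpha> - \<alpha>' z \<noteq> 0 \<or> \<beta> - \<beta>' z \<noteq> 0" if "z \<in> insert z0 Z" for z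
      using that f(3)[of z] g(2) \<alpha> \<beta> \<alpha>'[OF that] \<beta>'[OF that] by auto
    \<comment> \<open>At old roots \<open>f\<close> separates the values, at \<open>z0\<close> the
      polynomial \<open>g\<close> does. Hence for a suitable \<open>n\<close> the product
      \<open>f^n g\<close> separates at all of them.\<close>
    then obtain n :: nat where n: "\<And>z. z \<in> insert z0 Z \<Longrightarrow> (\<Sum>k<n. \<alpha> - \<alpha>' z) + (\<beta> - \<beta>' z) \<noteq> 0"
      using ex_multiple_avoiding_zero[of "insert z0 Z" "\<lambda>z. \<alpha> - \<alpha>' z" "\<lambda>z. \<beta> - \<beta>' z"] insert.hyps by auto
    define h where "h = (pmul ?P f ^^ n) g"
    have hG: "set h \<subseteq> G"
      unfolding h_def by (induction n) (use g P.set_pmul[OF D(1) f(1)] in auto)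
    have maps: "map fst h = (pmul L (map fst f) ^^ n) (map fst g)"
      "map snd h = (pmul L (map snd f) ^^ n) (map snd g)"
      unfolding h_def by (induction n) (simp_all add: map_pmul_square)
    have vA: "v (A h) = Fin ((\<Sum>k<n. \<alpha>) + \<beta>)"
      unfolding A_def maps using v_ev_power_mult[OF set_carr(1)[OF f(1)] set_carr(1)[OF g(1)] y(1)] \<alpha> \<beta>
      unfolding A_def by blast
    have vB: "v (B h z) = Fin ((\<Sum>k<n. \<alpha>' z) + \<beta>' z)" if z: "z \<in> insert z0 Z" for z
      unfolding B_def maps
      using v_ev_power_mult[OF set_carr(2)[OF f(1)] set_carr(2)[OF g(1)], of z] \<alpha>'[OF z] \<beta>'[OF z]
        z zs(1) insert.prems
      unfolding B_def by blast
    have "v (A h) \<noteq> v (B h z)" if z: "z \<in> insert z0 Z" for z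
      using n[OF z] unfolding vA vB[OF z] by (simp add: sum_subtractf algebra_simps)
    moreover have "A h \<noteq> \<zero>" using vA v_zero by auto
    ultimately show ?case using hG by blast
  qed
  from this[of "set zs"] obtain f where f: "set f \<subseteq> G" "A f \<noteq> \<zero>" "\<And>z. z \<in> set zs \<Longrightarrow> v (A f) \<noteq> v (B f z)"
    by auto
  define a where "a = A f"
  obtain \<gamma> where \<gamma>: "v a = Fin \<gamma>" using v_nonzero A_carr f a_def by blast
  let ?T = "fst ` G"
  have T': "subfield ?T L" using subfield_fst_isograph[OF G] .
  let ?A = "{a \<in> carrier L. (algebraic over ?T) a}"
  have "?T \<subseteq> ?A" using algebraic_self[OF subfieldE(1)[OF T']] subfieldE(3)[OF T'] by auto
  moreover have yA: "y \<in> ?A" using y algebraic_mono[OF T(2)] by auto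
  ultimately have "a \<in> ?A" unfolding a_def A_def
    using f(1) by (intro ev_mem_subring[OF subfieldE(1)[OF subfield_of_algebraics[OF T']]]) auto
  then have aA: "a \<in> carrier L" "(algebraic over ?T) a" by auto
  obtain k where k: "set k \<subseteq> G" "k \<noteq> []" "ev L (map fst k @ [\<one>]) a = \<zero>"
    and plain_a: "\<And>y'. y' \<in> carrier L \<Longrightarrow> ev L (map snd k @ [\<one>]) y' = \<zero> \<Longrightarrow>
       plain_graph L (graph_adjoin ?P G (a, y'))"
    by (rule plain_graph_adjoin_root[OF G' G(2) T' order_refl aA]) blast
  obtain ws where ws: "set ws \<subseteq> carrier L" "map snd k @ [\<one>] = plins L ws"
    using monic_splits set_carr(2)[OF k(1)] by blast
  \<comment> \<open>The pairs in \<open>k\<close> belong to an isograph, so a coefficient and its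
    image have the same value.\<close>
  have "map v (map fst k @ [\<one>]) = map v (plins L ws)"
    unfolding ws(2)[symmetric] using k(1) D(2) by auto
  then obtain z' where z': "z' \<in> set ws" "v z' = Fin \<gamma>"
    using newton_polygon[OF valued_field_axioms valued_field_axioms _ aA(1) k(3) \<gamma> ws(1)]
      set_carr(1)[OF k(1)] by auto
  have "plain_graph L (graph_adjoin ?P G (a, z'))"
    using plain_a ws z' by (simp add: ev_plins_eq_zero_iff subset_iff)
  then obtain H where H: "graph_adjoin ?P G (a, z') \<subseteq> H" "plain_graph L H" "inverse_closed L H"
    using V.isograph_fractions by blast
  have az: "(a, z') \<in> carrier ?P" using aA z' ws(1) by (auto simp: square_ring_simps)
  have GH: "G \<subseteq> H" "(a, z') \<in> H"
    using H(1) P.graph_adjoin_incl[OF subringE(1)[OF D(1)] az] P.graph_adjoin_mem[OF D(1) az] by auto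
  have yH: "(algebraic over (fst ` H)) y" using yA GH(1) algebraic_mono[of ?T "fst ` H"] by blast
  \<comment> \<open>The map sending \<open>a\<close> to \<open>z'\<close> is extended to
    \<open>y\<close> as a mere isomorphism; its values are not controlled, but only the images of
    \<open>y\<close> and \<open>a\<close> enter.\<close>
  obtain l where l: "set l \<subseteq> H" "l \<noteq> []" "ev L (map fst l @ [\<one>]) y = \<zero>"
    and plain_l: "\<And>y'. y' \<in> carrier L \<Longrightarrow> ev L (map snd l @ [\<one>]) y' = \<zero> \<Longrightarrow>
       plain_graph L (graph_adjoin ?P H (y, y'))"
    by (rule plain_graph_adjoin_root[OF H(2,3) V.subfield_fst_isograph[OF H(2,3)] order_refl y(1) yH]) blast
  note DH = V.isographD[OF H(2)]
  have "set (map snd l) \<subseteq> carrier L" using l(1) subringE(1)[OF DH(1)] unfolding square_ring_simps by auto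
  then obtain y' where y': "y' \<in> carrier L" "ev L (map snd l @ [\<one>]) y' = \<zero>"
    using monic_has_root[of "map snd l"] l(2) by auto
  let ?Q = "graph_adjoin ?P H (y, y')"
  have Q: "plain_graph L ?Q" using plain_l y' by blast
  have yy: "(y, y') \<in> carrier ?P" using y y' by (simp add: square_ring_simps)
  have HQ: "H \<subseteq> ?Q" "(y, y') \<in> ?Q"
    using P.graph_adjoin_incl[OF subringE(1)[OF DH(1)] yy] P.graph_adjoin_mem[OF DH(1) yy] by auto
  note SQ = V.isographD(1)[OF Q]
  have evQ: "(A h, B h y') \<in> ?Q" if "set h \<subseteq> G" for h
    using P.ev_mem_subring[OF SQ _ HQ(2), of h] that GH(1) HQ(1) by (simp add: ev_square A_def B_def)
  have mQ: "set (m @ [(\<one>, \<one>)]) \<subseteq> G" using m(1) subringE(3)[OF D(1)] by (auto simp: square_ring_simps)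
  have "ev L (map snd m @ [\<one>]) y' = \<zero>"
    using V.isograph_zero_iff[OF Q evQ[OF mQ]] m(3) by (simp add: A_def B_def)
  then have "y' \<in> set zs" using root_iff y' by blast
  moreover have "B f y' = z'"
    using V.isograph_unique[OF Q evQ[OF f(1)], of z'] GH(2) HQ(1) unfolding a_def by blast
  ultimately show False using f(3)[of y'] z'(2) \<gamma> unfolding a_def by simp
qed

text \<open>By Zorn's lemma there is a maximal isograph above \<open>G\<close>. Fractions and roots
  can both be adjoined isometrically, so it already contains them. The conclusion speaks of elements
  algebraic over an arbitrary subfield of the domain, because it is applied with small fields whose
  domain membership is easy to see.\<close>

theorem isograph_extension:
  assumes G: "isograph L v G"
  shows "\<exists>H. G \<subseteq> H \<and> isograph L v H \<and> inverse_closed L H \<and>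
    (\<forall>T y. subfield T L \<and> T \<subseteq> fst ` H \<and> y \<in> carrier L \<and> (algebraic over T) y \<longrightarrow> y \<in> fst ` H)"
proof -
  interpret P: cring "square_ring L" by (rule square_cring)
  define \<A> where "\<A> = {H. G \<subseteq> H \<and> isograph L v H}"
  have "\<exists>M\<in>\<A>. \<forall>N\<in>\<A>. M \<subseteq> N \<longrightarrow> N = M"
  proof (rule subset_Zorn_nonempty)
    show "\<A> \<noteq> {}" using G unfolding \<A>_def by blast
    fix C assume C: "C \<noteq> {}" "subset.chain \<A> C"
    have CA: "\<And>H. H \<in> C \<Longrightarrow> G \<subseteq> H \<and> isograph L v H"
      using C(2) unfolding subset.chain_def \<A>_def by blast
    have common: "\<exists>H\<in>C. p \<in> H \<and> q \<in> H" if "p \<in> \<Union>C" "q \<in> \<Union>C" for p q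
      using C(2) that unfolding subset.chain_def by blast
    have S: "\<And>H. H \<in> C \<Longrightarrow> subring H (square_ring L)" using CA unfolding isograph_def by blast
    have "isograph L v (\<Union>C)"
      unfolding isograph_def
    proof
      show "subring (\<Union>C) (square_ring L)"
      proof (rule P.subringI)
        show "\<Union>C \<subseteq> carrier (square_ring L)" using subringE(1)[OF S] by (rule Union_least)
        show "\<one>\<^bsub>square_ring L\<^esub> \<in> \<Union>C" using S subringE(3) C(1) by (metis UnionI ex_in_conv)
      next
        fix p assume "p \<in> \<Union>C"
        then obtain H where "H \<in> C" "p \<in> H" by blast
        then show "\<ominus>\<^bsub>square_ring L\<^esub> p \<in> \<Union>C" using S[of H] subringE(5)[of H] by (metis UnionI)
      next
        fix p q assume "p \<in> \<Union>C" "q \<in> \<Union>C"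
        then obtain H where H: "H \<in> C" "p \<in> H" "q \<in> H" using common by blast
        show "p \<otimes>\<^bsub>square_ring L\<^esub> q \<in> \<Union>C" "p \<oplus>\<^bsub>square_ring L\<^esub> q \<in> \<Union>C"
          using H(1) subringE(6,7)[OF S[OF H(1)] H(2,3)] by blast+
      qed
      show "\<forall>(a, b)\<in>\<Union>C. v a = v b"
      proof clarify
        fix a b H assume "(a, b) \<in> H" "H \<in> C"
        then show "v a = v b" using CA isographD(2) by blast
      qed
    qed
    moreover have "G \<subseteq> \<Union>C" using CA C(1) by blast
    ultimately show "\<Union>C \<in> \<A>" unfolding \<A>_def by blast
  qed
  then obtain H where HA: "H \<in> \<A>" "\<forall>N\<in>\<A>. H \<subseteq> N \<longrightarrow> N = H" by blast
  then have H: "G \<subseteq> H" "isograph L v H" unfolding \<A>_def by simp_all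
  have max: "N = H" if "isograph L v N" "H \<subseteq> N" for N
    using HA(2) that H(1) unfolding \<A>_def by simp
  have inv: "inverse_closed L H" using isograph_fractions[OF H(2)] max by blast
  have "y \<in> fst ` H" if T: "subfield T L" "T \<subseteq> fst ` H" and y: "y \<in> carrier L" "(algebraic over T) y" for T y
  proof -
    obtain y' where y': "y' \<in> carrier L" "isograph L v (graph_adjoin (square_ring L) H (y, y'))"
      using isograph_adjoin[OF H(2) inv T y] by blast
    have yy: "(y, y') \<in> carrier (square_ring L)" using y y' by (simp add: square_ring_simps)
    note S = isographD(1)[OF H(2)]
    have "graph_adjoin (square_ring L) H (y, y') = H"
      using max[OF y'(2)] P.graph_adjoin_incl[OF subringE(1)[OF S] yy] by blast
    then have "(y, y') \<in> H" using P.graph_adjoin_mem[OF S yy] by simp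
    then show ?thesis by force
  qed
  then show ?thesis using H inv by blast
qed

end

section \<open>Henselian fields and conjugates\<close>

lemma ev_carrier_update: "ev (L\<lparr>carrier := C\<rparr>) cs y = ev L cs y"
  by (induction cs) auto

lemma mem_algebraic_closure_in:
  "y \<in> algebraic_closure_in L F \<longleftrightarrow> y \<in> carrier L \<and> (ring.algebraic L over F) y"
  by (simp add: algebraic_closure_in_def)

context field begin

lemma subfield_algebraic_closure_in: "subfield F R \<Longrightarrow> subfield (algebraic_closure_in R F) R"
  using subfield_of_algebraics unfolding algebraic_closure_in_def by blast

lemma algebraic_closure_in_incl: "subfield F R \<Longrightarrow> F \<subseteq> algebraic_closure_in R F"
  using algebraic_self[OF subfieldE(1)] subfieldE(3) unfolding algebraic_closure_in_def by blast

lemma algebraic_closure_in_mono: "F \<subseteq> E \<Longrightarrow> algebraic_closure_in R F \<subseteq> algebraic_closure_in R E"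
  using algebraic_mono unfolding algebraic_closure_in_def by blast

lemma algebraic_closure_in_idem:
  assumes F: "subfield F R"
  shows "algebraic_closure_in R (algebraic_closure_in R F) = algebraic_closure_in R F"
proof
  let ?C = "algebraic_closure_in R F"
  have C: "subfield ?C R" using subfield_algebraic_closure_in[OF F] .
  show "?C \<subseteq> algebraic_closure_in R ?C" using algebraic_closure_in_incl[OF C] .
  show "algebraic_closure_in R ?C \<subseteq> ?C"
  proof
    fix y assume "y \<in> algebraic_closure_in R ?C"
    then have y: "y \<in> carrier R" "(algebraic over ?C) y" by (auto simp: mem_algebraic_closure_in)
    then obtain m where m: "set m \<subseteq> ?C" "ev R (m @ [\<one>]) y = \<zero>" using algebraic_iff_monic[OF C] by blast
    have mc: "set m \<subseteq> carrier R" "\<And>c. c \<in> set m \<Longrightarrow> (algebraic over F) c"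
      using m(1) by (auto simp: mem_algebraic_closure_in)
    let ?E = "finite_extension F m"
    have E: "subfield ?E R" "finite_dimension F ?E"
      using finite_extension_is_subfield[OF F mc] finite_extension_finite_dimension(1)[OF F mc] by auto
    have "set m \<subseteq> ?E" using finite_extension_mem[OF subfieldE(1)[OF F] mc(1)] .
    then have alg: "(algebraic over ?E) y" using algebraic_iff_monic[OF E(1) y(1)] m(2) by blast
    then have "finite_dimension ?E (simple_extension ?E y)"
      using finite_dimension_simple_extension[OF E(1) y(1)] by blast
    then have "finite_dimension F (simple_extension ?E y)" by (rule telescopic_base_dim(1)[OF F E])
    moreover have "subring (simple_extension ?E y) R" "y \<in> simple_extension ?E y"
      using simple_extension_is_subring simple_extension_mem subfieldE(1)[OF E(1)] y(1) by auto
    ultimately have "(algebraic over F) y" using finite_dimension_imp_algebraic[OF F] by blast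
    then show "y \<in> ?C" using y(1) by (simp add: mem_algebraic_closure_in)
  qed
qed

lemma diagonal_isograph:
  assumes F: "subfield F R" and v: "valued_field R v"
  shows "isograph R v (Id_on F)" "inverse_closed R (Id_on F)" "fst ` Id_on F = F"
proof -
  interpret P: cring "square_ring R" by (rule square_cring)
  note S = subringE[OF subfieldE(1)[OF F]]
  have "subring (Id_on F) (square_ring R)"
  proof (rule P.subringI)
    show "Id_on F \<subseteq> carrier (square_ring R)" "\<one>\<^bsub>square_ring R\<^esub> \<in> Id_on F"
      using S(1,3) by (auto simp: square_ring_simps)
  next
    fix p assume "p \<in> Id_on F"
    then obtain a where a: "p = (a, a)" "a \<in> F" by blast
    then have "a \<in> carrier R" using S(1) by blast
    then show "\<ominus>\<^bsub>square_ring R\<^esub> p \<in> Id_on F" unfolding a(1) using S(5)[OF a(2)] by (simp add: square_minus Id_onI)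
  next
    fix p q assume "p \<in> Id_on F" "q \<in> Id_on F"
    then obtain a b where "p = (a, a)" "a \<in> F" "q = (b, b)" "b \<in> F" by blast
    then show "p \<otimes>\<^bsub>square_ring R\<^esub> q \<in> Id_on F" "p \<oplus>\<^bsub>square_ring R\<^esub> q \<in> Id_on F"
      using S(6,7)[of a b] by (simp_all add: square_ring_simps Id_onI)
  qed
  then show "isograph R v (Id_on F)" unfolding isograph_def by auto
  show "inverse_closed R (Id_on F)"
    unfolding inverse_closed_def
  proof clarify
    fix a assume a: "a \<in> F" "a \<noteq> \<zero>"
    then have "inv a \<in> F" "inv a \<otimes> a = \<one>" using subfield_m_inv(1,3)[OF F, of a] by auto
    then show "\<exists>c d. (c, d) \<in> Id_on F \<and> c \<otimes> a = \<one> \<and> d \<otimes> a = \<one>" by blast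
  qed
  show "fst ` Id_on F = F" by force
qed

end

context algebraically_closed begin

text \<open>The diagonal is the identity of \<open>F\<close>. The minimal polynomial transferred
  along it is unchanged, and \<open>y'\<close> is one of its roots.\<close>

lemma conjugate_plain_graph:
  assumes F: "subfield F L" and y: "(algebraic over F) y" and conj: "conjugate L F y y'"
  shows "\<exists>G. plain_graph L G \<and> Id_on F \<subseteq> G \<and> (y, y') \<in> G"
proof -
  interpret P: cring "square_ring L" by (rule square_cring)
  interpret V: valued_field L "trivial_val L :: 'a \<Rightarrow> int extended" by (rule trivial_valued_field)
  note D = diagonal_isograph[OF F V.valued_field_axioms]
  have yc: "y \<in> carrier L" "y' \<in> carrier L" using conj unfolding conjugate_def by auto
  obtain m where m: "set m \<subseteq> Id_on F" "ev L (map fst m @ [\<one>]) y = \<zero>"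
    and plain: "\<And>y'. y' \<in> carrier L \<Longrightarrow> ev L (map snd m @ [\<one>]) y' = \<zero> \<Longrightarrow>
       plain_graph L (graph_adjoin (square_ring L) (Id_on F) (y, y'))"
    by (rule plain_graph_adjoin_root[OF D(1,2) F _ yc(1) y]) (use D(3) in blast)+
  have "map snd m = map fst m" using m(1) by (auto simp: Id_on_iff)
  moreover have "set (map fst m @ [\<one>]) \<subseteq> F" using m(1) subringE(3)[OF subfieldE(1)[OF F]] by auto
  then have "ev L (map fst m @ [\<one>]) y' = \<zero>" using conj m(2) unfolding conjugate_def by blast
  ultimately have "ev L (map snd m @ [\<one>]) y' = \<zero>" by (simp only:)
  then have pl: "plain_graph L (graph_adjoin (square_ring L) (Id_on F) (y, y'))" using plain yc by blast
  have yy: "(y, y') \<in> carrier (square_ring L)" using yc by (simp add: square_ring_simps)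
  note S = V.isographD(1)[OF D(1)]
  show ?thesis
    using pl P.graph_adjoin_incl[OF subringE(1)[OF S] yy] P.graph_adjoin_mem[OF S yy] by blast
qed

text \<open>The isometric extension theorem, read for the trivial valuation.\<close>

lemma plain_extension:
  assumes "plain_graph L G"
  shows "\<exists>H. G \<subseteq> H \<and> plain_graph L H \<and> (\<forall>F y. subfield F L \<and> Id_on F \<subseteq> H \<and>
    y \<in> algebraic_closure_in L F \<longrightarrow> (\<exists>z. (y, z) \<in> H))"
proof -
  interpret V: valued_field L "trivial_val L :: 'a \<Rightarrow> int extended" by (rule trivial_valued_field)
  interpret V: valued_closed L "trivial_val L :: 'a \<Rightarrow> int extended" by unfold_locales
  obtain H where H: "G \<subseteq> H" "plain_graph L H"
    "\<And>T y. subfield T L \<Longrightarrow> T \<subseteq> fst ` H \<Longrightarrow> y \<in> carrier L \<Longrightarrow> (algebraic over T) y \<Longrightarrow> y \<in> fst ` H"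
    using V.isograph_extension[OF assms] by blast
  have "\<exists>z. (y, z) \<in> H" if "subfield F L" "Id_on F \<subseteq> H" "y \<in> algebraic_closure_in L F" for F y
  proof -
    have "F \<subseteq> fst ` H" using that(2) by force
    then have "y \<in> fst ` H" using H(3) that unfolding mem_algebraic_closure_in by blast
    then show ?thesis by force
  qed
  then show ?thesis using H by blast
qed

end

context valued_closed begin

text \<open>Let \<open>w\<close> be another extension of the valuation. The Newton polygon of the
  minimal polynomial of \<open>y\<close> is the same for \<open>w\<close> and \<open>v\<close>,
  since both agree on the coefficients. Hence some conjugate \<open>z\<close> satisfies
  \<open>v z = w y\<close>, and \<open>conj\<close> replaces \<open>v z\<close> by
  \<open>v y\<close>.\<close>

lemma henselianI:
  assumes F: "subfield F L"
    and conj: "\<And>y y'. y \<in> algebraic_closure_in L F \<Longrightarrow> conjugate L F y y' \<Longrightarrow> v y = v y'"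
  shows "henselian L v F"
  unfolding henselian_def
proof (intro conjI allI impI ballI F)
  let ?C = "algebraic_closure_in L F"
  have C: "subfield ?C L" using subfield_algebraic_closure_in[OF F] .
  fix w :: "'a \<Rightarrow> 'g extended" and y
  assume w: "valued_field (L\<lparr>carrier := ?C\<rparr>) w \<and> (\<forall>a\<in>F. w a = v a)" and y: "y \<in> ?C"
  interpret W: valued_field "L\<lparr>carrier := ?C\<rparr>" w using w by blast
  have yc: "y \<in> carrier L" "(algebraic over F) y" using y by (auto simp: mem_algebraic_closure_in)
  show "w y = v y"
  proof (cases "y = \<zero>")
    case True
    then show ?thesis using W.v_zero v_zero by simp
  next
    case False
    then obtain \<gamma> where \<gamma>: "w y = Fin \<gamma>" using W.v_nonzero y by auto
    obtain p where p: "set p \<subseteq> F" "ev L (p @ [\<one>]) y = \<zero>" using algebraic_iff_monic[OF F yc(1)] yc(2) by blast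
    have one: "\<one> \<in> F" using subringE(3)[OF subfieldE(1)[OF F]] .
    obtain m where min: "minimal_poly L F y m"
      using minimal_poly_exists[OF F yc(1) _ monic_nonzero p(2)] p(1) one by auto
    then have m: "set (m @ [\<one>]) \<subseteq> F" "ev L (m @ [\<one>]) y = \<zero>" using one by (auto simp: minimal_poly_def)
    obtain zs where zs: "set zs \<subseteq> carrier L" "m @ [\<one>] = plins L zs"
      using monic_splits[of m] m subfieldE(3)[OF F] by auto
    have FC: "F \<subseteq> ?C" using algebraic_closure_in_incl[OF F] .
    have "map w (m @ [\<one>]) = map v (plins L zs)"
      unfolding zs(2)[symmetric] by (intro map_cong refl) (use m(1) w in blast)
    moreover have "set (m @ [\<one>]) \<subseteq> carrier (L\<lparr>carrier := ?C\<rparr>)" using subset_trans[OF m(1) FC] by simp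
    ultimately obtain z where z: "z \<in> set zs" "v z = Fin \<gamma>"
      using newton_polygon[OF W.valued_field_axioms valued_field_axioms, of "m @ [\<one>]" y \<gamma> zs] y \<gamma> zs m(2)
      by (auto simp: ev_carrier_update)
    then have "conjugate L F y z"
      using minimal_poly_conjugate[OF F yc(1) min] zs by (auto simp: ev_plins_eq_zero_iff)
    then show ?thesis using conj[OF y] z \<gamma> by simp
  qed
qed

text \<open>Composing \<open>v\<close> with an isomorphism defined on the algebraic closure of
  \<open>F\<close> and fixing \<open>F\<close> gives a valuation that extends the one of
  \<open>F\<close>. By uniqueness it is \<open>v\<close> itself.\<close>

lemma henselian_plain_graph:
  assumes F: "henselian L v F" and G: "plain_graph L G" "Id_on F \<subseteq> G"
    and ab: "(a, b) \<in> G" "a \<in> algebraic_closure_in L F"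
  shows "v a = v b"
proof -
  interpret V: valued_field L "trivial_val L :: 'a \<Rightarrow> int extended" by (rule trivial_valued_field)
  have FL: "subfield F L" using F unfolding henselian_def by blast
  let ?C = "algebraic_closure_in L F"
  have C: "subfield ?C L" using subfield_algebraic_closure_in[OF FL] .
  note CS = subringE[OF subfieldE(1)[OF C]]
  obtain H where H: "G \<subseteq> H" "plain_graph L H"
    and total: "\<And>y. y \<in> ?C \<Longrightarrow> \<exists>z. (y, z) \<in> H"
    using plain_extension[OF G(1)] FL G(2) by (metis subset_trans)
  \<comment> \<open>The graph \<open>H\<close> is single-valued and covers the algebraic closure, so
    the choice is forced there.\<close>
  define s where "s a = (SOME z. (a, z) \<in> H)" for a
  have s: "(a, s a) \<in> H" if "a \<in> ?C" for a unfolding s_def using someI_ex[OF total[OF that]] .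
  have s_eq: "s a = b" if "a \<in> ?C" "(a, b) \<in> H" for a b using V.isograph_unique[OF H(2) s that(2)] that by blast
  have sc: "s a \<in> carrier L" if "a \<in> ?C" for a using V.isographD(4)[OF H(2) s[OF that]] .
  have smult: "s (a \<otimes> b) = s a \<otimes> s b" and sadd: "s (a \<oplus> b) = s a \<oplus> s b" if "a \<in> ?C" "b \<in> ?C" for a b
    using s_eq[OF CS(6)[OF that]] s_eq[OF CS(7)[OF that]] V.isograph_ops(1,2)[OF H(2) s[OF that(1)] s[OF that(2)]]
    by auto
  have s0: "s a = \<zero> \<longleftrightarrow> a = \<zero>" if "a \<in> ?C" for a using V.isograph_zero_iff[OF H(2) s[OF that]] by blast
  have s00: "s \<zero> = \<zero>" using s0[OF CS(2)] by simp
  have field: "field (L\<lparr>carrier := ?C\<rparr>)" using subfield_iff(2)[OF C] .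
  have "valued_field (L\<lparr>carrier := ?C\<rparr>) (\<lambda>a. v (s a))"
    unfolding valued_field_def valued_field_axioms_def
    using field v_nonzero[OF sc] v_mult[OF sc sc] v_add[OF sc sc]
    by (simp add: s0 s00 v_zero smult sadd)
  moreover have "v (s a) = v a" if "a \<in> F" for a
  proof -
    have "(a, a) \<in> H" using that G(2) H(1) by auto
    then show ?thesis using s_eq[of a a] algebraic_closure_in_incl[OF FL] that by auto
  qed
  ultimately have "v (s a) = v a" using F ab(2) unfolding henselian_def by fast
  moreover have "s a = b" using s_eq[OF ab(2)] ab(1) H(1) by blast
  ultimately show ?thesis by simp
qed

lemma henselian_conjugate:
  assumes F: "henselian L v F" and y: "y \<in> algebraic_closure_in L F" and conj: "conjugate L F y y'"
  shows "v y = v y'"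
proof -
  have "subfield F L" using F unfolding henselian_def by blast
  then obtain G where "plain_graph L G" "Id_on F \<subseteq> G" "(y, y') \<in> G"
    using conjugate_plain_graph[of F y y'] y conj unfolding mem_algebraic_closure_in by blast
  then show ?thesis using henselian_plain_graph[OF F] y by blast
qed

text \<open>The intersection is relatively algebraically closed in \<open>E\<close>, so elements
  conjugate over it remain conjugate over \<open>E\<close> by \<open>conjugate_lift\<close>, where
  they have the same value.\<close>

lemma henselian_relative_closure:
  assumes E: "henselian L v E" and M: "subfield M L" "M \<subseteq> E"
  shows "henselian L v (E \<inter> algebraic_closure_in L M)"
proof (rule henselianI)
  have EL: "subfield E L" using E unfolding henselian_def by blast
  let ?C = "algebraic_closure_in L M"
  let ?F = "E \<inter> ?C"
  have C: "subfield ?C L" using subfield_algebraic_closure_in[OF M(1)] .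
  show F: "subfield ?F L"
  proof (rule subfieldI')
    show "subring ?F L" using subring_inter[OF subfieldE(1)[OF EL] subfieldE(1)[OF C]] .
    show "\<And>k. k \<in> ?F - {\<zero>} \<Longrightarrow> inv k \<in> ?F"
      using subfield_m_inv(1)[OF EL] subfield_m_inv(1)[OF C] by blast
  qed
  fix y y' assume y: "y \<in> algebraic_closure_in L ?F" "conjugate L ?F y y'"
  have "a \<in> ?F" if "a \<in> E" "(algebraic over ?F) a" for a
  proof -
    have "a \<in> algebraic_closure_in L ?C"
      using that algebraic_mono[of ?F ?C] subfieldE(3)[OF EL] by (auto simp: mem_algebraic_closure_in)
    then show ?thesis using that(1) algebraic_closure_in_idem[OF M(1)] by blast
  qed
  then have "conjugate L E y y'"
    using conjugate_lift[OF F EL _ _ _ _ y(2)] y(1) unfolding mem_algebraic_closure_in by blast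
  moreover have "y \<in> algebraic_closure_in L E" using y(1) algebraic_closure_in_mono[of ?F E] by blast
  ultimately show "v y = v y'" using henselian_conjugate[OF E] by blast
qed

end

lemma (in cring) plin_commute:
  assumes "z1 \<in> carrier R" "z2 \<in> carrier R" "set cs \<subseteq> carrier R" "a \<in> carrier R" "b \<in> carrier R"
  shows "plin R z1 a (plin R z2 b cs) = plin R z2 (a \<oplus> (z2 \<ominus> z1) \<otimes> b) (plin R z1 b cs)"
  using assms(3-5)
proof (induction cs arbitrary: a b)
  case Nil
  then show ?case using assms(1,2) by (simp, algebra)
next
  case (Cons c cs)
  then have c: "c \<in> carrier R" by simp
  have "plin R z1 (b \<ominus> z2 \<otimes> c) (plin R z2 c cs) =
      plin R z2 (b \<ominus> z2 \<otimes> c \<oplus> (z2 \<ominus> z1) \<otimes> c) (plin R z1 c cs)"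
    using Cons assms(1,2) by (intro Cons.IH) auto
  moreover have "b \<ominus> z2 \<otimes> c \<oplus> (z2 \<ominus> z1) \<otimes> c = b \<ominus> z1 \<otimes> c"
    using Cons.prems assms(1,2) c by algebra
  moreover have "a \<ominus> z1 \<otimes> (b \<ominus> z2 \<otimes> c) = a \<oplus> (z2 \<ominus> z1) \<otimes> b \<ominus> z2 \<otimes> (b \<ominus> z1 \<otimes> c)"
    using Cons.prems assms(1,2) c by algebra
  ultimately show ?case by simp
qed

lemma (in cring) plins_rotate1:
  "set zs \<subseteq> carrier R \<Longrightarrow> z \<in> carrier R \<Longrightarrow> plins R (z # zs) = plins R (zs @ [z])"
proof (induction zs)
  case (Cons w zs)
  have "set (plins R zs) \<subseteq> carrier R" using set_plins[OF carrier_is_subring] Cons.prems by auto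
  then have "plin R z \<zero> (plin R w \<zero> (plins R zs)) = plin R w \<zero> (plin R z \<zero> (plins R zs))"
    using plin_commute[of z w "plins R zs" \<zero> \<zero>] Cons.prems by simp
  then show ?case using Cons by simp
qed simp

lemma (in cring) plin_square:
  assumes "z \<in> carrier R \<times> carrier R" "set cs \<subseteq> carrier R \<times> carrier R"
  shows "map fst (plin (square_ring R) z r cs) = plin R (fst z) (fst r) (map fst cs) \<and>
    map snd (plin (square_ring R) z r cs) = plin R (snd z) (snd r) (map snd cs)"
  using assms
proof (induction cs arbitrary: r)
  case (Cons c cs)
  then show ?case
    by (cases z; cases r; cases c) (auto simp: square_ring_simps a_minus_def square_minus)
qed simp

lemma (in cring) map_plins_square:
  assumes "set ps \<subseteq> carrier R \<times> carrier R"
  shows "map fst (plins (square_ring R) ps) = plins R (map fst ps) \<and>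
    map snd (plins (square_ring R) ps) = plins R (map snd ps)"
proof -
  interpret P: cring "square_ring R" by (rule square_cring)
  show ?thesis using assms
  proof (induction ps)
    case (Cons p ps)
    have "set (plins (square_ring R) ps) \<subseteq> carrier R \<times> carrier R"
      using P.set_plins[OF P.carrier_is_subring, of ps] Cons.prems by (simp add: square_ring_simps)
    then show ?case using Cons plin_square[of p "plins (square_ring R) ps" "\<zero>\<^bsub>square_ring R\<^esub>"]
      by (simp add: square_ring_simps(5))
  qed (simp add: square_ring_simps)
qed

section \<open>The fixed field of an isometry\<close>

context valued_closed begin

lemma subfield_fixed_isograph:
  assumes G: "isograph L v G" "inverse_closed L G"
  shows "subfield {a. (a, a) \<in> G} L"
proof -
  let ?F = "{a. (a, a) \<in> G}"
  note D = isographD[OF G(1)] and ops = isograph_ops[OF G(1)]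
  have one: "(\<one>, \<one>) \<in> G" using subringE(3)[OF D(1)] by (simp add: square_ring_simps)
  show "subfield ?F L"
  proof (rule subfieldI')
    show "subring ?F L" by (rule subringI) (use D(3) one ops in auto)
    fix k assume k: "k \<in> ?F - {\<zero>}"
    then have kG: "(k, k) \<in> G" "k \<noteq> \<zero>" by auto
    then obtain c d where cd: "(c, d) \<in> G" "c \<otimes> k = \<one>" "d \<otimes> k = \<one>"
      using G(2) unfolding inverse_closed_def by blast
    have "k \<in> carrier L" "c \<in> carrier L" "d \<in> carrier L" using D(3,4) cd kG by blast+
    then have "inv k = c" "inv k = d" using comm_inv_char[of k c] comm_inv_char[of k d] cd m_comm by metis+
    then show "inv k \<in> ?F" using cd(1) by simp
  qed
qed

text \<open>
  The conjugates of \<open>y\<close> over the fixed field of an isometry form a single finite orbit, so they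
  have the same value.
\<close>

lemma henselian_fixed_field:
  assumes G: "isograph L v G" "inverse_closed L G" and total: "fst ` G = carrier L"
    and alg: "\<And>y. y \<in> carrier L \<Longrightarrow> (algebraic over {a. (a, a) \<in> G}) y"
  shows "henselian L v {a. (a, a) \<in> G}"
proof (rule henselianI)
  interpret P: cring "square_ring L" by (rule square_cring)
  let ?F = "{a. (a, a) \<in> G}"
  note D = isographD[OF G(1)] and ops = isograph_ops[OF G(1)]
  have one: "(\<one>, \<one>) \<in> G" using subringE(3)[OF D(1)] by (simp add: square_ring_simps)
  have F: "subfield ?F L" using subfield_fixed_isograph[OF G] .
  then show "subfield ?F L" .
  define t where "t a = (SOME b. (a, b) \<in> G)" for a
  have t: "(a, t a) \<in> G" if "a \<in> carrier L" for a
  proof -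
    have "\<exists>b. (a, b) \<in> G" using that total by force
    then show ?thesis unfolding t_def by (rule someI_ex)
  qed
  have tc: "t a \<in> carrier L" if "a \<in> carrier L" for a using D(4)[OF t[OF that]] .
  have inj: "a = b" if "a \<in> carrier L" "b \<in> carrier L" "t a = t b" for a b
  proof -
    have "(a \<ominus> b, t a \<ominus> t b) \<in> G" using ops(4)[OF t[OF that(1)] t[OF that(2)]] .
    then have "a \<ominus> b = \<zero>" using isograph_zero_iff[OF G(1)] that tc by (metis r_right_minus_eq)
    then show ?thesis using that by simp
  qed
  fix y y' assume "y \<in> algebraic_closure_in L ?F" and conj: "conjugate L ?F y y'"
  then have y: "y \<in> carrier L" "(algebraic over ?F) y" by (auto simp: mem_algebraic_closure_in)
  have y'c: "y' \<in> carrier L" using conj unfolding conjugate_def by blast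
  define orb where "orb k = (t ^^ k) y" for k :: nat
  have oc: "orb k \<in> carrier L" for k unfolding orb_def by (induction k) (use y tc in auto)
  have oG: "(orb k, orb (Suc k)) \<in> G" for k using t[OF oc[of k]] by (simp add: orb_def)
  have ov: "v (orb k) = v y" for k
  proof (induction k)
    case (Suc k)
    then show ?case using D(2)[OF oG[of k]] by simp
  qed (simp add: orb_def)
  obtain m where m: "set m \<subseteq> ?F" "ev L (m @ [\<one>]) y = \<zero>" using algebraic_iff_monic[OF F y(1)] y(2) by blast
  have mc: "set m \<subseteq> carrier L" using m(1) subfieldE(3)[OF F] by blast
  let ?mm = "map (\<lambda>a. (a, a)) (m @ [\<one>])"
  have mm: "set ?mm \<subseteq> G" using m(1) one by auto
  have root: "ev L (m @ [\<one>]) (orb k) = \<zero>" for k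
  proof (induction k)
    case (Suc k)
    have "ev (square_ring L) ?mm (orb k, orb (Suc k)) \<in> G" using P.ev_mem_subring[OF D(1) mm oG] .
    then have "(ev L (m @ [\<one>]) (orb k), ev L (m @ [\<one>]) (orb (Suc k))) \<in> G"
      unfolding ev_square by (simp add: comp_def)
    from isograph_zero_iff[OF G(1) this] show ?case using Suc by simp
  qed (use m in \<open>simp add: orb_def\<close>)
  obtain ws where ws: "set ws \<subseteq> carrier L" "m @ [\<one>] = plins L ws" using monic_splits[OF mc] by blast
  have "range orb \<subseteq> set ws" using root ws oc by (auto simp: ev_plins_eq_zero_iff)
  then have "finite (range orb)" using finite_subset by blast
  then have "\<not> inj orb" using finite_imageD by auto
  then obtain i j where ij: "i < j" "orb i = orb j" unfolding inj_on_def by (metis linorder_neqE_nat)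
  \<comment> \<open>By injectivity a coincidence in the orbit can be moved back to the start, so the
    orbit is a cycle through \<open>y\<close> of length \<open>j - i\<close>.\<close>
  have shift: "orb (j - k) = orb (i - k)" if "k \<le> i" for k
    using that
  proof (induction k)
    case (Suc k)
    have "j - k = Suc (j - Suc k)" "i - k = Suc (i - Suc k)" using Suc.prems ij(1) by auto
    then have "t (orb (j - Suc k)) = t (orb (i - Suc k))" using Suc by (simp add: orb_def)
    then show ?case using inj oc by blast
  qed (use ij in simp)
  define n where "n = j - i"
  have n: "n > 0" "orb n = y" using shift[of i] ij(1) by (auto simp: n_def orb_def)
  define zs where "zs = map orb [0..<n]"
  have zs_ne: "zs = y # map orb [1..<n]" "map orb [1..<Suc n] = map orb [1..<n] @ [y]"
    using n by (simp_all add: zs_def upt_conv_Cons orb_def[of 0])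
  \<comment> \<open>The product over the orbit is formed in the square ring with the pairs of
    consecutive members as roots. Its projections are the product over the orbit and the same
    product rotated by one, hence equal; so all coefficients are diagonal pairs of \<open>G\<close>,
    that is, elements of the fixed field.\<close>
  define ps where "ps = map (\<lambda>k. (orb k, orb (Suc k))) [0..<n]"
  have psG: "set ps \<subseteq> G" using oG by (auto simp: ps_def)
  then have psc: "set ps \<subseteq> carrier L \<times> carrier L"
    using subringE(1)[OF D(1)] unfolding square_ring_simps by blast
  have maps: "map fst ps = zs" "map snd ps = map orb [1..<Suc n]"
    unfolding One_nat_def map_Suc_upt[symmetric] map_map ps_def zs_def by (simp_all only: comp_def fst_conv snd_conv)
  have zsc: "set (map orb [1..<n]) \<subseteq> carrier L" using oc by auto
  have eq: "map fst (plins (square_ring L) ps) = plins L zs" "map snd (plins (square_ring L) ps) = plins L zs"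
    using map_plins_square[OF psc] plins_rotate1[OF zsc y(1)] unfolding maps zs_ne by auto
  have "map fst (plins (square_ring L) ps) = map snd (plins (square_ring L) ps)" unfolding eq ..
  then have diag: "\<forall>p\<in>set (plins (square_ring L) ps). fst p = snd p" by (simp only: map_eq_conv)
  have "set (plins L zs) \<subseteq> ?F"
  proof
    fix c assume "c \<in> set (plins L zs)"
    then obtain p where p: "p \<in> set (plins (square_ring L) ps)" "c = fst p" unfolding eq(1)[symmetric] by auto
    then have "p = (c, c)" using diag by (metis prod.collapse)
    then show "c \<in> ?F" using p(1) P.set_plins[OF D(1) psG] by blast
  qed
  moreover have zsc': "set zs \<subseteq> carrier L" using zsc y(1) unfolding zs_ne by simp
  have "ev L (plins L zs) y = \<zero>"
    by (rule iffD2[OF ev_plins_eq_zero_iff[OF zsc' y(1)]]) (simp add: zs_ne(1))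
  ultimately have "ev L (plins L zs) y' = \<zero>" using conj unfolding conjugate_def by blast
  then have "y' \<in> set zs" using ev_plins_eq_zero_iff[OF zsc' y'c] by blast
  then show "v y = v y'" unfolding zs_def using ov by auto
qed

end

section \<open>Density of the algebraic closures\<close>

lemma gauss_val_zero_cases: "gauss_val v 0 cs = Pinf \<or> gauss_val v 0 cs \<in> v ` set cs"
proof (induction cs)
  case (Cons c cs)
  have "Fin 0 + gauss_val v 0 cs = gauss_val v 0 cs" by (cases "gauss_val v 0 cs") auto
  then show ?case using Cons by (auto simp: min_def)
qed simp

locale dense_extension = valued_closed L v
  for L :: "('a, 'b) ring_scheme" (structure) and v :: "'a \<Rightarrow> 'g::linordered_ab_group_add extended" +
  fixes K Kh :: "'a set"
  assumes K: "subfield K L" and Kh: "subfield Kh L" and K_Kh: "K \<subseteq> Kh" and dense: "dense_in L v K Kh"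
begin

abbreviation "\<Gamma> \<equiv> value_group L v K"
abbreviation "A \<equiv> algebraic_closure_in L K"
abbreviation "B \<equiv> algebraic_closure_in L Kh"

text \<open>In \<open>L\<close>, values beyond all of \<open>\<Gamma>\<close> are possible, while
  elements of \<open>K\<close> approximate only up to bounds in \<open>\<Gamma>\<close>. Every
  precision requested from \<open>K\<close> must therefore be bounded in this sense.\<close>

definition bounded :: "'g \<Rightarrow> bool" where
  "bounded \<gamma> \<longleftrightarrow> (\<exists>\<delta>\<in>\<Gamma>. \<gamma> \<le> \<delta>)"

lemma Kh_carrier: "Kh \<subseteq> carrier L" and K_carrier: "K \<subseteq> carrier L"
  using subfieldE(3) K Kh by auto

lemma A: "subfield A L" and B: "subfield B L"
  using subfield_algebraic_closure_in K Kh by auto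

lemma A_B: "A \<subseteq> B" and Kh_B: "Kh \<subseteq> B" and K_A: "K \<subseteq> A"
  using algebraic_closure_in_mono[OF K_Kh] algebraic_closure_in_incl K Kh by auto

lemma B_carrier: "B \<subseteq> carrier L" using subfieldE(3)[OF B] .

lemma Gamma_zero: "0 \<in> \<Gamma>"
  unfolding value_group_def using subringE(3)[OF subfieldE(1)[OF K]] by (auto intro!: bexI[of _ \<one>])

lemma Gamma_add: assumes "\<gamma> \<in> \<Gamma>" "\<delta> \<in> \<Gamma>" shows "\<gamma> + \<delta> \<in> \<Gamma>"
proof -
  obtain a b where ab: "a \<in> K" "a \<noteq> \<zero>" "v a = Fin \<gamma>" "b \<in> K" "b \<noteq> \<zero>" "v b = Fin \<delta>"
    using assms unfolding value_group_def by blast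
  then have "a \<in> carrier L" "b \<in> carrier L" using K_carrier by auto
  then have "a \<otimes> b \<noteq> \<zero>" "v (a \<otimes> b) = Fin (\<gamma> + \<delta>)" using ab by (auto simp: integral_iff v_mult)
  then show ?thesis
    unfolding value_group_def using subringE(6)[OF subfieldE(1)[OF K] ab(1,4)] by blast
qed

lemma Gamma_minus: assumes "\<gamma> \<in> \<Gamma>" shows "- \<gamma> \<in> \<Gamma>"
proof -
  obtain a where a: "a \<in> K" "a \<noteq> \<zero>" "v a = Fin \<gamma>" using assms unfolding value_group_def by blast
  then have "a \<in> carrier L" using K_carrier by auto
  then have i: "v (inv a) = Fin (- \<gamma>)" using v_inv a by blast
  then have "inv a \<noteq> \<zero>" using v_zero by auto
  then show ?thesis unfolding value_group_def using subfield_m_inv(1)[OF K, of a] a i by blast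
qed

text \<open>An approximation of \<open>c\<close> in \<open>K\<close> that is closer than
  \<open>v c\<close> has the same value as \<open>c\<close>.\<close>

lemma value_Kh:
  assumes "c \<in> Kh" "c \<noteq> \<zero>" "v c = Fin \<gamma>" shows "\<gamma> \<in> \<Gamma>"
proof -
  have "\<gamma> \<in> value_group L v Kh" using assms unfolding value_group_def by blast
  then obtain k where k: "k \<in> K" "Fin \<gamma> < v (c \<ominus> k)" using dense assms unfolding dense_in_def by blast
  have c: "c \<in> carrier L" "k \<in> carrier L" using assms(1) k(1) Kh_carrier K_carrier by auto
  then have "v k = Fin \<gamma>" using v_eq_of_diff[of c k] k assms(3) by simp
  moreover have "k \<noteq> \<zero>" using \<open>v k = Fin \<gamma>\<close> v_zero by auto
  ultimately show ?thesis unfolding value_group_def using k by blast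
qed

lemma bounded_mono: "bounded \<delta> \<Longrightarrow> \<gamma> \<le> \<delta> \<Longrightarrow> bounded \<gamma>"
  unfolding bounded_def using order_trans by blast

lemma bounded_Gamma: "\<gamma> \<in> \<Gamma> \<Longrightarrow> bounded \<gamma>"
  unfolding bounded_def by blast

lemma bounded_add: "bounded \<gamma> \<Longrightarrow> bounded \<delta> \<Longrightarrow> bounded (\<gamma> + \<delta>)"
  unfolding bounded_def using Gamma_add add_mono by blast

lemma bounded_max: "bounded \<gamma> \<Longrightarrow> bounded \<delta> \<Longrightarrow> bounded (max \<gamma> \<delta>)"
  by (simp add: max_def)

lemma bounded_sum: "bounded \<gamma> \<Longrightarrow> bounded (\<Sum>k<(n::nat). \<gamma>)"
  by (induction n) (auto intro: bounded_add bounded_Gamma Gamma_zero)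

text \<open>Split the minimal polynomial of \<open>c\<close> as \<open>c0 + T r\<close>. Then
  \<open>c0 = - c r(c)\<close> with \<open>r(c)\<close> nonzero by minimality. For positive
  \<open>\<gamma>\<close> the value of \<open>r(c)\<close> is at least the least value
  \<open>\<mu>\<close> of a coefficient of \<open>r\<close>, so \<open>\<gamma>\<close> is at most
  \<open>v c0 - \<mu>\<close>, a difference of values of \<open>K\<close>.\<close>

lemma bounded_value:
  assumes "c \<in> B" "v c = Fin \<gamma>" shows "bounded \<gamma>"
proof (cases "\<gamma> \<le> 0")
  case True
  then show ?thesis using bounded_mono bounded_Gamma Gamma_zero by blast
next
  case False
  have c: "c \<in> carrier L" "c \<noteq> \<zero>" using assms B_carrier v_zero by auto
  obtain p where p: "set p \<subseteq> Kh" "ev L (p @ [\<one>]) c = \<zero>"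
    using assms(1) algebraic_iff_monic[OF Kh c(1)] by (auto simp: mem_algebraic_closure_in)
  have one: "\<one> \<in> Kh" using subringE(3)[OF subfieldE(1)[OF Kh]] .
  obtain m where min: "minimal_poly L Kh c m"
    using minimal_poly_exists[OF Kh c(1) _ monic_nonzero p(2)] p(1) one by auto
  then have m: "set (m @ [\<one>]) \<subseteq> Kh" "ev L (m @ [\<one>]) c = \<zero>" using one by (auto simp: minimal_poly_def)
  then obtain c0 r where r: "m = c0 # r" using c by (cases m) auto
  let ?e = "ev L (r @ [\<one>]) c"
  have rK: "set (r @ [\<one>]) \<subseteq> Kh" "c0 \<in> Kh" using m(1) r by auto
  have rc: "set (r @ [\<one>]) \<subseteq> carrier L" "c0 \<in> carrier L" using rK Kh_carrier by blast+
  have e: "?e \<in> carrier L" using ev_closed[OF rc(1) c(1)] .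
  have sum: "c0 \<oplus> c \<otimes> ?e = \<zero>" using m(2) r by simp
  have "?e \<noteq> \<zero>"
  proof
    assume "?e = \<zero>"
    moreover have "length (r @ [\<one>]) \<le> length m" using r by simp
    ultimately have "set (r @ [\<one>]) \<subseteq> {\<zero>}" using min rK(1) unfolding minimal_poly_def by blast
    then show False by simp
  qed
  then obtain \<epsilon> where \<epsilon>: "v ?e = Fin \<epsilon>" using v_nonzero[OF e] by blast
  have "c0 = \<ominus> (c \<otimes> ?e)" using sum rc(2) c(1) e by (simp add: sum_zero_eq_neg)
  then have v0: "v c0 = Fin (\<gamma> + \<epsilon>)" using v_mult[OF c(1) e] assms(2) \<epsilon> c(1) e by simp
  have le: "gauss_val v 0 (r @ [\<one>]) \<le> Fin \<epsilon>"
    using v_ev_ge[OF rc(1) c(1), of 0] False assms(2) \<epsilon> by simp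
  then have "gauss_val v 0 (r @ [\<one>]) \<in> v ` set (r @ [\<one>])"
    using gauss_val_zero_cases[of v "r @ [\<one>]"] by auto
  then obtain d where d: "d \<in> Kh" "gauss_val v 0 (r @ [\<one>]) = v d" using rK(1) by blast
  have dc: "d \<in> carrier L" using d Kh_carrier by blast
  then obtain \<mu> where \<mu>: "v d = Fin \<mu>" using le v_cases[of d] d(2) by auto
  have "d \<noteq> \<zero>" "c0 \<noteq> \<zero>" using \<mu> v0 v_zero by auto
  then have "\<mu> \<in> \<Gamma>" "\<gamma> + \<epsilon> \<in> \<Gamma>" using value_Kh[OF d(1) _ \<mu>] value_Kh[OF rK(2) _ v0] by blast+
  then have "\<gamma> + \<epsilon> + - \<mu> \<in> \<Gamma>" using Gamma_add Gamma_minus by blast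
  moreover have "\<gamma> \<le> \<gamma> + \<epsilon> + - \<mu>" using le d(2) \<mu> by (simp add: algebra_simps)
  ultimately show ?thesis unfolding bounded_def by blast
qed

lemma bounded_minus_value:
  assumes "c \<in> B" "v c = Fin \<gamma>" shows "bounded (- \<gamma>)"
proof -
  have c: "c \<in> carrier L" "c \<noteq> \<zero>" using assms B_carrier v_zero by auto
  have "v (inv c) = Fin (- \<gamma>)" using v_inv[OF c assms(2)] .
  moreover have "inv c \<in> B" using subfield_m_inv(1)[OF B, of c] assms(1) c by blast
  ultimately show ?thesis using bounded_value by blast
qed

lemma value_lower_bound:
  assumes "s \<in> B" shows "\<exists>\<mu>. bounded \<mu> \<and> 0 \<le> \<mu> \<and> Fin (- \<mu>) \<le> v s"
proof (cases "s = \<zero>")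
  case True
  then show ?thesis using v_zero bounded_Gamma[OF Gamma_zero] by (intro exI[of _ 0]) auto
next
  case False
  then obtain \<gamma> where \<gamma>: "v s = Fin \<gamma>" using v_nonzero assms B_carrier by blast
  have "- max 0 (- \<gamma>) \<le> \<gamma>" using minus_le_iff[of "max 0 (- \<gamma>)" \<gamma>] by simp
  then show ?thesis using \<gamma> bounded_max[OF bounded_Gamma[OF Gamma_zero] bounded_minus_value[OF assms \<gamma>]]
    by (intro exI[of _ "max 0 (- \<gamma>)"]) auto
qed

lemma eq_zero_of_unbounded:
  assumes "c \<in> B" "\<And>\<gamma>. \<gamma> \<in> \<Gamma> \<Longrightarrow> Fin \<gamma> < v c" shows "c = \<zero>"
proof (rule ccontr)
  assume "c \<noteq> \<zero>"
  then obtain \<gamma> where "v c = Fin \<gamma>" using v_nonzero assms(1) B_carrier by blast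
  moreover from this obtain \<delta> where "\<delta> \<in> \<Gamma>" "\<gamma> \<le> \<delta>" using bounded_value[OF assms(1)] unfolding bounded_def by blast
  ultimately show False using assms(2)[of \<delta>] by auto
qed

lemma approximate_Kh:
  assumes "c \<in> Kh" "bounded \<gamma>" shows "\<exists>k\<in>K. Fin \<gamma> < v (c \<ominus> k)"
proof -
  obtain \<delta> where \<delta>: "\<delta> \<in> \<Gamma>" "\<gamma> \<le> \<delta>" using assms(2) unfolding bounded_def by blast
  have "\<delta> \<in> value_group L v Kh" using \<delta>(1) K_Kh unfolding value_group_def by blast
  then obtain k where "k \<in> K" "Fin \<delta> < v (c \<ominus> k)" using dense assms(1) unfolding dense_in_def by blast
  moreover have "Fin \<gamma> \<le> Fin \<delta>" using \<delta>(2) by simp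
  ultimately show ?thesis using le_less_trans by blast
qed

text \<open>The coefficient of degree \<open>i\<close> needs a correction of value above
  \<open>\<gamma> - i \<gamma>0\<close>; accordingly the induction passes the bound
  \<open>\<gamma> - \<gamma>0\<close> to the tail.\<close>

lemma approximate_poly:
  assumes "set f \<subseteq> Kh" "bounded \<gamma>" "bounded (- \<gamma>0)"
  shows "\<exists>d. length d = length f \<and> set d \<subseteq> Kh \<and> Fin \<gamma> < gauss_val v \<gamma>0 d \<and> set (padd L f d) \<subseteq> K"
  using assms(1,2)
proof (induction f arbitrary: \<gamma>)
  case (Cons c f)
  have "bounded (\<gamma> + - \<gamma>0)" using bounded_add[OF Cons.prems(2) assms(3)] .
  then obtain d where d: "length d = length f" "set d \<subseteq> Kh" "Fin (\<gamma> + - \<gamma>0) < gauss_val v \<gamma>0 d"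
    "set (padd L f d) \<subseteq> K" using Cons.IH[of "\<gamma> + - \<gamma>0"] Cons.prems by auto
  obtain k where k: "k \<in> K" "Fin \<gamma> < v (c \<ominus> k)" using approximate_Kh[of c] Cons.prems by auto
  have c: "c \<in> Kh" "c \<in> carrier L" "k \<in> carrier L" "k \<in> Kh" using Cons.prems k K_Kh Kh_carrier by auto
  have "k \<ominus> c \<in> Kh" using subringE(5,7)[OF subfieldE(1)[OF Kh]] c by (simp add: a_minus_def)
  moreover have "c \<oplus> (k \<ominus> c) = k" using c by algebra
  moreover have "Fin \<gamma> < v (k \<ominus> c)" using k v_diff_commute c by simp
  moreover have "Fin \<gamma> < Fin \<gamma>0 + gauss_val v \<gamma>0 d"
    using d(3) Fin_add_less[of "Fin (\<gamma> + - \<gamma>0)" "gauss_val v \<gamma>0 d" \<gamma>0] by simp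
  ultimately show ?case using d k by (intro exI[of _ "(k \<ominus> c) # d"]) auto
qed simp

lemma v_ev_plins_le:
  assumes "set zs \<subseteq> carrier L" "a \<in> carrier L" "\<And>z. z \<in> set zs \<Longrightarrow> v (a \<ominus> z) \<le> Fin \<gamma>"
  shows "v (ev L (plins L zs) a) \<le> Fin (\<Sum>k<length zs. \<gamma>)"
  using assms(1,3)
proof (induction zs)
  case (Cons z zs)
  have c: "set (plins L zs) \<subseteq> carrier L" "z \<in> carrier L"
    using set_plins[OF carrier_is_subring] Cons.prems by auto
  have "v (ev L (plins L (z # zs)) a) = v (a \<ominus> z) + v (ev L (plins L zs) a)"
    using c assms(2) by (simp add: ev_plin v_mult)
  also have "\<dots> \<le> Fin \<gamma> + Fin (\<Sum>k<length zs. \<gamma>)" using Cons by (intro add_mono) auto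
  finally show ?case by (simp add: add.commute)
qed (use assms(2) in simp)

lemma padd_snoc:
  assumes "length d = length m" "set m \<subseteq> carrier L"
  shows "padd L (m @ [c]) d = padd L m d @ [c]"
  using assms
proof (induction m arbitrary: d)
  case (Cons a m)
  then obtain e d' where "d = e # d'" by (cases d) auto
  then show ?case using Cons by simp
qed simp

text \<open>Continuity of roots. The perturbed polynomial takes at \<open>a\<close> the value
  \<open>d(a)\<close>, which is small, and it is also the product of the differences
  \<open>a - z\<close> over its roots. If none of them exceeded \<open>\<gamma>\<close>, the product
  would have value at most \<open>n \<gamma>\<close>. The separate bound \<open>\<delta>\<close>
  lets later arguments control the perturbation itself.\<close>

lemma root_near:
  assumes a: "a \<in> B" "v a = Fin \<gamma>0" and m: "set m \<subseteq> Kh" "ev L (m @ [\<one>]) a = \<zero>"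
    and \<gamma>: "bounded \<gamma>" "bounded \<delta>"
  shows "\<exists>d z. length d = length m \<and> set d \<subseteq> Kh \<and> Fin \<delta> < gauss_val v \<gamma>0 d \<and> set (padd L m d) \<subseteq> K \<and>
    z \<in> carrier L \<and> ev L (padd L m d @ [\<one>]) z = \<zero> \<and> Fin \<gamma> < v (a \<ominus> z)"
proof -
  have ac: "a \<in> carrier L" using a B_carrier by blast
  have mc: "set m \<subseteq> carrier L" using m Kh_carrier by blast
  \<comment> \<open>The sum is \<open>n \<gamma>\<close> for the degree \<open>n\<close>, the bound
    that the product of all \<open>a - z\<close> must beat.\<close>
  define \<mu> where "\<mu> = max \<delta> (\<Sum>k<length m. \<gamma>)"
  have "bounded \<mu>" unfolding \<mu>_def by (intro bounded_max bounded_sum \<gamma>)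
  then obtain d where d: "length d = length m" "set d \<subseteq> Kh" "Fin \<mu> < gauss_val v \<gamma>0 d" "set (padd L m d) \<subseteq> K"
    using approximate_poly[OF m(1) _ bounded_minus_value[OF a]] by blast
  have dc: "set d \<subseteq> carrier L" using d Kh_carrier by blast
  have pc: "set (padd L m d) \<subseteq> carrier L" using d(4) K_carrier by blast
  obtain zs where zs: "set zs \<subseteq> carrier L" "padd L m d @ [\<one>] = plins L zs" "length zs = length m"
    using monic_splits[OF pc] d(1) by (auto simp: length_padd)
  have "ev L (padd L m d @ [\<one>]) a = ev L d a"
    using ev_padd[of "m @ [\<one>]" d a] m(2) mc dc ac by (simp add: padd_snoc[OF d(1) mc])
  moreover have "gauss_val v \<gamma>0 d \<le> v (ev L d a)" using v_ev_ge[OF dc ac] a(2) by simp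
  ultimately have big: "Fin \<mu> < v (ev L (plins L zs) a)" using d(3) zs(2) by simp
  have "\<exists>z\<in>set zs. Fin \<gamma> < v (a \<ominus> z)"
  proof (rule ccontr)
    assume "\<not> ?thesis"
    then have "v (ev L (plins L zs) a) \<le> Fin (\<Sum>k<length zs. \<gamma>)"
      by (intro v_ev_plins_le zs ac) (auto simp: not_less)
    also have "\<dots> \<le> Fin \<mu>" unfolding \<mu>_def zs(3) by simp
    finally show False using big by simp
  qed
  then obtain z where z: "z \<in> set zs" "Fin \<gamma> < v (a \<ominus> z)" by blast
  then have "z \<in> carrier L" using zs(1) by blast
  then have "ev L (padd L m d @ [\<one>]) z = \<zero>" unfolding zs(2) using z zs(1) by (simp add: ev_plins_eq_zero_iff)
  moreover have "Fin \<delta> \<le> Fin \<mu>" unfolding \<mu>_def by simp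
  then have "Fin \<delta> < gauss_val v \<gamma>0 d" using d(3) by (rule le_less_trans)
  ultimately show ?thesis using d z zs(1) by (intro exI[of _ d] exI[of _ z]) auto
qed

lemma A_dense:
  assumes a: "a \<in> B" and \<gamma>: "bounded \<gamma>"
  shows "\<exists>b\<in>A. Fin \<gamma> < v (a \<ominus> b)"
proof (cases "a = \<zero>")
  case True
  then show ?thesis using subringE(2)[OF subfieldE(1)[OF A]] v_zero
    by (intro bexI[of _ \<zero>]) (auto simp: a_minus_def)
next
  case False
  have ac: "a \<in> carrier L" using a B_carrier by blast
  obtain \<gamma>0 where v: "v a = Fin \<gamma>0" using v_nonzero[OF ac False] by blast
  obtain m where m: "set m \<subseteq> Kh" "ev L (m @ [\<one>]) a = \<zero>"
    using a algebraic_iff_monic[OF Kh ac] by (auto simp: mem_algebraic_closure_in)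
  obtain d z where z: "set (padd L m d) \<subseteq> K" "z \<in> carrier L" "ev L (padd L m d @ [\<one>]) z = \<zero>" "Fin \<gamma> < v (a \<ominus> z)"
    using root_near[OF a v m \<gamma> \<gamma>] by blast
  then have "z \<in> A" using algebraic_iff_monic[OF K z(2)] unfolding mem_algebraic_closure_in by blast
  then show ?thesis using z(4) by blast
qed

end

section \<open>Comparing the implicit constant fields\<close>

lemma mem_henselization:
  "y \<in> henselization L v F \<longleftrightarrow>
     (\<forall>E. F \<subseteq> E \<and> E \<subseteq> algebraic_closure_in L F \<and> henselian L v E \<longrightarrow> y \<in> E)"
  unfolding henselization_def by blast

lemma (in valued_field) v_add_gt:
  assumes "a \<in> carrier L" "b \<in> carrier L" "\<gamma> < v a" "\<gamma> < v b"
  shows "\<gamma> < v (a \<oplus> b)"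
proof -
  have "\<gamma> < min (v a) (v b)" using assms(3,4) by simp
  then show ?thesis using v_add[OF assms(1,2)] by (rule less_le_trans)
qed

lemma (in field) adjoin_subfield:
  assumes "subfield F R" "y \<in> carrier R"
  shows "subfield (adjoin R F y) R" "F \<subseteq> adjoin R F y" "y \<in> adjoin R F y"
    "\<And>E. subfield E R \<Longrightarrow> F \<subseteq> E \<Longrightarrow> y \<in> E \<Longrightarrow> adjoin R F y \<subseteq> E"
  using assms subfieldE(3)[OF assms(1)] generate_field_is_subfield[of "insert y F"]
    generate_field.incl[of _ "insert y F" R] generate_field_min_subfield1[of "insert y F"]
  unfolding adjoin_def by auto

locale completed_extension = dense_extension L v K Kh
  for L :: "('a, 'b) ring_scheme" (structure) and v :: "'a \<Rightarrow> 'g::linordered_ab_group_add extended"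
    and K Kh +
  fixes x :: 'a
  assumes x: "x \<in> carrier L" and x_transcendental: "(transcendental over Kh) x"
    and algebraic_x: "\<And>y. y \<in> carrier L \<Longrightarrow> (algebraic over (adjoin L Kh x)) y"
begin

abbreviation "Kx \<equiv> adjoin L K x"
abbreviation "Khx \<equiv> adjoin L Kh x"

lemmas Kx = adjoin_subfield[OF K x] and Khx = adjoin_subfield[OF Kh x]

lemma Kx_Khx: "Kx \<subseteq> Khx"
  using Kx(4)[OF Khx(1)] Khx(2,3) K_Kh by blast

lemma algebraic_closure_Khx: "algebraic_closure_in L Khx = carrier L"
  using algebraic_x unfolding algebraic_closure_in_def by blast

lemma IC_mono: "IC L v K x \<subseteq> IC L v Kh x"
proof
  fix b assume "b \<in> IC L v K x"
  then have b: "b \<in> A" "b \<in> henselization L v Kx" unfolding IC_def by auto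
  have "b \<in> E" if E: "Khx \<subseteq> E" "henselian L v E" for E
  proof -
    let ?E = "E \<inter> algebraic_closure_in L Kx"
    have "Kx \<subseteq> E" using Kx_Khx E(1) by blast
    then have "henselian L v ?E" "Kx \<subseteq> ?E"
      using henselian_relative_closure[OF E(2) Kx(1)] algebraic_closure_in_incl[OF Kx(1)] by auto
    then have "b \<in> ?E" using b(2)[unfolded mem_henselization, rule_format, of ?E] by simp
    then show ?thesis by simp
  qed
  then have "b \<in> henselization L v Khx" unfolding mem_henselization by simp
  then show "b \<in> IC L v Kh x" using b(1) A_B unfolding IC_def by auto
qed

lemma isograph_preserves_roots:
  assumes "isograph L w G" "valued_field L w" "subfield F L" "Id_on F \<subseteq> G" "(a, b) \<in> G"
    "a \<in> algebraic_closure_in L F"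
  shows "b \<in> algebraic_closure_in L F"
proof -
  interpret W: valued_field L w by fact
  interpret P: cring "square_ring L" by (rule square_cring)
  have a: "a \<in> carrier L" "b \<in> carrier L" using W.isographD(3,4)[OF assms(1,5)] by auto
  obtain m where m: "set m \<subseteq> F" "ev L (m @ [\<one>]) a = \<zero>"
    using algebraic_iff_monic[OF assms(3) a(1)] assms(6) unfolding mem_algebraic_closure_in by blast
  let ?mm = "map (\<lambda>a. (a, a)) (m @ [\<one>])"
  have "\<one> \<in> F" using subringE(3)[OF subfieldE(1)[OF assms(3)]] .
  then have "set ?mm \<subseteq> G" using m(1) assms(4) by auto
  then have "ev (square_ring L) ?mm (a, b) \<in> G" using P.ev_mem_subring[OF W.isographD(1)[OF assms(1)]] assms(5) by blast
  then have "(ev L (m @ [\<one>]) a, ev L (m @ [\<one>]) b) \<in> G" unfolding ev_square by (simp add: comp_def)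
  from W.isograph_zero_iff[OF assms(1) this] have "ev L (m @ [\<one>]) b = \<zero>" using m(2) by blast
  then show ?thesis using algebraic_iff_monic[OF assms(3) a(2)] a(2) m(1) unfolding mem_algebraic_closure_in by blast
qed

text \<open>An isometry of \<open>A\<close> extends by continuity.\<close>

definition graph_closure :: "('a \<times> 'a) set \<Rightarrow> ('a \<times> 'a) set" where
  "graph_closure G = {(s, t). s \<in> B \<and> t \<in> B \<and>
     (\<forall>\<gamma>\<in>\<Gamma>. \<exists>(p, q)\<in>G. Fin \<gamma> < v (s \<ominus> p) \<and> Fin \<gamma> < v (t \<ominus> q))}"

text \<open>Ring operations and values pass to limits of pairs. Since \<open>\<Gamma>\<close> bounds
  the values of \<open>B\<close>, a pair can be approximated beyond its own value, and then the
  approximating pair has the same values.\<close>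

lemma isograph_closure:
  assumes G: "isograph L v G" "G \<subseteq> B \<times> B"
  shows "isograph L v (graph_closure G)" "G \<subseteq> graph_closure G"
proof -
  interpret P: cring "square_ring L" by (rule square_cring)
  note D = isographD[OF G(1)] and ops = isograph_ops[OF G(1)]
  note S = subringE[OF subfieldE(1)[OF B]]
  have Gone: "(\<one>, \<one>) \<in> G" using subringE(3)[OF D(1)] by (simp add: square_ring_simps)
  let ?C = "graph_closure G"
  have CI: "(s, t) \<in> ?C" if "s \<in> B" "t \<in> B"
    "\<And>\<gamma>. \<gamma> \<in> \<Gamma> \<Longrightarrow> \<exists>p q. (p, q) \<in> G \<and> Fin \<gamma> < v (s \<ominus> p) \<and> Fin \<gamma> < v (t \<ominus> q)" for s t
    using that unfolding graph_closure_def by fast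
  have CD: "\<exists>p q. (p, q) \<in> G \<and> Fin \<gamma> < v (s \<ominus> p) \<and> Fin \<gamma> < v (t \<ominus> q)"
    if st: "(s, t) \<in> ?C" and b: "bounded \<gamma>" for s t \<gamma>
  proof -
    obtain \<delta> where d: "\<delta> \<in> \<Gamma>" "Fin \<gamma> \<le> Fin \<delta>" using b unfolding bounded_def by auto
    then obtain p q where "(p, q) \<in> G" "Fin \<delta> < v (s \<ominus> p)" "Fin \<delta> < v (t \<ominus> q)"
      using st unfolding graph_closure_def by fast
    then show ?thesis using d(2) le_less_trans by blast
  qed
  have CB: "s \<in> B" "t \<in> B" "s \<in> carrier L" "t \<in> carrier L" if "(s, t) \<in> ?C" for s t
    using that B_carrier unfolding graph_closure_def by auto
  show sub: "G \<subseteq> ?C"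
  proof clarify
    fix p q assume pq: "(p, q) \<in> G"
    have c: "p \<in> carrier L" "q \<in> carrier L" "p \<in> B" "q \<in> B" using pq G(2) B_carrier by auto
    then have "v (p \<ominus> p) = Pinf" "v (q \<ominus> q) = Pinf" using v_zero by (simp_all add: a_minus_def r_neg)
    then have "(p, q) \<in> G \<and> Fin \<gamma> < v (p \<ominus> p) \<and> Fin \<gamma> < v (q \<ominus> q)" for \<gamma> using pq by simp
    then show "(p, q) \<in> ?C" using CI[OF c(3,4)] by blast
  qed
  \<comment> \<open>From \<open>s s' - p p' = s (s' - p') + p' (s - p)\<close>: factors of value at
    least \<open>- \<mu>\<close> cost \<open>\<mu>\<close> in precision. Taking the maximum with 0
    ensures that \<open>p'\<close> also has value at least \<open>- \<mu>\<close>.\<close>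
  have prod: "Fin \<gamma> < v (s \<otimes> s' \<ominus> p \<otimes> p')"
    if c: "s \<in> carrier L" "s' \<in> carrier L" "p \<in> carrier L" "p' \<in> carrier L"
      and m: "0 \<le> \<mu>" "Fin (- \<mu>) \<le> v s" "Fin (- \<mu>) \<le> v s'"
      and d: "Fin (max (\<gamma> + \<mu>) 0) < v (s \<ominus> p)" "Fin (max (\<gamma> + \<mu>) 0) < v (s' \<ominus> p')"
    for s s' p p' \<gamma> \<mu>
  proof -
    have le: "Fin (\<gamma> + \<mu>) \<le> Fin (max (\<gamma> + \<mu>) 0)" "Fin (- \<mu>) \<le> Fin (max (\<gamma> + \<mu>) 0)"
      using m(1) by (auto simp: le_max_iff_disj)
    have p': "Fin (- \<mu>) \<le> v p'"
    proof -
      have "p' = s' \<ominus> (s' \<ominus> p')" using c by algebra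
      then have "min (v s') (v (s' \<ominus> p')) \<le> v p'" using v_diff[of s' "s' \<ominus> p'"] c by simp
      moreover have "Fin (- \<mu>) \<le> min (v s') (v (s' \<ominus> p'))" using m(3) less_imp_le[OF le_less_trans[OF le(2) d(2)]] by simp
      ultimately show ?thesis by (rule order_trans[rotated])
    qed
    have aux: "Fin \<gamma> < v (a \<otimes> b)" if ab: "a \<in> carrier L" "b \<in> carrier L" "Fin (- \<mu>) \<le> v a" "Fin (\<gamma> + \<mu>) < v b" for a b
    proof -
      have "Fin (\<gamma> + \<mu>) + Fin (- \<mu>) < v b + v a" using ab by (intro add_less_mono_extended) auto
      then show ?thesis using v_mult[OF ab(1,2)] by (simp add: add.commute)
    qed
    have eq: "s \<otimes> s' \<ominus> p \<otimes> p' = s \<otimes> (s' \<ominus> p') \<oplus> p' \<otimes> (s \<ominus> p)" using c by algebra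
    have 1: "Fin \<gamma> < v (s \<otimes> (s' \<ominus> p'))"
      by (rule aux[OF c(1) _ m(2) le_less_trans[OF le(1) d(2)]]) (simp add: c)
    have 2: "Fin \<gamma> < v (p' \<otimes> (s \<ominus> p))"
      by (rule aux[OF c(4) _ p' le_less_trans[OF le(1) d(1)]]) (simp add: c)
    show ?thesis unfolding eq by (rule v_add_gt[OF _ _ 1 2]) (simp_all add: c)
  qed
  show "isograph L v ?C"
    unfolding isograph_def
  proof
    show "subring ?C (square_ring L)"
    proof (rule P.subringI)
      show "?C \<subseteq> carrier (square_ring L)" using CB by (auto simp: square_ring_simps)
      show "\<one>\<^bsub>square_ring L\<^esub> \<in> ?C" using Gone sub by (auto simp: square_ring_simps)
    next
      fix st assume "st \<in> ?C"
      then obtain s t where st: "st = (s, t)" "(s, t) \<in> ?C" by (cases st) auto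
      note c = CB[OF st(2)]
      have "(\<ominus> s, \<ominus> t) \<in> ?C"
      proof (rule CI)
        fix \<gamma> assume "\<gamma> \<in> \<Gamma>"
        then obtain p q where pq: "(p, q) \<in> G" "Fin \<gamma> < v (s \<ominus> p)" "Fin \<gamma> < v (t \<ominus> q)"
          using CD[OF st(2) bounded_Gamma] by blast
        have "v (\<ominus> a \<ominus> \<ominus> b) = v (a \<ominus> b)" if "a \<in> carrier L" "b \<in> carrier L" for a b
        proof -
          have "\<ominus> a \<ominus> \<ominus> b = \<ominus> (a \<ominus> b)" using that by algebra
          then show ?thesis using that by simp
        qed
        then have "(\<ominus> p, \<ominus> q) \<in> G \<and> Fin \<gamma> < v (\<ominus> s \<ominus> \<ominus> p) \<and> Fin \<gamma> < v (\<ominus> t \<ominus> \<ominus> q)"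
          using pq ops(3)[OF pq(1,1)] D(3,4)[OF pq(1)] c by simp
        then show "\<exists>p q. (p, q) \<in> G \<and> Fin \<gamma> < v (\<ominus> s \<ominus> p) \<and> Fin \<gamma> < v (\<ominus> t \<ominus> q)" by blast
      qed (use S(5) c in auto)
      then show "\<ominus>\<^bsub>square_ring L\<^esub> st \<in> ?C" using st c by (simp add: square_minus)
    next
      fix st st' assume "st \<in> ?C" "st' \<in> ?C"
      then obtain s t s' t' where st: "st = (s, t)" "(s, t) \<in> ?C" and st': "st' = (s', t')" "(s', t') \<in> ?C"
        by (cases st; cases st') auto
      note c = CB[OF st(2)] and c' = CB[OF st'(2)]
      have "(s \<oplus> s', t \<oplus> t') \<in> ?C"
      proof (rule CI)
        fix \<gamma> assume "\<gamma> \<in> \<Gamma>"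
        then obtain p q p' q' where pq: "(p, q) \<in> G" "Fin \<gamma> < v (s \<ominus> p)" "Fin \<gamma> < v (t \<ominus> q)"
          and pq': "(p', q') \<in> G" "Fin \<gamma> < v (s' \<ominus> p')" "Fin \<gamma> < v (t' \<ominus> q')"
          using CD[OF st(2) bounded_Gamma] CD[OF st'(2) bounded_Gamma] by blast
        have "Fin \<gamma> < v (a \<oplus> a' \<ominus> (b \<oplus> b'))" if "a \<in> carrier L" "b \<in> carrier L" "a' \<in> carrier L" "b' \<in> carrier L"
          "Fin \<gamma> < v (a \<ominus> b)" "Fin \<gamma> < v (a' \<ominus> b')" for a b a' b'
        proof -
          have "a \<oplus> a' \<ominus> (b \<oplus> b') = (a \<ominus> b) \<oplus> (a' \<ominus> b')" using that(1-4) by algebra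
          then show ?thesis using v_add_gt[OF _ _ that(5,6)] that(1-4) by simp
        qed
        then show "\<exists>p q. (p, q) \<in> G \<and> Fin \<gamma> < v (s \<oplus> s' \<ominus> p) \<and> Fin \<gamma> < v (t \<oplus> t' \<ominus> q)"
          using ops(1)[OF pq(1) pq'(1)] pq pq' D(3,4)[OF pq(1)] D(3,4)[OF pq'(1)] c c' by blast
      qed (use S(7) c c' in auto)
      then show "st \<oplus>\<^bsub>square_ring L\<^esub> st' \<in> ?C" using st st' by (simp add: square_ring_simps)
      have "(s \<otimes> s', t \<otimes> t') \<in> ?C"
      proof (rule CI)
        fix \<gamma> assume \<gamma>: "\<gamma> \<in> \<Gamma>"
        obtain \<mu>1 \<mu>2 \<mu>3 \<mu>4 where \<mu>s: "bounded \<mu>1" "0 \<le> \<mu>1" "Fin (- \<mu>1) \<le> v s" "bounded \<mu>2" "Fin (- \<mu>2) \<le> v s'"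
          "bounded \<mu>3" "Fin (- \<mu>3) \<le> v t" "bounded \<mu>4" "Fin (- \<mu>4) \<le> v t'"
          using value_lower_bound c c' by metis
        \<comment> \<open>One bound for all four factors, so that the same approximating pairs serve
          both coordinates.\<close>
        define \<mu> where "\<mu> = max (max \<mu>1 \<mu>2) (max \<mu>3 \<mu>4)"
        have \<mu>: "bounded \<mu>" "0 \<le> \<mu>" unfolding \<mu>_def using \<mu>s bounded_max by (auto simp: le_max_iff_disj)
        have "Fin (- \<mu>) \<le> Fin (- \<mu>1)" "Fin (- \<mu>) \<le> Fin (- \<mu>2)" "Fin (- \<mu>) \<le> Fin (- \<mu>3)" "Fin (- \<mu>) \<le> Fin (- \<mu>4)"
          unfolding \<mu>_def by (auto simp: le_max_iff_disj)
        then have low: "Fin (- \<mu>) \<le> v s" "Fin (- \<mu>) \<le> v s'" "Fin (- \<mu>) \<le> v t" "Fin (- \<mu>) \<le> v t'"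
          using \<mu>s order_trans by blast+
        have b: "bounded (max (\<gamma> + \<mu>) 0)"
          using bounded_max bounded_add bounded_Gamma[OF \<gamma>] bounded_Gamma[OF Gamma_zero] \<mu> by blast
        obtain p q p' q' where pq: "(p, q) \<in> G" "Fin (max (\<gamma> + \<mu>) 0) < v (s \<ominus> p)" "Fin (max (\<gamma> + \<mu>) 0) < v (t \<ominus> q)"
          and pq': "(p', q') \<in> G" "Fin (max (\<gamma> + \<mu>) 0) < v (s' \<ominus> p')" "Fin (max (\<gamma> + \<mu>) 0) < v (t' \<ominus> q')"
          using CD[OF st(2) b] CD[OF st'(2) b] by blast
        have "Fin \<gamma> < v (s \<otimes> s' \<ominus> p \<otimes> p')" "Fin \<gamma> < v (t \<otimes> t' \<ominus> q \<otimes> q')"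
          using prod[OF c(3) c'(3) D(3)[OF pq(1)] D(3)[OF pq'(1)] \<mu>(2) low(1,2) pq(2) pq'(2)]
            prod[OF c(4) c'(4) D(4)[OF pq(1)] D(4)[OF pq'(1)] \<mu>(2) low(3,4) pq(3) pq'(3)] by auto
        then show "\<exists>p q. (p, q) \<in> G \<and> Fin \<gamma> < v (s \<otimes> s' \<ominus> p) \<and> Fin \<gamma> < v (t \<otimes> t' \<ominus> q)"
          using ops(2)[OF pq(1) pq'(1)] by blast
      qed (use S(6) c c' in auto)
      then show "st \<otimes>\<^bsub>square_ring L\<^esub> st' \<in> ?C" using st st' by (simp add: square_ring_simps)
    qed
    \<comment> \<open>Values are passed along the chain \<open>s\<close>, \<open>p\<close>,
      \<open>q\<close>, \<open>t\<close>, each neighbour being close enough to share the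
      value.\<close>
    have fin: "v t = Fin \<gamma>" if st: "(s, t) \<in> ?C" "v s = Fin \<gamma>" for s t \<gamma>
    proof -
      note c = CB[OF st(1)]
      obtain p q where pq: "(p, q) \<in> G" "Fin \<gamma> < v (s \<ominus> p)" "Fin \<gamma> < v (t \<ominus> q)"
        using CD[OF st(1) bounded_value[OF c(1) st(2)]] by blast
      note d = D(3,4)[OF pq(1)]
      have "v q = Fin \<gamma>" using v_eq_of_diff[of s p] c d pq st(2) D(2)[OF pq(1)] by simp
      then show ?thesis using v_eq_of_diff[of q t] c d pq(3) v_diff_commute[of q t] by simp
    qed
    \<comment> \<open>The mirrored form is needed for \<open>s = 0\<close>: it rules out that
      \<open>t\<close> has a finite value.\<close>
    have fin': "v s = Fin \<gamma>" if st: "(s, t) \<in> ?C" "v t = Fin \<gamma>" for s t \<gamma>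
    proof -
      note c = CB[OF st(1)]
      obtain p q where pq: "(p, q) \<in> G" "Fin \<gamma> < v (s \<ominus> p)" "Fin \<gamma> < v (t \<ominus> q)"
        using CD[OF st(1) bounded_value[OF c(2) st(2)]] by blast
      note d = D(3,4)[OF pq(1)]
      have "v p = Fin \<gamma>" using v_eq_of_diff[of t q] c d pq st(2) D(2)[OF pq(1)] by simp
      then show ?thesis using v_eq_of_diff[of p s] c d pq(2) v_diff_commute[of p s] by simp
    qed
    show "\<forall>(s, t)\<in>?C. v s = v t"
    proof clarify
      fix s t assume st: "(s, t) \<in> ?C"
      show "v s = v t"
      proof (cases "v s")
        case (Fin \<gamma>)
        then show ?thesis using fin[OF st Fin] by simp
      next
        case Pinf
        then show ?thesis using v_cases[OF CB(4)[OF st]] fin'[OF st] by fastforce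
      next
        case Minf
        then show ?thesis using v_not_Minf[OF CB(3)[OF st]] by simp
      qed
    qed
  qed
qed

lemma B_algebraically_closed:
  assumes "y \<in> carrier L" "set m \<subseteq> B" "ev L (m @ [\<one>]) y = \<zero>" shows "y \<in> B"
proof -
  have "y \<in> algebraic_closure_in L B"
    using algebraic_iff_monic[OF B assms(1)] assms unfolding mem_algebraic_closure_in by blast
  then show ?thesis using algebraic_closure_in_idem[OF Kh] by blast
qed

text \<open>Over the algebraically closed field \<open>B\<close>, values of polynomials in \<open>x\<close> are sums of values \<open>v (x - c)\<close>.\<close>

lemma isograph_adjoin_x:
  assumes G: "isograph L v G" and total: "\<And>c. c \<in> B \<Longrightarrow> \<exists>d. (c, d) \<in> G" and fst_B: "fst ` G \<subseteq> B"
    and vx: "\<And>c d. (c, d) \<in> G \<Longrightarrow> v (x \<ominus> c) = v (x \<ominus> d)"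
  shows "isograph L v (graph_adjoin (square_ring L) G (x, x))"
proof -
  interpret P: cring "square_ring L" by (rule square_cring)
  note D = isographD[OF G(1)] and ops = isograph_ops[OF G(1)]
  have xx: "(x, x) \<in> carrier (square_ring L)" using x by (simp add: square_ring_simps)
  have GP: "G \<subseteq> carrier (square_ring L)" using subringE(1)[OF D(1)] .
  have carr: "set (map fst p) \<subseteq> carrier L" "set (map snd p) \<subseteq> carrier L" if "set p \<subseteq> G" for p
    using that GP unfolding square_ring_simps by auto
  have key: "v (ev L (map fst p) x) = v (ev L (map snd p) x)" if "set p \<subseteq> G" for p
    using that
  proof (induction "length p" arbitrary: p rule: less_induct)
    case less
    show ?case
    proof (cases "length p \<le> 1")
      case True
      then consider "p = []" | c d where "p = [(c, d)]" by (cases p) auto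
      then show ?thesis
      proof cases
        case 2
        then have cd: "(c, d) \<in> G" using less.prems by simp
        show ?thesis using 2 D(2-4)[OF cd] x by simp
      qed simp
    next
      case False
      then have "p \<noteq> []" by auto
      then obtain q c d where p: "p = q @ [(c, d)]" by (metis append_butlast_last_id surj_pair)
      have q: "q \<noteq> []" "set q \<subseteq> G" and cd: "(c, d) \<in> G" using False p less.prems by auto
      have cdc: "c \<in> carrier L" "d \<in> carrier L" using D(3,4)[OF cd] .
      show ?thesis
      \<comment> \<open>A vanishing leading pair is dropped; otherwise the leading coefficient can
        be normalised and a root exists in \<open>B\<close>.\<close>
      proof (cases "c = \<zero>")
        case True
        then have "d = \<zero>" using isograph_zero_iff[OF G cd] by simp
        then have "ev L (map fst p) x = ev L (map fst q) x" "ev L (map snd p) x = ev L (map snd q) x"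
          using p True carr[OF q(2)] x by (simp_all add: ev_append)
        then show ?thesis using less.hyps[of q] q p by simp
      next
        case False
        have ic: "inv c \<in> carrier L" "inv c \<otimes> c = \<one>" using cdc False field_Units by auto
        have cB: "c \<in> B" "set (map fst q) \<subseteq> B" using fst_B cd q(2) by force+
        then have icB: "inv c \<in> B" using subfield_m_inv(1)[OF B, of c] False by blast
        define m where "m = map ((\<otimes>) (inv c)) (map fst q)"
        have mB: "set m \<subseteq> B" unfolding m_def using set_smult[OF subfieldE(1)[OF B] icB cB(2)] .
        have mp: "map ((\<otimes>) (inv c)) (map fst p) = m @ [\<one>]" using p ic by (simp add: m_def)
        obtain r where r: "r \<in> carrier L" "ev L (m @ [\<one>]) r = \<zero>"
          using monic_has_root[of m] mB B_carrier q(1) by (auto simp: m_def)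
        have rB: "r \<in> B" using B_algebraically_closed[OF r(1) mB r(2)] .
        have "inv c \<otimes> ev L (map fst p) r = \<zero>"
          using r ev_smult[OF ic(1) carr(1)[OF less.prems] r(1)] mp by simp
        then have root: "ev L (map fst p) r = \<zero>"
          using integral[of "inv c"] ic ev_closed[OF carr(1)[OF less.prems] r(1)] cdc by force
        obtain s where s: "(r, s) \<in> G" using total[OF rB] by blast
        have sc: "s \<in> carrier L" using D(4)[OF s] .
        \<comment> \<open>The division takes place over the graph, at the pair formed by the root
          \<open>r\<close> and its image \<open>s\<close>. The remainder pair has first entry
          \<open>p(r) = 0\<close>, so it is zero, and both projections lose a linear factor
          simultaneously.\<close>
        obtain \<rho> ds where pd: "\<rho> \<in> G" "set ds \<subseteq> G" "p = plin (square_ring L) (r, s) \<rho> ds"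
          using P.synthetic_division[OF D(1) s less.prems] \<open>p \<noteq> []\<close> by blast
        obtain \<rho>1 \<rho>2 where \<rho>: "\<rho> = (\<rho>1, \<rho>2)" by (cases \<rho>)
        have \<rho>G: "(\<rho>1, \<rho>2) \<in> G" using pd \<rho> by simp
        have \<rho>c: "\<rho>1 \<in> carrier L" "\<rho>2 \<in> carrier L" using D(3,4)[OF \<rho>G] .
        have dsc: "set ds \<subseteq> carrier (square_ring L)" using pd GP by blast
        have maps: "map fst p = plin L r \<rho>1 (map fst ds)" "map snd p = plin L s \<rho>2 (map snd ds)"
          using plin_square[of "(r, s)" ds \<rho>] pd(3) dsc r sc \<rho> unfolding square_ring_simps by auto
        have "\<rho>1 = \<zero>"
          using root ev_plin[OF r(1) \<rho>c(1) carr(1)[OF pd(2)] r(1)] \<rho>c(1) ev_closed[OF carr(1)[OF pd(2)] r(1)] r(1)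
          unfolding maps by (simp add: r_right_minus_eq a_minus_def r_neg)
        then have \<rho>0: "\<rho>1 = \<zero>" "\<rho>2 = \<zero>" using isograph_zero_iff[OF G \<rho>G] by auto
        have "length ds < length p" using pd(3) by simp
        then have IH: "v (ev L (map fst ds) x) = v (ev L (map snd ds) x)" using less.hyps pd(2) by blast
        have e: "ev L (map fst ds) x \<in> carrier L" "ev L (map snd ds) x \<in> carrier L"
          using ev_closed carr[OF pd(2)] x by blast+
        have "v (ev L (map fst p) x) = v (x \<ominus> r) + v (ev L (map fst ds) x)"
          unfolding maps using ev_plin[OF r(1) zero_closed carr(1)[OF pd(2)] x] \<rho>0 e r(1) x by (simp add: v_mult)
        moreover have "v (ev L (map snd p) x) = v (x \<ominus> s) + v (ev L (map snd ds) x)"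
          unfolding maps using ev_plin[OF sc zero_closed carr(2)[OF pd(2)] x] \<rho>0 e sc x by (simp add: v_mult)
        ultimately show ?thesis using IH vx[OF s] by simp
      qed
    qed
  qed
  show ?thesis
    unfolding isograph_def
  proof
    show "subring (graph_adjoin (square_ring L) G (x, x)) (square_ring L)"
      using P.subring_graph_adjoin[OF D(1) xx] .
    show "\<forall>(a, b)\<in>graph_adjoin (square_ring L) G (x, x). v a = v b"
      using key unfolding graph_adjoin_def by (auto simp: ev_square)
  qed
qed

text \<open>The polynomial \<open>f\<close> makes \<open>b\<close> a simple root, so a henselian
  field that misses \<open>b\<close> admits a different conjugate of \<open>b\<close>. Without a
  simple root there might be nothing to which \<open>b\<close> could be moved.\<close>

lemma IC_descend:
  assumes b: "b \<in> A" "b \<in> IC L v Kh x" and f: "set f \<subseteq> K" "ev L f b = \<zero>" "dv L f b \<noteq> \<zero>"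
  shows "b \<in> IC L v K x"
proof -
  interpret P: cring "square_ring L" by (rule square_cring)
  interpret V: valued_field L "trivial_val L :: 'a \<Rightarrow> int extended" by (rule trivial_valued_field)
  have "b \<in> E" if E: "Kx \<subseteq> E" "henselian L v E" for E
  proof (rule ccontr)
    assume "b \<notin> E"
    have EL: "subfield E L" using E(2) unfolding henselian_def by blast
    have KE: "K \<subseteq> E" "x \<in> E" using E(1) Kx by auto
    let ?C = "algebraic_closure_in L E"
    have C: "subfield ?C L" and EC: "E \<subseteq> ?C" and AC: "A \<subseteq> ?C"
      using subfield_algebraic_closure_in[OF EL] algebraic_closure_in_incl[OF EL]
        algebraic_closure_in_mono[OF KE(1)] by auto
    have bc: "b \<in> carrier L" using b A_B B_carrier by blast
    obtain b' where b': "b' \<noteq> b" "conjugate L E b b'"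
      using simple_root_conjugate[OF EL subset_trans[OF f(1) KE(1)] f(2,3) bc \<open>b \<notin> E\<close>] by blast
    have "b \<in> ?C" using b AC by blast
    then obtain G where G: "plain_graph L G" "Id_on E \<subseteq> G" "(b, b') \<in> G"
      using conjugate_plain_graph[OF EL _ b'(2)] unfolding mem_algebraic_closure_in by blast
    obtain H where H: "G \<subseteq> H" "plain_graph L H"
      and total: "\<And>F y. subfield F L \<and> Id_on F \<subseteq> H \<and> y \<in> algebraic_closure_in L F \<Longrightarrow> \<exists>z. (y, z) \<in> H"
      using plain_extension[OF G(1)] by blast
    have HE: "Id_on E \<subseteq> H" using G(2) H(1) by blast
    have iso: "v p = v q" if "(p, q) \<in> H" "p \<in> ?C" for p q
      using henselian_plain_graph[OF E(2) H(2) HE that] .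
    note DH = V.isographD[OF H(2)] and opsH = V.isograph_ops[OF H(2)]
    have HK: "Id_on K \<subseteq> H" using HE KE(1) by blast
    \<comment> \<open>\<open>H\<close> is known to preserve values only on the algebraic closure of
      \<open>E\<close>; restricting to \<open>A\<close> gives an isograph for
      \<open>v\<close>.\<close>
    define GA where "GA = {(p, q) \<in> H. p \<in> A}"
    have GA_A: "p \<in> A" "q \<in> A" if "(p, q) \<in> GA" for p q
      using that isograph_preserves_roots[OF H(2) V.valued_field_axioms K HK] unfolding GA_def by auto
    note SA = subringE[OF subfieldE(1)[OF A]]
    have GA: "isograph L v GA"
      unfolding isograph_def
    proof
      show "subring GA (square_ring L)"
      proof (rule P.subringI)
        show "GA \<subseteq> carrier (square_ring L)" using subringE(1)[OF DH(1)] unfolding GA_def by blast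
        show "\<one>\<^bsub>square_ring L\<^esub> \<in> GA"
          using opsH(5)[OF H(1)[THEN subsetD, OF G(3)] H(1)[THEN subsetD, OF G(3)]] SA(3)
          unfolding GA_def by (simp add: square_ring_simps)
      next
        fix p assume p: "p \<in> GA"
        then obtain s t where st: "p = (s, t)" "(s, t) \<in> H" "s \<in> A" unfolding GA_def by blast
        show "\<ominus>\<^bsub>square_ring L\<^esub> p \<in> GA"
          using opsH(3)[OF st(2,2)] SA(5)[OF st(3)] DH(3,4)[OF st(2)] unfolding GA_def st(1)
          by (simp add: square_minus)
      next
        fix p p' assume p: "p \<in> GA" "p' \<in> GA"
        then obtain s t s' t' where st: "p = (s, t)" "(s, t) \<in> H" "s \<in> A" "p' = (s', t')" "(s', t') \<in> H" "s' \<in> A"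
          unfolding GA_def by blast
        show "p \<otimes>\<^bsub>square_ring L\<^esub> p' \<in> GA" "p \<oplus>\<^bsub>square_ring L\<^esub> p' \<in> GA"
          using opsH(1,2)[OF st(2,5)] SA(6,7)[OF st(3,6)] unfolding GA_def st(1,4)
          by (simp_all add: square_ring_simps)
      qed
      show "\<forall>(p, q)\<in>GA. v p = v q" using iso AC unfolding GA_def by blast
    qed
    have GB: "GA \<subseteq> B \<times> B" using GA_A A_B by auto
    \<comment> \<open>Pairs \<open>(k, k)\<close> with \<open>k\<close> in \<open>K\<close> belong
      to \<open>GA\<close>, and they approximate \<open>(c, c)\<close> for \<open>c\<close> in
      \<open>Kh\<close>.\<close>
    have Kh_closure: "Id_on Kh \<subseteq> graph_closure GA"
    proof
      fix p assume "p \<in> Id_on Kh"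
      then obtain c where c: "p = (c, c)" "c \<in> Kh" by blast
      have "\<exists>(p, q)\<in>GA. Fin \<gamma> < v (c \<ominus> p) \<and> Fin \<gamma> < v (c \<ominus> q)" if \<gamma>: "\<gamma> \<in> \<Gamma>" for \<gamma>
      proof -
        obtain k where "k \<in> K" "Fin \<gamma> < v (c \<ominus> k)" using approximate_Kh[OF c(2) bounded_Gamma[OF \<gamma>]] by blast
        moreover from this have "(k, k) \<in> GA" using HK K_A unfolding GA_def by auto
        ultimately show ?thesis by blast
      qed
      then show "p \<in> graph_closure GA" using c Kh_B unfolding graph_closure_def by blast
    qed
    \<comment> \<open>Totality on \<open>B\<close> is not derived from limits: the closure fixes
      \<open>Kh\<close>, so isometric extension supplies an image for everything algebraic over
      \<open>Kh\<close>.\<close>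
    obtain J where J: "graph_closure GA \<subseteq> J" "isograph L v J"
      and Jtotal: "\<And>T y. subfield T L \<Longrightarrow> T \<subseteq> fst ` J \<Longrightarrow> y \<in> carrier L \<Longrightarrow> (algebraic over T) y \<Longrightarrow> y \<in> fst ` J"
      using isograph_extension[OF isograph_closure(1)[OF GA GB]] by blast
    have GAJ: "GA \<subseteq> J" using isograph_closure(2)[OF GA GB] J(1) by blast
    have KhJ: "Id_on Kh \<subseteq> J" using Kh_closure J(1) by blast
    note DJ = isographD[OF J(2)] and opsJ = isograph_ops[OF J(2)]
    have totalB: "\<exists>d. (c, d) \<in> J" if "c \<in> B" for c
    proof -
      have "Kh \<subseteq> fst ` J" using KhJ by force
      then have "c \<in> fst ` J" using Jtotal[OF Kh] that unfolding mem_algebraic_closure_in by blast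
      then show ?thesis by force
    qed
    have JB: "d \<in> B" if "(c, d) \<in> J" "c \<in> B" for c d
      using isograph_preserves_roots[OF J(2) valued_field_axioms Kh KhJ that] .
    define JB where "JB = {(p, q) \<in> J. p \<in> B}"
    note SB = subringE[OF subfieldE(1)[OF B]]
    have JBiso: "isograph L v JB"
      unfolding isograph_def
    proof
      show "subring JB (square_ring L)"
      proof (rule P.subringI)
        show "JB \<subseteq> carrier (square_ring L)" using subringE(1)[OF DJ(1)] unfolding JB_def by blast
        show "\<one>\<^bsub>square_ring L\<^esub> \<in> JB"
          using subringE(3)[OF DJ(1)] SB(3) unfolding JB_def by (simp add: square_ring_simps)
      next
        fix p assume p: "p \<in> JB"
        then obtain s t where st: "p = (s, t)" "(s, t) \<in> J" "s \<in> B" unfolding JB_def by blast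
        show "\<ominus>\<^bsub>square_ring L\<^esub> p \<in> JB"
          using opsJ(3)[OF st(2,2)] SB(5)[OF st(3)] DJ(3,4)[OF st(2)] unfolding JB_def st(1)
          by (simp add: square_minus)
      next
        fix p p' assume p: "p \<in> JB" "p' \<in> JB"
        then obtain s t s' t' where st: "p = (s, t)" "(s, t) \<in> J" "s \<in> B" "p' = (s', t')" "(s', t') \<in> J" "s' \<in> B"
          unfolding JB_def by blast
        show "p \<otimes>\<^bsub>square_ring L\<^esub> p' \<in> JB" "p \<oplus>\<^bsub>square_ring L\<^esub> p' \<in> JB"
          using opsJ(1,2)[OF st(2,5)] SB(6,7)[OF st(3,6)] unfolding JB_def st(1,4)
          by (simp_all add: square_ring_simps)
      qed
      show "\<forall>(p, q)\<in>JB. v p = v q" using DJ(2) unfolding JB_def by blast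
    qed
    have vx: "v (x \<ominus> c) = v (x \<ominus> d)" if "(c, d) \<in> JB" for c d
    proof -
      have cd: "(c, d) \<in> J" "c \<in> B" "d \<in> B" using that JB unfolding JB_def by auto
      have cc: "c \<in> carrier L" "d \<in> carrier L" using cd B_carrier by auto
      \<comment> \<open>A pair \<open>(a, a')\<close> from \<open>GA\<close> close to
        \<open>c\<close> in the first coordinate is equally close to \<open>d\<close> in the second,
        because \<open>J\<close> is isometric. As \<open>x\<close> lies in \<open>E\<close>, it is
        fixed by \<open>H\<close>, so \<open>v (x - a) = v (x - a')\<close>.\<close>
      have near: "\<exists>a a'. Fin \<gamma> < v (c \<ominus> a) \<and> Fin \<gamma> < v (d \<ominus> a') \<and> v (x \<ominus> a) = v (x \<ominus> a') \<and>
          a \<in> carrier L \<and> a' \<in> carrier L" if \<gamma>: "\<gamma> \<in> \<Gamma>" for \<gamma>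
      proof -
        obtain a where a: "a \<in> A" "Fin \<gamma> < v (c \<ominus> a)" using A_dense[OF cd(2) bounded_Gamma[OF \<gamma>]] by blast
        obtain a' where a': "(a, a') \<in> H" using total[of K a] K HK a(1) by blast
        then have aG: "(a, a') \<in> GA" using a(1) unfolding GA_def by blast
        then have "v (c \<ominus> a) = v (d \<ominus> a')" using DJ(2)[OF opsJ(4)[OF cd(1)]] GAJ by blast
        moreover have "(x, x) \<in> H" using HE KE(2) by blast
        then have "(x \<ominus> a, x \<ominus> a') \<in> H" using opsH(4) a' by blast
        moreover have "x \<ominus> a \<in> ?C"
          using subringE(5,7)[OF subfieldE(1)[OF C]] KE(2) EC AC a(1) by (simp add: a_minus_def subset_iff)
        ultimately have "Fin \<gamma> < v (c \<ominus> a) \<and> Fin \<gamma> < v (d \<ominus> a') \<and> v (x \<ominus> a) = v (x \<ominus> a') \<and>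
          a \<in> carrier L \<and> a' \<in> carrier L" using a(2) iso DH(3,4)[OF a'] by simp
        then show ?thesis by blast
      qed
      have transfer: "v (x \<ominus> a) = v (x \<ominus> c)" if "v (x \<ominus> c) \<le> Fin \<gamma>" "Fin \<gamma> < v (c \<ominus> a)" "a \<in> carrier L" "c \<in> carrier L"
        for a c \<gamma>
      proof -
        have "x \<ominus> a = (x \<ominus> c) \<oplus> (c \<ominus> a)" using that(3,4) x by algebra
        then show ?thesis using v_add_eq[of "x \<ominus> c" "c \<ominus> a"] le_less_trans[OF that(1,2)] that(3,4) x by simp
      qed
      show ?thesis
      \<comment> \<open>If the distance of \<open>x\<close> to \<open>c\<close> or to
        \<open>d\<close> is bounded by some \<open>\<gamma>\<close>, an approximation beyond
        \<open>\<gamma>\<close> does not change it. Otherwise both distances exceed all of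
        \<open>\<Gamma>\<close>, and then \<open>c = d\<close>.\<close>
      proof (cases "\<exists>\<gamma>\<in>\<Gamma>. v (x \<ominus> c) \<le> Fin \<gamma> \<or> v (x \<ominus> d) \<le> Fin \<gamma>")
        case True
        then obtain \<gamma> where \<gamma>: "\<gamma> \<in> \<Gamma>" "v (x \<ominus> c) \<le> Fin \<gamma> \<or> v (x \<ominus> d) \<le> Fin \<gamma>" by blast
        obtain a a' where a: "Fin \<gamma> < v (c \<ominus> a)" "Fin \<gamma> < v (d \<ominus> a')" "v (x \<ominus> a) = v (x \<ominus> a')"
          "a \<in> carrier L" "a' \<in> carrier L" using near[OF \<gamma>(1)] by blast
        have a2: "Fin \<gamma> < v (a \<ominus> c)" "Fin \<gamma> < v (a' \<ominus> d)" using a cc v_diff_commute by auto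
        show ?thesis
        proof (cases "v (x \<ominus> c) \<le> Fin \<gamma>")
          case True
          then have 1: "v (x \<ominus> a) = v (x \<ominus> c)" using transfer a cc by blast
          then have "v (x \<ominus> a') \<le> Fin \<gamma>" using True a(3) by simp
          then have "v (x \<ominus> d) = v (x \<ominus> a')" using transfer a2 a cc by blast
          then show ?thesis using 1 a(3) by simp
        next
          case False
          then have le: "v (x \<ominus> d) \<le> Fin \<gamma>" using \<gamma>(2) by blast
          then have 1: "v (x \<ominus> a') = v (x \<ominus> d)" using transfer a cc by blast
          then have "v (x \<ominus> a) \<le> Fin \<gamma>" using le a(3) by simp
          then have "v (x \<ominus> c) = v (x \<ominus> a)" using transfer a2 a cc by blast
          then show ?thesis using 1 a(3) by simp
        qed
      next
        case False
        have "c \<ominus> d = \<zero>"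
        proof (rule eq_zero_of_unbounded)
          show "c \<ominus> d \<in> B" using SB(5,7) cd by (simp add: a_minus_def)
          fix \<gamma> assume "\<gamma> \<in> \<Gamma>"
          then have "Fin \<gamma> < v (c \<ominus> x)" "Fin \<gamma> < v (x \<ominus> d)" using False v_diff_commute cc x by (auto simp: not_le)
          then show "Fin \<gamma> < v (c \<ominus> d)" using v_diff_trans[OF cc(1) x cc(2)] by (meson less_le_trans min_less_iff_conj)
        qed
        then have "c = d" using cc by simp
        then show ?thesis by simp
      qed
    qed
    have JBtotal: "\<exists>d. (c, d) \<in> JB" if "c \<in> B" for c using totalB[OF that] that unfolding JB_def by blast
    have "fst ` JB \<subseteq> B" unfolding JB_def by auto
    then have Q: "isograph L v (graph_adjoin (square_ring L) JB (x, x))"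
      using isograph_adjoin_x[OF JBiso JBtotal _ vx] by blast
    \<comment> \<open>\<open>N\<close> is defined on all of \<open>L\<close>: it fixes
      \<open>Kh\<close> and \<open>x\<close>, and \<open>L\<close> is algebraic over the field
      generated by them. This also makes \<open>L\<close> algebraic over the fixed field of
      \<open>N\<close>.\<close>
    obtain N where N: "graph_adjoin (square_ring L) JB (x, x) \<subseteq> N" "isograph L v N" "inverse_closed L N"
      and Ntotal: "\<And>T y. subfield T L \<Longrightarrow> T \<subseteq> fst ` N \<Longrightarrow> y \<in> carrier L \<Longrightarrow> (algebraic over T) y \<Longrightarrow> y \<in> fst ` N"
      using isograph_extension[OF Q] by blast
    have xx: "(x, x) \<in> carrier (square_ring L)" using x by (simp add: square_ring_simps)
    note SJ = isographD(1)[OF JBiso]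
    have JN: "JB \<subseteq> N" "(x, x) \<in> N"
      using N(1) P.graph_adjoin_incl[OF subringE(1)[OF SJ] xx] P.graph_adjoin_mem[OF SJ xx] by auto
    let ?F = "{a. (a, a) \<in> N}"
    have F: "subfield ?F L" using subfield_fixed_isograph[OF N(2,3)] .
    have "(c, c) \<in> N" if "c \<in> Kh" for c
    proof -
      have "(c, c) \<in> JB" using that KhJ Kh_B unfolding JB_def by auto
      then show ?thesis using JN(1) by blast
    qed
    then have KhxF: "Khx \<subseteq> ?F" using Khx(4)[OF F] JN(2) by blast
    have algF: "(algebraic over ?F) y" if "y \<in> carrier L" for y
      using algebraic_mono[OF KhxF] algebraic_x[OF that] by blast
    have FN: "?F \<subseteq> fst ` N" by force
    have "y \<in> fst ` N" if "y \<in> carrier L" for y using Ntotal[OF F FN that algF[OF that]] .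
    moreover have "fst ` N \<subseteq> carrier L" using isographD(3)[OF N(2)] by auto
    ultimately have "fst ` N = carrier L" by blast
    then have hens: "henselian L v ?F" using henselian_fixed_field[OF N(2,3)] algF by blast
    have FL: "?F \<subseteq> algebraic_closure_in L Khx" using algebraic_closure_Khx subfieldE(3)[OF F] by simp
    have "b \<in> henselization L v Khx" using b(2) unfolding IC_def by blast
    from this[unfolded mem_henselization, rule_format, OF conjI[OF KhxF conjI[OF FL hens]]]
    have bbN: "(b, b) \<in> N" by simp
    \<comment> \<open>The pair moving \<open>b\<close> has survived all extensions, although
      \<open>b\<close> is also fixed.\<close>
    have "(b, b') \<in> GA" using G(3) H(1) b(1) unfolding GA_def by blast
    then have "(b, b') \<in> JB" using GAJ b(1) A_B unfolding JB_def by blast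
    then have "(b, b') \<in> N" using JN(1) by blast
    then show False using isograph_unique[OF N(2) bbN] b'(1) by blast
  qed
  then have "b \<in> henselization L v Kx" unfolding mem_henselization by blast
  then show ?thesis using b(1) unfolding IC_def by blast
qed

end

section \<open>Approximation by separable elements\<close>

context valued_field begin

text \<open>The coefficients of the quotient are recovered from those of the product from the top
  down by \<open>r = (r - z d) + z d\<close>. For \<open>v z\<close> at least
  \<open>\<gamma>\<close> no step falls below the Gauss value of the product; the shift by
  \<open>\<gamma>\<close> reflects the lower degree of the quotient.\<close>

lemma gauss_val_quotient:
  assumes "z \<in> carrier L" "Fin \<gamma> \<le> v z" "r \<in> carrier L" "set ds \<subseteq> carrier L"
  shows "gauss_val v \<gamma> (plin L z r ds) \<le> v r \<and> gauss_val v \<gamma> (plin L z r ds) \<le> Fin \<gamma> + gauss_val v \<gamma> ds"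
  using assms(3,4)
proof (induction ds arbitrary: r)
  case (Cons d ds)
  then have d: "d \<in> carrier L" "set ds \<subseteq> carrier L" "z \<otimes> d \<in> carrier L" using assms(1) by auto
  let ?q = "gauss_val v \<gamma> (plin L z d ds)"
  have IH: "?q \<le> v d" "?q \<le> Fin \<gamma> + gauss_val v \<gamma> ds" using Cons.IH[OF d(1,2)] by auto
  have le: "gauss_val v \<gamma> (plin L z r (d # ds)) \<le> v (r \<ominus> z \<otimes> d)"
    "gauss_val v \<gamma> (plin L z r (d # ds)) \<le> Fin \<gamma> + ?q" by auto
  have "Fin \<gamma> + ?q \<le> v z + v d" using assms(2) IH(1) by (rule add_mono)
  then have zd: "Fin \<gamma> + ?q \<le> v (z \<otimes> d)" using v_mult assms(1) d(1) by simp
  have "r = (r \<ominus> z \<otimes> d) \<oplus> z \<otimes> d" using Cons.prems(1) d by algebra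
  then have "min (v (r \<ominus> z \<otimes> d)) (v (z \<otimes> d)) \<le> v r"
    using v_add[of "r \<ominus> z \<otimes> d" "z \<otimes> d"] Cons.prems(1) d by simp
  then have 1: "gauss_val v \<gamma> (plin L z r (d # ds)) \<le> v r"
    using le(1) order_trans[OF le(2) zd] by (meson min.boundedI order_trans)
  have "?q \<le> min (v d) (Fin \<gamma> + gauss_val v \<gamma> ds)" using IH by simp
  then have "Fin \<gamma> + ?q \<le> Fin \<gamma> + gauss_val v \<gamma> (d # ds)" by (simp add: Fin_add_le_iff)
  then show ?case using 1 order_trans[OF le(2)] by blast
qed simp

text \<open>Differentiation lowers each degree by one, which costs one \<open>\<gamma>\<close>;
  integer multiples cannot lower a value.\<close>

lemma gauss_val_dv:
  assumes "y \<in> carrier L" "Fin \<gamma> \<le> v y" "set cs \<subseteq> carrier L"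
  shows "gauss_val v \<gamma> cs \<le> Fin \<gamma> + v (dv L cs y)"
  using assms(3)
proof (induction cs)
  case (Cons c cs)
  then have cs: "set cs \<subseteq> carrier L" by simp
  have c: "ev L cs y \<in> carrier L" "dv L cs y \<in> carrier L" using cs assms(1) by auto
  have 1: "gauss_val v \<gamma> cs \<le> v (ev L cs y)" using v_ev_ge[OF cs assms(1,2)] .
  have "gauss_val v \<gamma> cs \<le> Fin \<gamma> + v (dv L cs y)" using Cons.IH[OF cs] .
  also have "\<dots> \<le> v y + v (dv L cs y)" using assms(2) by (rule add_right_mono)
  also have "\<dots> = v (y \<otimes> dv L cs y)" using v_mult assms(1) c by simp
  finally have "gauss_val v \<gamma> cs \<le> v (dv L (c # cs) y)"
    using 1 v_add[of "ev L cs y" "y \<otimes> dv L cs y"] c assms(1) by (simp) (meson min.boundedI order_trans)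
  then have "Fin \<gamma> + gauss_val v \<gamma> cs \<le> Fin \<gamma> + v (dv L (c # cs) y)" by (simp only: Fin_add_le_iff)
  then show ?case by (simp del: dv.simps add: min.coboundedI2)
qed (simp add: v_zero)

end

lemma (in field) subfield_Inter:
  assumes "\<A> \<noteq> {}" "\<And>E. E \<in> \<A> \<Longrightarrow> subfield E R"
  shows "subfield (\<Inter>\<A>) R"
proof (rule subfieldI')
  show "subring (\<Inter>\<A>) R" using assms subfieldE(1) by (intro subring_Inter) auto
  show "inv k \<in> \<Inter>\<A>" if "k \<in> \<Inter>\<A> - {\<zero>}" for k
    using that assms(2) subfield_m_inv(1) by fast
qed

context valued_closed begin

text \<open>The algebraic closure of \<open>F\<close> is itself henselian, so the intersection runs
  over a nonempty family of subfields.\<close>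

lemma subfield_henselization:
  assumes "subfield F L" shows "subfield (henselization L v F) L"
  unfolding henselization_def
proof (rule subfield_Inter)
  let ?C = "algebraic_closure_in L F"
  have "henselian L v ?C"
    unfolding henselian_def algebraic_closure_in_idem[OF assms]
    using subfield_algebraic_closure_in[OF assms] by simp
  then have "?C \<in> {E. F \<subseteq> E \<and> E \<subseteq> ?C \<and> henselian L v E}"
    using algebraic_closure_in_incl[OF assms] by simp
  then show "{E. F \<subseteq> E \<and> E \<subseteq> ?C \<and> henselian L v E} \<noteq> {}" by blast
qed (simp add: henselian_def)

lemma henselization_incl: "F \<subseteq> henselization L v F"
  unfolding henselization_def by blast

lemma subfield_IC:
  assumes F: "subfield F L" and y: "y \<in> carrier L"
  shows "subfield (IC L v F y) L" "F \<subseteq> IC L v F y"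
proof -
  note a = adjoin_subfield[OF F y]
  have "subfield (\<Inter>{algebraic_closure_in L F, henselization L v (adjoin L F y)}) L"
    using subfield_algebraic_closure_in[OF F] subfield_henselization[OF a(1)] by (intro subfield_Inter) auto
  then show "subfield (IC L v F y) L" unfolding IC_def by simp
  show "F \<subseteq> IC L v F y"
    using algebraic_closure_in_incl[OF F] a(2) henselization_incl unfolding IC_def by blast
qed

end

context completed_extension begin

lemma gauss_val_lower_bound:
  assumes "bounded (- \<gamma>)" "set cs \<subseteq> B"
  shows "\<exists>\<mu>. bounded \<mu> \<and> 0 \<le> \<mu> \<and> Fin (- \<mu>) \<le> gauss_val v \<gamma> cs"
  using assms(2)
proof (induction cs)
  case Nil
  then show ?case using bounded_Gamma[OF Gamma_zero] by (intro exI[of _ 0]) auto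
next
  case (Cons c cs)
  then obtain \<mu> where \<mu>: "bounded \<mu>" "0 \<le> \<mu>" "Fin (- \<mu>) \<le> gauss_val v \<gamma> cs" by auto
  obtain \<nu> where \<nu>: "bounded \<nu>" "0 \<le> \<nu>" "Fin (- \<nu>) \<le> v c" using value_lower_bound[of c] Cons.prems by auto
  define \<kappa> where "\<kappa> = max \<nu> (\<mu> + - \<gamma>)"
  have "bounded \<kappa>" unfolding \<kappa>_def by (intro bounded_max bounded_add \<mu> \<nu> assms(1))
  moreover have "0 \<le> \<kappa>" unfolding \<kappa>_def using \<nu>(2) by (simp add: le_max_iff_disj)
  moreover have "Fin (- \<kappa>) \<le> v c"
  proof -
    have "Fin (- \<kappa>) \<le> Fin (- \<nu>)" unfolding \<kappa>_def by simp
    then show ?thesis using \<nu>(3) by (rule order_trans)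
  qed
  moreover have "Fin (- \<kappa>) \<le> Fin \<gamma> + gauss_val v \<gamma> cs"
  proof -
    have "- \<kappa> \<le> - (\<mu> + - \<gamma>)" by (rule le_imp_neg_le) (simp add: \<kappa>_def)
    then have "Fin (- \<kappa>) \<le> Fin \<gamma> + Fin (- \<mu>)" by (simp add: algebra_simps)
    also have "\<dots> \<le> Fin \<gamma> + gauss_val v \<gamma> cs" using \<mu>(3) by (simp only: Fin_add_le_iff)
    finally show ?thesis .
  qed
  ultimately show ?case by (intro exI[of _ \<kappa>]) simp
qed

text \<open>
  Krasner's lemma: if a polynomial over \<open>K\<close> is close to the minimal polynomial of \<open>a\<close>, then it
  has exactly one root near \<open>a\<close>, and that root lies in every henselian field containing \<open>a\<close>.
\<close>

lemma IC_dense_separable: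
  assumes a: "a \<in> IC L v Kh x" and f: "set f \<subseteq> Kh" "ev L f a = \<zero>" "dv L f a \<noteq> \<zero>" and \<gamma>: "bounded \<gamma>"
  shows "\<exists>e\<in>IC L v K x. Fin \<gamma> < v (a \<ominus> e)"
proof (cases "a = \<zero>")
  case True
  have "\<zero> \<in> IC L v K x" using subringE(2)[OF subfieldE(1)[OF subfield_IC(1)[OF K x]]] .
  then show ?thesis using True v_zero by (intro bexI[of _ \<zero>]) (auto simp: a_minus_def)
next
  case False
  have aB: "a \<in> B" "a \<in> carrier L" using a B_carrier unfolding IC_def by auto
  obtain \<gamma>0 where \<gamma>0: "v a = Fin \<gamma>0" using v_nonzero aB False by blast
  have one: "\<one> \<in> Kh" using subringE(3)[OF subfieldE(1)[OF Kh]] .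
  have "\<not> set f \<subseteq> {\<zero>}" using f(3) dv_all_zero aB by blast
  then obtain m where min: "minimal_poly L Kh a m" using minimal_poly_exists[OF Kh aB(2) f(1) _ f(2)] by blast
  then have m: "set m \<subseteq> Kh" "ev L (m @ [\<one>]) a = \<zero>" unfolding minimal_poly_def by blast+
  let ?M = "m @ [\<one>]"
  have M: "set ?M \<subseteq> Kh" "set ?M \<subseteq> B" "set ?M \<subseteq> carrier L" using m(1) one Kh_B B_carrier by auto
  have mc: "set m \<subseteq> carrier L" using M by simp
  obtain q where q: "set q \<subseteq> Kh" "dv L f a = dv L q a \<otimes> ev L ?M a \<oplus> ev L q a \<otimes> dv L ?M a"
    using min f(1,2) aB unfolding minimal_poly_def by meson
  have qc: "set q \<subseteq> carrier L" using q(1) Kh_carrier by blast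
  have dvM: "dv L ?M a \<in> carrier L" using dv_closed[OF M(3) aB(2)] .
  have dM: "dv L ?M a \<noteq> \<zero>"
    using q(2) f(3) m(2) dvM dv_closed[OF qc aB(2)] ev_closed[OF qc aB(2)] by auto
  obtain \<delta> where \<delta>: "v (dv L ?M a) = Fin \<delta>" using v_nonzero[OF dvM dM] by blast
  have dv_B: "dv L p y \<in> B" if "set p \<subseteq> B" "y \<in> B" for p y
    using that
  proof (induction p)
    case (Cons c p)
    then show ?case using ev_mem_subring[OF subfieldE(1)[OF B], of p y] subringE(6,7)[OF subfieldE(1)[OF B]] by auto
  qed (use subringE(2)[OF subfieldE(1)[OF B]] in simp)
  have b\<delta>: "bounded \<delta>" using bounded_value[OF dv_B[OF M(2) aB(1)] \<delta>] .
  have b\<gamma>0: "bounded \<gamma>0" "bounded (- \<gamma>0)" using bounded_value[OF aB(1) \<gamma>0] bounded_minus_value[OF aB(1) \<gamma>0] by auto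
  obtain \<mu> where \<mu>: "bounded \<mu>" "0 \<le> \<mu>" "Fin (- \<mu>) \<le> gauss_val v \<gamma>0 ?M"
    using gauss_val_lower_bound[OF b\<gamma>0(2) M(2)] by blast
  \<comment> \<open>Exceeding \<open>\<gamma>\<close> is the accuracy wanted in the end, and
    exceeding \<open>\<gamma>0\<close> forces \<open>v z = v a\<close>. The last entry ensures that
    \<open>a - y\<close> times an element of value at least \<open>- \<mu> - 2 \<gamma>0\<close> has
    value above \<open>\<delta>\<close>, the value of the derivative at \<open>a\<close>.\<close>
  define \<beta> where "\<beta> = max \<gamma> (max \<gamma>0 (\<delta> + \<mu> + \<gamma>0 + \<gamma>0))"
  \<comment> \<open>The 0 keeps the lower bound \<open>- \<mu>\<close> valid for the perturbed
    polynomial; \<open>\<delta> + \<gamma>0\<close> keeps the value \<open>\<delta>\<close> of its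
    derivative at \<open>a\<close>.\<close>
  define \<epsilon> where "\<epsilon> = max 0 (\<delta> + \<gamma>0)"
  have "bounded \<beta>" "bounded \<epsilon>" unfolding \<beta>_def \<epsilon>_def
    by (intro bounded_max bounded_add \<gamma> b\<gamma>0 b\<delta> \<mu> bounded_Gamma[OF Gamma_zero])+
  then obtain d z where d: "length d = length m" "set d \<subseteq> Kh" "Fin \<epsilon> < gauss_val v \<gamma>0 d" "set (padd L m d) \<subseteq> K"
    and z: "z \<in> carrier L" "ev L (padd L m d @ [\<one>]) z = \<zero>" "Fin \<beta> < v (a \<ominus> z)"
    using root_near[OF aB(1) \<gamma>0 m] by blast
  let ?N = "padd L m d @ [\<one>]"
  have dc: "set d \<subseteq> carrier L" using d(2) Kh_carrier by blast
  have N: "set ?N \<subseteq> K" "set ?N \<subseteq> carrier L"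
    using d(4) subringE(3)[OF subfieldE(1)[OF K]] K_carrier by auto
  have NM: "?N = padd L ?M d" using padd_snoc[OF d(1) mc] by simp
  have \<beta>: "Fin \<gamma> \<le> Fin \<beta>" "Fin \<gamma>0 \<le> Fin \<beta>" "Fin (\<delta> + \<mu> + \<gamma>0 + \<gamma>0) \<le> Fin \<beta>"
    unfolding \<beta>_def by (auto simp: le_max_iff_disj)
  have \<epsilon>: "Fin 0 \<le> Fin \<epsilon>" "Fin (\<delta> + \<gamma>0) \<le> Fin \<epsilon>" unfolding \<epsilon>_def by auto
  have vz: "v z = Fin \<gamma>0" using v_eq_of_diff[OF aB(2) z(1)] \<gamma>0 le_less_trans[OF \<beta>(2) z(3)] by simp
  have dvN: "v (dv L ?N a) = Fin \<delta>"
  proof -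
    have "Fin (\<delta> + \<gamma>0) < Fin \<gamma>0 + v (dv L d a)"
      using le_less_trans[OF \<epsilon>(2) d(3)] gauss_val_dv[OF aB(2) _ dc] \<gamma>0 by (metis less_le_trans order_refl)
    then have "Fin \<gamma>0 + Fin \<delta> < Fin \<gamma>0 + v (dv L d a)" by (simp add: add.commute)
    then have "Fin \<delta> < v (dv L d a)" by (simp only: Fin_add_less_iff)
    moreover have "dv L ?N a = dv L ?M a \<oplus> dv L d a" unfolding NM by (rule dv_padd[OF M(3) dc aB(2)])
    ultimately show ?thesis using v_add_eq[OF dvM dv_closed[OF dc aB(2)]] \<delta> by simp
  qed
  have gN: "Fin (- \<mu>) \<le> gauss_val v \<gamma>0 ?N"
  proof -
    have padd: "min (gauss_val v \<gamma>0 p) (gauss_val v \<gamma>0 q) \<le> gauss_val v \<gamma>0 (padd L p q)"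
      if "set p \<subseteq> carrier L" "set q \<subseteq> carrier L" for p q
      using that
    proof (induction p arbitrary: q)
      case (Cons c p)
      show ?case
      proof (cases q)
        case (Cons e q')
        have IH: "min (gauss_val v \<gamma>0 p) (gauss_val v \<gamma>0 q') \<le> gauss_val v \<gamma>0 (padd L p q')"
          using Cons.IH Cons.prems Cons by simp
        let ?l = "min (gauss_val v \<gamma>0 (c # p)) (gauss_val v \<gamma>0 q)"
        have "?l \<le> min (v c) (v e)" using Cons by (simp add: min.coboundedI1 min.coboundedI2)
        also have "\<dots> \<le> v (c \<oplus> e)" using v_add Cons.prems Cons by simp
        finally have 1: "?l \<le> v (c \<oplus> e)" .
        have "?l \<le> Fin \<gamma>0 + gauss_val v \<gamma>0 p" "?l \<le> Fin \<gamma>0 + gauss_val v \<gamma>0 q'"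
          using Cons by (simp_all add: min.coboundedI1 min.coboundedI2)
        then have "?l \<le> Fin \<gamma>0 + min (gauss_val v \<gamma>0 p) (gauss_val v \<gamma>0 q')"
          unfolding min_def[of "gauss_val v \<gamma>0 p"] by simp
        also have "\<dots> \<le> Fin \<gamma>0 + gauss_val v \<gamma>0 (padd L p q')" using IH by (simp only: Fin_add_le_iff)
        finally show ?thesis using 1 Cons by simp
      qed simp
    qed simp
    have "Fin (- \<mu>) \<le> Fin 0" using \<mu>(2) by simp
    then have "Fin (- \<mu>) \<le> gauss_val v \<gamma>0 d" using \<epsilon>(1) d(3) by (meson less_imp_le order_trans)
    then show ?thesis unfolding NM using \<mu>(3) padd[OF M(3) dc] by (meson min.boundedI order_trans)
  qed
  have "padd L m d \<noteq> []" using z(1,2) by auto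
  then obtain k where k: "set k \<subseteq> carrier L" "?N = plin L z \<zero> (k @ [\<one>])"
    using monic_synthetic_division[OF carrier_is_subring z(1) _ _ z(2)] N(2) by auto
  define g where "g = k @ [\<one>]"
  have gc: "set g \<subseteq> carrier L" using k(1) by (simp add: g_def)
  have Ng: "?N = plin L z \<zero> g" using k(2) by (simp add: g_def)
  have gg: "Fin (- \<mu>) \<le> Fin \<gamma>0 + gauss_val v \<gamma>0 g"
  proof -
    have "gauss_val v \<gamma>0 ?N \<le> Fin \<gamma>0 + gauss_val v \<gamma>0 g"
      unfolding Ng using gauss_val_quotient[OF z(1) _ zero_closed gc, of \<gamma>0] vz by simp
    then show ?thesis using gN by (rule order_trans[rotated])
  qed
  have big: "Fin \<delta> < v ((a \<ominus> y) \<otimes> w)"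
    if y: "y \<in> carrier L" "w \<in> carrier L" "Fin \<beta> < v (a \<ominus> y)" "Fin (- \<mu>) \<le> Fin \<gamma>0 + (Fin \<gamma>0 + v w)" for y w
  proof -
    have "Fin (- \<mu>) \<le> Fin (\<gamma>0 + \<gamma>0) + v w" using y(4) by (cases "v w") (auto simp: add.assoc)
    then have w: "Fin (- \<mu> - \<gamma>0 - \<gamma>0) \<le> v w" by (cases "v w") (auto simp: algebra_simps)
    have "Fin (\<delta> + \<mu> + \<gamma>0 + \<gamma>0) + Fin (- \<mu> - \<gamma>0 - \<gamma>0) < v (a \<ominus> y) + v w"
      using le_less_trans[OF \<beta>(3) y(3)] w by (intro add_less_mono_extended) auto
    then show ?thesis using v_mult[of "a \<ominus> y" w] y(1,2) aB(2) by (simp add: algebra_simps)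
  qed
  \<comment> \<open>With the perturbed polynomial written as \<open>(T - z) g\<close>, its
    derivative at \<open>a\<close> is \<open>g(a) + (a - z) g'(a)\<close>, and the second term has
    value above \<open>\<delta>\<close>.\<close>
  have vg: "v (ev L g a) = Fin \<delta>"
  proof -
    have c: "ev L g a \<in> carrier L" "dv L g a \<in> carrier L" using gc aB(2) by auto
    have dN: "dv L ?N a = (a \<ominus> z) \<otimes> dv L g a \<oplus> ev L g a"
      unfolding Ng using dv_plin[OF z(1) zero_closed gc aB(2)] c z(1) aB(2) by (simp add: a_comm)
    have "gauss_val v \<gamma>0 g \<le> Fin \<gamma>0 + v (dv L g a)" using gauss_val_dv[OF aB(2) _ gc] \<gamma>0 by simp
    then have "Fin \<gamma>0 + gauss_val v \<gamma>0 g \<le> Fin \<gamma>0 + (Fin \<gamma>0 + v (dv L g a))" by (simp only: Fin_add_le_iff)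
    then have "Fin \<delta> < v ((a \<ominus> z) \<otimes> dv L g a)" using big[OF z(1) c(2) z(3)] gg by (blast intro: order_trans)
    moreover have "ev L g a = dv L ?N a \<oplus> \<ominus> ((a \<ominus> z) \<otimes> dv L g a)"
    proof -
      have "((a \<ominus> z) \<otimes> dv L g a) \<in> carrier L" using c z(1) aB(2) by simp
      then show ?thesis unfolding dN using c(1) by algebra
    qed
    moreover have "dv L ?N a \<in> carrier L" using N(2) aB(2) by (intro dv_closed)
    ultimately show ?thesis
      using v_add_eq[of "dv L ?N a" "\<ominus> ((a \<ominus> z) \<otimes> dv L g a)"] dvN c z(1) aB(2) by simp
  qed
  \<comment> \<open>A root \<open>y\<close> of \<open>g\<close> near \<open>a\<close> would split
    off \<open>a - y\<close> from \<open>g(a)\<close> and push its value above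
    \<open>\<delta>\<close>. The element \<open>y = z\<close> is allowed, so \<open>z\<close> is
    also shown to be a simple root.\<close>
  have unique: False if y: "y \<in> carrier L" "ev L g y = \<zero>" "Fin \<beta> < v (a \<ominus> y)" for y
  proof -
    have "k \<noteq> []" using y(1,2) by (auto simp: g_def)
    then obtain h where h: "set h \<subseteq> carrier L" "g = plin L y \<zero> (h @ [\<one>])"
      using monic_synthetic_division[OF carrier_is_subring y(1) k(1)] y(2) unfolding g_def by blast
    have hc: "set (h @ [\<one>]) \<subseteq> carrier L" using h(1) by simp
    let ?w = "ev L (h @ [\<one>]) a"
    have wc: "?w \<in> carrier L" using ev_closed[OF hc aB(2)] .
    have vy: "v y = Fin \<gamma>0" using v_eq_of_diff[OF aB(2) y(1)] \<gamma>0 le_less_trans[OF \<beta>(2) y(3)] by simp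
    have "gauss_val v \<gamma>0 g \<le> Fin \<gamma>0 + gauss_val v \<gamma>0 (h @ [\<one>])"
      unfolding h(2) using gauss_val_quotient[OF y(1) _ zero_closed hc, of \<gamma>0] vy by simp
    also have "\<dots> \<le> Fin \<gamma>0 + v ?w" using v_ev_ge[OF hc aB(2), of \<gamma>0] \<gamma>0 by (simp only: Fin_add_le_iff order_refl)
    finally have "Fin \<gamma>0 + gauss_val v \<gamma>0 g \<le> Fin \<gamma>0 + (Fin \<gamma>0 + v ?w)" by (simp only: Fin_add_le_iff)
    then have "Fin \<delta> < v ((a \<ominus> y) \<otimes> ?w)" using big[OF y(1) wc y(3)] gg by (blast intro: order_trans)
    moreover have "ev L g a = (a \<ominus> y) \<otimes> ?w"
      unfolding h(2) using ev_plin[OF y(1) zero_closed hc aB(2)] y(1) aB(2) wc by simp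
    ultimately show False using vg by simp
  qed
  have evN: "ev L ?N y = (y \<ominus> z) \<otimes> ev L g y" if "y \<in> carrier L" for y
    unfolding Ng using ev_plin[OF z(1) zero_closed gc that] z(1) that ev_closed[OF gc that] by simp
  have dNz: "dv L ?N z \<noteq> \<zero>"
  proof -
    have "dv L ?N z = ev L g z"
      unfolding Ng using dv_plin[OF z(1) zero_closed gc z(1)] z(1) ev_closed[OF gc z(1)] dv_closed[OF gc z(1)]
      by (simp add: a_minus_def r_neg)
    then show ?thesis using unique[OF z(1) _ z(3)] by auto
  qed
  have zA: "z \<in> A" using algebraic_iff_monic[OF K z(1)] z(1,2) d(4) unfolding mem_algebraic_closure_in by blast
  \<comment> \<open>If \<open>z\<close> were missing, a conjugate \<open>y\<close> of
    \<open>z\<close> over \<open>E\<close> would be another root. Since \<open>a\<close> lies in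
    \<open>E\<close>, the isomorphism sending \<open>z\<close> to \<open>y\<close> fixes
    \<open>a\<close> and preserves \<open>v (a - z)\<close>, which puts \<open>y\<close> near
    \<open>a\<close> as well.\<close>
  have "z \<in> E" if E: "Khx \<subseteq> E" "E \<subseteq> algebraic_closure_in L Khx" "henselian L v E" for E
  proof (rule ccontr)
    assume zE: "z \<notin> E"
    have EL: "subfield E L" using E(3) unfolding henselian_def by blast
    have "a \<in> henselization L v Khx" using a unfolding IC_def by blast
    from this[unfolded mem_henselization, rule_format, OF conjI[OF E(1) conjI[OF E(2,3)]]] have aE: "a \<in> E" .
    have "set ?N \<subseteq> E" using N(1) K_Kh Khx(2) E(1) by blast
    then obtain y where y: "y \<noteq> z" "conjugate L E z y"
      using simple_root_conjugate[OF EL _ z(2) dNz z(1) zE] by blast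
    have yc: "y \<in> carrier L" using y(2) unfolding conjugate_def by blast
    have "ev L ?N y = \<zero>" using y(2) z(2) \<open>set ?N \<subseteq> E\<close> unfolding conjugate_def by blast
    then have "ev L g y = \<zero>" using evN[OF yc] y(1) yc z(1) integral[of "y \<ominus> z" "ev L g y"] ev_closed[OF gc yc] by auto
    moreover have "v (a \<ominus> z) = v (a \<ominus> y)"
    proof -
      interpret V: valued_field L "trivial_val L :: 'a \<Rightarrow> int extended" by (rule trivial_valued_field)
      have alg: "algebraic_closure_in L E = carrier L"
        using algebraic_closure_in_mono[OF E(1)] algebraic_closure_Khx by (auto simp: mem_algebraic_closure_in)
      obtain G where G: "plain_graph L G" "Id_on E \<subseteq> G" "(z, y) \<in> G"
        using conjugate_plain_graph[OF EL _ y(2)] alg z(1) unfolding algebraic_closure_in_def by blast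
      have "(a \<ominus> z, a \<ominus> y) \<in> G" using V.isograph_ops(4)[OF G(1) _ G(3)] G(2) aE by blast
      then show ?thesis using henselian_plain_graph[OF E(3) G(1,2)] alg aB(2) z(1) by simp
    qed
    ultimately show False using unique[OF yc] z(3) by simp
  qed
  then have "z \<in> henselization L v Khx" unfolding mem_henselization by blast
  then have "z \<in> IC L v Kh x" using zA A_B unfolding IC_def by blast
  then have "z \<in> IC L v K x" using IC_descend[OF zA _ N(1) z(2) dNz] by blast
  then show ?thesis using le_less_trans[OF \<beta>(1) z(3)] by blast
qed

end

section \<open>Positive characteristic\<close>

context cring begin

fun nat_elem :: "nat \<Rightarrow> 'a" where
  "nat_elem 0 = \<zero>"
| "nat_elem (Suc n) = nat_elem n \<oplus> \<one>"

lemma nat_elem_closed [simp, intro]: "nat_elem n \<in> carrier R"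
  by (induction n) auto

lemma nat_elem_add: "nat_elem (m + n) = nat_elem m \<oplus> nat_elem n"
  by (induction n) (auto simp: a_assoc)

lemma nat_elem_mult: "nat_elem (m * n) = nat_elem m \<otimes> nat_elem n"
  by (induction n) (auto simp: nat_elem_add r_distr a_comm)

lemma nat_elem_one [simp]: "nat_elem (Suc 0) = \<one>"
  by simp

lemma binomial_expansion:
  assumes a: "a \<in> carrier R" and b: "b \<in> carrier R"
  shows "(a \<oplus> b) [^] n = (\<Oplus>k\<in>{..n}. nat_elem (n choose k) \<otimes> (a [^] k \<otimes> b [^] (n - k)))"
proof (induction n)
  case 0
  show ?case using a b by simp
next
  case (Suc n)
  define t where "t k = a [^] k \<otimes> b [^] (Suc n - k)" for k
  define s where "s k = nat_elem (n choose k) \<otimes> (a [^] k \<otimes> b [^] (n - k))" for k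
  have tc: "t k \<in> carrier R" and sc: "s k \<in> carrier R" for k using a b by (auto simp: t_def s_def)
  have aS: "(\<Oplus>k\<in>{..n}. s k) \<otimes> a = (\<Oplus>k\<in>{..n}. nat_elem (n choose k) \<otimes> t (Suc k))"
    using a b by (subst finsum_ldistr) (auto simp: s_def t_def intro!: finsum_cong' simp: m_ac)
  have "(\<Oplus>k\<in>{..n}. s k) \<otimes> b = (\<Oplus>k\<in>{..n}. s k \<otimes> b)"
    using a b sc by (subst finsum_ldistr) auto
  also have "\<dots> = (\<Oplus>k\<in>{..n}. nat_elem (n choose k) \<otimes> t k)"
  proof (intro finsum_cong')
    fix k assume "k \<in> {..n}"
    then have "Suc n - k = Suc (n - k)" by auto
    then show "s k \<otimes> b = nat_elem (n choose k) \<otimes> t k" using a b by (simp add: s_def t_def m_assoc)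
  qed (use tc in auto)
  \<comment> \<open>The additional index \<open>n + 1\<close> has coefficient 0; it allows index 0
    to be split off so that the remaining range is again \<open>{..n}\<close>.\<close>
  also have "\<dots> = (\<Oplus>k\<in>{..Suc n}. nat_elem (n choose k) \<otimes> t k)"
    using tc by (subst finsum_Suc) (auto simp: binomial_eq_0)
  also have "\<dots> = (\<Oplus>k\<in>{..n}. nat_elem (n choose Suc k) \<otimes> t (Suc k)) \<oplus> t 0"
    using tc by (subst finsum_Suc2) auto
  finally have bS: "(\<Oplus>k\<in>{..n}. s k) \<otimes> b = (\<Oplus>k\<in>{..n}. nat_elem (n choose Suc k) \<otimes> t (Suc k)) \<oplus> t 0" .
  have "(\<Oplus>k\<in>{..Suc n}. nat_elem (Suc n choose k) \<otimes> t k) =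
      (\<Oplus>k\<in>{..n}. nat_elem (Suc n choose Suc k) \<otimes> t (Suc k)) \<oplus> t 0"
    using tc by (subst finsum_Suc2) auto
  also have "(\<Oplus>k\<in>{..n}. nat_elem (Suc n choose Suc k) \<otimes> t (Suc k)) =
      (\<Oplus>k\<in>{..n}. nat_elem (n choose k) \<otimes> t (Suc k) \<oplus> nat_elem (n choose Suc k) \<otimes> t (Suc k))"
    using tc by (intro finsum_cong') (auto simp: nat_elem_add l_distr)
  also have "\<dots> = (\<Oplus>k\<in>{..n}. nat_elem (n choose k) \<otimes> t (Suc k)) \<oplus>
      (\<Oplus>k\<in>{..n}. nat_elem (n choose Suc k) \<otimes> t (Suc k))"
    using tc by (intro finsum_addf) auto
  finally have "(\<Oplus>k\<in>{..Suc n}. nat_elem (Suc n choose k) \<otimes> t k) = (\<Oplus>k\<in>{..n}. s k) \<otimes> a \<oplus> (\<Oplus>k\<in>{..n}. s k) \<otimes> b"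
    unfolding aS bS using tc by (simp add: a_assoc)
  also have "\<dots> = (\<Oplus>k\<in>{..n}. s k) \<otimes> (a \<oplus> b)" using a b sc by (simp add: r_distr)
  also have "(\<Oplus>k\<in>{..n}. s k) = (a \<oplus> b) [^] n" using Suc unfolding s_def by simp
  finally show ?case unfolding t_def by simp
qed

lemma frobenius_add:
  assumes p: "Factorial_Ring.prime p" "nat_elem p = \<zero>" and a: "a \<in> carrier R" and b: "b \<in> carrier R"
  shows "(a \<oplus> b) [^] p = a [^] p \<oplus> b [^] p"
proof -
  obtain q where q: "p = Suc q" using prime_gt_0_nat[OF p(1)] by (cases p) auto
  have q0: "q > 0" using prime_gt_1_nat[OF p(1)] q by simp
  define s where "s k = nat_elem (p choose k) \<otimes> (a [^] k \<otimes> b [^] (p - k))" for k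
  have sc: "s k \<in> carrier R" for k using a b by (auto simp: s_def)
  obtain r where r: "q = Suc r" using q0 by (cases q) auto
  \<comment> \<open>The inner binomial coefficients are divisible by \<open>p\<close>, because
    \<open>k\<close> times \<open>p choose k\<close> is a multiple of \<open>p\<close> while
    \<open>k\<close> itself is not.\<close>
  have "s (Suc k) = \<zero>" if "k \<le> r" for k
  proof -
    have "Suc k * (p choose Suc k) = p * ((p - 1) choose k)" using times_binomial_minus1_eq[of "Suc k" p] by simp
    then have "p dvd Suc k * (p choose Suc k)" by simp
    moreover have "\<not> p dvd Suc k" using that q r by (auto dest: dvd_imp_le)
    ultimately have "p dvd (p choose Suc k)" using prime_dvd_mult_iff[OF p(1)] by blast
    then obtain j where "p choose Suc k = p * j" by blast
    then show ?thesis unfolding s_def using a b p(2) by (simp add: nat_elem_mult)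
  qed
  then have "(\<Oplus>k\<in>{..r}. s (Suc k)) = \<zero>" by (intro add.finprod_one_eqI) auto
  then have "(\<Oplus>k\<in>{..q}. s k) = s 0" unfolding r using sc by (subst finsum_Suc2) auto
  then have "(\<Oplus>k\<in>{..p}. s k) = s p \<oplus> s 0" unfolding q using sc by (subst finsum_Suc) auto
  moreover have "s p = a [^] p" "s 0 = b [^] p" using a b by (auto simp: s_def)
  ultimately show ?thesis using binomial_expansion[OF a b, of p] unfolding s_def by simp
qed

lemma frobenius_iter_add:
  assumes p: "Factorial_Ring.prime p" "nat_elem p = \<zero>" and a: "a \<in> carrier R" and b: "b \<in> carrier R"
  shows "(a \<oplus> b) [^] (p ^ k) = a [^] (p ^ k) \<oplus> b [^] (p ^ k)"
proof (induction k)
  case (Suc k)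
  have *: "c [^] (p ^ Suc k) = (c [^] (p ^ k)) [^] p" if "c \<in> carrier R" for c
    using nat_pow_pow[OF that, of "p ^ k" p] by (simp add: mult.commute)
  show ?case using *[of "a \<oplus> b"] *[OF a] *[OF b] Suc frobenius_add[OF p] a b by simp
qed (use a b in simp)

lemma frobenius_ev:
  assumes p: "Factorial_Ring.prime p" "nat_elem p = \<zero>" and h: "set h \<subseteq> carrier R" and u: "u \<in> carrier R"
  shows "ev R h u [^] p = ev R (map (\<lambda>c. c [^] p) h) (u [^] p)"
  using h
proof (induction h)
  case Nil
  have "p > 0" using prime_gt_0_nat[OF p(1)] .
  then show ?case by (simp add: nat_pow_zero)
next
  case (Cons c h)
  have "ev R h u \<in> carrier R" using Cons.prems u by auto
  then show ?case using Cons frobenius_add[OF p] u by (simp add: nat_pow_distrib)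
qed

text \<open>The coefficients \<open>(k + i) c_i\<close>. For \<open>k = 1\<close> this is the
  derivative of \<open>c # cs\<close> for any \<open>c\<close>; the general \<open>k\<close> is
  needed for the recursion.\<close>

fun der :: "nat \<Rightarrow> 'a list \<Rightarrow> 'a list" where
  "der k [] = []"
| "der k (c # cs) = (nat_elem k \<otimes> c) # der (Suc k) cs"

lemma ev_der:
  "set cs \<subseteq> carrier R \<Longrightarrow> y \<in> carrier R \<Longrightarrow>
     ev R (der k cs) y = nat_elem k \<otimes> ev R cs y \<oplus> y \<otimes> dv R cs y"
proof (induction cs arbitrary: k)
  case (Cons c cs)
  have c: "c \<in> carrier R" "ev R cs y \<in> carrier R" "dv R cs y \<in> carrier R" using Cons.prems by auto
  have e: "nat_elem k \<in> carrier R" by simp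
  show ?case using Cons c e by (simp, algebra)
qed simp

lemma length_der [simp]: "length (der k cs) = length cs"
  by (induction cs arbitrary: k) auto

lemma nat_elem_mem: "subring S R \<Longrightarrow> nat_elem k \<in> S"
  by (induction k) (auto simp: subringE)

lemma set_der: "subring S R \<Longrightarrow> set cs \<subseteq> S \<Longrightarrow> set (der k cs) \<subseteq> S"
  by (induction cs arbitrary: k) (auto simp: subringE nat_elem_mem)

lemma last_der: "cs \<noteq> [] \<Longrightarrow> last (der k cs) = nat_elem (k + length cs - 1) \<otimes> last cs"
proof (induction cs arbitrary: k)
  case (Cons c cs)
  show ?case
  proof (cases "cs = []")
    case False
    then have "der (Suc k) cs \<noteq> []" by (metis length_0_conv length_der)
    then show ?thesis using Cons.IH[OF False, of "Suc k"] False by (simp del: nat_elem.simps)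
  qed simp
qed simp

text \<open>The coefficients of \<open>f (T ^ n)\<close>, for \<open>n > 0\<close>.\<close>

fun stretch :: "nat \<Rightarrow> 'a list \<Rightarrow> 'a list" where
  "stretch n [] = []"
| "stretch n (c # cs) = c # replicate (n - 1) \<zero> @ stretch n cs"

lemma ev_replicate_zero:
  "set l \<subseteq> carrier R \<Longrightarrow> y \<in> carrier R \<Longrightarrow> ev R (replicate k \<zero> @ l) y = y [^] k \<otimes> ev R l y"
  by (induction k) (auto simp: m_ac)

lemma set_stretch: "subring S R \<Longrightarrow> set cs \<subseteq> S \<Longrightarrow> set (stretch n cs) \<subseteq> S"
  by (induction cs) (auto simp: subringE)

lemma ev_stretch:
  assumes n: "n > 0" and y: "y \<in> carrier R"
  shows "set cs \<subseteq> carrier R \<Longrightarrow> ev R (stretch n cs) y = ev R cs (y [^] n)"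
proof (induction cs)
  case (Cons c cs)
  then have "set (stretch n cs) \<subseteq> carrier R" using set_stretch[OF carrier_is_subring] by simp
  moreover have "y \<otimes> y [^] (n - 1) = y [^] n" using n y by (cases n) (simp_all add: m_comm)
  moreover have "ev R cs (y [^] n) \<in> carrier R" using Cons.prems y by auto
  ultimately show ?case using Cons y by (simp add: ev_replicate_zero flip: m_assoc)
qed simp

lemma dv_replicate_zero:
  "set l \<subseteq> carrier R \<Longrightarrow> y \<in> carrier R \<Longrightarrow> dv R (replicate (Suc k) \<zero> @ l) y =
     nat_elem (Suc k) \<otimes> (y [^] k \<otimes> ev R l y) \<oplus> y [^] Suc k \<otimes> dv R l y"
proof (induction k)
  case (Suc k)
  define e d q where "e = ev R l y" and "d = dv R l y" and "q = y [^] k"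
  have c: "e \<in> carrier R" "d \<in> carrier R" "q \<in> carrier R" "nat_elem k \<in> carrier R"
    using Suc.prems by (auto simp: e_def d_def q_def)
  have "dv R (replicate (Suc (Suc k)) \<zero> @ l) y = y [^] Suc k \<otimes> e \<oplus> y \<otimes> dv R (replicate (Suc k) \<zero> @ l) y"
    using Suc.prems ev_replicate_zero[of l y "Suc k"] by (simp add: e_def)
  also have "dv R (replicate (Suc k) \<zero> @ l) y = nat_elem (Suc k) \<otimes> (q \<otimes> e) \<oplus> y [^] Suc k \<otimes> d"
    using Suc by (simp add: e_def d_def q_def)
  finally show ?case unfolding e_def[symmetric] d_def[symmetric] nat_pow_Suc nat_elem.simps q_def[symmetric]
    using c Suc.prems(2) by algebra
qed simp

text \<open>All exponents are multiples of \<open>n\<close>, and \<open>n\<close> vanishes in the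
  ring.\<close>

lemma dv_stretch:
  assumes n: "nat_elem n = \<zero>" "n > 0" and y: "y \<in> carrier R"
  shows "set cs \<subseteq> carrier R \<Longrightarrow> dv R (stretch n cs) y = \<zero>"
proof (induction cs)
  case (Cons c cs)
  then have s: "set (stretch n cs) \<subseteq> carrier R" using set_stretch[OF carrier_is_subring] by simp
  obtain k where k: "n = Suc k" using n by (cases n) auto
  have "dv R (stretch n (c # cs)) y = dv R (replicate n \<zero> @ stretch n cs) y" using k by simp
  also have "\<dots> = \<zero>" unfolding k using dv_replicate_zero[OF s y, of k] Cons n(1) y s
    unfolding k by (simp del: nat_elem.simps replicate.simps)
  finally show ?case .
qed simp

end

context domain begin

lemma prime_characteristic:
  assumes "n > 0" "nat_elem n = \<zero>"
  shows "\<exists>p. Factorial_Ring.prime p \<and> nat_elem p = \<zero>"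
proof -
  define p where "p = (LEAST n. n > 0 \<and> nat_elem n = \<zero>)"
  have p: "p > 0" "nat_elem p = \<zero>" unfolding p_def using LeastI[of "\<lambda>n. n > 0 \<and> nat_elem n = \<zero>" n] assms by auto
  have least: "q \<ge> p" if "q > 0" "nat_elem q = \<zero>" for q unfolding p_def using that by (intro Least_le) simp
  have "p \<noteq> 1" using p(2) by auto
  then have "1 < p" using p(1) by simp
  moreover have "m = 1 \<or> m = p" if md: "m dvd p" for m
  proof -
    obtain k where k: "p = m * k" using md by blast
    then have pos: "m > 0" "k > 0" using p(1) by auto
    have "nat_elem m = \<zero> \<or> nat_elem k = \<zero>"
      using p(2) k nat_elem_mult[of m k] integral[of "nat_elem m" "nat_elem k"] by auto
    then show ?thesis
    proof
      assume "nat_elem m = \<zero>"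
      then have "m * k \<le> m" using least pos(1) k by blast
      then show ?thesis using k pos by (cases k) auto
    next
      assume "nat_elem k = \<zero>"
      then have "m * k \<le> k" using least pos(2) k by blast
      then show ?thesis using k pos by (cases m) auto
    qed
  qed
  ultimately have "Factorial_Ring.prime p" unfolding prime_nat_iff by blast
  then show ?thesis using p by blast
qed

lemma frobenius_iter_inj:
  assumes p: "Factorial_Ring.prime p" "nat_elem p = \<zero>" and a: "a \<in> carrier R" and b: "b \<in> carrier R"
    and eq: "a [^] (p ^ k) = b [^] (p ^ k)"
  shows "a = b"
proof -
  have "a = (a \<ominus> b) \<oplus> b" using a b by algebra
  then have "a [^] (p ^ k) = (a \<ominus> b) [^] (p ^ k) \<oplus> b [^] (p ^ k)"
    using frobenius_iter_add[OF p, of "a \<ominus> b" b k] a b by simp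
  then have w: "(a \<ominus> b) [^] (p ^ k) \<oplus> b [^] (p ^ k) = b [^] (p ^ k)" using eq by simp
  have "w = \<zero>" if "w \<oplus> c = c" "w \<in> carrier R" "c \<in> carrier R" for w c
  proof -
    have "w = (w \<oplus> c) \<ominus> c" using that(2,3) by algebra
    then show ?thesis using that(1,3) by (simp add: a_minus_def r_neg)
  qed
  from this[OF w] have "(a \<ominus> b) [^] (p ^ k) = \<zero>" using a b by simp
  then have "a \<ominus> b = \<zero>"
  proof (rule contrapos_pp)
    assume "a \<ominus> b \<noteq> \<zero>"
    then have "(a \<ominus> b) [^] n \<noteq> \<zero>" for n :: nat
      using a b by (induction n) (auto simp: integral_iff)
    then show "(a \<ominus> b) [^] (p ^ k) \<noteq> \<zero>" .
  qed
  then show ?thesis using a b by simp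
qed

end

section \<open>Separability\<close>

lemma (in cring) subring_pow: "subring S R \<Longrightarrow> u \<in> S \<Longrightarrow> u [^] (n :: nat) \<in> S"
  by (induction n) (auto simp: subringE)

lemma (in cring) simple_extension_iff_ev:
  assumes F: "F \<subseteq> carrier R" and u: "u \<in> carrier R"
  shows "a \<in> simple_extension F u \<longleftrightarrow> (\<exists>h. set h \<subseteq> F \<and> a = ev R h u)"
proof
  assume "a \<in> simple_extension F u"
  then show "\<exists>h. set h \<subseteq> F \<and> a = ev R h u"
  proof induction
    case zero
    show ?case by (intro exI[of _ "[]"]) simp
  next
    case (lin k1 k2)
    then obtain h where h: "set h \<subseteq> F" "k1 = ev R h u" by blast
    have "ev R h u \<in> carrier R" using h F u by auto
    then have "k1 \<otimes> u \<oplus> k2 = ev R (k2 # h) u" using h lin(2) F u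
      by (simp add: m_comm[of _ u] a_comm subset_iff)
    then show ?case using h lin(2) by (intro exI[of _ "k2 # h"]) auto
  qed
next
  assume "\<exists>h. set h \<subseteq> F \<and> a = ev R h u"
  then obtain h where h: "set h \<subseteq> F" "a = ev R h u" by blast
  have "ev R h u \<in> simple_extension F u" using h(1)
  proof (induction h)
    case (Cons c h)
    then have c: "ev R h u \<in> carrier R" "c \<in> carrier R" "c \<in> F" using F u by auto
    have "ev R h u \<otimes> u \<oplus> c \<in> simple_extension F u" using Cons c by (intro simple_extension.lin) auto
    then show ?case using c u by (simp add: m_comm a_comm)
  qed simp
  then show "a \<in> simple_extension F u" using h by simp
qed

context field begin

text \<open>The derivative of the minimal polynomial vanishes at \<open>a\<close> and has smaller
  degree, so all its coefficients are zero. Its leading coefficient is the degree of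
  \<open>a\<close>, taken in the field.\<close>

lemma inseparable_characteristic:
  assumes F: "subfield F R" and a: "a \<in> carrier R" "(algebraic over F) a"
    and insep: "\<And>f. set f \<subseteq> F \<Longrightarrow> ev R f a = \<zero> \<Longrightarrow> dv R f a = \<zero>"
  shows "\<exists>n>0. nat_elem n = \<zero>"
proof -
  have one: "\<one> \<in> F" using subringE(3)[OF subfieldE(1)[OF F]] .
  obtain k where k: "set k \<subseteq> F" "ev R (k @ [\<one>]) a = \<zero>" using algebraic_iff_monic[OF F a(1)] a(2) by blast
  obtain m where min: "minimal_poly R F a m"
    using minimal_poly_exists[OF F a(1) _ monic_nonzero k(2)] k(1) one by auto
  then have m: "set (m @ [\<one>]) \<subseteq> F" "ev R (m @ [\<one>]) a = \<zero>" using one by (auto simp: minimal_poly_def)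
  then have "m \<noteq> []" using a by auto
  then obtain c cs where cs: "m @ [\<one>] = c # cs" "length cs = length m" "cs \<noteq> []" "last cs = \<one>"
    by (cases m) auto
  have csF: "set cs \<subseteq> F" "set cs \<subseteq> carrier R" using m(1) cs(1) subfieldE(3)[OF F] by auto
  have c: "ev R cs a \<in> carrier R" "dv R cs a \<in> carrier R" using csF(2) a(1) by auto
  have "ev R (der 1 cs) a = dv R (m @ [\<one>]) a" unfolding cs(1) using ev_der[OF csF(2) a(1), of 1] c by simp
  then have "ev R (der 1 cs) a = \<zero>" using insep[OF m] by simp
  then have "set (der 1 cs) \<subseteq> {\<zero>}"
    using min set_der[OF subfieldE(1)[OF F] csF(1), of 1] cs(2) unfolding minimal_poly_def by simp
  moreover have "last (der 1 cs) \<in> set (der 1 cs)" using cs(3) by (metis last_in_set length_0_conv length_der)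
  ultimately have "nat_elem (length cs) = \<zero>" using last_der[OF cs(3), of 1] cs(4) by auto
  then show ?thesis using cs(3) by blast
qed

text \<open>If \<open>a = h(a^p)\<close>, then \<open>a\<close> is a root of
  \<open>h(T^p) - T\<close>, whose derivative is the constant \<open>- 1\<close>.\<close>

lemma simple_root_of_power:
  assumes F: "subfield F R" and a: "a \<in> carrier R" and p: "nat_elem p = \<zero>" "p > 0"
    and mem: "a \<in> simple_extension F (a [^] p)"
  shows "\<exists>f. set f \<subseteq> F \<and> ev R f a = \<zero> \<and> dv R f a \<noteq> \<zero>"
proof -
  have FR: "F \<subseteq> carrier R" using subfieldE(3)[OF F] .
  note S = subfieldE(1)[OF F]
  obtain h where h: "set h \<subseteq> F" "a = ev R h (a [^] p)"
    using mem simple_extension_iff_ev[OF FR, of "a [^] p" a] a by auto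
  have hc: "set h \<subseteq> carrier R" using h(1) FR by blast
  have sF: "set (stretch p h) \<subseteq> F" using set_stretch[OF S h(1)] .
  have lF: "set [\<zero>, \<ominus> \<one>] \<subseteq> F" using subringE(2,3,5)[OF S] by auto
  let ?f = "padd R (stretch p h) [\<zero>, \<ominus> \<one>]"
  have sc: "set (stretch p h) \<subseteq> carrier R" "set [\<zero>, \<ominus> \<one>] \<subseteq> carrier R" using sF FR by auto
  have "ev R ?f a = a \<oplus> \<ominus> a"
    using ev_padd[OF sc a] ev_stretch[OF p(2) a hc] h(2) a by (simp add: r_minus)
  moreover have "dv R ?f a = \<ominus> \<one>"
    using dv_padd[OF sc a] dv_stretch[OF p a hc] a by simp
  moreover have "\<ominus> \<one> \<noteq> \<zero>" using one_not_zero by (metis minus_minus minus_zero one_closed)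
  ultimately show ?thesis using set_padd[OF S sF lF] a by (intro exI[of _ ?f]) (simp add: r_neg)
qed

text \<open>Write \<open>y\<close> as a fraction \<open>f(x) / g(x)\<close> over \<open>N\<close>.
  Then \<open>f - y g\<close> has coefficients in \<open>B\<close> and vanishes at the
  transcendental \<open>x\<close>, so it is zero coefficientwise, and comparison at a nonzero
  coefficient of \<open>g\<close> exhibits \<open>y\<close> as a fraction of elements of
  \<open>N\<close>.\<close>

lemma mem_of_adjoin_transcendental:
  assumes N: "subfield N R" and B: "subfield B R" "N \<subseteq> B" and x: "x \<in> carrier R"
    and trans: "\<And>f. set f \<subseteq> B \<Longrightarrow> ev R f x = \<zero> \<Longrightarrow> set f \<subseteq> {\<zero>}"
    and y: "y \<in> adjoin R N x" "y \<in> B"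
  shows "y \<in> N"
proof -
  note S = subfieldE(1)[OF N]
  have NR: "N \<subseteq> carrier R" using subfieldE(3)[OF N] .
  have ec: "ev R f x \<in> carrier R" if "set f \<subseteq> N" for f using that NR x by auto
  \<comment> \<open>The fractions of polynomials in \<open>x\<close> form a subfield; as it contains
    \<open>N\<close> and \<open>x\<close>, it contains everything in
    \<open>adjoin R N x\<close>.\<close>
  define Q where "Q = {q \<in> carrier R. \<exists>f g. set f \<subseteq> N \<and> set g \<subseteq> N \<and> ev R g x \<noteq> \<zero> \<and> q \<otimes> ev R g x = ev R f x}"
  have QI: "q \<in> Q" if "q \<in> carrier R" "set f \<subseteq> N" "set g \<subseteq> N" "ev R g x \<noteq> \<zero>" "q \<otimes> ev R g x = ev R f x" for q f g
    using that unfolding Q_def by blast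
  have one: "set [\<one>] \<subseteq> N" "ev R [\<one>] x = \<one>" using subringE(3)[OF S] x by auto
  have "subfield Q R"
  proof (rule subfieldI')
    show "subring Q R"
    proof (rule subringI)
      show "Q \<subseteq> carrier R" unfolding Q_def by blast
      show "\<one> \<in> Q" by (rule QI[OF _ one(1) one(1)]) (use one in auto)
    next
      fix q assume "q \<in> Q"
      then obtain f g where q: "q \<in> carrier R" "set f \<subseteq> N" "set g \<subseteq> N" "ev R g x \<noteq> \<zero>" "q \<otimes> ev R g x = ev R f x"
        unfolding Q_def by blast
      have o: "\<ominus> \<one> \<in> N" using subringE(3,5)[OF S] by auto
      have fc: "set f \<subseteq> carrier R" using q(2) NR by blast
      show "\<ominus> q \<in> Q"
        by (rule QI[OF _ set_smult[OF S o q(2)] q(3,4)])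
          (use q ec[OF q(2)] ec[OF q(3)] x fc in \<open>simp_all add: ev_smult l_minus\<close>)
    next
      fix q q' assume "q \<in> Q" "q' \<in> Q"
      then obtain f g f' g' where q: "q \<in> carrier R" "set f \<subseteq> N" "set g \<subseteq> N" "ev R g x \<noteq> \<zero>" "q \<otimes> ev R g x = ev R f x"
        and q': "q' \<in> carrier R" "set f' \<subseteq> N" "set g' \<subseteq> N" "ev R g' x \<noteq> \<zero>" "q' \<otimes> ev R g' x = ev R f' x"
        unfolding Q_def by blast
      have c: "set f \<subseteq> carrier R" "set g \<subseteq> carrier R" "set f' \<subseteq> carrier R" "set g' \<subseteq> carrier R"
        using q q' NR by blast+
      note e = ec[OF q(2)] ec[OF q(3)] ec[OF q'(2)] ec[OF q'(3)]
      have gg: "set (pmul R g g') \<subseteq> N" "ev R (pmul R g g') x = ev R g x \<otimes> ev R g' x"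
        using set_pmul[OF S q(3) q'(3)] ev_pmul[OF c(2,4) x] by auto
      have nz: "ev R (pmul R g g') x \<noteq> \<zero>" using gg(2) q(4) q'(4) e integral by auto
      show "q \<otimes> q' \<in> Q"
      proof (rule QI[OF _ set_pmul[OF S q(2) q'(2)] gg(1) nz])
        have "q \<otimes> q' \<otimes> (ev R g x \<otimes> ev R g' x) = (q \<otimes> ev R g x) \<otimes> (q' \<otimes> ev R g' x)"
          using q(1) q'(1) e by algebra
        then show "q \<otimes> q' \<otimes> ev R (pmul R g g') x = ev R (pmul R f f') x"
          unfolding gg(2) ev_pmul[OF c(1,3) x] q(5) q'(5) .
      qed (use q(1) q'(1) in simp)
      have l: "set (pmul R f g') \<subseteq> N" "set (pmul R f' g) \<subseteq> N"
        using set_pmul[OF S q(2) q'(3)] set_pmul[OF S q'(2) q(3)] by auto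
      then have lc: "set (pmul R f g') \<subseteq> carrier R" "set (pmul R f' g) \<subseteq> carrier R" using NR by blast+
      show "q \<oplus> q' \<in> Q"
      proof (rule QI[OF _ set_padd[OF S l] gg(1) nz])
        have "(q \<oplus> q') \<otimes> (ev R g x \<otimes> ev R g' x) = (q \<otimes> ev R g x) \<otimes> ev R g' x \<oplus> (q' \<otimes> ev R g' x) \<otimes> ev R g x"
          using q(1) q'(1) e by algebra
        then show "(q \<oplus> q') \<otimes> ev R (pmul R g g') x = ev R (padd R (pmul R f g') (pmul R f' g)) x"
          unfolding gg(2) ev_padd[OF lc x] ev_pmul[OF c(1,4) x] ev_pmul[OF c(3,2) x] q(5) q'(5) .
      qed (use q(1) q'(1) in simp)
    qed
    fix q assume "q \<in> Q - {\<zero>}"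
    then obtain f g where q: "q \<in> carrier R" "set f \<subseteq> N" "set g \<subseteq> N" "ev R g x \<noteq> \<zero>" "q \<otimes> ev R g x = ev R f x" "q \<noteq> \<zero>"
      unfolding Q_def by blast
    have i: "inv q \<in> carrier R" "inv q \<otimes> q = \<one>" using q field_Units by auto
    have "ev R f x \<noteq> \<zero>" using q integral ec[OF q(3)] by metis
    moreover have "inv q \<otimes> ev R f x = ev R g x"
      unfolding q(5)[symmetric] using i q(1) ec[OF q(3)] by (simp flip: m_assoc)
    ultimately show "inv q \<in> Q" using QI[OF i(1) q(3,2)] by blast
  qed
  moreover have "N \<subseteq> Q"
  proof
    fix n assume "n \<in> N"
    then have n: "set [n] \<subseteq> N" "n \<in> carrier R" using NR by auto
    show "n \<in> Q" by (rule QI[OF n(2) n(1) one(1)]) (use n one x in auto)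
  qed
  moreover have "x \<in> Q"
  proof (rule QI[OF x _ one(1)])
    show "set [\<zero>, \<one>] \<subseteq> N" using subringE(2,3)[OF S] by auto
  qed (use one x in auto)
  ultimately have "y \<in> Q" using adjoin_subfield(4)[OF N x] y(1) by blast
  then obtain f g where q: "y \<in> carrier R" "set f \<subseteq> N" "set g \<subseteq> N" "ev R g x \<noteq> \<zero>" "y \<otimes> ev R g x = ev R f x"
    unfolding Q_def by blast
  let ?h = "padd R f (map ((\<otimes>) (\<ominus> y)) g)"
  have yB: "\<ominus> y \<in> B" "\<ominus> y \<in> carrier R" using subringE(5)[OF subfieldE(1)[OF B(1)]] y(2) q(1) by auto
  have cc: "set f \<subseteq> carrier R" "set g \<subseteq> carrier R" using q NR by blast+
  have gB: "set (map ((\<otimes>) (\<ominus> y)) g) \<subseteq> B"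
    using set_smult[OF subfieldE(1)[OF B(1)] yB(1)] q(3) B(2) by blast
  then have hB: "set ?h \<subseteq> B" using set_padd[OF subfieldE(1)[OF B(1)]] q(2) B(2) by blast
  have "ev R ?h x = ev R f x \<oplus> \<ominus> y \<otimes> ev R g x"
    using ev_padd[OF cc(1) _ x] gB subfieldE(3)[OF B(1)] ev_smult[OF yB(2) cc(2) x] by auto
  also have "\<dots> = \<zero>" using q(5)[symmetric] q(1) ec[OF q(3)] by (simp add: l_minus r_neg)
  finally have h0: "set ?h \<subseteq> {\<zero>}" using trans[OF hB] by blast
  have "\<not> set g \<subseteq> {\<zero>}" using q(4) ev_all_zero x by blast
  \<comment> \<open>Induction on \<open>f\<close> searches for the first nonzero coefficient of
    \<open>g\<close>. If \<open>f\<close> ends before it, that coefficient times \<open>- y\<close>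
    is zero, so \<open>y = 0\<close>.\<close>
  then show "y \<in> N" using h0 q(2,3)
  proof (induction f arbitrary: g)
    case Nil
    then obtain c where c: "c \<in> set g" "c \<noteq> \<zero>" by auto
    then have "\<ominus> y \<otimes> c \<in> {\<zero>}" using Nil.prems(2) by auto
    then have "\<ominus> y = \<zero>" using integral[of "\<ominus> y" c] c Nil.prems(4) NR yB(2) by blast
    then have "y = \<zero>" using q(1) by (metis minus_minus minus_zero)
    then show ?case using subringE(2)[OF S] by simp
  next
    case (Cons a f)
    then obtain b g' where g: "g = b # g'" by (cases g) auto
    have ab: "a \<oplus> \<ominus> y \<otimes> b = \<zero>" "a \<in> N" "b \<in> N" "a \<in> carrier R" "b \<in> carrier R" using Cons.prems NR unfolding g by auto
    show ?case
    proof (cases "b = \<zero>")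
      case True
      then have "\<not> set g' \<subseteq> {\<zero>}" using Cons.prems(1) g by auto
      then show ?thesis using Cons.IH[of g'] Cons.prems g by auto
    next
      case False
      have i: "inv b \<in> N" "b \<otimes> inv b = \<one>" using subfield_m_inv(1,2)[OF N, of b] ab False by auto
      have ic: "inv b \<in> carrier R" using i NR by blast
      have "y \<otimes> b = a"
      proof -
        have "y \<otimes> b = a \<ominus> (a \<oplus> \<ominus> y \<otimes> b)" using ab(4,5) q(1) by algebra
        then show ?thesis using ab by (simp add: a_minus_def)
      qed
      then have "a \<otimes> inv b = y \<otimes> (b \<otimes> inv b)" using m_assoc[OF q(1) ab(5) ic] by simp
      then have "y = a \<otimes> inv b" using i q(1) by simp
      then show ?thesis using subringE(6)[OF S ab(2) i(1)] by simp
    qed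
  qed
qed

text \<open>As \<open>u\<close> and \<open>w = u^p\<close> generate the same field, the powers of
  \<open>w\<close> below the degree \<open>d\<close> are independent over \<open>M\<close>. Write
  \<open>a\<close> as the sum of \<open>c_i u^i\<close>. Then \<open>a^p\<close> is the sum of
  \<open>c_i^p w^i\<close>; since it lies in \<open>M\<close>, all \<open>c_i^p\<close> with
  \<open>i > 0\<close> vanish, and \<open>a = c_0\<close>.\<close>

lemma equal_degree_coefficients:
  assumes M: "subfield M R" and u: "u \<in> carrier R" "(algebraic over M) u"
    and p: "Factorial_Ring.prime p" "nat_elem p = \<zero>" and sep: "u \<in> simple_extension M (u [^] p)"
    and a: "a \<in> simple_extension M u" "a [^] p \<in> M"
  shows "a \<in> M"
proof -
  let ?w = "u [^] p"
  note S = subfieldE(1)[OF M]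
  have MR: "M \<subseteq> carrier R" using subfieldE(3)[OF M] .
  have w: "?w \<in> carrier R" using u by simp
  have Su: "subring (simple_extension M u) R" and Sw: "subring (simple_extension M ?w) R"
    using simple_extension_is_subring[OF S] u(1) w by auto
  have wu: "?w \<in> simple_extension M u"
    using simple_extension_mem[OF S u(1)] subring_pow[OF Su] by auto
  have eq: "simple_extension M ?w = simple_extension M u"
    using simple_extension_subring_incl[OF Su simple_extension_incl[OF MR u(1)] wu]
      simple_extension_subring_incl[OF Sw simple_extension_incl[OF MR w] sep] by blast
  have walg: "(algebraic over M) ?w" using simple_extesion_mem_imp_algebraic[OF M u wu] .
  define d where "d = degree (Irr M u)"
  have d: "degree (Irr M ?w) = d"
    using dimension_is_inj[OF M dimension_simple_extension[OF M w walg]] dimension_simple_extension[OF M u]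
    unfolding eq d_def by blast
  have ind: "independent M (exp_base ?w d)" using exp_base_independent[OF M w walg] unfolding d .
  have "a \<in> Span M (exp_base u d)" using a(1) Span_exp_base[OF M u] unfolding d_def by blast
  then obtain Ks where Ks: "set Ks \<subseteq> M" "length Ks = d" "a = combine Ks (exp_base u d)"
    using Span_mem_iff_length_version[OF M exp_base_closed[OF u(1)]] by (auto simp: exp_base_def)
  have Kc: "set Ks \<subseteq> carrier R" using Ks(1) MR by blast
  have aK: "a = ev R (rev Ks) u"
    using combine_eq_eval[of Ks u] ev_eq_eval[of "rev Ks" u] Ks Kc u by simp
  show "a \<in> M"
  proof (cases "rev Ks")
    case Nil
    then show ?thesis using aK subringE(2)[OF S] by simp
  next
    case (Cons c h)
    have ch: "c \<in> M" "set h \<subseteq> M" using Ks(1) Cons by (metis insert_subset list.set(2) set_rev)+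
    then have chc: "c \<in> carrier R" "set h \<subseteq> carrier R" using MR by auto
    let ?h = "map (\<lambda>c. c [^] p) h"
    have hM: "set ?h \<subseteq> M" using ch(2) subring_pow[OF S] by auto
    then have hc: "set ?h \<subseteq> carrier R" using MR by blast
    have ac: "a \<in> carrier R" unfolding aK using Kc u by auto
    have cp: "c [^] p \<in> M" "c [^] p \<in> carrier R" using subring_pow[OF S ch(1)] chc by auto
    \<comment> \<open>The relation \<open>a^p = h(w)\<close>, with \<open>a^p\<close> moved into the
      constant coefficient; independence kills every coefficient of it.\<close>
    let ?W = "(c [^] p \<ominus> a [^] p) # ?h"
    have WM: "set ?W \<subseteq> M" using hM cp(1) a(2) subringE(5,7)[OF S] by (simp add: a_minus_def)
    have ap: "a [^] p = c [^] p \<oplus> ?w \<otimes> ev R ?h ?w"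
      using frobenius_ev[OF p, of "c # h" u] chc u aK Cons by simp
    have "ev R ?h ?w \<in> carrier R" using hc w by auto
    then have "?w \<otimes> ev R ?h ?w \<in> carrier R" using w by simp
    moreover have "s \<ominus> (s \<oplus> t) \<oplus> t = \<zero>" if "s \<in> carrier R" "t \<in> carrier R" for s t
      using that by algebra
    ultimately have W0: "ev R ?W ?w = \<zero>" unfolding ev.simps ap using cp(2) by blast
    have Wc: "set ?W \<subseteq> carrier R" using WM MR by blast
    have len: "length (rev ?W) = d" using Ks(2) Cons by (metis length_Cons length_map length_rev)
    have "combine (rev ?W) (exp_base ?w d) = \<zero>"
      using combine_eq_eval[of "rev ?W" ?w] ev_eq_eval[OF Wc w] W0 len by (metis)
    then have "set (take (length (exp_base ?w d)) (rev ?W)) \<subseteq> {\<zero>}"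
      using independent_imp_trivial_combine[OF M ind, of "rev ?W"] WM by simp
    moreover have "length (exp_base ?w d) = d" by (simp add: exp_base_def)
    ultimately have "set ?h \<subseteq> {\<zero>}" using len by (metis dual_order.refl insert_subset list.set(2) set_rev take_all_iff)
    have "set h \<subseteq> {\<zero>}"
    proof
      fix b assume b: "b \<in> set h"
      then have "b [^] p = \<zero>" using \<open>set ?h \<subseteq> {\<zero>}\<close> by auto
      then have "b [^] (p ^ 1) = \<zero> [^] (p ^ 1)" using prime_gt_0_nat[OF p(1)] by (simp add: nat_pow_zero)
      then show "b \<in> {\<zero>}" using frobenius_iter_inj[OF p, of b \<zero> 1] b chc by auto
    qed
    then have "a = c" using aK Cons ev_all_zero u chc by simp
    then show ?thesis using ch by simp
  qed
qed

lemma subfield_Union_chain: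
  assumes "C \<noteq> {}" "subset.chain \<A> C" "\<And>T. T \<in> C \<Longrightarrow> subfield T R"
  shows "subfield (\<Union>C) R"
proof (rule subfieldI')
  have S: "subring T R" if "T \<in> C" for T using subfieldE(1)[OF assms(3)[OF that]] .
  show "subring (\<Union>C) R"
  proof (rule subringI)
    show "\<Union>C \<subseteq> carrier R" using subringE(1)[OF S] by (rule Union_least)
    show "\<one> \<in> \<Union>C" using S subringE(3) assms(1) by (metis UnionI ex_in_conv)
  next
    fix a assume "a \<in> \<Union>C"
    then obtain T where "T \<in> C" "a \<in> T" by blast
    then show "\<ominus> a \<in> \<Union>C" using S[of T] subringE(5)[of T] by (metis UnionI)
  next
    fix a b assume "a \<in> \<Union>C" "b \<in> \<Union>C"
    then obtain T where T: "T \<in> C" "a \<in> T" "b \<in> T" using assms(2) unfolding subset.chain_def by blast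
    show "a \<otimes> b \<in> \<Union>C" "a \<oplus> b \<in> \<Union>C" using T(1) subringE(6,7)[OF S[OF T(1)] T(2,3)] by blast+
  qed
  fix a assume "a \<in> \<Union>C - {\<zero>}"
  then obtain T where T: "T \<in> C" "a \<in> T" "a \<noteq> \<zero>" by blast
  then show "inv a \<in> \<Union>C" using subfield_m_inv(1)[OF assms(3)[OF T(1)], of a] by blast
qed

end

section \<open>Henselian fields avoiding an inseparable element\<close>

context valued_closed begin

text \<open>
  A maximal field \<open>T\<close> over which \<open>a\<close> stays inseparable is separably closed, hence henselian,
  since every element of \<open>L\<close> is purely inseparable over \<open>T\<close>.
\<close>

lemma henselian_avoiding_inseparable:
  assumes p: "Factorial_Ring.prime p" "nat_elem p = \<zero>"
    and T0: "subfield T0 L" and alg: "\<And>y. y \<in> carrier L \<Longrightarrow> (algebraic over T0) y"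
    and a: "a \<in> carrier L" "a \<notin> simple_extension T0 (a [^] p)"
  shows "\<exists>T. T0 \<subseteq> T \<and> henselian L v T \<and> a \<notin> T"
proof -
  define \<A> where "\<A> = {T. subfield T L \<and> T0 \<subseteq> T \<and> a \<notin> simple_extension T (a [^] p)}"
  have ap: "a [^] p \<in> carrier L" using a by simp
  have "\<exists>M\<in>\<A>. \<forall>N\<in>\<A>. M \<subseteq> N \<longrightarrow> N = M"
  proof (rule subset_Zorn_nonempty)
    show "\<A> \<noteq> {}" using T0 a unfolding \<A>_def by blast
    fix C assume C: "C \<noteq> {}" "subset.chain \<A> C"
    have CA: "T \<in> \<A>" if "T \<in> C" for T using C(2) that unfolding subset.chain_def by blast
    have sub: "subfield (\<Union>C) L" using subfield_Union_chain[OF C] CA unfolding \<A>_def by blast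
    have "a \<notin> simple_extension (\<Union>C) (a [^] p)"
    proof
      assume "a \<in> simple_extension (\<Union>C) (a [^] p)"
      then obtain h where h: "set h \<subseteq> \<Union>C" "a = ev L h (a [^] p)"
        using simple_extension_iff_ev[OF subfieldE(3)[OF sub] ap] by blast
      obtain T where T: "T \<in> C" "set h \<subseteq> T" using finite_subset_Union_chain[OF _ h(1) C] by blast
      have "subfield T L" using CA[OF T(1)] unfolding \<A>_def by blast
      then have "a \<in> simple_extension T (a [^] p)"
        using simple_extension_iff_ev[OF subfieldE(3) ap] T(2) h(2) by blast
      then show False using CA[OF T(1)] unfolding \<A>_def by blast
    qed
    moreover have "T0 \<subseteq> \<Union>C" using C(1) CA unfolding \<A>_def by blast
    ultimately show "\<Union>C \<in> \<A>" using sub unfolding \<A>_def by blast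
  qed
  then obtain T where TA: "T \<in> \<A>" and max: "\<And>N. N \<in> \<A> \<Longrightarrow> T \<subseteq> N \<Longrightarrow> N = T" by blast
  have T: "subfield T L" "T0 \<subseteq> T" "a \<notin> simple_extension T (a [^] p)" using TA unfolding \<A>_def by auto
  have TL: "T \<subseteq> carrier L" using subfieldE(3)[OF T(1)] .
  have algT: "(algebraic over E) y" if "T \<subseteq> E" "y \<in> carrier L" for E y
    using algebraic_mono[of T0 E] T(2) that alg by blast
  \<comment> \<open>Adjoining a \<open>u\<close> outside \<open>T\<close> would leave the family, so
    \<open>a\<close> lies in \<open>T(u)(a^p)\<close>, hence in \<open>M(u)\<close> for
    \<open>M = T(a^p)\<close>. Since \<open>u\<close> lies in \<open>M(u^p)\<close> and
    \<open>a^p\<close> in \<open>M\<close>, the preceding lemma puts \<open>a\<close> into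
    \<open>M\<close>, against the choice of \<open>T\<close>.\<close>
  have sep: "u \<in> T" if u: "u \<in> carrier L" "u \<in> simple_extension T (u [^] p)" for u
  proof (rule ccontr)
    assume uT: "u \<notin> T"
    let ?U = "simple_extension T u"
    have U: "subfield ?U L" "T \<subseteq> ?U" "u \<in> ?U"
      using simple_extension_is_subfield[OF T(1) u(1)] algT[OF order_refl u(1)] simple_extension_incl[OF TL u(1)]
        simple_extension_mem[OF subfieldE(1)[OF T(1)] u(1)] by auto
    then have "?U \<noteq> T" using uT by blast
    then have "?U \<notin> \<A>" using max U(2) by blast
    then have aU: "a \<in> simple_extension ?U (a [^] p)" using U T(2) unfolding \<A>_def by blast
    let ?M = "simple_extension T (a [^] p)"
    have M: "subfield ?M L" "T \<subseteq> ?M" "a [^] p \<in> ?M"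
      using simple_extension_is_subfield[OF T(1) ap] algT[OF order_refl ap] simple_extension_incl[OF TL ap]
        simple_extension_mem[OF subfieldE(1)[OF T(1)] ap] by auto
    have M_carr: "?M \<subseteq> carrier L" using subfieldE(3)[OF M(1)] .
    let ?MU = "simple_extension ?M u"
    have MU: "subring ?MU L" "?M \<subseteq> ?MU" "u \<in> ?MU"
      using simple_extension_is_subring[OF subfieldE(1)[OF M(1)] u(1)] simple_extension_incl[OF M_carr u(1)]
        simple_extension_mem[OF subfieldE(1)[OF M(1)] u(1)] by auto
    have "?U \<subseteq> ?MU" using simple_extension_subring_incl[OF MU(1) _ MU(3)] M(2) MU(2) by blast
    then have "simple_extension ?U (a [^] p) \<subseteq> ?MU"
      using simple_extension_subring_incl[OF MU(1), of ?U "a [^] p"] M(3) MU(2) by blast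
    then have aMU: "a \<in> ?MU" using aU by blast
    have "u \<in> simple_extension ?M (u [^] p)" using u(2) mono_simple_extension[OF M(2)] by blast
    then have "a \<in> ?M"
      by (rule equal_degree_coefficients[OF M(1) u(1) algT[OF M(2) u(1)] p _ aMU M(3)])
    then show False using T(3) by blast
  qed
  \<comment> \<open>Take \<open>k\<close> such that \<open>y^(p^k)\<close> has least degree over
    \<open>T\<close>. Then one more power \<open>p\<close> generates the same field, so
    \<open>y^(p^k)\<close> satisfies the condition of \<open>sep\<close>.\<close>
  have pow_mem: "\<exists>k. y [^] (p ^ k) \<in> T" if y: "y \<in> carrier L" for y
  proof -
    define D where "D k = degree (Irr T (y [^] (p ^ k)))" for k :: nat
    obtain k where k: "\<And>j. D k \<le> D j" using ex_has_least_nat[of "\<lambda>_. True" 0 D] by auto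
    let ?u = "y [^] (p ^ k)"
    have u: "?u \<in> carrier L" using y by simp
    have upk: "?u [^] p = y [^] (p ^ Suc k)" using nat_pow_pow[OF y, of "p ^ k" p] by (simp add: mult.commute)
    have w: "?u [^] p \<in> carrier L" using u by simp
    note algu = algT[OF order_refl u] and algw = algT[OF order_refl w]
    have dims: "dimension (D k) T (simple_extension T ?u)" "dimension (D (Suc k)) T (simple_extension T (?u [^] p))"
      using dimension_simple_extension[OF T(1) u algu] dimension_simple_extension[OF T(1) w algw]
      unfolding D_def upk by auto
    have Su: "subring (simple_extension T ?u) L" using simple_extension_is_subring[OF subfieldE(1)[OF T(1)] u] .
    have wu: "?u [^] p \<in> simple_extension T ?u"
      using subring_pow[OF Su simple_extension_mem[OF subfieldE(1)[OF T(1)] u]] .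
    have incl: "simple_extension T (?u [^] p) \<subseteq> simple_extension T ?u"
      using simple_extension_subring_incl[OF Su simple_extension_incl[OF TL u] wu] .
    have ind: "independent T (exp_base (?u [^] p) (D (Suc k)))"
      using exp_base_independent[OF T(1) w algw] unfolding D_def upk .
    have span: "Span T (exp_base (?u [^] p) (D (Suc k))) = simple_extension T (?u [^] p)"
      using Span_exp_base[OF T(1) w algw] unfolding D_def upk .
    have "set (exp_base (?u [^] p) (D (Suc k))) \<subseteq> Span T (exp_base (?u [^] p) (D (Suc k)))"
      by (rule Span_base_incl[OF T(1) exp_base_closed[OF w]])
    then have "set (exp_base (?u [^] p) (D (Suc k))) \<subseteq> simple_extension T (?u [^] p)" unfolding span .
    then have sub: "set (exp_base (?u [^] p) (D (Suc k))) \<subseteq> simple_extension T ?u" using incl by blast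
    have len: "length (exp_base (?u [^] p) (D (Suc k))) = D (Suc k)" by (simp add: exp_base_def)
    have "D (Suc k) \<le> D k"
      using independent_length_le_dimension[OF T(1) dims(1) ind sub] unfolding len .
    then have "D (Suc k) = D k" using k[of "Suc k"] by simp
    then have "simple_extension T (?u [^] p) = simple_extension T ?u"
      using independent_length_eq_dimension[OF T(1) dims(1) ind sub] unfolding len span by simp
    then have "?u \<in> simple_extension T (?u [^] p)" using simple_extension_mem[OF subfieldE(1)[OF T(1)] u] by simp
    then show ?thesis using sep[OF u] by blast
  qed
  have "henselian L v T"
  proof (rule henselianI[OF T(1)])
    fix y y' assume y: "y \<in> algebraic_closure_in L T" and conj: "conjugate L T y y'"
    have yc: "y \<in> carrier L" "y' \<in> carrier L" using conj unfolding conjugate_def by auto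
    obtain k where k: "y [^] (p ^ k) \<in> T" using pow_mem yc by blast
    let ?u = "y [^] (p ^ k)"
    have u: "?u \<in> carrier L" using yc by simp
    have one: "\<one> \<in> T" "\<zero> \<in> T" using subringE(2,3)[OF subfieldE(1)[OF T(1)]] by auto
    \<comment> \<open>The polynomial \<open>T^(p^k) - y^(p^k)\<close> over the field has
      \<open>y\<close> as its only root, so \<open>y\<close> has no other conjugate.\<close>
    let ?l = "padd L [\<ominus> ?u] (replicate (p ^ k) \<zero> @ [\<one>])"
    have lT: "set [\<ominus> ?u] \<subseteq> T" "set (replicate (p ^ k) \<zero> @ [\<one>]) \<subseteq> T"
      using one subringE(5)[OF subfieldE(1)[OF T(1)] k] by auto
    have lc: "set [\<ominus> ?u] \<subseteq> carrier L" "set (replicate (p ^ k) \<zero> @ [\<one>]) \<subseteq> carrier L" using lT TL by blast+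
    have e: "ev L ?l z = \<ominus> ?u \<oplus> z [^] (p ^ k)" if "z \<in> carrier L" for z
      using ev_padd[OF lc that] ev_replicate_zero[of "[\<one>]" z] that u by simp
    have "ev L ?l y = \<zero>" using e[OF yc(1)] u by (simp add: l_neg)
    then have "ev L ?l y' = \<zero>"
      using conj set_padd[OF subfieldE(1)[OF T(1)] lT] unfolding conjugate_def by blast
    then have "\<ominus> ?u \<oplus> y' [^] (p ^ k) = \<zero>" using e[OF yc(2)] by simp
    then have "y' [^] (p ^ k) = ?u" using u yc by (metis minus_equality minus_minus a_comm a_inv_closed nat_pow_closed)
    then have "y = y'" using frobenius_iter_inj[OF p yc, of k] by simp
    then show "v y = v y'" by simp
  qed
  moreover have "a \<notin> T" using T(3) simple_extension_incl[OF TL ap] by blast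
  ultimately show ?thesis using T(2) by blast
qed

end

context completed_extension begin

lemma x_transcendental_over_B:
  assumes "set f \<subseteq> B" "ev L f x = \<zero>" shows "set f \<subseteq> {\<zero>}"
proof (rule ccontr)
  assume "\<not> ?thesis"
  then obtain m where "minimal_poly L B x m" using minimal_poly_exists[OF B x assms(1) _ assms(2)] by blast
  then have "x \<in> B" using B_algebraically_closed[OF x, of m] unfolding minimal_poly_def by blast
  then show False using x_transcendental by (simp add: mem_algebraic_closure_in over_def)
qed

text \<open>For inseparable \<open>a\<close>, the field \<open>N = Kh(a^p)\<close> does not contain
  \<open>a\<close>. Since \<open>x\<close> is transcendental over \<open>B\<close>, the field
  \<open>N(x)\<close> meets \<open>B\<close> in \<open>N\<close>, so \<open>a\<close> is not
  obtained by adjoining \<open>a^p\<close> to \<open>Kh(x)\<close> either. A henselian field above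
  \<open>Kh(x)\<close> can then avoid \<open>a\<close>.\<close>

lemma IC_separable:
  assumes a: "a \<in> IC L v Kh x"
  shows "\<exists>f. set f \<subseteq> Kh \<and> ev L f a = \<zero> \<and> dv L f a \<noteq> \<zero>"
proof (rule ccontr)
  assume insep: "\<not> ?thesis"
  have aB: "a \<in> B" "a \<in> carrier L" "(algebraic over Kh) a"
    using a unfolding IC_def by (auto simp: mem_algebraic_closure_in)
  obtain n where "n > 0" "nat_elem n = \<zero>" using inseparable_characteristic[OF Kh aB(2,3)] insep by blast
  then obtain p where p: "Factorial_Ring.prime p" "nat_elem p = \<zero>" using prime_characteristic by blast
  have p0: "p > 0" using prime_gt_0_nat[OF p(1)] .
  have ap: "a [^] p \<in> carrier L" "a [^] p \<in> B" using subring_pow[OF subfieldE(1)[OF B] aB(1)] aB(2) by auto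
  let ?N = "simple_extension Kh (a [^] p)"
  have aN: "a \<notin> ?N" using simple_root_of_power[OF Kh aB(2) p(2) p0] insep by blast
  have N: "subfield ?N L" "Kh \<subseteq> ?N" "a [^] p \<in> ?N"
    using simple_extension_is_subfield[OF Kh ap(1)] simple_extension_incl[OF Kh_carrier ap(1)]
      simple_extension_mem[OF subfieldE(1)[OF Kh] ap(1)] ap(2) by (auto simp: mem_algebraic_closure_in)
  have NB: "?N \<subseteq> B" using simple_extension_subring_incl[OF subfieldE(1)[OF B] Kh_B ap(2)] .
  note NX = adjoin_subfield[OF N(1) x]
  have "Khx \<subseteq> adjoin L ?N x" using Khx(4)[OF NX(1)] N(2) NX(2,3) by blast
  then have "simple_extension Khx (a [^] p) \<subseteq> adjoin L ?N x"
    using simple_extension_subring_incl[OF subfieldE(1)[OF NX(1)]] N(3) NX(2) by blast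
  then have "a \<notin> simple_extension Khx (a [^] p)"
    using mem_of_adjoin_transcendental[OF N(1) B NB x x_transcendental_over_B _ aB(1)] aN by blast
  then obtain T where T: "Khx \<subseteq> T" "henselian L v T" "a \<notin> T"
    using henselian_avoiding_inseparable[OF p Khx(1) algebraic_x aB(2)] by blast
  have "T \<subseteq> algebraic_closure_in L Khx"
    using T(2) subfieldE(3) unfolding algebraic_closure_Khx henselian_def by blast
  moreover have "a \<in> henselization L v Khx" using a unfolding IC_def by blast
  ultimately show False using T unfolding mem_henselization by blast
qed

lemma IC_dense:
  assumes "a \<in> IC L v Kh x" "bounded \<gamma>"
  shows "\<exists>e\<in>IC L v K x. Fin \<gamma> < v (a \<ominus> e)"
  using IC_separable[OF assms(1)] IC_dense_separable[OF assms(1) _ _ _ assms(2)] by blast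

end

section \<open>Completeness\<close>

text \<open>The elements of value \<open>Pinf\<close> form an ideal, maximal by
  \<open>W_inv\<close>. The quotient is realised on representatives inside the type
  \<open>'a\<close>, because the maximality condition of a completion tests only fields with carrier
  type \<open>'g \<Rightarrow> 'a\<close>, not fields of cosets.\<close>

lemma (in cring) valued_field_quotient:
  fixes W :: "'a \<Rightarrow> 'g::linordered_ab_group_add extended"
  assumes W0: "W \<zero> = Pinf" and W1: "W \<one> \<noteq> Pinf"
    and W_Minf: "\<And>a. a \<in> carrier R \<Longrightarrow> W a \<noteq> Minf"
    and W_mult: "\<And>a b. a \<in> carrier R \<Longrightarrow> b \<in> carrier R \<Longrightarrow> W (a \<otimes> b) = W a + W b"
    and W_add: "\<And>a b. a \<in> carrier R \<Longrightarrow> b \<in> carrier R \<Longrightarrow> min (W a) (W b) \<le> W (a \<oplus> b)"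
    and W_inv: "\<And>a. a \<in> carrier R \<Longrightarrow> W a \<noteq> Pinf \<Longrightarrow> \<exists>b\<in>carrier R. W (a \<otimes> b \<ominus> \<one>) = Pinf"
  shows "\<exists>(M :: 'a ring) w \<pi>. valued_field M w \<and> \<pi> \<in> ring_hom R M \<and> \<pi> ` carrier R = carrier M \<and>
    (\<forall>a\<in>carrier R. w (\<pi> a) = W a) \<and>
    (\<forall>a\<in>carrier R. \<forall>b\<in>carrier R. \<pi> a = \<pi> b \<longleftrightarrow> W (a \<ominus> b) = Pinf)"
proof -
  define I where "I = {a \<in> carrier R. W a = Pinf}"
  have Pinf_add: "Pinf + u = Pinf" if "u \<noteq> Minf" for u :: "'g extended" using that by (cases u) auto
  have W_ideal: "W (a \<otimes> b) = Pinf" if "a \<in> carrier R" "b \<in> carrier R" "W a = Pinf" for a b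
    using W_mult[OF that(1,2)] that(3) Pinf_add W_Minf[OF that(2)] by simp
  have W_neg: "W (\<ominus> a) = Pinf" if "a \<in> carrier R" "W a = Pinf" for a
    using W_ideal[of a "\<ominus> \<one>"] that by (simp add: r_minus)
  have W_sum: "W (a \<oplus> b) = Pinf" if "a \<in> carrier R" "b \<in> carrier R" "W a = Pinf" "W b = Pinf" for a b
    using W_add[OF that(1,2)] that(3,4) by simp
  have I: "ideal I R"
  proof (rule idealI)
    show "ring R" by (rule ring_axioms)
    show "subgroup I (add_monoid R)"
    proof
      show "inv\<^bsub>add_monoid R\<^esub> a \<in> I" if "a \<in> I" for a
        using that W_neg unfolding I_def a_inv_def[symmetric] by simp
    qed (use W0 W_sum in \<open>auto simp: I_def\<close>)
    show "r \<otimes> a \<in> I" "a \<otimes> r \<in> I" if "a \<in> I" "r \<in> carrier R" for a r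
      using that W_ideal m_comm[of r a] unfolding I_def by auto
  qed
  have "maximalideal I R"
  proof (rule maximalidealI[OF I])
    show "carrier R \<noteq> I" using W1 unfolding I_def by (metis (mono_tags, lifting) mem_Collect_eq one_closed)
    fix J assume J: "ideal J R" "I \<subseteq> J" "J \<subseteq> carrier R"
    show "J = I \<or> J = carrier R"
    proof (cases "J = I")
      case False
      then obtain a where a: "a \<in> J" "a \<in> carrier R" "W a \<noteq> Pinf" using J(2,3) unfolding I_def by blast
      then obtain b where b: "b \<in> carrier R" "W (a \<otimes> b \<ominus> \<one>) = Pinf" using W_inv by blast
      interpret J: ideal J R by fact
      have c: "a \<otimes> b \<in> carrier R" "a \<otimes> b \<ominus> \<one> \<in> carrier R" using a(2) b(1) by auto
      then have "a \<otimes> b \<ominus> \<one> \<in> J" using J(2) b(2) unfolding I_def by blast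
      then have "a \<otimes> b \<oplus> \<ominus> (a \<otimes> b \<ominus> \<one>) \<in> J"
        by (intro J.a_closed J.a_inv_closed J.I_r_closed a(1) b(1))
      moreover have "a \<otimes> b \<oplus> \<ominus> (a \<otimes> b \<ominus> \<one>) = \<one>"
        using c(1) one_closed by algebra
      ultimately show ?thesis using J.one_imp_carrier by simp
    qed simp
  qed
  then have field_quot: "field (R Quot I)" using maximalideal.quotient_is_field is_cring by blast
  \<comment> \<open>The chosen representative depends only on the class of \<open>a\<close>, since
    congruent elements give the same choice predicate.\<close>
  define \<pi> where "\<pi> a = (SOME b. b \<in> carrier R \<and> W (b \<ominus> a) = Pinf)" for a
  have \<pi>: "\<pi> a \<in> carrier R" "W (\<pi> a \<ominus> a) = Pinf" if "a \<in> carrier R" for a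
  proof -
    have "a \<in> carrier R \<and> W (a \<ominus> a) = Pinf" using that W0 by (simp add: a_minus_def r_neg)
    then have "\<exists>b. b \<in> carrier R \<and> W (b \<ominus> a) = Pinf" by blast
    from someI_ex[OF this] show "\<pi> a \<in> carrier R" "W (\<pi> a \<ominus> a) = Pinf" unfolding \<pi>_def by blast+
  qed
  have \<pi>_iff: "\<pi> a = \<pi> b \<longleftrightarrow> W (a \<ominus> b) = Pinf" if ab: "a \<in> carrier R" "b \<in> carrier R" for a b
  proof
    assume eq: "\<pi> a = \<pi> b"
    have "a \<ominus> b = \<ominus> (\<pi> a \<ominus> a) \<oplus> (\<pi> a \<ominus> b)" using ab \<pi>(1)[OF ab(1)] by algebra
    then show "W (a \<ominus> b) = Pinf"
      using W_sum[OF _ _ W_neg[OF _ \<pi>(2)[OF ab(1)]], of "\<pi> a \<ominus> b"] \<pi>(2)[OF ab(2)] ab \<pi>(1) eq by simp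
  next
    assume w: "W (a \<ominus> b) = Pinf"
    have "W (c \<ominus> a) = Pinf \<longleftrightarrow> W (c \<ominus> b) = Pinf" if c: "c \<in> carrier R" for c
    proof
      assume "W (c \<ominus> a) = Pinf"
      moreover have "c \<ominus> b = (c \<ominus> a) \<oplus> (a \<ominus> b)" using c ab by algebra
      ultimately show "W (c \<ominus> b) = Pinf" using W_sum[of "c \<ominus> a" "a \<ominus> b"] w c ab by simp
    next
      assume "W (c \<ominus> b) = Pinf"
      moreover have "c \<ominus> a = (c \<ominus> b) \<oplus> \<ominus> (a \<ominus> b)" using c ab by algebra
      ultimately show "W (c \<ominus> a) = Pinf" using W_sum[of "c \<ominus> b" "\<ominus> (a \<ominus> b)"] W_neg w c ab by simp
    qed
    then show "\<pi> a = \<pi> b" unfolding \<pi>_def by meson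
  qed
  have weak: "weak_ring_morphism \<pi> I R"
    by (rule weak_ring_morphismI[OF I]) (use \<pi>_iff in \<open>auto simp: I_def\<close>)
  define M where "M = image_ring \<pi> R"
  have M: "field M" unfolding M_def using image_ring_is_field[OF weak field_quot] .
  have hom: "\<pi> \<in> ring_hom R M" unfolding M_def using weak_ring_morphism_is_hom[OF weak] .
  have surj: "\<pi> ` carrier R = carrier M" unfolding M_def image_ring_carrier ..
  interpret M: field M by fact
  interpret H: ring_hom_ring R M \<pi> using hom by unfold_locales
  have "W a = W b" if ab: "a \<in> carrier R" "b \<in> carrier R" "\<pi> a = \<pi> b" for a b
  proof -
    have w: "W (a \<ominus> b) = Pinf" using \<pi>_iff ab by blast
    have "a = (a \<ominus> b) \<oplus> b" "b = \<ominus> (a \<ominus> b) \<oplus> a" using ab by algebra+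
    then have "min Pinf (W b) \<le> W a" "min Pinf (W a) \<le> W b"
      using W_add[of "a \<ominus> b" b] W_add[of "\<ominus> (a \<ominus> b)" a] w W_neg[OF _ w] ab by auto
    then show ?thesis by simp
  qed
  then have inj: "W (inv_into (carrier R) \<pi> (\<pi> a)) = W a" if "a \<in> carrier R" for a
    using that by (meson f_inv_into_f imageI inv_into_into)
  define w where "w = (\<lambda>y. W (inv_into (carrier R) \<pi> y))"
  have w: "w (\<pi> a) = W a" if "a \<in> carrier R" for a unfolding w_def using inj[OF that] .
  have "valued_field M w"
  proof
    show "w \<zero>\<^bsub>M\<^esub> = Pinf" using w[OF zero_closed] W0 by simp
    show "\<exists>\<gamma>. w y = Fin \<gamma>" if y: "y \<in> carrier M" "y \<noteq> \<zero>\<^bsub>M\<^esub>" for y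
    proof -
      obtain a where a: "a \<in> carrier R" "y = \<pi> a" using y(1) surj by blast
      have "W a \<noteq> Pinf"
      proof
        assume "W a = Pinf"
        then have "\<pi> a = \<pi> \<zero>" using \<pi>_iff[OF a(1) zero_closed] a(1) by (simp add: a_minus_def)
        then show False using y(2) a(2) by simp
      qed
      then show ?thesis using w[OF a(1)] W_Minf[OF a(1)] a(2) by (cases "W a") auto
    qed
    fix y z assume "y \<in> carrier M" "z \<in> carrier M"
    then obtain a b where ab: "a \<in> carrier R" "y = \<pi> a" "b \<in> carrier R" "z = \<pi> b" using surj by blast
    show "w (y \<otimes>\<^bsub>M\<^esub> z) = w y + w z" "min (w y) (w z) \<le> w (y \<oplus>\<^bsub>M\<^esub> z)"
      using w[OF m_closed[OF ab(1,3)]] w[OF a_closed[OF ab(1,3)]] w[OF ab(1)] w[OF ab(3)]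
        W_mult[OF ab(1,3)] W_add[OF ab(1,3)] ab by simp_all
  qed
  then show ?thesis using hom surj w \<pi>_iff by blast
qed

section \<open>Cauchy families over \<open>K\<close>\<close>

context dense_extension begin

text \<open>\<open>\<Gamma>\<close> is the directed index set. Families are functions on all of
  \<open>'g\<close>, but their behaviour outside \<open>\<Gamma>\<close> never matters for
  limits.\<close>

definition eventually_on :: "('g \<Rightarrow> bool) \<Rightarrow> bool" where
  "eventually_on P \<longleftrightarrow> (\<exists>\<delta>0\<in>\<Gamma>. \<forall>\<delta>\<in>\<Gamma>. \<delta>0 \<le> \<delta> \<longrightarrow> P \<delta>)"

lemma eventually_on_conj:
  assumes "eventually_on P" "eventually_on Q" shows "eventually_on (\<lambda>\<delta>. P \<delta> \<and> Q \<delta>)"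
proof -
  obtain a b where ab: "a \<in> \<Gamma>" "\<And>\<delta>. \<delta> \<in> \<Gamma> \<Longrightarrow> a \<le> \<delta> \<Longrightarrow> P \<delta>" "b \<in> \<Gamma>" "\<And>\<delta>. \<delta> \<in> \<Gamma> \<Longrightarrow> b \<le> \<delta> \<Longrightarrow> Q \<delta>"
    using assms unfolding eventually_on_def by blast
  then have "max a b \<in> \<Gamma>" by (simp add: max_def)
  then show ?thesis unfolding eventually_on_def using ab by (intro bexI[of _ "max a b"]) auto
qed

lemma eventually_on_mono: "eventually_on P \<Longrightarrow> (\<And>\<delta>. \<delta> \<in> \<Gamma> \<Longrightarrow> P \<delta> \<Longrightarrow> Q \<delta>) \<Longrightarrow> eventually_on Q"
  unfolding eventually_on_def by blast

lemma eventually_on_all: "(\<And>\<delta>. \<delta> \<in> \<Gamma> \<Longrightarrow> P \<delta>) \<Longrightarrow> eventually_on P"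
  unfolding eventually_on_def using Gamma_zero by blast

lemma eventually_on_ge: "\<gamma> \<in> \<Gamma> \<Longrightarrow> (\<And>\<delta>. \<delta> \<in> \<Gamma> \<Longrightarrow> \<gamma> \<le> \<delta> \<Longrightarrow> P \<delta>) \<Longrightarrow> eventually_on P"
  unfolding eventually_on_def by blast

lemma eventually_on_ex: "eventually_on P \<Longrightarrow> \<exists>\<delta>\<in>\<Gamma>. P \<delta>"
  unfolding eventually_on_def by blast

text \<open>Membership in \<open>K\<close> is asked for at every index, also outside
  \<open>\<Gamma>\<close>, so that the ring laws hold as equations between functions.\<close>

definition cauchy :: "('g \<Rightarrow> 'a) \<Rightarrow> bool" where
  "cauchy f \<longleftrightarrow> (\<forall>\<gamma>. f \<gamma> \<in> K) \<and>
     (\<forall>\<gamma>\<in>\<Gamma>. \<exists>\<epsilon>\<in>\<Gamma>. \<forall>\<delta>\<in>\<Gamma>. \<forall>\<delta>'\<in>\<Gamma>. \<epsilon> \<le> \<delta> \<longrightarrow> \<epsilon> \<le> \<delta>' \<longrightarrow> Fin \<gamma> < v (f \<delta> \<ominus> f \<delta>'))"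

definition null :: "('g \<Rightarrow> 'a) \<Rightarrow> bool" where
  "null f \<longleftrightarrow> (\<forall>\<gamma>\<in>\<Gamma>. eventually_on (\<lambda>\<delta>. Fin \<gamma> < v (f \<delta>)))"

definition limit_value :: "('g \<Rightarrow> 'a) \<Rightarrow> 'g extended \<Rightarrow> bool" where
  "limit_value f u \<longleftrightarrow> (u = Pinf \<and> null f) \<or> (\<exists>\<gamma>\<in>\<Gamma>. u = Fin \<gamma> \<and> eventually_on (\<lambda>\<delta>. v (f \<delta>) = Fin \<gamma>))"

lemma cauchy_carrier: "cauchy f \<Longrightarrow> f \<gamma> \<in> K" "cauchy f \<Longrightarrow> f \<gamma> \<in> carrier L"
  unfolding cauchy_def using K_carrier by auto

lemma cauchyD:
  assumes "cauchy f" "\<gamma> \<in> \<Gamma>"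
  obtains \<epsilon> where "\<epsilon> \<in> \<Gamma>"
    "\<And>\<delta> \<delta>'. \<delta> \<in> \<Gamma> \<Longrightarrow> \<delta>' \<in> \<Gamma> \<Longrightarrow> \<epsilon> \<le> \<delta> \<Longrightarrow> \<epsilon> \<le> \<delta>' \<Longrightarrow> Fin \<gamma> < v (f \<delta> \<ominus> f \<delta>')"
  using assms unfolding cauchy_def by blast

lemma cauchyI:
  assumes "\<And>\<gamma>. f \<gamma> \<in> K"
    and "\<And>\<gamma>. \<gamma> \<in> \<Gamma> \<Longrightarrow> \<exists>\<epsilon>\<in>\<Gamma>. \<forall>\<delta>\<in>\<Gamma>. \<forall>\<delta>'\<in>\<Gamma>. \<epsilon> \<le> \<delta> \<longrightarrow> \<epsilon> \<le> \<delta>' \<longrightarrow> Fin \<gamma> < v (f \<delta> \<ominus> f \<delta>')"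
  shows "cauchy f"
  unfolding cauchy_def using assms by blast

lemma limit_value_unique:
  assumes "limit_value f u" "limit_value f t" shows "u = t"
proof -
  have 1: False if "null f" "\<gamma> \<in> \<Gamma>" "eventually_on (\<lambda>\<delta>. v (f \<delta>) = Fin \<gamma>)" for \<gamma>
    using eventually_on_ex[OF eventually_on_conj[OF that(3) that(1)[unfolded null_def, rule_format, OF that(2)]]] by auto
  have 2: "\<gamma> = \<delta>" if "eventually_on (\<lambda>\<delta>. v (f \<delta>) = Fin \<gamma>)" "eventually_on (\<lambda>\<gamma>. v (f \<gamma>) = Fin \<delta>)" for \<gamma> \<delta>
    using eventually_on_ex[OF eventually_on_conj[OF that]] by auto
  show ?thesis using assms unfolding limit_value_def using 1 2 by blast
qed

text \<open>If \<open>f\<close> does not eventually exceed \<open>\<gamma>\<close>, then from the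
  Cauchy index for \<open>\<gamma>\<close> on its value is at most \<open>\<gamma>\<close> while all
  differences are larger. The value is constant from there.\<close>

lemma limit_value_exists:
  assumes f: "cauchy f" shows "\<exists>u. limit_value f u"
proof (cases "null f")
  case True
  then show ?thesis unfolding limit_value_def by blast
next
  case False
  then obtain \<gamma> where \<gamma>: "\<gamma> \<in> \<Gamma>" "\<not> eventually_on (\<lambda>\<delta>. Fin \<gamma> < v (f \<delta>))" unfolding null_def by blast
  obtain \<epsilon> where \<epsilon>: "\<epsilon> \<in> \<Gamma>" "\<And>\<delta> \<delta>'. \<delta> \<in> \<Gamma> \<Longrightarrow> \<delta>' \<in> \<Gamma> \<Longrightarrow> \<epsilon> \<le> \<delta> \<Longrightarrow> \<epsilon> \<le> \<delta>' \<Longrightarrow> Fin \<gamma> < v (f \<delta> \<ominus> f \<delta>')"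
    using cauchyD[OF f \<gamma>(1)] by blast
  have c: "f \<delta> \<in> carrier L" for \<delta> using cauchy_carrier[OF f] by blast
  have le: "v (f \<epsilon>) \<le> Fin \<gamma>"
  proof (rule ccontr)
    assume "\<not> ?thesis"
    then have big: "Fin \<gamma> < v (f \<epsilon>)" by simp
    have "eventually_on (\<lambda>\<delta>. Fin \<gamma> < v (f \<delta>))"
    proof (rule eventually_on_ge[OF \<epsilon>(1)])
      fix \<delta> assume "\<delta> \<in> \<Gamma>" "\<epsilon> \<le> \<delta>"
      then have "Fin \<gamma> < v (f \<delta> \<ominus> f \<epsilon>)" using \<epsilon> by simp
      moreover have "f \<delta> = (f \<delta> \<ominus> f \<epsilon>) \<oplus> f \<epsilon>" using c[of \<delta>] c[of \<epsilon>] by algebra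
      ultimately show "Fin \<gamma> < v (f \<delta>)" using v_add_gt[of "f \<delta> \<ominus> f \<epsilon>" "f \<epsilon>" "Fin \<gamma>"] big c by simp
    qed
    then show False using \<gamma> by blast
  qed
  then obtain \<eta> where \<eta>: "v (f \<epsilon>) = Fin \<eta>" using v_cases[OF c[of \<epsilon>]] by auto
  then have "f \<epsilon> \<noteq> \<zero>" using v_zero by auto
  then have "\<eta> \<in> \<Gamma>" using \<eta> cauchy_carrier(1)[OF f] unfolding value_group_def by blast
  moreover have "eventually_on (\<lambda>\<delta>. v (f \<delta>) = Fin \<eta>)"
  proof (rule eventually_on_ge[OF \<epsilon>(1)])
    fix \<delta> assume "\<delta> \<in> \<Gamma>" "\<epsilon> \<le> \<delta>"
    then have "v (f \<epsilon>) < v (f \<epsilon> \<ominus> f \<delta>)" using le_less_trans[OF le] \<epsilon> by simp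
    then show "v (f \<delta>) = Fin \<eta>" using v_eq_of_diff[OF c[of \<epsilon>] c[of \<delta>]] \<eta> by simp
  qed
  ultimately show ?thesis unfolding limit_value_def by blast
qed

lemma limit_value_less:
  assumes "limit_value f u" "Fin \<gamma> < u" "\<gamma> \<in> \<Gamma>" shows "eventually_on (\<lambda>\<delta>. Fin \<gamma> < v (f \<delta>))"
  using assms(1) unfolding limit_value_def
proof (elim disjE conjE bexE)
  assume "null f" then show ?thesis using assms(3) unfolding null_def by blast
next
  fix \<delta> assume "u = Fin \<delta>" "eventually_on (\<lambda>\<epsilon>. v (f \<epsilon>) = Fin \<delta>)"
  then show ?thesis using assms(2) by (elim eventually_on_mono) simp
qed

lemma less_limit_value:
  assumes "limit_value f u" "eventually_on (\<lambda>\<delta>. Fin \<gamma> < v (f \<delta>))" shows "Fin \<gamma> < u"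
  using assms(1) unfolding limit_value_def
proof (elim disjE conjE bexE)
  fix \<delta> assume "u = Fin \<delta>" "eventually_on (\<lambda>\<epsilon>. v (f \<epsilon>) = Fin \<delta>)"
  then show ?thesis using eventually_on_ex[OF eventually_on_conj[OF assms(2)]] by fastforce
qed simp

lemma limit_value_cases:
  assumes "limit_value f u"
  obtains "u = Pinf" | \<gamma> where "\<gamma> \<in> \<Gamma>" "u = Fin \<gamma>"
  using assms unfolding limit_value_def by blast

lemma cauchy_lower_bound:
  assumes "cauchy f"
  obtains \<mu> where "\<mu> \<in> \<Gamma>" "eventually_on (\<lambda>\<delta>. Fin \<mu> \<le> v (f \<delta>))"
proof -
  obtain u where u: "limit_value f u" using limit_value_exists[OF assms] by blast
  then show thesis
  proof (cases rule: limit_value_cases)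
    case 1
    then have "eventually_on (\<lambda>\<delta>. Fin 0 < v (f \<delta>))" using limit_value_less[OF u _ Gamma_zero] by simp
    then have "eventually_on (\<lambda>\<delta>. Fin 0 \<le> v (f \<delta>))" by (rule eventually_on_mono) (rule less_imp_le)
    then show thesis using that Gamma_zero by blast
  next
    case (2 \<gamma>)
    then have "eventually_on (\<lambda>\<delta>. v (f \<delta>) = Fin \<gamma>)" using u unfolding limit_value_def by auto
    then have "eventually_on (\<lambda>\<delta>. Fin \<gamma> \<le> v (f \<delta>))" by (rule eventually_on_mono) simp
    then show thesis using that 2(1) by blast
  qed
qed

lemma cauchy_const: "k \<in> K \<Longrightarrow> cauchy (\<lambda>_. k)"
  by (rule cauchyI) (use K_carrier Gamma_zero v_zero in \<open>auto simp: a_minus_def r_neg subset_iff\<close>)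

lemma cauchy_add:
  assumes f: "cauchy f" and g: "cauchy g" shows "cauchy (\<lambda>\<delta>. f \<delta> \<oplus> g \<delta>)"
proof (rule cauchyI)
  note c = cauchy_carrier[OF f] cauchy_carrier[OF g]
  show "f \<delta> \<oplus> g \<delta> \<in> K" for \<delta> using subringE(7)[OF subfieldE(1)[OF K] c(1,3)] .
  fix \<gamma> assume \<gamma>: "\<gamma> \<in> \<Gamma>"
  obtain \<epsilon>1 where 1: "\<epsilon>1 \<in> \<Gamma>" "\<And>\<delta> \<delta>'. \<delta> \<in> \<Gamma> \<Longrightarrow> \<delta>' \<in> \<Gamma> \<Longrightarrow> \<epsilon>1 \<le> \<delta> \<Longrightarrow> \<epsilon>1 \<le> \<delta>' \<Longrightarrow> Fin \<gamma> < v (f \<delta> \<ominus> f \<delta>')"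
    using cauchyD[OF f \<gamma>] by blast
  obtain \<epsilon>2 where 2: "\<epsilon>2 \<in> \<Gamma>" "\<And>\<delta> \<delta>'. \<delta> \<in> \<Gamma> \<Longrightarrow> \<delta>' \<in> \<Gamma> \<Longrightarrow> \<epsilon>2 \<le> \<delta> \<Longrightarrow> \<epsilon>2 \<le> \<delta>' \<Longrightarrow> Fin \<gamma> < v (g \<delta> \<ominus> g \<delta>')"
    using cauchyD[OF g \<gamma>] by blast
  have "Fin \<gamma> < v ((f \<delta> \<oplus> g \<delta>) \<ominus> (f \<delta>' \<oplus> g \<delta>'))"
    if d: "\<delta> \<in> \<Gamma>" "\<delta>' \<in> \<Gamma>" "max \<epsilon>1 \<epsilon>2 \<le> \<delta>" "max \<epsilon>1 \<epsilon>2 \<le> \<delta>'" for \<delta> \<delta>'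
  proof -
    have "(f \<delta> \<oplus> g \<delta>) \<ominus> (f \<delta>' \<oplus> g \<delta>') = (f \<delta> \<ominus> f \<delta>') \<oplus> (g \<delta> \<ominus> g \<delta>')"
      using c(2)[of \<delta>] c(2)[of \<delta>'] c(4)[of \<delta>] c(4)[of \<delta>'] by algebra
    then show ?thesis using v_add_gt[OF _ _ 1(2) 2(2)] c d by simp
  qed
  moreover have "max \<epsilon>1 \<epsilon>2 \<in> \<Gamma>" using 1(1) 2(1) by (simp add: max_def)
  ultimately show "\<exists>\<epsilon>\<in>\<Gamma>. \<forall>\<delta>\<in>\<Gamma>. \<forall>\<delta>'\<in>\<Gamma>. \<epsilon> \<le> \<delta> \<longrightarrow> \<epsilon> \<le> \<delta>' \<longrightarrow>
      Fin \<gamma> < v ((f \<delta> \<oplus> g \<delta>) \<ominus> (f \<delta>' \<oplus> g \<delta>'))" by blast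
qed

lemma add_less_of_le:
  assumes "Fin \<mu> \<le> (a :: 'g extended)" "Fin (\<gamma> - \<mu>) < b" shows "Fin \<gamma> < a + b"
  using assms by (cases a; cases b) (auto simp: algebra_simps intro: add_le_less_mono less_le_trans)

lemma cauchy_mult:
  assumes f: "cauchy f" and g: "cauchy g" shows "cauchy (\<lambda>\<delta>. f \<delta> \<otimes> g \<delta>)"
proof (rule cauchyI)
  note c = cauchy_carrier[OF f] cauchy_carrier[OF g]
  show "f \<delta> \<otimes> g \<delta> \<in> K" for \<delta> using subringE(6)[OF subfieldE(1)[OF K] c(1,3)] .
  obtain \<mu> \<nu> where b: "\<mu> \<in> \<Gamma>" "eventually_on (\<lambda>\<delta>. Fin \<mu> \<le> v (f \<delta>))" "\<nu> \<in> \<Gamma>" "eventually_on (\<lambda>\<delta>. Fin \<nu> \<le> v (g \<delta>))"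
    using cauchy_lower_bound[OF f] cauchy_lower_bound[OF g] by metis
  obtain \<epsilon>0 where e0: "\<epsilon>0 \<in> \<Gamma>" "\<And>\<delta>. \<delta> \<in> \<Gamma> \<Longrightarrow> \<epsilon>0 \<le> \<delta> \<Longrightarrow> Fin \<mu> \<le> v (f \<delta>) \<and> Fin \<nu> \<le> v (g \<delta>)"
    using eventually_on_conj[OF b(2,4)] unfolding eventually_on_def by blast
  fix \<gamma> assume \<gamma>: "\<gamma> \<in> \<Gamma>"
  have G: "\<gamma> - \<nu> \<in> \<Gamma>" "\<gamma> - \<mu> \<in> \<Gamma>" using Gamma_add[OF \<gamma> Gamma_minus] b(1,3) by force+
  obtain \<epsilon>1 where 1: "\<epsilon>1 \<in> \<Gamma>" "\<And>\<delta> \<delta>'. \<delta> \<in> \<Gamma> \<Longrightarrow> \<delta>' \<in> \<Gamma> \<Longrightarrow> \<epsilon>1 \<le> \<delta> \<Longrightarrow> \<epsilon>1 \<le> \<delta>' \<Longrightarrow> Fin (\<gamma> - \<nu>) < v (f \<delta> \<ominus> f \<delta>')"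
    using cauchyD[OF f G(1)] by blast
  obtain \<epsilon>2 where 2: "\<epsilon>2 \<in> \<Gamma>" "\<And>\<delta> \<delta>'. \<delta> \<in> \<Gamma> \<Longrightarrow> \<delta>' \<in> \<Gamma> \<Longrightarrow> \<epsilon>2 \<le> \<delta> \<Longrightarrow> \<epsilon>2 \<le> \<delta>' \<Longrightarrow> Fin (\<gamma> - \<mu>) < v (g \<delta> \<ominus> g \<delta>')"
    using cauchyD[OF g G(2)] by blast
  let ?m = "max \<epsilon>0 (max \<epsilon>1 \<epsilon>2)"
  have "Fin \<gamma> < v ((f \<delta> \<otimes> g \<delta>) \<ominus> (f \<delta>' \<otimes> g \<delta>'))"
    if d: "\<delta> \<in> \<Gamma>" "\<delta>' \<in> \<Gamma>" "?m \<le> \<delta>" "?m \<le> \<delta>'" for \<delta> \<delta>'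
  proof -
    have eq: "(f \<delta> \<otimes> g \<delta>) \<ominus> (f \<delta>' \<otimes> g \<delta>') = f \<delta> \<otimes> (g \<delta> \<ominus> g \<delta>') \<oplus> g \<delta>' \<otimes> (f \<delta> \<ominus> f \<delta>')"
      using c(2)[of \<delta>] c(2)[of \<delta>'] c(4)[of \<delta>] c(4)[of \<delta>'] by algebra
    have "Fin \<gamma> < v (f \<delta> \<otimes> (g \<delta> \<ominus> g \<delta>'))" "Fin \<gamma> < v (g \<delta>' \<otimes> (f \<delta> \<ominus> f \<delta>'))"
      using add_less_of_le[of \<mu> "v (f \<delta>)"] add_less_of_le[of \<nu> "v (g \<delta>')"] e0(2) 1(2) 2(2) d c by (simp_all add: v_mult)
    then show ?thesis unfolding eq using v_add_gt c by simp
  qed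
  moreover have "?m \<in> \<Gamma>" using 1(1) 2(1) e0(1) by (simp add: max_def)
  ultimately show "\<exists>\<epsilon>\<in>\<Gamma>. \<forall>\<delta>\<in>\<Gamma>. \<forall>\<delta>'\<in>\<Gamma>. \<epsilon> \<le> \<delta> \<longrightarrow> \<epsilon> \<le> \<delta>' \<longrightarrow>
      Fin \<gamma> < v ((f \<delta> \<otimes> g \<delta>) \<ominus> (f \<delta>' \<otimes> g \<delta>'))" by blast
qed

text \<open>From \<open>1/s - 1/t = (t - s) / (s t)\<close> the loss of precision is
  \<open>2 \<eta>\<close>. The default 0 keeps the family inside \<open>K\<close> at indices where
  \<open>f\<close> vanishes; eventually there are none.\<close>

lemma cauchy_inverse:
  assumes f: "cauchy f" and \<eta>: "\<eta> \<in> \<Gamma>" "eventually_on (\<lambda>\<delta>. v (f \<delta>) = Fin \<eta>)"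
  defines "g \<equiv> \<lambda>\<delta>. if f \<delta> = \<zero> then \<zero> else inv (f \<delta>)"
  shows "cauchy g" "eventually_on (\<lambda>\<delta>. f \<delta> \<otimes> g \<delta> = \<one>)"
proof -
  note c = cauchy_carrier[OF f]
  have gK: "g \<delta> \<in> K" for \<delta>
    using subfield_m_inv(1)[OF K, of "f \<delta>"] c(1) subringE(2)[OF subfieldE(1)[OF K]] by (auto simp: g_def)
  then have gc: "g \<delta> \<in> carrier L" for \<delta> using K_carrier by blast
  have fg: "f \<delta> \<otimes> g \<delta> = \<one>" "v (g \<delta>) = Fin (- \<eta>)" if "v (f \<delta>) = Fin \<eta>" for \<delta>
  proof -
    have "f \<delta> \<noteq> \<zero>" using that v_zero by auto
    then show "f \<delta> \<otimes> g \<delta> = \<one>" "v (g \<delta>) = Fin (- \<eta>)" using v_inv[OF c(2) _ that] c(2) by (auto simp: g_def field_Units)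
  qed
  show "eventually_on (\<lambda>\<delta>. f \<delta> \<otimes> g \<delta> = \<one>)" using \<eta>(2) fg by (elim eventually_on_mono)
  show "cauchy g"
  proof (rule cauchyI)
    fix \<gamma> assume \<gamma>: "\<gamma> \<in> \<Gamma>"
    have G: "\<gamma> + \<eta> + \<eta> \<in> \<Gamma>" using Gamma_add \<gamma> \<eta>(1) by blast
    obtain \<epsilon>1 where 1: "\<epsilon>1 \<in> \<Gamma>" "\<And>\<delta> \<delta>'. \<delta> \<in> \<Gamma> \<Longrightarrow> \<delta>' \<in> \<Gamma> \<Longrightarrow> \<epsilon>1 \<le> \<delta> \<Longrightarrow> \<epsilon>1 \<le> \<delta>' \<Longrightarrow> Fin (\<gamma> + \<eta> + \<eta>) < v (f \<delta> \<ominus> f \<delta>')"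
      using cauchyD[OF f G] by blast
    obtain \<epsilon>0 where e0: "\<epsilon>0 \<in> \<Gamma>" "\<And>\<delta>. \<delta> \<in> \<Gamma> \<Longrightarrow> \<epsilon>0 \<le> \<delta> \<Longrightarrow> v (f \<delta>) = Fin \<eta>"
      using \<eta>(2) unfolding eventually_on_def by blast
    have "Fin \<gamma> < v (g \<delta> \<ominus> g \<delta>')"
      if d: "\<delta> \<in> \<Gamma>" "\<delta>' \<in> \<Gamma>" "max \<epsilon>0 \<epsilon>1 \<le> \<delta>" "max \<epsilon>0 \<epsilon>1 \<le> \<delta>'" for \<delta> \<delta>'
    proof -
      have w: "v (f \<delta>) = Fin \<eta>" "v (f \<delta>') = Fin \<eta>" using e0 d by auto
      have r: "x \<otimes> y \<otimes> (a' \<ominus> a) = (a' \<otimes> y) \<otimes> x \<ominus> (a \<otimes> x) \<otimes> y"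
        if "x \<in> carrier L" "y \<in> carrier L" "a \<in> carrier L" "a' \<in> carrier L" for x y a a'
        using that by algebra
      have eq: "g \<delta> \<otimes> g \<delta>' \<otimes> (f \<delta>' \<ominus> f \<delta>) = g \<delta> \<ominus> g \<delta>'"
        using r[OF gc gc c(2) c(2), of \<delta> \<delta>' \<delta>' \<delta>] fg(1)[OF w(1)] fg(1)[OF w(2)] gc by simp
      have "Fin (\<gamma> + \<eta> + \<eta>) < v (f \<delta>' \<ominus> f \<delta>)" using 1 d by simp
      moreover have "v (g \<delta> \<ominus> g \<delta>') = Fin (- \<eta> - \<eta>) + v (f \<delta>' \<ominus> f \<delta>)"
        unfolding eq[symmetric] using fg(2)[OF w(1)] fg(2)[OF w(2)] gc c(2) by (simp add: v_mult)
      moreover have "\<gamma> - (- \<eta> - \<eta>) = \<gamma> + \<eta> + \<eta>" by (simp add: algebra_simps)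
      ultimately show ?thesis
        using add_less_of_le[OF order_refl, of \<gamma> "- \<eta> - \<eta>" "v (f \<delta>' \<ominus> f \<delta>)"] by metis
    qed
    moreover have "max \<epsilon>0 \<epsilon>1 \<in> \<Gamma>" using 1(1) e0(1) by (simp add: max_def)
    ultimately show "\<exists>\<epsilon>\<in>\<Gamma>. \<forall>\<delta>\<in>\<Gamma>. \<forall>\<delta>'\<in>\<Gamma>. \<epsilon> \<le> \<delta> \<longrightarrow> \<epsilon> \<le> \<delta>' \<longrightarrow> Fin \<gamma> < v (g \<delta> \<ominus> g \<delta>')" by blast
  qed (rule gK)
qed

definition cauchy_ring :: "('g \<Rightarrow> 'a) ring" where
  "cauchy_ring = \<lparr>carrier = {f. cauchy f}, monoid.mult = (\<lambda>f g \<delta>. f \<delta> \<otimes> g \<delta>), one = (\<lambda>_. \<one>),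
     ring.zero = (\<lambda>_. \<zero>), ring.add = (\<lambda>f g \<delta>. f \<delta> \<oplus> g \<delta>)\<rparr>"

lemma cauchy_zero: "cauchy (\<lambda>_. \<zero>)" and cauchy_one: "cauchy (\<lambda>_. \<one>)"
  using cauchy_const subringE(2,3)[OF subfieldE(1)[OF K]] by auto

lemma cauchy_minus:
  assumes "cauchy f" shows "cauchy (\<lambda>\<delta>. \<ominus> f \<delta>)"
proof -
  have "\<ominus> \<one> \<in> K" using subringE(3,5)[OF subfieldE(1)[OF K]] by blast
  then have "cauchy (\<lambda>\<delta>. f \<delta> \<otimes> \<ominus> \<one>)" using cauchy_mult[OF assms cauchy_const] by simp
  then show ?thesis using cauchy_carrier(2)[OF assms] by (simp add: r_minus)
qed

lemma cauchy_ring: "cring cauchy_ring"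
proof (rule cringI)
  show "abelian_group cauchy_ring"
  proof (rule abelian_groupI)
    fix f assume "f \<in> carrier cauchy_ring"
    then have f: "cauchy f" by (simp add: cauchy_ring_def)
    show "\<exists>g\<in>carrier cauchy_ring. g \<oplus>\<^bsub>cauchy_ring\<^esub> f = \<zero>\<^bsub>cauchy_ring\<^esub>"
      using cauchy_minus[OF f] cauchy_carrier(2)[OF f]
      by (intro bexI[of _ "\<lambda>\<delta>. \<ominus> f \<delta>"]) (auto simp: cauchy_ring_def l_neg)
  qed (auto simp: cauchy_ring_def cauchy_zero cauchy_add a_ac cauchy_carrier(2))
  show "Group.comm_monoid cauchy_ring"
    by (rule comm_monoidI) (auto simp: cauchy_ring_def cauchy_one cauchy_mult m_ac cauchy_carrier(2))
qed (auto simp: cauchy_ring_def l_distr cauchy_carrier(2))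

lemma cauchy_ring_minus:
  assumes f: "cauchy f" and g: "cauchy g" shows "f \<ominus>\<^bsub>cauchy_ring\<^esub> g = (\<lambda>\<delta>. f \<delta> \<ominus> g \<delta>)"
proof -
  interpret C: cring cauchy_ring by (rule cauchy_ring)
  have "\<ominus>\<^bsub>cauchy_ring\<^esub> g = (\<lambda>\<delta>. \<ominus> g \<delta>)"
    by (rule C.minus_equality)
       (use cauchy_minus[OF g] g cauchy_carrier(2)[OF g] in \<open>auto simp: cauchy_ring_def l_neg\<close>)
  then show ?thesis unfolding a_minus_def by (simp add: cauchy_ring_def)
qed

lemma cauchy_diff: "cauchy f \<Longrightarrow> cauchy g \<Longrightarrow> cauchy (\<lambda>\<delta>. f \<delta> \<ominus> g \<delta>)"
  using cauchy_add[OF _ cauchy_minus] unfolding a_minus_def .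

definition lim_val :: "('g \<Rightarrow> 'a) \<Rightarrow> 'g extended" where
  "lim_val f = (THE u. limit_value f u)"

lemma lim_val_eq: "limit_value f u \<Longrightarrow> lim_val f = u"
  unfolding lim_val_def using limit_value_unique by blast

lemma lim_val: "cauchy f \<Longrightarrow> limit_value f (lim_val f)"
  using limit_value_exists lim_val_eq by auto

lemma lim_val_Pinf: "cauchy f \<Longrightarrow> lim_val f = Pinf \<longleftrightarrow> null f"
  using lim_val[of f] lim_val_eq[of f Pinf] unfolding limit_value_def by auto

lemma lim_val_ge:
  assumes f: "cauchy f" and le: "\<And>\<gamma>. \<gamma> \<in> \<Gamma> \<Longrightarrow> Fin \<gamma> < u \<Longrightarrow> eventually_on (\<lambda>\<delta>. Fin \<gamma> < v (f \<delta>))"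
  shows "u \<le> lim_val f"
proof (cases rule: limit_value_cases[OF lim_val[OF f]])
  case (2 \<gamma>)
  show ?thesis
  proof (rule ccontr)
    assume "\<not> ?thesis"
    then have "Fin \<gamma> < u" unfolding 2(2) not_le .
    then have "Fin \<gamma> < lim_val f" using less_limit_value[OF lim_val[OF f] le[OF 2(1)]] by blast
    then show False using 2(2) by simp
  qed
qed simp

lemma lim_val_add:
  assumes f: "cauchy f" and g: "cauchy g"
  shows "min (lim_val f) (lim_val g) \<le> lim_val (\<lambda>\<delta>. f \<delta> \<oplus> g \<delta>)"
proof (rule lim_val_ge[OF cauchy_add[OF f g]])
  fix \<gamma> assume "\<gamma> \<in> \<Gamma>" "Fin \<gamma> < min (lim_val f) (lim_val g)"
  then have "eventually_on (\<lambda>\<delta>. Fin \<gamma> < v (f \<delta>) \<and> Fin \<gamma> < v (g \<delta>))"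
    using limit_value_less[OF lim_val[OF f]] limit_value_less[OF lim_val[OF g]] by (intro eventually_on_conj) auto
  then show "eventually_on (\<lambda>\<delta>. Fin \<gamma> < v (f \<delta> \<oplus> g \<delta>))"
    by (rule eventually_on_mono) (use v_add_gt cauchy_carrier(2)[OF f] cauchy_carrier(2)[OF g] in blast)
qed

lemma null_mult:
  assumes f: "cauchy f" and g: "cauchy g" "null g"
  shows "null (\<lambda>\<delta>. f \<delta> \<otimes> g \<delta>)"
  unfolding null_def
proof
  fix \<gamma> assume \<gamma>: "\<gamma> \<in> \<Gamma>"
  obtain \<mu> where \<mu>: "\<mu> \<in> \<Gamma>" "eventually_on (\<lambda>\<delta>. Fin \<mu> \<le> v (f \<delta>))" using cauchy_lower_bound[OF f] by blast
  have "\<gamma> - \<mu> \<in> \<Gamma>" using Gamma_add[OF \<gamma> Gamma_minus[OF \<mu>(1)]] by simp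
  then have "eventually_on (\<lambda>\<delta>. Fin (\<gamma> - \<mu>) < v (g \<delta>))" using g(2) unfolding null_def by blast
  from eventually_on_conj[OF \<mu>(2) this] show "eventually_on (\<lambda>\<delta>. Fin \<gamma> < v (f \<delta> \<otimes> g \<delta>))"
    by (rule eventually_on_mono)
       (use add_less_of_le cauchy_carrier(2)[OF f] cauchy_carrier(2)[OF g(1)] in \<open>auto simp: v_mult\<close>)
qed

lemma lim_val_mult:
  assumes f: "cauchy f" and g: "cauchy g"
  shows "lim_val (\<lambda>\<delta>. f \<delta> \<otimes> g \<delta>) = lim_val f + lim_val g"
proof -
  note c = cauchy_carrier(2)[OF f] cauchy_carrier(2)[OF g]
  have comm: "(\<lambda>\<delta>. g \<delta> \<otimes> f \<delta>) = (\<lambda>\<delta>. f \<delta> \<otimes> g \<delta>)" using c m_comm by auto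
  show ?thesis
  proof (cases rule: limit_value_cases[OF lim_val[OF f]])
    case 1
    then have "null (\<lambda>\<delta>. f \<delta> \<otimes> g \<delta>)" using null_mult[OF g f] lim_val_Pinf[OF f] comm by simp
    then show ?thesis using lim_val_Pinf[OF cauchy_mult[OF f g]] 1
      by (cases rule: limit_value_cases[OF lim_val[OF g]]) auto
  next
    case (2 \<gamma>)
    show ?thesis
    proof (cases rule: limit_value_cases[OF lim_val[OF g]])
      case 1
      then have "null (\<lambda>\<delta>. f \<delta> \<otimes> g \<delta>)" using null_mult[OF f g] lim_val_Pinf[OF g] by simp
      then show ?thesis using lim_val_Pinf[OF cauchy_mult[OF f g]] 1 2 by simp
    next
      case (2 \<delta>)
      note d = 2 \<open>\<gamma> \<in> \<Gamma>\<close> \<open>lim_val f = Fin \<gamma>\<close>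
      have "eventually_on (\<lambda>\<epsilon>. v (f \<epsilon>) = Fin \<gamma>)" "eventually_on (\<lambda>\<epsilon>. v (g \<epsilon>) = Fin \<delta>)"
        using lim_val[OF f] lim_val[OF g] d unfolding limit_value_def by auto
      from eventually_on_conj[OF this]
      have "eventually_on (\<lambda>\<epsilon>. v (f \<epsilon> \<otimes> g \<epsilon>) = Fin (\<gamma> + \<delta>))"
        by (rule eventually_on_mono) (use c in \<open>auto simp: v_mult\<close>)
      then have "limit_value (\<lambda>\<epsilon>. f \<epsilon> \<otimes> g \<epsilon>) (Fin (\<gamma> + \<delta>))"
        unfolding limit_value_def using Gamma_add d by blast
      then show ?thesis using lim_val_eq d by simp
    qed
  qed
qed

definition tends :: "('g \<Rightarrow> 'a) \<Rightarrow> 'a \<Rightarrow> bool" where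
  "tends f y \<longleftrightarrow> (\<forall>\<gamma>. f \<gamma> \<in> K) \<and> (\<forall>\<gamma>\<in>\<Gamma>. eventually_on (\<lambda>\<delta>. Fin \<gamma> < v (y \<ominus> f \<delta>)))"

lemma tendsD: "tends f y \<Longrightarrow> \<gamma> \<in> \<Gamma> \<Longrightarrow> eventually_on (\<lambda>\<delta>. Fin \<gamma> < v (y \<ominus> f \<delta>))"
  unfolding tends_def by blast

lemma tends_cauchy:
  assumes f: "tends f y" and y: "y \<in> carrier L" shows "cauchy f"
proof (rule cauchyI)
  show fK: "f \<gamma> \<in> K" for \<gamma> using f unfolding tends_def by blast
  then have fc: "f \<gamma> \<in> carrier L" for \<gamma> using K_carrier by blast
  fix \<gamma> assume "\<gamma> \<in> \<Gamma>"
  then obtain \<epsilon> where \<epsilon>: "\<epsilon> \<in> \<Gamma>" "\<And>\<delta>. \<delta> \<in> \<Gamma> \<Longrightarrow> \<epsilon> \<le> \<delta> \<Longrightarrow> Fin \<gamma> < v (y \<ominus> f \<delta>)"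
    using tendsD[OF f] unfolding eventually_on_def by blast
  have "Fin \<gamma> < v (f \<delta> \<ominus> f \<delta>')" if "\<delta> \<in> \<Gamma>" "\<delta>' \<in> \<Gamma>" "\<epsilon> \<le> \<delta>" "\<epsilon> \<le> \<delta>'" for \<delta> \<delta>'
  proof -
    have "f \<delta> \<ominus> f \<delta>' = (f \<delta> \<ominus> y) \<oplus> (y \<ominus> f \<delta>')" using fc[of \<delta>] fc[of \<delta>'] y by algebra
    moreover have "Fin \<gamma> < v (f \<delta> \<ominus> y)" "Fin \<gamma> < v (y \<ominus> f \<delta>')"
      using \<epsilon>(2) that v_diff_commute[OF fc y] by auto
    ultimately show ?thesis using v_add_gt fc y by simp
  qed
  then show "\<exists>\<epsilon>\<in>\<Gamma>. \<forall>\<delta>\<in>\<Gamma>. \<forall>\<delta>'\<in>\<Gamma>. \<epsilon> \<le> \<delta> \<longrightarrow> \<epsilon> \<le> \<delta>' \<longrightarrow> Fin \<gamma> < v (f \<delta> \<ominus> f \<delta>')"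
    using \<epsilon>(1) by blast
qed

lemma tends_exists:
  assumes y: "y \<in> Kh" shows "\<exists>f. tends f y"
proof -
  have "\<exists>k\<in>K. \<gamma> \<in> \<Gamma> \<longrightarrow> Fin \<gamma> < v (y \<ominus> k)" for \<gamma>
    using approximate_Kh[OF y bounded_Gamma] subringE(2)[OF subfieldE(1)[OF K]] by blast
  then obtain f where f: "\<And>\<gamma>. f \<gamma> \<in> K" "\<And>\<gamma>. \<gamma> \<in> \<Gamma> \<Longrightarrow> Fin \<gamma> < v (y \<ominus> f \<gamma>)" by metis
  have "eventually_on (\<lambda>\<delta>. Fin \<gamma> < v (y \<ominus> f \<delta>))" if "\<gamma> \<in> \<Gamma>" for \<gamma>
  proof (rule eventually_on_ge[OF that])
    fix \<delta> assume "\<delta> \<in> \<Gamma>" "\<gamma> \<le> \<delta>"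
    then have "Fin \<gamma> \<le> Fin \<delta>" "Fin \<delta> < v (y \<ominus> f \<delta>)" using f by auto
    then show "Fin \<gamma> < v (y \<ominus> f \<delta>)" by (rule le_less_trans)
  qed
  then show ?thesis unfolding tends_def using f(1) by blast
qed

lemma tends_null_iff:
  assumes f: "tends f y" and g: "cauchy g" and y: "y \<in> carrier L"
  shows "null (\<lambda>\<delta>. f \<delta> \<ominus> g \<delta>) \<longleftrightarrow> tends g y"
proof -
  have c: "f \<delta> \<in> carrier L" "g \<delta> \<in> carrier L" "g \<delta> \<in> K" for \<delta>
    using cauchy_carrier[OF tends_cauchy[OF f y]] cauchy_carrier[OF g] by auto
  have eq: "y \<ominus> g \<delta> = (y \<ominus> f \<delta>) \<oplus> (f \<delta> \<ominus> g \<delta>)" "f \<delta> \<ominus> g \<delta> = (f \<delta> \<ominus> y) \<oplus> (y \<ominus> g \<delta>)" for \<delta>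
    using c(1)[of \<delta>] c(2)[of \<delta>] y by algebra+
  have "eventually_on (\<lambda>\<delta>. Fin \<gamma> < v (f \<delta> \<ominus> g \<delta>)) \<longleftrightarrow> eventually_on (\<lambda>\<delta>. Fin \<gamma> < v (y \<ominus> g \<delta>))"
    if \<gamma>: "\<gamma> \<in> \<Gamma>" for \<gamma>
  proof
    assume "eventually_on (\<lambda>\<delta>. Fin \<gamma> < v (f \<delta> \<ominus> g \<delta>))"
    from eventually_on_conj[OF this tendsD[OF f \<gamma>]]
    show "eventually_on (\<lambda>\<delta>. Fin \<gamma> < v (y \<ominus> g \<delta>))"
      by (rule eventually_on_mono) (use eq(1) v_add_gt c y in simp)
  next
    assume "eventually_on (\<lambda>\<delta>. Fin \<gamma> < v (y \<ominus> g \<delta>))"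
    from eventually_on_conj[OF this tendsD[OF f \<gamma>]]
    show "eventually_on (\<lambda>\<delta>. Fin \<gamma> < v (f \<delta> \<ominus> g \<delta>))"
    proof (rule eventually_on_mono)
      fix \<delta> assume "Fin \<gamma> < v (y \<ominus> g \<delta>) \<and> Fin \<gamma> < v (y \<ominus> f \<delta>)"
      then show "Fin \<gamma> < v (f \<delta> \<ominus> g \<delta>)"
        using v_diff_commute[OF y c(1)] v_add_gt[of "f \<delta> \<ominus> y" "y \<ominus> g \<delta>" "Fin \<gamma>"] eq(2)[of \<delta>] c y by simp
    qed
  qed
  then show ?thesis unfolding null_def tends_def using c(3) by blast
qed

lemma tends_const: "k \<in> K \<Longrightarrow> tends (\<lambda>_. k) k"
  unfolding tends_def using K_carrier v_zero by (auto simp: a_minus_def r_neg subset_iff intro: eventually_on_all)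

lemma tends_add:
  assumes f: "tends f y" and g: "tends g z" and yz: "y \<in> carrier L" "z \<in> carrier L"
  shows "tends (\<lambda>\<delta>. f \<delta> \<oplus> g \<delta>) (y \<oplus> z)"
proof -
  note cf = tends_cauchy[OF f yz(1)] and cg = tends_cauchy[OF g yz(2)]
  note c = cauchy_carrier(2)[OF cf] cauchy_carrier(2)[OF cg]
  have "eventually_on (\<lambda>\<delta>. Fin \<gamma> < v ((y \<oplus> z) \<ominus> (f \<delta> \<oplus> g \<delta>)))" if \<gamma>: "\<gamma> \<in> \<Gamma>" for \<gamma>
    using eventually_on_conj[OF tendsD[OF f \<gamma>] tendsD[OF g \<gamma>]]
  proof (rule eventually_on_mono)
    fix \<delta> assume "Fin \<gamma> < v (y \<ominus> f \<delta>) \<and> Fin \<gamma> < v (z \<ominus> g \<delta>)"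
    moreover have "(y \<oplus> z) \<ominus> (f \<delta> \<oplus> g \<delta>) = (y \<ominus> f \<delta>) \<oplus> (z \<ominus> g \<delta>)"
      using c(1)[of \<delta>] c(2)[of \<delta>] yz by algebra
    ultimately show "Fin \<gamma> < v ((y \<oplus> z) \<ominus> (f \<delta> \<oplus> g \<delta>))" using v_add_gt c yz by simp
  qed
  then show ?thesis unfolding tends_def using cauchy_carrier(1)[OF cauchy_add[OF cf cg]] by blast
qed

lemma value_lower_bound_B:
  assumes "z \<in> B" obtains \<nu> where "\<nu> \<in> \<Gamma>" "Fin \<nu> \<le> v z"
proof -
  obtain \<mu> \<delta> where \<mu>: "Fin (- \<mu>) \<le> v z" and \<delta>: "\<delta> \<in> \<Gamma>" "\<mu> \<le> \<delta>"
    using value_lower_bound[OF assms] unfolding bounded_def by blast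
  have "Fin (- \<delta>) \<le> Fin (- \<mu>)" using \<delta>(2) by simp
  then have "Fin (- \<delta>) \<le> v z" using \<mu> by (rule order_trans)
  then show thesis using that Gamma_minus[OF \<delta>(1)] by blast
qed

lemma tends_mult:
  assumes f: "tends f y" and g: "tends g z" and yz: "y \<in> carrier L" "z \<in> B"
  shows "tends (\<lambda>\<delta>. f \<delta> \<otimes> g \<delta>) (y \<otimes> z)"
proof -
  have zc: "z \<in> carrier L" using yz(2) B_carrier by blast
  note cf = tends_cauchy[OF f yz(1)] and cg = tends_cauchy[OF g zc]
  note c = cauchy_carrier(2)[OF cf] cauchy_carrier(2)[OF cg]
  obtain \<mu> where \<mu>: "\<mu> \<in> \<Gamma>" "eventually_on (\<lambda>\<delta>. Fin \<mu> \<le> v (f \<delta>))" using cauchy_lower_bound[OF cf] by blast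
  obtain \<nu> where \<nu>: "\<nu> \<in> \<Gamma>" "Fin \<nu> \<le> v z" using value_lower_bound_B[OF yz(2)] by blast
  have "eventually_on (\<lambda>\<delta>. Fin \<gamma> < v ((y \<otimes> z) \<ominus> (f \<delta> \<otimes> g \<delta>)))" if \<gamma>: "\<gamma> \<in> \<Gamma>" for \<gamma>
  proof -
    have G: "\<gamma> - \<nu> \<in> \<Gamma>" "\<gamma> - \<mu> \<in> \<Gamma>" using Gamma_add[OF \<gamma> Gamma_minus] \<mu>(1) \<nu>(1) by force+
    show ?thesis using eventually_on_conj[OF \<mu>(2) eventually_on_conj[OF tendsD[OF f G(1)] tendsD[OF g G(2)]]]
    proof (rule eventually_on_mono)
      fix \<delta> assume d: "Fin \<mu> \<le> v (f \<delta>) \<and> Fin (\<gamma> - \<nu>) < v (y \<ominus> f \<delta>) \<and> Fin (\<gamma> - \<mu>) < v (z \<ominus> g \<delta>)"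
      have "(y \<otimes> z) \<ominus> (f \<delta> \<otimes> g \<delta>) = f \<delta> \<otimes> (z \<ominus> g \<delta>) \<oplus> z \<otimes> (y \<ominus> f \<delta>)"
        using c(1)[of \<delta>] c(2)[of \<delta>] yz(1) zc by algebra
      moreover have "Fin \<gamma> < v (f \<delta> \<otimes> (z \<ominus> g \<delta>))" "Fin \<gamma> < v (z \<otimes> (y \<ominus> f \<delta>))"
        using add_less_of_le[of \<mu> "v (f \<delta>)"] add_less_of_le[of \<nu> "v z"] \<nu>(2) d c yz(1) zc by (simp_all add: v_mult)
      ultimately show "Fin \<gamma> < v ((y \<otimes> z) \<ominus> (f \<delta> \<otimes> g \<delta>))" using v_add_gt c yz(1) zc by simp
    qed
  qed
  then show ?thesis unfolding tends_def using cauchy_carrier(1)[OF cauchy_mult[OF cf cg]] by blast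
qed

lemma tends_lim_val:
  assumes f: "tends f y" and y: "y \<in> Kh" shows "lim_val f = v y"
proof (rule lim_val_eq)
  have yc: "y \<in> carrier L" using y Kh_carrier by blast
  note c = cauchy_carrier(2)[OF tends_cauchy[OF f yc]]
  show "limit_value f (v y)"
  proof (cases "y = \<zero>")
    case True
    have "v (\<zero> \<ominus> f \<delta>) = v (f \<delta>)" for \<delta> using c[of \<delta>] by (simp add: a_minus_def)
    then have "null f" unfolding null_def using tendsD[OF f] True by simp
    then show ?thesis unfolding limit_value_def using True v_zero by simp
  next
    case False
    then obtain \<gamma> where \<gamma>: "v y = Fin \<gamma>" using v_nonzero[OF yc] by blast
    then have G: "\<gamma> \<in> \<Gamma>" using value_Kh[OF y False] by blast
    have "eventually_on (\<lambda>\<delta>. v (f \<delta>) = Fin \<gamma>)"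
      by (rule eventually_on_mono[OF tendsD[OF f G]]) (use v_eq_of_diff[OF yc c] \<gamma> in simp)
    then show ?thesis unfolding limit_value_def using G \<gamma> by blast
  qed
qed

text \<open>The quotient of the ring of Cauchy families by the null families competes with \<open>Kh\<close> in the
  maximality condition, so every Cauchy family has a limit in \<open>Kh\<close>.\<close>

lemma cauchy_tends:
  assumes max: "is_completion L v K Kh" and f: "cauchy f"
  shows "\<exists>y\<in>Kh. tends f y"
proof -
  interpret C: cring cauchy_ring by (rule cauchy_ring)
  have [simp]: "f \<in> carrier cauchy_ring \<longleftrightarrow> cauchy f" "g \<otimes>\<^bsub>cauchy_ring\<^esub> h = (\<lambda>\<delta>. g \<delta> \<otimes> h \<delta>)"
    "g \<oplus>\<^bsub>cauchy_ring\<^esub> h = (\<lambda>\<delta>. g \<delta> \<oplus> h \<delta>)" "\<one>\<^bsub>cauchy_ring\<^esub> = (\<lambda>_. \<one>)" "\<zero>\<^bsub>cauchy_ring\<^esub> = (\<lambda>_. \<zero>)"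
    for f g h by (auto simp: cauchy_ring_def)
  have oneK: "\<one> \<in> K" using subringE(3)[OF subfieldE(1)[OF K]] .
  have v1: "lim_val (\<lambda>_. \<one>) = 0" using tends_lim_val[OF tends_const] oneK K_Kh v_one by (auto simp: zero_extended_def)
  have "\<exists>(M :: ('g \<Rightarrow> 'a) ring) w \<pi>. valued_field M w \<and> \<pi> \<in> ring_hom cauchy_ring M \<and>
    \<pi> ` carrier cauchy_ring = carrier M \<and>
    (\<forall>a\<in>carrier cauchy_ring. w (\<pi> a) = lim_val a) \<and>
    (\<forall>a\<in>carrier cauchy_ring. \<forall>b\<in>carrier cauchy_ring. \<pi> a = \<pi> b \<longleftrightarrow> lim_val (a \<ominus>\<^bsub>cauchy_ring\<^esub> b) = Pinf)"
  proof (rule C.valued_field_quotient)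
    show "lim_val \<zero>\<^bsub>cauchy_ring\<^esub> = Pinf" using tends_lim_val[OF tends_const] subringE(2)[OF subfieldE(1)[OF K]] K_Kh v_zero by auto
    show "lim_val \<one>\<^bsub>cauchy_ring\<^esub> \<noteq> Pinf" using v1 by (simp add: zero_extended_def)
    show "lim_val a \<noteq> Minf" if "a \<in> carrier cauchy_ring" for a
      using lim_val[of a] that unfolding limit_value_def by auto
    fix a assume a: "a \<in> carrier cauchy_ring" "lim_val a \<noteq> Pinf"
    then obtain \<eta> where \<eta>: "\<eta> \<in> \<Gamma>" "eventually_on (\<lambda>\<delta>. v (a \<delta>) = Fin \<eta>)"
      using lim_val[of a] unfolding limit_value_def by auto
    let ?b = "\<lambda>\<delta>. if a \<delta> = \<zero> then \<zero> else inv (a \<delta>)"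
    have ac: "cauchy a" using a by simp
    note b = cauchy_inverse[OF ac \<eta>]
    have "null (\<lambda>\<delta>. a \<delta> \<otimes> ?b \<delta> \<ominus> \<one>)"
      unfolding null_def
    proof
      fix \<gamma> assume "\<gamma> \<in> \<Gamma>"
      show "eventually_on (\<lambda>\<delta>. Fin \<gamma> < v (a \<delta> \<otimes> ?b \<delta> \<ominus> \<one>))"
        by (rule eventually_on_mono[OF b(2)]) (simp add: a_minus_def r_neg v_zero)
    qed
    then have "lim_val (a \<otimes>\<^bsub>cauchy_ring\<^esub> ?b \<ominus>\<^bsub>cauchy_ring\<^esub> \<one>\<^bsub>cauchy_ring\<^esub>) = Pinf"
      using lim_val_Pinf[OF cauchy_diff[OF cauchy_mult[OF ac b(1)] cauchy_one]]
        cauchy_ring_minus[OF cauchy_mult[OF ac b(1)] cauchy_one] by simp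
    then show "\<exists>b\<in>carrier cauchy_ring. lim_val (a \<otimes>\<^bsub>cauchy_ring\<^esub> b \<ominus>\<^bsub>cauchy_ring\<^esub> \<one>\<^bsub>cauchy_ring\<^esub>) = Pinf"
      using b(1) by (intro bexI[of _ ?b]) auto
  qed (simp_all add: lim_val_mult lim_val_add)
  then obtain M :: "('g \<Rightarrow> 'a) ring" and w \<pi> where M: "valued_field M w" "\<pi> \<in> ring_hom cauchy_ring M"
    "\<pi> ` {f. cauchy f} = carrier M" "\<And>a. cauchy a \<Longrightarrow> w (\<pi> a) = lim_val a"
    and eq: "\<And>a b. cauchy a \<Longrightarrow> cauchy b \<Longrightarrow> \<pi> a = \<pi> b \<longleftrightarrow> lim_val (a \<ominus>\<^bsub>cauchy_ring\<^esub> b) = Pinf"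
    by (auto simp: cauchy_ring_def)
  interpret M: valued_field M w by fact
  interpret H: ring_hom_ring cauchy_ring M \<pi>
    using M(2) C.ring_axioms M.ring_axioms by (simp add: ring_hom_ring_def ring_hom_ring_axioms_def)
  \<comment> \<open>Any family tending to \<open>y\<close> may be chosen: by \<open>same\<close>,
    the class determines the limit and is determined by it.\<close>
  define \<phi> where "\<phi> y = \<pi> (SOME f. tends f y)" for y
  have same: "\<pi> f = \<pi> g \<longleftrightarrow> tends g y" if "tends f y" "y \<in> Kh" "cauchy g" for f g y
    using that eq[of f g] tends_null_iff[OF that(1,3)] tends_cauchy[OF that(1)] Kh_carrier cauchy_ring_minus
      lim_val_Pinf[OF cauchy_diff] by (simp add: subset_iff)
  have \<phi>: "\<phi> y = \<pi> f" if "tends f y" "y \<in> Kh" for f y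
  proof -
    have "tends (SOME f. tends f y) y" using someI[of "\<lambda>f. tends f y" f] that(1) .
    then show ?thesis unfolding \<phi>_def using same[OF _ that(2)] that tends_cauchy Kh_carrier by blast
  qed
  have sub: "subfield Kh L" by (rule Kh)
  have "\<phi> \<in> ring_hom (L\<lparr>carrier := Kh\<rparr>) M"
  proof (rule ring_hom_memI)
    fix y z assume "y \<in> carrier (L\<lparr>carrier := Kh\<rparr>)" "z \<in> carrier (L\<lparr>carrier := Kh\<rparr>)"
    then have yz: "y \<in> Kh" "z \<in> Kh" by auto
    then obtain f g where fg: "tends f y" "tends g z" using tends_exists by blast
    have yzc: "y \<in> carrier L" "z \<in> carrier L" "z \<in> B" using yz Kh_carrier Kh_B by auto
    have cfg: "cauchy f" "cauchy g" using tends_cauchy fg yzc by auto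
    have "y \<otimes> z \<in> Kh" "y \<oplus> z \<in> Kh" using subringE(6,7)[OF subfieldE(1)[OF Kh] yz] by auto
    then have "\<phi> (y \<otimes> z) = \<pi> (\<lambda>\<delta>. f \<delta> \<otimes> g \<delta>)" "\<phi> (y \<oplus> z) = \<pi> (\<lambda>\<delta>. f \<delta> \<oplus> g \<delta>)"
      using \<phi> tends_mult[OF fg yzc(1,3)] tends_add[OF fg yzc(1,2)] by blast+
    then show "\<phi> (y \<otimes>\<^bsub>L\<lparr>carrier := Kh\<rparr>\<^esub> z) = \<phi> y \<otimes>\<^bsub>M\<^esub> \<phi> z" "\<phi> (y \<oplus>\<^bsub>L\<lparr>carrier := Kh\<rparr>\<^esub> z) = \<phi> y \<oplus>\<^bsub>M\<^esub> \<phi> z"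
      using \<phi>[OF fg(1) yz(1)] \<phi>[OF fg(2) yz(2)] H.hom_mult[of f g] H.hom_add[of f g] cfg by simp_all
  next
    show "\<phi> \<one>\<^bsub>L\<lparr>carrier := Kh\<rparr>\<^esub> = \<one>\<^bsub>M\<^esub>" using \<phi>[OF tends_const[OF oneK]] oneK K_Kh H.hom_one by auto
    fix y assume "y \<in> carrier (L\<lparr>carrier := Kh\<rparr>)"
    then have y: "y \<in> Kh" by simp
    then obtain f where f: "tends f y" using tends_exists by blast
    then have "cauchy f" using tends_cauchy y Kh_carrier by blast
    then show "\<phi> y \<in> carrier M" using \<phi>[OF f y] H.hom_closed[of f] by simp
  qed
  moreover have "w (\<phi> y) = v y" if y: "y \<in> Kh" for y
  proof -
    obtain f where f: "tends f y" using y tends_exists by blast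
    then have "cauchy f" using tends_cauchy y Kh_carrier by blast
    then show ?thesis using \<phi>[OF f y] M(4) tends_lim_val[OF f y] by simp
  qed
  moreover have "dense_in M w (\<phi> ` K) (carrier M)"
    unfolding dense_in_def
  proof (intro ballI)
    fix a \<gamma> assume "a \<in> carrier M" and \<gamma>: "\<gamma> \<in> value_group M w (carrier M)"
    then obtain f where f: "cauchy f" "a = \<pi> f" using M(3) by blast
    \<comment> \<open>A value of \<open>M\<close> is the limit value of a Cauchy family, hence an
      element of \<open>\<Gamma>\<close>, so the Cauchy condition can be used at this
      precision.\<close>
    obtain g where g: "cauchy g" "lim_val g = Fin \<gamma>" using \<gamma> M(3,4) unfolding value_group_def by force
    have G: "\<gamma> \<in> \<Gamma>" using lim_val[OF g(1)] g(2) unfolding limit_value_def by auto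
    obtain \<epsilon> where \<epsilon>: "\<epsilon> \<in> \<Gamma>" "\<And>\<delta>. \<delta> \<in> \<Gamma> \<Longrightarrow> \<epsilon> \<le> \<delta> \<Longrightarrow> Fin \<gamma> < v (f \<delta> \<ominus> f \<epsilon>)"
      using cauchyD[OF f(1) G] by (metis order_refl)
    have fe: "f \<epsilon> \<in> K" using cauchy_carrier(1)[OF f(1)] .
    \<comment> \<open>A constant family taken from a late member of \<open>f\<close> approximates
      the class of \<open>f\<close>.\<close>
    let ?c = "\<lambda>_. f \<epsilon>"
    note cc = cauchy_const[OF fe]
    have "\<phi> (f \<epsilon>) = \<pi> ?c" using \<phi>[OF tends_const[OF fe]] fe K_Kh by blast
    then have "a \<ominus>\<^bsub>M\<^esub> \<phi> (f \<epsilon>) = \<pi> (f \<ominus>\<^bsub>cauchy_ring\<^esub> ?c)"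
      using f cc H.hom_add[of f "\<ominus>\<^bsub>cauchy_ring\<^esub> ?c"] H.hom_a_inv[of ?c] C.a_inv_closed[of ?c]
      unfolding a_minus_def by simp
    then have "w (a \<ominus>\<^bsub>M\<^esub> \<phi> (f \<epsilon>)) = lim_val (\<lambda>\<delta>. f \<delta> \<ominus> f \<epsilon>)"
      using M(4)[OF cauchy_diff[OF f(1) cc]] cauchy_ring_minus[OF f(1) cc] by simp
    moreover have "Fin \<gamma> < lim_val (\<lambda>\<delta>. f \<delta> \<ominus> f \<epsilon>)"
      using less_limit_value[OF lim_val[OF cauchy_diff[OF f(1) cc]] eventually_on_ge[OF \<epsilon>(1)]] \<epsilon>(2) by blast
    ultimately show "\<exists>b\<in>\<phi> ` K. Fin \<gamma> < w (a \<ominus>\<^bsub>M\<^esub> b)"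
      by (intro bexI[of _ "\<phi> (f \<epsilon>)"] imageI fe) simp
  qed
  ultimately have "\<phi> ` Kh = carrier M" using max M(1) unfolding is_completion_def by blast
  then obtain y where y: "y \<in> Kh" "\<pi> f = \<phi> y" using M(3) f by (metis (mono_tags, lifting) imageE image_eqI mem_Collect_eq)
  obtain g where g: "tends g y" using y tends_exists by blast
  then show ?thesis using same[OF g y(1) f] \<phi>[OF g y(1)] y by metis
qed

text \<open>Replacing each \<open>c \<gamma>\<close> by an element of \<open>K\<close> closer than
  \<open>\<gamma>\<close> yields a Cauchy family over \<open>K\<close> with the same limit.\<close>

lemma complete_Kh:
  assumes max: "is_completion L v K Kh"
    and c: "\<And>\<gamma>. \<gamma> \<in> \<Gamma> \<Longrightarrow> c \<gamma> \<in> Kh"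
    and cd: "\<And>\<gamma> \<delta>. \<gamma> \<in> \<Gamma> \<Longrightarrow> \<delta> \<in> \<Gamma> \<Longrightarrow> \<gamma> \<le> \<delta> \<Longrightarrow> Fin \<gamma> < v (c \<gamma> \<ominus> c \<delta>)"
  shows "\<exists>y\<in>Kh. \<forall>\<gamma>\<in>\<Gamma>. Fin \<gamma> < v (y \<ominus> c \<gamma>)"
proof -
  have "\<exists>k\<in>K. \<gamma> \<in> \<Gamma> \<longrightarrow> Fin \<gamma> < v (c \<gamma> \<ominus> k)" for \<gamma>
    using approximate_Kh[OF c bounded_Gamma] subringE(2)[OF subfieldE(1)[OF K]] by blast
  then obtain f where f: "\<And>\<gamma>. f \<gamma> \<in> K" "\<And>\<gamma>. \<gamma> \<in> \<Gamma> \<Longrightarrow> Fin \<gamma> < v (c \<gamma> \<ominus> f \<gamma>)" by metis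
  have fc: "f \<gamma> \<in> carrier L" for \<gamma> using f(1) K_carrier by blast
  have cc: "c \<gamma> \<in> carrier L" if "\<gamma> \<in> \<Gamma>" for \<gamma> using c[OF that] Kh_carrier by blast
  have cf: "Fin \<gamma> < v (c \<gamma> \<ominus> f \<delta>)" if "\<gamma> \<in> \<Gamma>" "\<delta> \<in> \<Gamma>" "\<gamma> \<le> \<delta>" for \<gamma> \<delta>
  proof -
    have "c \<gamma> \<ominus> f \<delta> = (c \<gamma> \<ominus> c \<delta>) \<oplus> (c \<delta> \<ominus> f \<delta>)" using cc that fc[of \<delta>] by algebra
    moreover have "Fin \<gamma> < v (c \<delta> \<ominus> f \<delta>)" using le_less_trans[of "Fin \<gamma>" "Fin \<delta>"] f(2)[OF that(2)] that(3) by simp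
    ultimately show ?thesis using v_add_gt cd that cc fc by simp
  qed
  have "cauchy f"
  proof (rule cauchyI)
    fix \<gamma> assume \<gamma>: "\<gamma> \<in> \<Gamma>"
    have "Fin \<gamma> < v (f \<delta> \<ominus> f \<delta>')" if d: "\<delta> \<in> \<Gamma>" "\<delta>' \<in> \<Gamma>" "\<gamma> \<le> \<delta>" "\<gamma> \<le> \<delta>'" for \<delta> \<delta>'
    proof -
      have "f \<delta> \<ominus> f \<delta>' = (f \<delta> \<ominus> c \<gamma>) \<oplus> (c \<gamma> \<ominus> f \<delta>')" using cc[OF \<gamma>] fc[of \<delta>] fc[of \<delta>'] by algebra
      moreover have "Fin \<gamma> < v (f \<delta> \<ominus> c \<gamma>)" "Fin \<gamma> < v (c \<gamma> \<ominus> f \<delta>')"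
        using cf[OF \<gamma>] d v_diff_commute[OF fc cc[OF \<gamma>]] by auto
      ultimately show ?thesis using v_add_gt fc cc[OF \<gamma>] by simp
    qed
    then show "\<exists>\<epsilon>\<in>\<Gamma>. \<forall>\<delta>\<in>\<Gamma>. \<forall>\<delta>'\<in>\<Gamma>. \<epsilon> \<le> \<delta> \<longrightarrow> \<epsilon> \<le> \<delta>' \<longrightarrow> Fin \<gamma> < v (f \<delta> \<ominus> f \<delta>')"
      using \<gamma> by blast
  qed (rule f(1))
  then obtain y where y: "y \<in> Kh" "tends f y" using cauchy_tends[OF max] by blast
  have yc: "y \<in> carrier L" using y(1) Kh_carrier by blast
  have "Fin \<gamma> < v (y \<ominus> c \<gamma>)" if \<gamma>: "\<gamma> \<in> \<Gamma>" for \<gamma>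
  proof -
    have "eventually_on (\<lambda>\<delta>. \<gamma> \<le> \<delta>)" by (rule eventually_on_ge[OF \<gamma>])
    from eventually_on_ex[OF eventually_on_conj[OF tendsD[OF y(2) \<gamma>] this]]
    obtain \<delta> where d: "\<delta> \<in> \<Gamma>" "Fin \<gamma> < v (y \<ominus> f \<delta>)" "\<gamma> \<le> \<delta>" by blast
    have "y \<ominus> c \<gamma> = (y \<ominus> f \<delta>) \<oplus> (f \<delta> \<ominus> c \<gamma>)" using cc[OF \<gamma>] fc[of \<delta>] yc by algebra
    moreover have "Fin \<gamma> < v (f \<delta> \<ominus> c \<gamma>)" using cf[OF \<gamma> d(1,3)] v_diff_commute[OF fc cc[OF \<gamma>]] by simp
    ultimately show ?thesis using v_add_gt d(2) fc cc[OF \<gamma>] yc by simp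
  qed
  then show ?thesis using y(1) by blast
qed

end

section \<open>Completeness of finite-dimensional spaces\<close>

lemma (in ring) Span_incl:
  assumes S: "subring S R" "F \<subseteq> S" and "set es \<subseteq> S" shows "Span F es \<subseteq> S"
  using assms(3)
proof (induction es)
  case Nil
  then show ?case using subringE(2)[OF S(1)] by simp
next
  case (Cons e es)
  then have "e \<in> S" "Span F es \<subseteq> S" by auto
  then have "k \<otimes> e \<oplus> u \<in> S" if "k \<in> F" "u \<in> Span F es" for k u
    using that S(2) subringE(6,7)[OF S(1)] by blast
  then have "line_extension F e (Span F es) \<subseteq> S" unfolding subset_iff line_extension_mem_iff by blast
  then show ?case by simp
qed

context dense_extension begin

text \<open>Only families whose member at \<open>\<gamma>\<close> already has precision
  \<open>\<gamma>\<close> are tested. A loss of precision by a constant is removed by translating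
  the index.\<close>

definition complete :: "'a set \<Rightarrow> bool" where
  "complete V \<longleftrightarrow> (\<forall>c. (\<forall>\<gamma>\<in>\<Gamma>. c \<gamma> \<in> V) \<and> (\<forall>\<gamma>\<in>\<Gamma>. \<forall>\<delta>\<in>\<Gamma>. \<gamma> \<le> \<delta> \<longrightarrow> Fin \<gamma> < v (c \<gamma> \<ominus> c \<delta>)) \<longrightarrow>
     (\<exists>y\<in>V. \<forall>\<gamma>\<in>\<Gamma>. Fin \<gamma> < v (y \<ominus> c \<gamma>)))"

lemma completeD:
  assumes "complete V" "\<And>\<gamma>. \<gamma> \<in> \<Gamma> \<Longrightarrow> c \<gamma> \<in> V"
    and "\<And>\<gamma> \<delta>. \<gamma> \<in> \<Gamma> \<Longrightarrow> \<delta> \<in> \<Gamma> \<Longrightarrow> \<gamma> \<le> \<delta> \<Longrightarrow> Fin \<gamma> < v (c \<gamma> \<ominus> c \<delta>)"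
  obtains y where "y \<in> V" "\<And>\<gamma>. \<gamma> \<in> \<Gamma> \<Longrightarrow> Fin \<gamma> < v (y \<ominus> c \<gamma>)"
proof -
  have "\<exists>y\<in>V. \<forall>\<gamma>\<in>\<Gamma>. Fin \<gamma> < v (y \<ominus> c \<gamma>)"
    using assms(1)[unfolded complete_def, rule_format, of c] assms(2,3) by simp
  then show thesis using that by blast
qed

lemma approximating_cauchy:
  assumes e: "e \<in> carrier L" and u: "\<And>\<gamma>. \<gamma> \<in> \<Gamma> \<Longrightarrow> u \<gamma> \<in> carrier L"
    "\<And>\<gamma>. \<gamma> \<in> \<Gamma> \<Longrightarrow> Fin \<gamma> < v (e \<ominus> u \<gamma>)" and d: "\<gamma> \<in> \<Gamma>" "\<delta> \<in> \<Gamma>" "\<gamma> \<le> \<delta>"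
  shows "Fin \<gamma> < v (u \<gamma> \<ominus> u \<delta>)"
proof -
  have "u \<gamma> \<ominus> u \<delta> = (u \<gamma> \<ominus> e) \<oplus> (e \<ominus> u \<delta>)" using e u(1)[OF d(1)] u(1)[OF d(2)] by algebra
  moreover have "Fin \<gamma> < v (u \<gamma> \<ominus> e)" using u(2)[OF d(1)] v_diff_commute[OF u(1)[OF d(1)] e] by simp
  moreover have "Fin \<gamma> < v (e \<ominus> u \<delta>)" using le_less_trans[of "Fin \<gamma>" "Fin \<delta>"] u(2)[OF d(2)] d(3) by simp
  ultimately show ?thesis using v_add_gt u(1) d e by simp
qed

text \<open>If no bound existed, \<open>e\<close> would be the limit of a Cauchy family in
  \<open>V\<close>. Completeness gives a limit in \<open>V\<close>, and the two limits agree because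
  \<open>\<Gamma>\<close> is cofinal in the values of \<open>B\<close>.\<close>

lemma distance_bounded:
  assumes V: "complete V" "V \<subseteq> B" and e: "e \<in> B" "e \<notin> V"
  shows "\<exists>\<delta>\<in>\<Gamma>. \<forall>u\<in>V. v (e \<ominus> u) \<le> Fin \<delta>"
proof (rule ccontr)
  assume "\<not> ?thesis"
  then have "\<forall>\<delta>\<in>\<Gamma>. \<exists>u\<in>V. Fin \<delta> < v (e \<ominus> u)" by (simp add: not_le)
  then obtain u where u: "\<And>\<delta>. \<delta> \<in> \<Gamma> \<Longrightarrow> u \<delta> \<in> V" "\<And>\<delta>. \<delta> \<in> \<Gamma> \<Longrightarrow> Fin \<delta> < v (e \<ominus> u \<delta>)" by metis
  have ec: "e \<in> carrier L" using e(1) B_carrier by blast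
  have uc: "u \<delta> \<in> carrier L" if "\<delta> \<in> \<Gamma>" for \<delta> using u(1)[OF that] V(2) B_carrier by blast
  obtain y where y: "y \<in> V" "\<And>\<gamma>. \<gamma> \<in> \<Gamma> \<Longrightarrow> Fin \<gamma> < v (y \<ominus> u \<gamma>)"
    using completeD[of V u, OF V(1) u(1) approximating_cauchy[OF ec uc u(2)]] by blast
  have yc: "y \<in> carrier L" "y \<in> B" using y(1) V(2) B_carrier by auto
  have "e \<ominus> y = \<zero>"
  proof (rule eq_zero_of_unbounded)
    show "e \<ominus> y \<in> B" using subringE(5,7)[OF subfieldE(1)[OF B]] e(1) yc(2) unfolding a_minus_def by blast
    fix \<gamma> assume \<gamma>: "\<gamma> \<in> \<Gamma>"
    have "e \<ominus> y = (e \<ominus> u \<gamma>) \<oplus> (u \<gamma> \<ominus> y)" using ec yc(1) uc[OF \<gamma>] by algebra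
    moreover have "Fin \<gamma> < v (u \<gamma> \<ominus> y)" using y(2)[OF \<gamma>] v_diff_commute[OF uc[OF \<gamma>] yc(1)] by simp
    ultimately show "Fin \<gamma> < v (e \<ominus> y)" using v_add_gt u(2)[OF \<gamma>] ec yc(1) uc[OF \<gamma>] by simp
  qed
  then have "e = y" using ec yc(1) by simp
  then show False using e(2) y(1) by simp
qed

text \<open>For \<open>e\<close> outside \<open>V\<close> the distance bound makes both coordinates
  of \<open>k e + u\<close> depend continuously on the sum, up to constant losses of precision.
  Coordinates of a Cauchy family therefore converge in \<open>Kh\<close> and in
  \<open>V\<close>.\<close>

lemma complete_line_extension:
  assumes complete_Kh: "complete Kh" and V: "complete V" "V \<subseteq> B"
    and V_zero: "\<zero> \<in> V" and V_add: "\<And>u t. u \<in> V \<Longrightarrow> t \<in> V \<Longrightarrow> u \<oplus> t \<in> V"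
    and V_smult: "\<And>k u. k \<in> Kh \<Longrightarrow> u \<in> V \<Longrightarrow> k \<otimes> u \<in> V" and e: "e \<in> B"
  shows "complete (line_extension Kh e V)"
proof (cases "e \<in> V")
  case True
  have Kh0: "\<zero> \<in> Kh" using subringE(2)[OF subfieldE(1)[OF Kh]] .
  have "u \<in> line_extension Kh e V" if "u \<in> V" for u
    unfolding line_extension_mem_iff
  proof (rule bexI[OF bexI[OF _ that] Kh0])
    have "u \<in> carrier L" "e \<in> carrier L" using that V(2) B_carrier e by auto
    then show "u = \<zero> \<otimes> e \<oplus> u" by simp
  qed
  moreover have "u \<in> V" if "u \<in> line_extension Kh e V" for u
    using that V_add V_smult True unfolding line_extension_mem_iff by blast
  ultimately have "line_extension Kh e V = V" by blast
  then show ?thesis using V(1) by simp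
next
  case False
  note KhR = subfieldE(1)[OF Kh]
  have ec: "e \<in> carrier L" using e B_carrier by blast
  have Vc: "u \<in> carrier L" if "u \<in> V" for u using that V(2) B_carrier by blast
  have Kc: "k \<in> carrier L" if "k \<in> Kh" for k using that Kh_carrier by blast
  have V_minus: "u \<ominus> t \<in> V" if "u \<in> V" "t \<in> V" for u t
    using V_add[OF that(1) V_smult[OF _ that(2), of "\<ominus> \<one>"]] subringE(3,5)[OF KhR] Vc[OF that(2)]
    by (simp add: a_minus_def l_minus)
  have Kh_minus: "k \<ominus> l \<in> Kh" if "k \<in> Kh" "l \<in> Kh" for k l
    using that subringE(5,7)[OF KhR] unfolding a_minus_def by blast
  obtain \<delta> where \<delta>: "\<delta> \<in> \<Gamma>" "\<And>u. u \<in> V \<Longrightarrow> v (e \<ominus> u) \<le> Fin \<delta>" using distance_bounded[OF V e False] by blast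
  \<comment> \<open>For nonzero \<open>k\<close>, the sum \<open>k e + u\<close> is \<open>k\<close>
    times the difference of \<open>e\<close> and an element of \<open>V\<close>.\<close>
  have dist: "v (k \<otimes> e \<oplus> u) \<le> v k + Fin \<delta>" if ku: "k \<in> Kh" "u \<in> V" for k u
  proof (cases "k = \<zero>")
    case False
    note k = Kc[OF ku(1)]
    have i: "inv k \<in> Kh" "inv k \<in> carrier L" "k \<otimes> inv k = \<one>"
      using subfield_m_inv[OF Kh, of k] ku(1) False k by (auto simp: field_Units)
    let ?t = "\<ominus> \<one> \<otimes> (inv k \<otimes> u)"
    have t: "?t \<in> V" using V_smult subringE(3,5)[OF KhR] i(1) ku(2) by blast
    have "k \<otimes> (e \<ominus> ?t) = k \<otimes> e \<oplus> (k \<otimes> inv k) \<otimes> u" using k ec i(2) Vc[OF ku(2)] by algebra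
    then have "k \<otimes> e \<oplus> u = k \<otimes> (e \<ominus> ?t)" using i(3) Vc[OF ku(2)] by simp
    then have "v (k \<otimes> e \<oplus> u) = v k + v (e \<ominus> ?t)" using k ec Vc[OF t] by (simp add: v_mult)
    moreover obtain \<kappa> where "v k = Fin \<kappa>" using v_nonzero[OF k False] by blast
    ultimately show ?thesis using \<delta>(2)[OF t] by (simp only: Fin_add_le_iff)
  qed (simp add: v_zero)
  obtain \<mu> where \<mu>: "\<mu> \<in> \<Gamma>" "Fin \<mu> \<le> v e" using value_lower_bound_B[OF e] by blast
  have smult_less: "Fin \<gamma> < v (e \<otimes> k)" if "Fin (\<gamma> - \<mu>) < v k" "k \<in> Kh" for \<gamma> k
    using add_less_of_le[OF \<mu>(2) that(1)] v_mult ec Kc that(2) by simp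
  \<comment> \<open>The loss for the coordinate in \<open>V\<close>: it is the difference of the
    sum, with precision \<open>\<gamma>\<close>, and of \<open>k e\<close>, with precision
    \<open>\<gamma> - \<delta> + \<mu>\<close>.\<close>
  define \<rho> where "\<rho> = min 0 (\<mu> - \<delta>)"
  have \<mu>\<delta>: "\<mu> - \<delta> \<in> \<Gamma>" using Gamma_add[OF \<mu>(1) Gamma_minus[OF \<delta>(1)]] by simp
  then have \<rho>: "\<rho> \<in> \<Gamma>" "\<rho> \<le> 0" "\<rho> \<le> \<mu> - \<delta>" using Gamma_zero by (auto simp: \<rho>_def min_def)
  have shift: "\<gamma> - \<eta> \<in> \<Gamma>" if "\<gamma> \<in> \<Gamma>" "\<eta> \<in> \<Gamma>" for \<gamma> \<eta> using Gamma_add[OF that(1) Gamma_minus[OF that(2)]] by simp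
  show ?thesis
    unfolding complete_def
  proof (intro allI impI, elim conjE)
    fix c assume c: "\<forall>\<gamma>\<in>\<Gamma>. c \<gamma> \<in> line_extension Kh e V"
      "\<forall>\<gamma>\<in>\<Gamma>. \<forall>\<delta>\<in>\<Gamma>. \<gamma> \<le> \<delta> \<longrightarrow> Fin \<gamma> < v (c \<gamma> \<ominus> c \<delta>)"
    have "\<forall>\<gamma>\<in>\<Gamma>. \<exists>k u. k \<in> Kh \<and> u \<in> V \<and> c \<gamma> = k \<otimes> e \<oplus> u" using c(1) unfolding line_extension_mem_iff by blast
    then obtain k u where ku: "\<And>\<gamma>. \<gamma> \<in> \<Gamma> \<Longrightarrow> k \<gamma> \<in> Kh" "\<And>\<gamma>. \<gamma> \<in> \<Gamma> \<Longrightarrow> u \<gamma> \<in> V"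
      "\<And>\<gamma>. \<gamma> \<in> \<Gamma> \<Longrightarrow> c \<gamma> = k \<gamma> \<otimes> e \<oplus> u \<gamma>" by metis
    have kc: "k \<gamma> \<in> carrier L" and uc: "u \<gamma> \<in> carrier L" if "\<gamma> \<in> \<Gamma>" for \<gamma> using ku(1,2) that Kc Vc by auto
    have k_diff: "Fin (\<gamma> - \<delta>) < v (k \<gamma> \<ominus> k \<gamma>')" if g: "\<gamma> \<in> \<Gamma>" "\<gamma>' \<in> \<Gamma>" "\<gamma> \<le> \<gamma>'" for \<gamma> \<gamma>'
    proof -
      have "c \<gamma> \<ominus> c \<gamma>' = (k \<gamma> \<ominus> k \<gamma>') \<otimes> e \<oplus> (u \<gamma> \<ominus> u \<gamma>')"
        unfolding ku(3)[OF g(1)] ku(3)[OF g(2)] using kc[OF g(1)] kc[OF g(2)] uc[OF g(1)] uc[OF g(2)] ec by algebra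
      then have "Fin \<gamma> < v (k \<gamma> \<ominus> k \<gamma>') + Fin \<delta>"
        using less_le_trans dist[OF Kh_minus[OF ku(1)[OF g(1)] ku(1)[OF g(2)]] V_minus[OF ku(2)[OF g(1)] ku(2)[OF g(2)]]]
          c(2)[rule_format, OF g] by metis
      then show ?thesis by (cases "v (k \<gamma> \<ominus> k \<gamma>')") (auto simp: algebra_simps)
    qed
    have u_diff: "Fin (\<gamma> + \<rho>) < v (u \<gamma> \<ominus> u \<gamma>')" if g: "\<gamma> \<in> \<Gamma>" "\<gamma>' \<in> \<Gamma>" "\<gamma> \<le> \<gamma>'" for \<gamma> \<gamma>'
    proof -
      have eq: "u \<gamma> \<ominus> u \<gamma>' = (c \<gamma> \<ominus> c \<gamma>') \<oplus> e \<otimes> (k \<gamma>' \<ominus> k \<gamma>)"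
        unfolding ku(3)[OF g(1)] ku(3)[OF g(2)] using kc[OF g(1)] kc[OF g(2)] uc[OF g(1)] uc[OF g(2)] ec by algebra
      have cc: "c \<gamma> \<ominus> c \<gamma>' \<in> carrier L"
        unfolding ku(3)[OF g(1)] ku(3)[OF g(2)] using kc uc g ec by simp
      have "\<gamma> + \<rho> \<le> \<gamma>" "\<gamma> + \<rho> - \<mu> \<le> \<gamma> - \<delta>" using \<rho>(2,3) by (auto simp: algebra_simps)
      then have "Fin (\<gamma> + \<rho>) \<le> Fin \<gamma>" "Fin (\<gamma> + \<rho> - \<mu>) \<le> Fin (\<gamma> - \<delta>)" by auto
      then have "Fin (\<gamma> + \<rho>) < v (c \<gamma> \<ominus> c \<gamma>')" "Fin (\<gamma> + \<rho> - \<mu>) < v (k \<gamma>' \<ominus> k \<gamma>)"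
        using le_less_trans[OF _ c(2)[rule_format, OF g]] le_less_trans[OF _ k_diff[OF g]]
        unfolding v_diff_commute[OF kc[OF g(1)] kc[OF g(2)]] by blast+
      then show ?thesis
        unfolding eq using v_add_gt[OF cc] smult_less Kh_minus ku(1) g ec kc by simp
    qed
    \<comment> \<open>The translation by \<open>\<delta>\<close> restores the precision demanded by
      \<open>completeD\<close>; for the other coordinate the translation by \<open>- \<rho>\<close>
      does the same.\<close>
    obtain a where a: "a \<in> Kh" "\<And>\<gamma>. \<gamma> \<in> \<Gamma> \<Longrightarrow> Fin \<gamma> < v (a \<ominus> k (\<gamma> + \<delta>))"
    proof (rule completeD[OF complete_Kh, of "\<lambda>\<gamma>. k (\<gamma> + \<delta>)"])
      show "k (\<gamma> + \<delta>) \<in> Kh" if "\<gamma> \<in> \<Gamma>" for \<gamma> using ku(1) Gamma_add that \<delta>(1) by blast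
      show "Fin \<gamma> < v (k (\<gamma> + \<delta>) \<ominus> k (\<eta> + \<delta>))" if "\<gamma> \<in> \<Gamma>" "\<eta> \<in> \<Gamma>" "\<gamma> \<le> \<eta>" for \<gamma> \<eta>
        using k_diff[of "\<gamma> + \<delta>" "\<eta> + \<delta>"] Gamma_add that \<delta>(1) by simp
    qed blast
    obtain b where b: "b \<in> V" "\<And>\<gamma>. \<gamma> \<in> \<Gamma> \<Longrightarrow> Fin \<gamma> < v (b \<ominus> u (\<gamma> - \<rho>))"
    proof (rule completeD[OF V(1), of "\<lambda>\<gamma>. u (\<gamma> - \<rho>)"])
      show "u (\<gamma> - \<rho>) \<in> V" if "\<gamma> \<in> \<Gamma>" for \<gamma> using ku(2) shift that \<rho>(1) by blast
      show "Fin \<gamma> < v (u (\<gamma> - \<rho>) \<ominus> u (\<eta> - \<rho>))" if "\<gamma> \<in> \<Gamma>" "\<eta> \<in> \<Gamma>" "\<gamma> \<le> \<eta>" for \<gamma> \<eta>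
        using u_diff[of "\<gamma> - \<rho>" "\<eta> - \<rho>"] shift that \<rho>(1) by simp
    qed blast
    have "Fin \<gamma> < v ((a \<otimes> e \<oplus> b) \<ominus> c \<gamma>)" if \<gamma>: "\<gamma> \<in> \<Gamma>" for \<gamma>
    proof -
      \<comment> \<open>At this later index both coordinates are precise enough for
        \<open>\<gamma>\<close>, since \<open>\<rho>\<close> is at most 0 and at most
        \<open>\<mu> - \<delta>\<close>.\<close>
      define \<eta> where "\<eta> = \<gamma> - \<rho>"
      have \<eta>: "\<eta> \<in> \<Gamma>" "\<gamma> \<le> \<eta>" using shift \<gamma> \<rho>(1,2) by (auto simp: \<eta>_def algebra_simps)
      have carr: "a \<in> carrier L" "b \<in> carrier L" using a(1) b(1) Kc Vc by auto
      have cc: "c \<gamma> \<in> carrier L" "c \<eta> \<in> carrier L" using ku(3) kc uc ec \<gamma> \<eta>(1) by auto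
      have eq: "(a \<otimes> e \<oplus> b) \<ominus> c \<gamma> = (e \<otimes> (a \<ominus> k \<eta>) \<oplus> (b \<ominus> u \<eta>)) \<oplus> (c \<eta> \<ominus> c \<gamma>)"
        unfolding ku(3)[OF \<eta>(1)] using cc(1) carr kc[OF \<eta>(1)] uc[OF \<eta>(1)] ec by algebra
      have "Fin \<gamma> < v (c \<eta> \<ominus> c \<gamma>)" using c(2) \<gamma> \<eta> v_diff_commute[OF cc(2,1)] by simp
      moreover have "Fin \<gamma> < v (b \<ominus> u \<eta>)" using b(2)[OF \<gamma>] unfolding \<eta>_def .
      moreover have "Fin \<gamma> < v (e \<otimes> (a \<ominus> k \<eta>))"
      proof (rule smult_less[OF _ Kh_minus[OF a(1) ku(1)[OF \<eta>(1)]]])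
        have "\<gamma> - \<mu> \<le> \<eta> - \<delta>" using \<rho>(3) by (simp add: \<eta>_def algebra_simps)
        then have "Fin (\<gamma> - \<mu>) \<le> Fin (\<eta> - \<delta>)" by simp
        also have "\<dots> < v (a \<ominus> k \<eta>)" using a(2)[OF shift[OF \<eta>(1) \<delta>(1)]] by simp
        finally show "Fin (\<gamma> - \<mu>) < v (a \<ominus> k \<eta>)" .
      qed
      ultimately show ?thesis unfolding eq using v_add_gt carr kc[OF \<eta>(1)] uc[OF \<eta>(1)] ec cc by simp
    qed
    moreover have "a \<otimes> e \<oplus> b \<in> line_extension Kh e V" unfolding line_extension_mem_iff using a(1) b(1) by blast
    ultimately show "\<exists>y\<in>line_extension Kh e V. \<forall>\<gamma>\<in>\<Gamma>. Fin \<gamma> < v (y \<ominus> c \<gamma>)" by blast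
  qed
qed

lemma complete_Span:
  assumes complete_Kh: "complete Kh" and es: "set es \<subseteq> B"
  shows "complete (Span Kh es)"
  using es
proof (induction es)
  case Nil
  show ?case unfolding complete_def using Gamma_zero by (auto simp: a_minus_def v_zero)
next
  case (Cons e es)
  have es: "set es \<subseteq> carrier L" using Cons.prems B_carrier by auto
  have "Span Kh es \<subseteq> B" using Span_incl[OF subfieldE(1)[OF B] Kh_B] Cons.prems by simp
  then show ?case
    using complete_line_extension[OF complete_Kh, of "Span Kh es" e] Cons Span_subgroup_props(2,3)[OF Kh es]
      Span_smult_closed[OF Kh es] by simp
qed

end

context completed_extension begin

lemma IC_maximal:
  fixes M :: "('g \<Rightarrow> 'a) ring" and w :: "('g \<Rightarrow> 'a) \<Rightarrow> 'g extended"
  assumes max: "is_completion L v K Kh" and fin: "finite_dimension K (IC L v K x)"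
    and M: "valued_field M w" and hom: "\<phi> \<in> ring_hom (L\<lparr>carrier := IC L v Kh x\<rparr>) M"
    and iso: "\<And>a. a \<in> IC L v Kh x \<Longrightarrow> w (\<phi> a) = v a"
    and dense_M: "dense_in M w (\<phi> ` IC L v K x) (carrier M)"
  shows "\<phi> ` IC L v Kh x = carrier M"
proof
  let ?E = "IC L v K x" and ?F = "IC L v Kh x"
  interpret M: valued_field M w by fact
  note E = subfield_IC[OF K x] and F = subfield_IC[OF Kh x]
  have F_B: "?F \<subseteq> B" unfolding IC_def by blast
  have Fc: "?F \<subseteq> carrier L" using subfieldE(3)[OF F(1)] .
  have \<phi>: "\<phi> a \<in> carrier M" "\<phi> (a \<oplus> b) = \<phi> a \<oplus>\<^bsub>M\<^esub> \<phi> b" if "a \<in> ?F" "b \<in> ?F" for a b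
    using ring_hom_closed[OF hom] ring_hom_add[OF hom] that by auto
  then show "\<phi> ` ?F \<subseteq> carrier M" by auto
  have diff: "w (\<phi> a \<ominus>\<^bsub>M\<^esub> \<phi> b) = v (a \<ominus> b)" if "a \<in> ?F" "b \<in> ?F" for a b
  proof -
    have ab: "a \<ominus> b \<in> ?F" using that subringE(5,7)[OF subfieldE(1)[OF F(1)]] unfolding a_minus_def by blast
    have "a \<in> carrier L" "b \<in> carrier L" using that Fc by auto
    then have "a = (a \<ominus> b) \<oplus> b" by algebra
    then have eq: "\<phi> a = \<phi> (a \<ominus> b) \<oplus>\<^bsub>M\<^esub> \<phi> b" using \<phi>(2)[OF ab that(2)] by simp
    have "\<phi> (a \<ominus> b) \<in> carrier M" "\<phi> b \<in> carrier M" using \<phi>(1) ab that by auto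
    then have "(\<phi> (a \<ominus> b) \<oplus>\<^bsub>M\<^esub> \<phi> b) \<ominus>\<^bsub>M\<^esub> \<phi> b = \<phi> (a \<ominus> b)" by algebra
    then show ?thesis unfolding eq using iso[OF ab] by simp
  qed
  have \<Gamma>_M: "\<gamma> \<in> value_group M w (carrier M)" if \<gamma>: "\<gamma> \<in> \<Gamma>" for \<gamma>
  proof -
    obtain k where k: "k \<in> K" "v k = Fin \<gamma>" using \<gamma> unfolding value_group_def by blast
    then have "k \<in> ?F" using K_Kh F(2) by blast
    then have "\<phi> k \<in> carrier M" "w (\<phi> k) = Fin \<gamma>" using \<phi>(1) iso k(2) by auto
    moreover from this have "\<phi> k \<noteq> \<zero>\<^bsub>M\<^esub>" using M.v_zero by auto
    ultimately show ?thesis unfolding value_group_def by blast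
  qed
  \<comment> \<open>\<open>\<Gamma>\<close> is cofinal in the values of \<open>M\<close> too: by
    density a nonzero \<open>y\<close> has the value of some \<open>\<phi> e\<close>, and values of
    \<open>B\<close> are bounded by \<open>\<Gamma>\<close>.\<close>
  have cofinal: "y = \<zero>\<^bsub>M\<^esub>" if y: "y \<in> carrier M" and big: "\<And>\<gamma>. \<gamma> \<in> \<Gamma> \<Longrightarrow> Fin \<gamma> < w y" for y
  proof (rule ccontr)
    assume y0: "y \<noteq> \<zero>\<^bsub>M\<^esub>"
    then obtain \<gamma> where \<gamma>: "w y = Fin \<gamma>" using M.v_nonzero[OF y] by blast
    then have "\<gamma> \<in> value_group M w (carrier M)" unfolding value_group_def using y y0 by blast
    then obtain e where e: "e \<in> ?E" "Fin \<gamma> < w (y \<ominus>\<^bsub>M\<^esub> \<phi> e)" using dense_M y unfolding dense_in_def by blast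
    then have eF: "e \<in> ?F" using IC_mono by blast
    then have "v e = Fin \<gamma>" using M.v_eq_of_diff[OF y \<phi>(1)] e(2) \<gamma> iso by simp
    then obtain \<delta> where "\<delta> \<in> \<Gamma>" "\<gamma> \<le> \<delta>" using bounded_value F_B eF unfolding bounded_def by blast
    then show False using big[of \<delta>] \<gamma> by simp
  qed
  \<comment> \<open>Finiteness enters here: approximations in the smaller constant field lie in the
    \<open>Kh\<close>-span of finitely many of its elements, and this span is complete although the
    constant field itself need not be.\<close>
  obtain n where "dimension n K ?E" using fin by (rule finite_dimensionE')
  then obtain es where es: "set es \<subseteq> carrier L" "Span K es = ?E" using exists_base[OF K] by blast
  have es_E: "set es \<subseteq> ?E" using Span_base_incl[OF K es(1)] es(2) by simp
  have K_span: "Span K es \<subseteq> Span Kh es"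
  proof (induction es)
    case (Cons e es)
    then have "line_extension K e (Span K es) \<subseteq> line_extension Kh e (Span Kh es)"
      unfolding subset_iff line_extension_mem_iff using K_Kh by blast
    then show ?case by simp
  qed simp
  have span_F: "Span Kh es \<subseteq> ?F" using Span_incl[OF subfieldE(1)[OF F(1)] F(2)] es_E IC_mono by blast
  have "complete Kh"
    unfolding complete_def
  proof (intro allI impI, elim conjE)
    fix c assume "\<forall>\<gamma>\<in>\<Gamma>. c \<gamma> \<in> Kh" "\<forall>\<gamma>\<in>\<Gamma>. \<forall>\<delta>\<in>\<Gamma>. \<gamma> \<le> \<delta> \<longrightarrow> Fin \<gamma> < v (c \<gamma> \<ominus> c \<delta>)"
    then show "\<exists>y\<in>Kh. \<forall>\<gamma>\<in>\<Gamma>. Fin \<gamma> < v (y \<ominus> c \<gamma>)" by (intro complete_Kh[OF max]) simp_all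
  qed
  moreover have "set es \<subseteq> B" using es_E IC_mono F_B by blast
  ultimately have complete: "complete (Span Kh es)" by (rule complete_Span)
  show "carrier M \<subseteq> \<phi> ` ?F"
  proof
    fix y assume y: "y \<in> carrier M"
    have "\<forall>\<gamma>\<in>\<Gamma>. \<exists>e\<in>?E. Fin \<gamma> < w (y \<ominus>\<^bsub>M\<^esub> \<phi> e)" using dense_M y \<Gamma>_M unfolding dense_in_def by blast
    then obtain c where c: "\<And>\<gamma>. \<gamma> \<in> \<Gamma> \<Longrightarrow> c \<gamma> \<in> ?E" "\<And>\<gamma>. \<gamma> \<in> \<Gamma> \<Longrightarrow> Fin \<gamma> < w (y \<ominus>\<^bsub>M\<^esub> \<phi> (c \<gamma>))" by metis
    have cF: "c \<gamma> \<in> ?F" if "\<gamma> \<in> \<Gamma>" for \<gamma> using c(1)[OF that] IC_mono by blast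
    have cM: "\<phi> (c \<gamma>) \<in> carrier M" if "\<gamma> \<in> \<Gamma>" for \<gamma> using \<phi>(1) cF[OF that] by blast
    have c_diff: "Fin \<gamma> < v (c \<gamma> \<ominus> c \<delta>)" if d: "\<gamma> \<in> \<Gamma>" "\<delta> \<in> \<Gamma>" "\<gamma> \<le> \<delta>" for \<gamma> \<delta>
    proof -
      have "\<phi> (c \<gamma>) \<ominus>\<^bsub>M\<^esub> \<phi> (c \<delta>) = (\<phi> (c \<gamma>) \<ominus>\<^bsub>M\<^esub> y) \<oplus>\<^bsub>M\<^esub> (y \<ominus>\<^bsub>M\<^esub> \<phi> (c \<delta>))"
        using y cM[OF d(1)] cM[OF d(2)] by algebra
      moreover have "Fin \<gamma> < w (\<phi> (c \<gamma>) \<ominus>\<^bsub>M\<^esub> y)" using c(2)[OF d(1)] M.v_diff_commute[OF cM[OF d(1)] y] by simp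
      moreover have "Fin \<gamma> < w (y \<ominus>\<^bsub>M\<^esub> \<phi> (c \<delta>))" using le_less_trans[of "Fin \<gamma>" "Fin \<delta>"] c(2)[OF d(2)] d(3) by simp
      ultimately show ?thesis
        using M.v_add_gt[of "\<phi> (c \<gamma>) \<ominus>\<^bsub>M\<^esub> y" "y \<ominus>\<^bsub>M\<^esub> \<phi> (c \<delta>)" "Fin \<gamma>"] cM d y diff[OF cF[OF d(1)] cF[OF d(2)]] by simp
    qed
    \<comment> \<open>The approximating elements are transported into \<open>L\<close>, where their
      limit \<open>u\<close> exists; in \<open>M\<close> the difference of \<open>y\<close> and
      \<open>\<phi> u\<close> then exceeds all of \<open>\<Gamma>\<close>.\<close>
    have c_span: "c \<gamma> \<in> Span Kh es" if "\<gamma> \<in> \<Gamma>" for \<gamma> using c(1)[OF that] K_span unfolding es(2) by (rule subsetD[rotated])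
    have "\<exists>u\<in>Span Kh es. \<forall>\<gamma>\<in>\<Gamma>. Fin \<gamma> < v (u \<ominus> c \<gamma>)"
      by (rule completeD[OF complete c_span c_diff]) blast+
    then obtain u where u: "u \<in> Span Kh es" "\<And>\<gamma>. \<gamma> \<in> \<Gamma> \<Longrightarrow> Fin \<gamma> < v (u \<ominus> c \<gamma>)" by blast
    have uF: "u \<in> ?F" using u(1) span_F by blast
    have uM: "\<phi> u \<in> carrier M" using \<phi>(1) uF by blast
    have "y \<ominus>\<^bsub>M\<^esub> \<phi> u = \<zero>\<^bsub>M\<^esub>"
    proof (rule cofinal)
      show "y \<ominus>\<^bsub>M\<^esub> \<phi> u \<in> carrier M" using y uM by simp
      fix \<gamma> assume \<gamma>: "\<gamma> \<in> \<Gamma>"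
      have "y \<ominus>\<^bsub>M\<^esub> \<phi> u = (y \<ominus>\<^bsub>M\<^esub> \<phi> (c \<gamma>)) \<oplus>\<^bsub>M\<^esub> (\<phi> (c \<gamma>) \<ominus>\<^bsub>M\<^esub> \<phi> u)"
        using y cM[OF \<gamma>] uM by algebra
      moreover have "Fin \<gamma> < w (\<phi> (c \<gamma>) \<ominus>\<^bsub>M\<^esub> \<phi> u)"
        using u(2)[OF \<gamma>] diff[OF uF cF[OF \<gamma>]] M.v_diff_commute[OF cM[OF \<gamma>] uM] by simp
      ultimately show "Fin \<gamma> < w (y \<ominus>\<^bsub>M\<^esub> \<phi> u)" using M.v_add_gt c(2)[OF \<gamma>] y cM[OF \<gamma>] uM by simp
    qed
    then have "y = \<phi> u" using y uM by simp
    then show "y \<in> \<phi> ` ?F" using uF by blast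
  qed
qed

end

theorem corollary9p2:
  fixes L :: "('a, 'b) ring_scheme"
    and v :: "'a \<Rightarrow> 'g::linordered_ab_group_add extended"
    and K Kh :: "'a set" and x :: 'a
  assumes "valued_field L v"
    and "is_completion L v K Kh"
    and "x \<in> carrier L" and "(ring.transcendental L over Kh) x"
    and "algebraic_closure L (adjoin L Kh x)"
    and "\<not> valuation_algebraic_type_II L v K Kh x"
    and "henselian L v K"
    and "ring.finite_dimension L K (IC L v K x)"
  shows "is_completion L v (IC L v K x) (IC L v Kh x)"
proof -
  interpret valued_field L v by fact
  interpret C: algebraic_closure L "adjoin L Kh x" by fact
  interpret valued_closed L v by unfold_locales
  have "dense_extension L v K Kh"
    using assms(2) valued_closed_axioms
    unfolding is_completion_def dense_extension_def dense_extension_axioms_def by blast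
  then interpret completed_extension L v K Kh x
    using assms(3,4) C.algebraic_extension
    by (simp add: completed_extension_def completed_extension_axioms_def)
  note E = subfield_IC[OF K x] and F = subfield_IC[OF Kh x]
  have "dense_in L v (IC L v K x) (IC L v Kh x)"
    unfolding dense_in_def
  proof (intro ballI)
    fix a \<gamma> assume a: "a \<in> IC L v Kh x" and "\<gamma> \<in> value_group L v (IC L v Kh x)"
    then obtain b where "b \<in> IC L v Kh x" "v b = Fin \<gamma>" unfolding value_group_def by blast
    \<comment> \<open>The required precision is a value of an element of \<open>B\<close>, so it
      does not leave the range in which \<open>K\<close> approximates.\<close>
    then have "bounded \<gamma>" using bounded_value unfolding IC_def by blast
    then show "\<exists>b\<in>IC L v K x. Fin \<gamma> < v (a \<ominus>\<^bsub>L\<^esub> b)" using IC_dense[OF a] by blast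
  qed
  then show ?thesis
    unfolding is_completion_def using E(1) F(1) IC_mono IC_maximal[OF assms(2,8)] by blast
qed

end
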